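(* Let $\alpha\in(1,2]$ and let $\mu=(\mu(k),k\ge0)$ be an aperiodic probability distribution on the non-negative integers with $\sum_{k\ge0}k\mu(k)=1$ and $\mu(0)+\mu(1)<1$, which belongs to the domain of attraction of a stable law of index $\alpha$, with normalizing sequence $(B_n)_{n\ge1}$ (see context). Let $\mathcal T^{(n)}_{\rm GW}$ be a Galton--Watson tree with offspring distribution $\mu$ conditioned on having $n$ vertices. Conditioned on the tree, delete each edge $e$ at the random time $\widehat T_e=\frac{n}{B_n}(1-U_e)$, where the $U_e$ are i.i.d. uniform on $(0,1)$, and let $\widehat X^{(n)}(\cdot)=(\widehat X^{(n)}_i(\cdot))_{i\ge1}$ be the associated fragmentation process of normalized component sizes (see context). Then the family of processes $\widehat X^{(n)}(\cdot)$ is tight in $D(\mathbb R_+,\mathbb S^{\downarrow}_{\le1})$.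
   Context: $\mu$ belongs to the domain of attraction of a stable law of index $\alpha\in(1,2]$ if, for i.i.d. random variables $(Y_i)_{i\ge1}$ with distribution $\mu$, there is a sequence of positive reals $(B_n)_{n\ge1}$ with $B_n\to\infty$ and $(Y_1+\dots+Y_n-n)/B_n\to Z_\alpha$ in distribution, where $\mathbb E[e^{-\lambda Z_\alpha}]=e^{\lambda^\alpha}$ for $\lambda>0$ if $\alpha\in(1,2)$, and $\mathbb E[e^{-\lambda Z_2}]=e^{\lambda^2/2}$ for $\lambda>0$ if $\alpha=2$ (so $Z_2$ is standard Gaussian). Only those $n$ for which the conditioning event has positive probability are considered (all sufficiently large $n$, by aperiodicity). $\mathbb R_+:=[0,\infty)$. $\mathbb S^{\downarrow}_{\le1}:=\{(x_i)_{i=1}^\infty: x_1\ge x_2\ge\dots\ge0,\ \sum_{i}x_i\le1\}$, with the product topology. $D(\mathbb R_+,\mathbb S^{\downarrow}_{\le1})$ is the space of càdlàg functions $\mathbb R_+\to\mathbb S^{\downarrow}_{\le1}$ with the Skorohod $J_1$ topology. For $t\ge0$, $\widehat X^{(n)}(t)$ is the sequence of the numbers of vertices, divided by $n$, of the connected components of the forest obtained from $\mathcal T^{(n)}_{\rm GW}$ by removing all edges with $\widehat T_e\le t$, arranged in decreasing order and extended by zeros. *)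

theory Defs
  imports "HOL-Probability.Probability"
begin

section \<open>Skorohod space over the half line\<close>

text \<open>A path is a function on \<open>[0,\<infinity>)\<close>, encoded as a function on the reals that is
  \<^const>\<open>undefined\<close> at negative arguments, so that distinct elements are distinct paths.\<close>

definition cadlag_paths :: "'a::topological_space set \<Rightarrow> (real \<Rightarrow> 'a) set" where
  "cadlag_paths E = {f \<in> {0..} \<rightarrow>\<^sub>E E.
     (\<forall>t\<ge>0. (f \<longlongrightarrow> f t) (at_right t)) \<and>
     (\<forall>t>0. \<exists>l\<in>E. (f \<longlongrightarrow> l) (at_left t))}"

text \<open>Increasing bijections of \<open>[0,\<infinity>)\<close>; they fix 0 and are automatically continuous.\<close>

definition time_changes :: "(real \<Rightarrow> real) set" where
  "time_changes = {l. strict_mono_on {0..} l \<and> bij_betw l {0..} {0..}}"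

definition skorohod_nbhd ::
    "'a::metric_space set \<Rightarrow> (real \<Rightarrow> 'a) \<Rightarrow> real \<Rightarrow> real \<Rightarrow> (real \<Rightarrow> 'a) set" where
  "skorohod_nbhd E x N e = {y \<in> cadlag_paths E. \<exists>l\<in>time_changes.
     (\<forall>s\<ge>0. \<bar>l s - s\<bar> < e) \<and> (\<forall>s\<in>{0..N}. dist (y (l s)) (x s) < e)}"

text \<open>The \<open>J\<^sub>1\<close> topology: \<open>y n\<close> tends to \<open>x\<close> iff there are time changes \<open>l n\<close> such that
  \<open>l n\<close> tends to the identity uniformly on \<open>[0,\<infinity>)\<close> and \<open>y n \<circ> l n\<close> tends to \<open>x\<close>
  uniformly on \<open>[0,N]\<close> for every \<open>N\<close> (Jacod--Shiryaev, Limit Theorems for Stochastic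
  Processes, VI.1.14).  By diagonalisation this says that \<open>y n\<close> is eventually in
  \<open>skorohod_nbhd E x N e\<close> for all \<open>N\<close> and all \<open>e > 0\<close>.\<close>

definition skorohod_open :: "'a::metric_space set \<Rightarrow> (real \<Rightarrow> 'a) set \<Rightarrow> bool" where
  "skorohod_open E U \<longleftrightarrow> U \<subseteq> cadlag_paths E \<and>
     (\<forall>x\<in>U. \<exists>N. \<exists>e>0. skorohod_nbhd E x N e \<subseteq> U)"

definition skorohod_topology :: "'a::metric_space set \<Rightarrow> (real \<Rightarrow> 'a) topology" where
  "skorohod_topology E = topology (skorohod_open E)"

lemma skorohod_nbhd_mono:
  assumes "N \<le> N'" "e' \<le> e"
  shows "skorohod_nbhd E x N' e' \<subseteq> skorohod_nbhd E x N e"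
proof
  fix y assume "y \<in> skorohod_nbhd E x N' e'"
  then obtain l where "y \<in> cadlag_paths E" "l \<in> time_changes"
    "\<forall>s\<ge>0. \<bar>l s - s\<bar> < e'" "\<forall>s\<in>{0..N'}. dist (y (l s)) (x s) < e'"
    by (auto simp: skorohod_nbhd_def)
  moreover from this have "\<forall>s\<ge>0. \<bar>l s - s\<bar> < e" "\<forall>s\<in>{0..N}. dist (y (l s)) (x s) < e"
    using assms by (force intro: less_le_trans)+
  ultimately show "y \<in> skorohod_nbhd E x N e"
    by (auto simp: skorohod_nbhd_def)
qed

lemma istopology_skorohod_open: "istopology (skorohod_open E)"
  unfolding istopology_def
proof (intro conjI allI impI)
  fix S T assume S: "skorohod_open E S" and T: "skorohod_open E T"
  show "skorohod_open E (S \<inter> T)"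
    unfolding skorohod_open_def
  proof (intro conjI ballI)
    show "S \<inter> T \<subseteq> cadlag_paths E" using S by (auto simp: skorohod_open_def)
    fix x assume "x \<in> S \<inter> T"
    then obtain N e N' e' where *: "e > 0" "skorohod_nbhd E x N e \<subseteq> S"
      "e' > 0" "skorohod_nbhd E x N' e' \<subseteq> T"
      using S T unfolding skorohod_open_def by blast
    have "skorohod_nbhd E x (max N N') (min e e') \<subseteq> S \<inter> T"
      using skorohod_nbhd_mono[of N "max N N'" "min e e'" e E x]
        skorohod_nbhd_mono[of N' "max N N'" "min e e'" e' E x] * by auto
    moreover have "min e e' > 0" using * by simp
    ultimately show "\<exists>N. \<exists>e>0. skorohod_nbhd E x N e \<subseteq> S \<inter> T" by blast
  qed
next
  fix K :: "(real \<Rightarrow> 'a) set set"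
  assume *: "\<forall>S\<in>K. skorohod_open E S"
  show "skorohod_open E (\<Union>K)"
    unfolding skorohod_open_def
  proof (intro conjI ballI)
    show "\<Union>K \<subseteq> cadlag_paths E" using * by (auto simp: skorohod_open_def)
    fix x assume "x \<in> \<Union>K"
    then obtain S where "S \<in> K" "x \<in> S" by blast
    moreover from this obtain N e where "e > 0" "skorohod_nbhd E x N e \<subseteq> S"
      using * unfolding skorohod_open_def by blast
    ultimately show "\<exists>N. \<exists>e>0. skorohod_nbhd E x N e \<subseteq> \<Union>K" by blast
  qed
qed

lemma openin_skorohod_topology: "openin (skorohod_topology E) U \<longleftrightarrow> skorohod_open E U"
  by (simp add: skorohod_topology_def topology_inverse'[OF istopology_skorohod_open])

lemma topspace_skorohod_topology: "topspace (skorohod_topology E) = cadlag_paths E"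
proof
  show "topspace (skorohod_topology E) \<subseteq> cadlag_paths E"
    using openin_topspace[of "skorohod_topology E"]
    unfolding openin_skorohod_topology skorohod_open_def by blast
  have "openin (skorohod_topology E) (cadlag_paths E)"
    unfolding openin_skorohod_topology skorohod_open_def
    by (auto simp: skorohod_nbhd_def intro!: exI[of _ "1::real"])
  then show "cadlag_paths E \<subseteq> topspace (skorohod_topology E)"
    by (rule openin_subset)
qed

text \<open>If the event \<open>X i \<in> K\<close> is not measurable then its \<^const>\<open>measure\<close> is 0, so the
  inequality (for \<open>e < 1\<close>) includes the measurability of the event.\<close>

definition tight_family ::
    "'b topology \<Rightarrow> 'i set \<Rightarrow> ('i \<Rightarrow> 'w measure) \<Rightarrow> ('i \<Rightarrow> 'w \<Rightarrow> 'b) \<Rightarrow> bool" where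
  "tight_family T I P X \<longleftrightarrow> (\<forall>e>0. \<exists>K. compactin T K \<and>
     (\<forall>i\<in>I. measure (P i) {w \<in> space (P i). X i w \<in> K} \<ge> 1 - e))"

text \<open>The space \<open>S\<^sup>\<down>\<close> of mass partitions, indexed from 0.  The library topology on
  \<^typ>\<open>nat \<Rightarrow> real\<close> is the product topology, and \<^const>\<open>dist\<close> on that type metrizes it.  As the
  space is compact, any other metric for the product topology gives the same \<open>J\<^sub>1\<close> topology.\<close>

definition mass_partitions :: "(nat \<Rightarrow> real) set" where
  "mass_partitions = {x. decseq x \<and> (\<forall>i. 0 \<le> x i) \<and> summable x \<and> suminf x \<le> 1}"


section \<open>Offspring distributions\<close>

text \<open>The law of \<open>Z\<^sub>\<alpha>\<close>, determined by its Laplace transform on \<open>(0,\<infinity>)\<close>.\<close>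

definition stable_law :: "real \<Rightarrow> real measure \<Rightarrow> bool" where
  "stable_law \<alpha> Z \<longleftrightarrow> real_distribution Z \<and>
     (\<forall>r>0. integrable Z (\<lambda>x. exp (- r * x)) \<and>
       (LINT x|Z. exp (- r * x)) =
         (if \<alpha> = 2 then exp (r\<^sup>2 / 2) else exp (r powr \<alpha>)))"

definition domain_of_attraction :: "nat pmf \<Rightarrow> real \<Rightarrow> (nat \<Rightarrow> real) \<Rightarrow> bool" where
  "domain_of_attraction \<mu> \<alpha> B \<longleftrightarrow>
     (\<forall>n\<ge>1. B n > 0) \<and> filterlim B at_top sequentially \<and>
     (\<exists>Z. stable_law \<alpha> Z \<and>
       weak_conv_m
         (\<lambda>n. distr (\<Pi>\<^sub>M i\<in>UNIV. measure_pmf \<mu>) borel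
           (\<lambda>Y. ((\<Sum>i=1..n. real (Y i)) - real n) / B n)) Z)"

definition aperiodic :: "nat pmf \<Rightarrow> bool" where
  "aperiodic \<mu> \<longleftrightarrow> Gcd (set_pmf \<mu>) = 1"


section \<open>Conditioned Galton--Watson trees\<close>

text \<open>Vertices are Ulam--Harris words: \<open>[]\<close> is the root and \<open>u @ [j]\<close> is the child number
  \<open>j\<close> (counted from 0) of \<open>u\<close>.  If \<open>\<xi> u\<close> is the offspring number of \<open>u\<close>, then \<open>gw_tree \<xi>\<close> is
  the vertex set of the resulting tree.\<close>

definition gw_tree :: "(nat list \<Rightarrow> nat) \<Rightarrow> nat list set" where
  "gw_tree \<xi> = {u. \<forall>i<length u. u ! i < \<xi> (take i u)}"

definition offspring_field :: "nat pmf \<Rightarrow> (nat list \<Rightarrow> nat) measure" where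
  "offspring_field \<mu> = (\<Pi>\<^sub>M u\<in>UNIV. measure_pmf \<mu>)"

definition size_event :: "nat pmf \<Rightarrow> nat \<Rightarrow> (nat list \<Rightarrow> nat) set" where
  "size_event \<mu> n = {\<xi> \<in> space (offspring_field \<mu>). finite (gw_tree \<xi>) \<and> card (gw_tree \<xi>) = n}"

definition conditioned_offspring_field :: "nat pmf \<Rightarrow> nat \<Rightarrow> (nat list \<Rightarrow> nat) measure" where
  "conditioned_offspring_field \<mu> n = uniform_measure (offspring_field \<mu>) (size_event \<mu> n)"


section \<open>Fragmentation\<close>

type_synonym edge = "nat list \<times> nat list"

definition tree_edges :: "nat list set \<Rightarrow> edge set" where
  "tree_edges V = {(butlast u, u) | u. u \<in> V \<and> u \<noteq> []}"

definition components :: "'v set \<Rightarrow> ('v \<times> 'v) set \<Rightarrow> 'v set set" where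
  "components V F = V // {(u, v) \<in> V \<times> V. (u, v) \<in> (F \<union> F\<inverse>)\<^sup>*}"

definition component_sizes :: "'v set \<Rightarrow> ('v \<times> 'v) set \<Rightarrow> nat multiset" where
  "component_sizes V F = image_mset card (mset_set (components V F))"

definition ranked :: "nat multiset \<Rightarrow> nat \<Rightarrow> nat" where
  "ranked M i = (let xs = rev (sorted_list_of_multiset M) in if i < length xs then xs ! i else 0)"

definition deletion_time :: "(nat \<Rightarrow> real) \<Rightarrow> nat \<Rightarrow> (edge \<Rightarrow> real) \<Rightarrow> edge \<Rightarrow> real" where
  "deletion_time B n U e = real n / B n * (1 - U e)"

text \<open>The tree conditioned on having \<open>n\<close> vertices, together with independent marks \<open>U\<close>,
  i.i.d. uniform on \<open>(0,1)\<close>.  Marks are attached to all pairs of words; only those of the tree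
  edges are used.\<close>

definition fragmentation_space ::
    "nat pmf \<Rightarrow> nat \<Rightarrow> ((nat list \<Rightarrow> nat) \<times> (edge \<Rightarrow> real)) measure" where
  "fragmentation_space \<mu> n =
     conditioned_offspring_field \<mu> n \<Otimes>\<^sub>M (\<Pi>\<^sub>M e\<in>UNIV. uniform_measure lborel {0<..<1})"

definition fragmentation_process ::
    "(nat \<Rightarrow> real) \<Rightarrow> nat \<Rightarrow> (nat list \<Rightarrow> nat) \<times> (edge \<Rightarrow> real) \<Rightarrow> real \<Rightarrow> nat \<Rightarrow> real" where
  "fragmentation_process B n = (\<lambda>(\<xi>, U). \<lambda>t\<in>{0..}. \<lambda>i.
     real (ranked (component_sizes (gw_tree \<xi>)
       {e \<in> tree_edges (gw_tree \<xi>). \<not> deletion_time B n U e \<le> t}) i) / real n)"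

end

theory Submission
  imports Defs "HOL-Complex_Analysis.Complex_Analysis" "HOL-Library.Sublist"
begin

text \<open>Since \<open>measure\<close> of a non-measurable set is 0, tightness includes the
  measurability of the event that a path lies in the compact set. The underlying space also carries
  infinite trees. There the components may be infinite in number, their multiset is then empty by
  convention, and paths can fail to be right-continuous. So the event is first rewritten with
  rational times and a separate explosion condition. The moment bounds balance as follows. Put r = n
  / B n. Cut sizes sum to order n r and an edge is cut in a window of length h with probability at
  most h / r, so the mean mass moved in a window has order n h. For cuts of size at most \<eta> n
  the second moment is at most n^2 (\<eta> C h + C^2 h^2), which beats the N / h windows once \<eta>
  and h are small. At most C r / \<eta> cuts are larger, so some two of them fall within \<delta> of
  each other with probability of order \<delta> N C^2 / \<eta>^2. None of this depends on n. The
  conclusion concerns every n with a positive conditioning probability, so asymptotic bounds must be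
  completed by a maximum over finitely many n.\<close>

text \<open>
  A set of paths in a compact space is relatively compact for \<open>J\<^sub>1\<close> when the two-sided oscillation
  \<open>min (dist (x s) (x t)) (dist (x t) (x u))\<close> over \<open>s < t < u\<close> with \<open>u - s\<close> small is uniformly
  small, and there are no early jumps.  Cutting the edge above a vertex \<open>v\<close> moves at most the mass of the
  smaller of the subtree of \<open>v\<close> and its complement.  So an oscillation larger than \<open>\<epsilon>\<close> needs either two
  almost simultaneous cuts at edges with two large sides, or many small cuts in a short time.  Since an edge
  is cut in a window of length \<open>h\<close> with probability at most \<open>h B\<^sub>n / n\<close>, first and second moments show both to
  be unlikely as soon as the sum of the sizes of all subtrees is of order \<open>n \<cdot> n / B\<^sub>n\<close>.

  By Lagrange inversion, the expectation of this sum on the event that the tree has \<open>n\<close> vertices is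
  \<open>\<Sum>i=1..n. P (S\<^sub>i = i - 1) * P (S\<^sub>n\<^sub>-\<^sub>i = n - i)\<close>, and the probability of the event is
  \<open>P (S\<^sub>n = n - 1) / n\<close>, where \<open>S\<close> is the random walk with step law \<open>\<mu>\<close>.  The local limit bounds
  \<open>P (S\<^sub>n = k) \<le> C / B\<^sub>n\<close> and \<open>P (S\<^sub>n = n - 1) \<ge> c / B\<^sub>n\<close> then give the required order.  They
  follow by Fourier inversion: convergence of the characteristic functions of the rescaled walk controls
  \<open>1 - \<bar>\<phi>\<bar>\<^sup>2\<close> at the scales \<open>1 / B\<^sub>n\<close>, hence at all small arguments, and aperiodicity keeps it away from 0
  elsewhere.
\<close>

section \<open>Relatively compact sets of Skorohod paths\<close>

text \<open>This is the modulus that Billingsley calls \<open>w''\<close>.  It does not see a jump close to the starting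
  point, whence the separate condition at time 0 in \<open>skorohod_class\<close>.\<close>

definition two_sided_osc :: "real set \<Rightarrow> real \<Rightarrow> real \<Rightarrow> (real \<Rightarrow> 'a::metric_space) \<Rightarrow> bool" where
  "two_sided_osc A d e x \<longleftrightarrow> (\<forall>s\<in>A. \<forall>t\<in>A. \<forall>u\<in>A. s < t \<longrightarrow> t < u \<longrightarrow> u - s < d \<longrightarrow>
     dist (x s) (x t) \<le> e \<or> dist (x t) (x u) \<le> e)"

section \<open>One-sided limits and two-level behaviour from two-sided oscillation\<close>

lemma two_sided_oscD:
  "two_sided_osc A d e x \<Longrightarrow> s \<in> A \<Longrightarrow> t \<in> A \<Longrightarrow> u \<in> A \<Longrightarrow> s < t \<Longrightarrow> t < u \<Longrightarrow> u - s < d \<Longrightarrow>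
     dist (x s) (x t) \<le> e \<or> dist (x t) (x u) \<le> e"
  by (auto simp: two_sided_osc_def)

lemma two_sided_osc_mono:
  assumes "two_sided_osc A d e x" "A' \<subseteq> A" "d' \<le> d" "e \<le> e'"
  shows "two_sided_osc A' d' e' x"
  unfolding two_sided_osc_def
proof (intro ballI impI)
  fix s t u assume "s \<in> A'" "t \<in> A'" "u \<in> A'" "s < t" "t < u" "u - s < d'"
  then show "dist (x s) (x t) \<le> e' \<or> dist (x t) (x u) \<le> e'"
    using two_sided_oscD[OF assms(1), of s t u] assms(2-4) by force
qed

text \<open>Compactness supplies a cluster value \<open>l\<close> at \<open>t\<close>. Any later
  point \<open>s\<close> close to \<open>t\<close> lies between two points whose values are near
  \<open>l\<close>, and the oscillation condition forces the value at \<open>s\<close> to be near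
  one of the two. The domain \<open>A\<close> is arbitrary because the limit of a subsequence is at
  first known at rational times only.\<close>

lemma right_limit_of_two_sided_osc:
  fixes y :: "real \<Rightarrow> 'a::metric_space"
  assumes E: "compact E" and yE: "\<And>q. q \<in> A \<Longrightarrow> y q \<in> E"
    and ne: "\<And>h. h > 0 \<Longrightarrow> A \<inter> {t<..<t+h} \<noteq> {}"
    and osc: "\<And>e. e > 0 \<Longrightarrow> \<exists>d>0. two_sided_osc (A \<inter> {t<..<t+d}) d e y"
  obtains l where "l \<in> E" "\<And>e. e > 0 \<Longrightarrow> \<exists>h>0. \<forall>q\<in>A \<inter> {t<..<t+h}. dist (y q) l \<le> e"
proof -
  have "\<forall>k. \<exists>q. q \<in> A \<inter> {t<..<t + 1 / real (Suc k)}"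
    using ne by (metis ex_in_conv of_nat_0_less_iff zero_less_Suc zero_less_divide_1_iff)
  then obtain q where q: "\<And>k. q k \<in> A \<inter> {t<..<t + 1 / real (Suc k)}" by metis
  then have "\<forall>k. y (q k) \<in> E" using yE by blast
  then obtain l r where l: "l \<in> E" and r: "strict_mono (r :: nat \<Rightarrow> nat)"
    and lim: "((\<lambda>k. y (q k)) \<circ> r) \<longlonglongrightarrow> l"
    using E compact_imp_seq_compact[of E] seq_compactE[of E "\<lambda>k. y (q k)"] by metis
  have freq: "\<exists>p\<in>A. t < p \<and> p < t + h \<and> dist (y p) l < e" if "h > 0" "e > 0" for h e
  proof -
    have "\<forall>\<^sub>F k in sequentially. dist (y (q (r k))) l < e"
      using lim \<open>e > 0\<close> by (auto simp: tendsto_iff)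
    moreover have "\<forall>\<^sub>F k in sequentially. 1 / real (Suc k) < h"
      using \<open>h > 0\<close> order_tendstoD(2)[OF LIMSEQ_inverse_real_of_nat, of h]
      by (simp add: inverse_eq_divide)
    ultimately obtain k where k: "dist (y (q (r k))) l < e" "1 / real (Suc k) < h"
      using eventually_happens[OF eventually_conj] by fastforce
    have "1 / real (Suc (r k)) \<le> 1 / real (Suc k)"
      using seq_suble[OF r, of k] by (intro divide_left_mono) auto
    then show ?thesis using q[of "r k"] k by (intro bexI[of _ "q (r k)"]) auto
  qed
  show thesis
  proof (rule that[OF l])
    fix e :: real assume "e > 0"
    obtain d where d: "d > 0" "two_sided_osc (A \<inter> {t<..<t+d}) d (e/2) y"
      using osc[of "e/2"] \<open>e > 0\<close> by auto
    obtain p where p: "p \<in> A" "t < p" "p < t + d" "dist (y p) l < e/2"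
      using freq[of d "e/2"] d \<open>e > 0\<close> by auto
    show "\<exists>h>0. \<forall>q\<in>A \<inter> {t<..<t+h}. dist (y q) l \<le> e"
    proof (intro exI[of _ "p - t"] conjI ballI)
      fix s assume s: "s \<in> A \<inter> {t<..<t + (p - t)}"
      obtain p' where p': "p' \<in> A" "t < p'" "p' < s" "dist (y p') l < e/2"
        using freq[of "s - t" "e/2"] s \<open>e > 0\<close> by auto
      have "dist (y p') (y s) \<le> e/2 \<or> dist (y s) (y p) \<le> e/2"
        by (rule two_sided_oscD[OF d(2)]) (use s p p' in auto)
      then show "dist (y s) l \<le> e"
      proof
        assume "dist (y p') (y s) \<le> e/2"
        then show ?thesis using p'(4) dist_triangle2[of "y s" l "y p'"]
          by (simp add: dist_commute)
      next
        assume "dist (y s) (y p) \<le> e/2"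
        then show ?thesis using p(4) dist_triangle[of "y s" l "y p"] by simp
      qed
    qed (use p in auto)
  qed
qed

text \<open>Time reflection of the preceding lemma: the oscillation condition is symmetric in its
  outer points.\<close>

lemma left_limit_of_two_sided_osc:
  fixes y :: "real \<Rightarrow> 'a::metric_space"
  assumes E: "compact E" and yE: "\<And>q. q \<in> A \<Longrightarrow> y q \<in> E"
    and ne: "\<And>h. h > 0 \<Longrightarrow> A \<inter> {t-h<..<t} \<noteq> {}"
    and osc: "\<And>e. e > 0 \<Longrightarrow> \<exists>d>0. two_sided_osc (A \<inter> {t-d<..<t}) d e y"
  obtains l where "l \<in> E" "\<And>e. e > 0 \<Longrightarrow> \<exists>h>0. \<forall>q\<in>A \<inter> {t-h<..<t}. dist (y q) l \<le> e"
proof (rule right_limit_of_two_sided_osc[of E "uminus ` A" "\<lambda>q. y (- q)" "- t"])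
  fix h :: real assume "h > 0"
  then obtain a where "a \<in> A" "t - h < a" "a < t" using ne[of h] by auto
  then show "uminus ` A \<inter> {- t<..<- t + h} \<noteq> {}" by (auto intro!: exI[of _ "-a"])
next
  fix e :: real assume "e > 0"
  then obtain d where d: "d > 0" "two_sided_osc (A \<inter> {t-d<..<t}) d e y" using osc by auto
  have "two_sided_osc (uminus ` A \<inter> {- t<..<- t + d}) d e (\<lambda>q. y (- q))"
    unfolding two_sided_osc_def
  proof (intro ballI impI)
    fix p q r assume *: "p \<in> uminus ` A \<inter> {- t<..<- t + d}" "q \<in> uminus ` A \<inter> {- t<..<- t + d}"
      "r \<in> uminus ` A \<inter> {- t<..<- t + d}" "p < q" "q < r" "r - p < d"
    have "dist (y (- r)) (y (- q)) \<le> e \<or> dist (y (- q)) (y (- p)) \<le> e"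
      by (rule two_sided_oscD[OF d(2)]) (use * in auto)
    then show "dist (y (- p)) (y (- q)) \<le> e \<or> dist (y (- q)) (y (- r)) \<le> e"
      by (auto simp: dist_commute)
  qed
  with d show "\<exists>d>0. two_sided_osc (uminus ` A \<inter> {- t<..<- t + d}) d e (\<lambda>q. y (- q))" by blast
next
  fix l assume l: "l \<in> E" "\<And>e. e > 0 \<Longrightarrow> \<exists>h>0. \<forall>q\<in>uminus ` A \<inter> {- t<..<- t + h}. dist (y (- q)) l \<le> e"
  show thesis
  proof (rule that[OF l(1)])
    fix e :: real assume "e > 0"
    then obtain h where "h > 0" "\<forall>q\<in>uminus ` A \<inter> {- t<..<- t + h}. dist (y (- q)) l \<le> e"
      using l(2) by blast
    then show "\<exists>h>0. \<forall>q\<in>A \<inter> {t-h<..<t}. dist (y q) l \<le> e"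
      by (intro exI[of _ h]) (force simp: image_iff)
  qed
qed (use E yE in auto)

text \<open>On an interval shorter than \<open>d\<close> a path has essentially two levels, those of
  its end points. The switch \<tau> is the last time at which the path is still far from its right
  level. A time before \<tau> and the time \<open>a\<close> are both compared with some later time
  that is far from \<open>x b\<close>, which gives the factor 2. Right-continuity puts \<tau> itself
  on the second level.\<close>

lemma switch_point:
  fixes x :: "real \<Rightarrow> 'a::metric_space"
  assumes osc: "two_sided_osc {a..b} d e x" and "b - a < d" "a \<le> b" "e \<ge> 0"
    and rc: "\<And>t. a \<le> t \<Longrightarrow> t < b \<Longrightarrow> (x \<longlongrightarrow> x t) (at_right t)"
  obtains \<tau> where "a \<le> \<tau>" "\<tau> \<le> b" "\<And>t. a \<le> t \<Longrightarrow> t < \<tau> \<Longrightarrow> dist (x t) (x a) \<le> 2 * e"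
    "\<And>t. \<tau> \<le> t \<Longrightarrow> t \<le> b \<Longrightarrow> dist (x t) (x b) \<le> e"
proof -
  define B where "B = {t\<in>{a..b}. dist (x t) (x b) > e}"
  show thesis
  proof (cases "B = {}")
    case True
    then show ?thesis by (intro that[of a]) (use assms in \<open>force simp: B_def\<close>)+
  next
    case False
    have bdd: "bdd_above B" by (auto simp: B_def bdd_above_def)
    define \<tau> where "\<tau> = Sup B"
    obtain t0 where t0: "t0 \<in> B" using False by blast
    have up: "t \<le> \<tau>" if "t \<in> B" for t
      unfolding \<tau>_def using that bdd by (rule cSup_upper)
    have \<tau>: "a \<le> \<tau>" "\<tau> \<le> b"
      using up[OF t0] t0 unfolding \<tau>_def by (auto simp: B_def intro!: cSup_least)
    have after: "dist (x t) (x b) \<le> e" if "\<tau> < t" "t \<le> b" for t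
      using up[of t] that \<tau> by (force simp: B_def)
    have at: "dist (x \<tau>) (x b) \<le> e" if "\<tau> < b"
    proof (rule tendsto_upperbound)
      show "((\<lambda>t. dist (x t) (x b)) \<longlongrightarrow> dist (x \<tau>) (x b)) (at_right \<tau>)"
        by (intro tendsto_intros rc) (use \<tau> that in auto)
      show "\<forall>\<^sub>F t in at_right \<tau>. dist (x t) (x b) \<le> e"
        unfolding eventually_at_right[OF that]
        by (rule exI[of _ b]) (auto intro!: after simp: that)
    qed auto
    show ?thesis
    proof (rule that[OF \<tau>])
      fix t assume t: "a \<le> t" "t < \<tau>"
      then obtain t' where t': "t' \<in> B" "t < t'"
        using less_cSupD[OF False] unfolding \<tau>_def by blast
      have b: "a \<le> t'" "t' < b" "\<not> dist (x t') (x b) \<le> e"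
        using t' \<open>e \<ge> 0\<close> by (auto simp: B_def) (metis dist_self less_eq_real_def not_less)
      have 1: "dist (x a) (x t') \<le> e"
        using two_sided_oscD[OF osc, of a t' b] b assms(2) t t' by force
      have 2: "dist (x t) (x t') \<le> e"
        using two_sided_oscD[OF osc, of t t' b] b assms(2) t t' by force
      show "dist (x t) (x a) \<le> 2 * e"
        using 1 2 dist_triangle2[of "x t" "x a" "x t'"] by linarith
    next
      fix t assume "\<tau> \<le> t" "t \<le> b"
      then show "dist (x t) (x b) \<le> e" using after at \<open>e \<ge> 0\<close> 
        by (cases "t = b"; cases "t = \<tau>") auto
    qed
  qed
qed

text \<open>One index \<open>j\<close> sets both the horizon and the precision, so that a single
  sequence \<delta> describes the class.\<close>

definition skorohod_class :: "'a::metric_space set \<Rightarrow> (nat \<Rightarrow> real) \<Rightarrow> (real \<Rightarrow> 'a) set" where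
  "skorohod_class E \<delta> = {x \<in> cadlag_paths E. \<forall>j.
     two_sided_osc {0..<real j} (\<delta> j) (1 / Suc j) x \<and>
     (\<forall>t. 0 \<le> t \<and> t < \<delta> j \<longrightarrow> dist (x 0) (x t) \<le> 1 / Suc j)}"

text \<open>Left limits follow from the oscillation bound and compactness; only right-continuity has
  to be supplied.\<close>

lemma cadlag_pathsI:
  assumes E: "compact E" and "x \<in> {0..} \<rightarrow>\<^sub>E E"
    and "\<And>t. t \<ge> 0 \<Longrightarrow> (x \<longlongrightarrow> x t) (at_right t)"
    and osc: "\<And>j. \<delta> j > 0" "\<And>j. two_sided_osc {0..<real j} (\<delta> j) (1 / Suc j) x"
  shows "x \<in> cadlag_paths E"
  unfolding cadlag_paths_def
proof (intro CollectI conjI allI impI)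
  fix t :: real assume "t > 0"
  have "\<exists>l\<in>E. \<forall>e>0. \<exists>h>0. \<forall>q\<in>{0..} \<inter> {t-h<..<t}. dist (x q) l \<le> e"
  proof (rule left_limit_of_two_sided_osc[of E "{0..}" x t])
    fix h :: real assume "h > 0"
    then have "max 0 (t - h/2) \<in> {0..} \<inter> {t - h<..<t}" using \<open>t > 0\<close> by auto
    then show "{0..} \<inter> {t - h<..<t} \<noteq> {}" by blast
  next
    fix e :: real assume "e > 0"
    obtain j0 :: nat where j0: "1 / e < real j0" using reals_Archimedean2 by blast
    obtain j1 :: nat where j1: "t < real j1" using reals_Archimedean2 by blast
    define j where "j = max j0 j1"
    have "1 / e < Suc j" using j0 by (auto simp: j_def)
    then have "1 / Suc j \<le> e" using \<open>e > 0\<close> by (simp add: field_simps)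
    moreover have "t < real j" using j1 by (auto simp: j_def)
    ultimately show "\<exists>d>0. two_sided_osc ({0..} \<inter> {t - d<..<t}) d e x"
      using osc by (intro exI[of _ "\<delta> j"] conjI osc two_sided_osc_mono[OF osc(2)[of j]]) auto
  qed (use assms in \<open>auto simp: PiE_iff\<close>)
  then obtain l where l: "l \<in> E" "\<And>e. e > 0 \<Longrightarrow> \<exists>h>0. \<forall>q\<in>{0..} \<inter> {t-h<..<t}. dist (x q) l \<le> e"
    by blast
  have "(x \<longlongrightarrow> l) (at_left t)"
  proof (rule tendstoI)
    fix e :: real assume "e > 0"
    then obtain h where h: "h > 0" "\<forall>q\<in>{0..} \<inter> {t-h<..<t}. dist (x q) l \<le> e/2"
      using l(2)[of "e/2"] by auto
    have "max 0 (t - h) < t" using h \<open>t > 0\<close> by auto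
    then show "\<forall>\<^sub>F s in at_left t. dist (x s) l < e"
      unfolding eventually_at_left[OF \<open>max 0 (t - h) < t\<close>] using h \<open>e > 0\<close>
      by (intro exI[of _ "max 0 (t-h)"]) (auto intro: le_less_trans[of _ "e/2"])
  qed
  then show "\<exists>l\<in>E. (x \<longlongrightarrow> l) (at_left t)" using l by blast
qed (use assms in auto)


text \<open>The cut points of the approximating partition are produced by Bolzano's lemma, and the time
  change is built by induction along the chain of cut points; near each cut point the
  approximating path switches between its two levels at the time given by
  \<open>switch_point\<close>.\<close>

context
  fixes E :: "'a::metric_space set" and \<delta> :: "nat \<Rightarrow> real" and X :: "nat \<Rightarrow> real \<Rightarrow> 'a"
    and x y :: "real \<Rightarrow> 'a"
  assumes \<delta>: "\<And>j. \<delta> j > 0"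
    and X: "\<And>n. X n \<in> skorohod_class E \<delta>"
    and y: "\<And>q. q \<in> \<rat> \<Longrightarrow> q \<ge> 0 \<Longrightarrow> (\<lambda>n. X n q) \<longlonglongrightarrow> y q"
    and xr: "\<And>t e. t \<ge> 0 \<Longrightarrow> e > 0 \<Longrightarrow> \<exists>h>0. \<forall>q\<in>\<rat> \<inter> {t<..<t+h}. dist (y q) (x t) \<le> e"
    and xl: "\<And>t. t > 0 \<Longrightarrow> \<exists>l. \<forall>e>0. \<exists>h>0. \<forall>q\<in>\<rat> \<inter> {0..} \<inter> {t-h<..<t}. dist (y q) l \<le> e"
begin

text \<open>The interval is open so that jumps of the limit may sit at both of its ends, and only
  rational times are tested because \<open>y\<close> is a limit at rational times only.\<close>

definition flat_step :: "real \<Rightarrow> real \<Rightarrow> real \<Rightarrow> bool" where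
  "flat_step e b c \<longleftrightarrow> b < c \<and> (\<forall>q\<in>\<rat> \<inter> {b<..<c}. \<forall>q'\<in>\<rat> \<inter> {b<..<c}. dist (y q) (y q') \<le> e)"

lemma flat_chain:
  assumes "M \<ge> 0" "e > 0"
  shows "(flat_step e)\<^sup>*\<^sup>* 0 M"
proof -
  have "0 \<le> (0::real) \<longrightarrow> (flat_step e)\<^sup>*\<^sup>* 0 M"
    using \<open>M \<ge> 0\<close>
  \<comment> \<open>The guard on \<open>a\<close> keeps the argument on the half line, where the
    one-sided limits exist.\<close>
  proof (induction rule: Bolzano[where P = "\<lambda>a b. 0 \<le> a \<longrightarrow> (flat_step e)\<^sup>*\<^sup>* a b"])
    case (local t)
    have "\<exists>h>0. \<forall>c. t < c \<and> c < t + h \<longrightarrow> flat_step e t c"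
    proof -
      obtain h where h: "h > 0" "\<forall>q\<in>\<rat> \<inter> {t<..<t+h}. dist (y q) (x t) \<le> e/2"
        using xr[of t "e/2"] local \<open>e > 0\<close> by auto
      have "flat_step e t c" if "t < c" "c < t + h" for c
        unfolding flat_step_def
      proof (intro conjI ballI)
        fix q q' assume "q \<in> \<rat> \<inter> {t<..<c}" "q' \<in> \<rat> \<inter> {t<..<c}"
        then have "dist (y q) (x t) \<le> e/2" "dist (y q') (x t) \<le> e/2"
          using h(2) that by auto
        then show "dist (y q) (y q') \<le> e" using dist_triangle2[of "y q" "y q'" "x t"] by linarith
      qed (use that in auto)
      then show ?thesis using h by blast
    qed
    then obtain h where h: "h > 0" "\<And>c. t < c \<Longrightarrow> c < t + h \<Longrightarrow> flat_step e t c" by blast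
    have "\<exists>h>0. \<forall>c. 0 \<le> c \<and> t - h < c \<and> c < t \<longrightarrow> flat_step e c t"
    proof (cases "t = 0")
      case True
      then show ?thesis by (auto intro: exI[of _ 1])
    next
      case False
      then obtain l where "\<forall>e>0. \<exists>h>0. \<forall>q\<in>\<rat> \<inter> {0..} \<inter> {t-h<..<t}. dist (y q) l \<le> e"
        using xl[of t] local by auto
      then obtain h where h: "h > 0" "\<forall>q\<in>\<rat> \<inter> {0..} \<inter> {t-h<..<t}. dist (y q) l \<le> e/2"
        using \<open>e > 0\<close> by (meson half_gt_zero)
      have "flat_step e c t" if "0 \<le> c" "t - h < c" "c < t" for c
        unfolding flat_step_def
      proof (intro conjI ballI)
        fix q q' assume "q \<in> \<rat> \<inter> {c<..<t}" "q' \<in> \<rat> \<inter> {c<..<t}"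
        then have "dist (y q) l \<le> e/2" "dist (y q') l \<le> e/2"
          using h(2) that by auto
        then show "dist (y q) (y q') \<le> e" using dist_triangle2[of "y q" "y q'" l] by linarith
      qed (use that in auto)
      then show ?thesis using h by blast
    qed
    then obtain h' where h': "h' > 0" "\<And>c. 0 \<le> c \<Longrightarrow> t - h' < c \<Longrightarrow> c < t \<Longrightarrow> flat_step e c t" by blast
    have "(flat_step e)\<^sup>*\<^sup>* a b" if "a \<le> t" "t \<le> b" "b - a < min h h'" "0 \<le> a" for a b
    proof -
      have "(flat_step e)\<^sup>*\<^sup>* a t" using h'(2)[of a] that by (cases "a = t") auto
      moreover have "(flat_step e)\<^sup>*\<^sup>* t b" using h(2)[of b] that by (cases "t = b") auto
      ultimately show ?thesis by (rule rtranclp_trans)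
    qed
    then show ?case using h(1) h'(1) by (intro exI[of _ "min h h'"]) auto
  qed (auto intro: rtranclp_trans)
  then show ?thesis by simp
qed

lemma X_osc: "two_sided_osc {0..<real j} (\<delta> j) (1 / Suc j) (X n)"
  and X_zero: "0 \<le> t \<Longrightarrow> t < \<delta> j \<Longrightarrow> dist (X n 0) (X n t) \<le> 1 / Suc j"
  and X_cadlag: "X n \<in> cadlag_paths E"
  and X_right: "t \<ge> 0 \<Longrightarrow> (X n \<longlongrightarrow> X n t) (at_right t)"
  using X[of n] by (auto simp: skorohod_class_def cadlag_paths_def)

text \<open>Pointwise convergence at rational times becomes uniform closeness inside a flat step. On
  a finite rational grid of mesh below \<open>\<delta> J\<close> the path is eventually close to
  \<open>y\<close>, and between two grid points the oscillation bound keeps it close to one of the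
  grid values.\<close>

lemma X_between:
  assumes step: "flat_step e p p'" and "0 \<le> p" and "b \<in> \<rat>" "a \<in> \<rat>" "p < b" "b < a" "a < p'" "p' \<le> real J"
    and J: "1 / Suc J \<le> e" and "e > 0"
  shows "\<forall>\<^sub>F n in sequentially. \<forall>t\<in>{b..a}. dist (X n t) (y b) \<le> 3 * e"
    and "\<forall>\<^sub>F n in sequentially. dist (X n a) (y b) \<le> 2 * e"
    and "\<forall>\<^sub>F n in sequentially. dist (X n b) (y b) \<le> e"
proof -
  have flat: "dist (y q) (y b) \<le> e" if "q \<in> \<rat>" "q \<in> {b..a}" for q
    using step that assms by (auto simp: flat_step_def)
  have ev: "\<forall>\<^sub>F n in sequentially. dist (X n q) (y q) \<le> e" if "q \<in> \<rat>" "q \<in> {b..a}" for q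
    using tendstoD[OF y[of q] \<open>e > 0\<close>] that assms by (auto elim: eventually_mono)
  have ev': "\<forall>\<^sub>F n in sequentially. dist (X n q) (y b) \<le> 2 * e" if "q \<in> \<rat>" "q \<in> {b..a}" for q
    using ev[OF that]
  proof eventually_elim
    case (elim n)
    then show ?case using flat[OF that] dist_triangle[of "X n q" "y b" "y q"] by linarith
  qed
  show "\<forall>\<^sub>F n in sequentially. dist (X n a) (y b) \<le> 2 * e"
    "\<forall>\<^sub>F n in sequentially. dist (X n b) (y b) \<le> e"
    using ev'[of a] ev[of b] assms by auto
  obtain m :: nat where m: "(a - b) / \<delta> J < real m" using reals_Archimedean2 by blast
  have m0: "m > 0" using m \<delta>[of J] \<open>b < a\<close> by (metis diff_gt_0_iff_gt divide_pos_pos gr0I less_asym of_nat_0)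
  define v where "v = (a - b) / real m"
  define g where "g i = b + real i * v" for i
  have w: "v > 0" "v < \<delta> J" "real m * v = a - b"
    using m m0 \<delta>[of J] \<open>b < a\<close> by (auto simp: field_simps v_def)
  have "v \<in> \<rat>" using assms by (auto simp: v_def)
  have g: "g i \<in> \<rat>" "i \<le> m \<Longrightarrow> g i \<in> {b..a}" for i
  proof -
    show "g i \<in> \<rat>" using assms \<open>v \<in> \<rat>\<close> by (auto simp: g_def)
    assume "i \<le> m"
    have "real i * v \<le> real m * v"
      using \<open>i \<le> m\<close> w by (intro mult_right_mono) auto
    moreover have "real i * v \<ge> 0" using w by simp
    ultimately show "g i \<in> {b..a}" unfolding g_def using w by simp
  qed
  have "\<forall>\<^sub>F n in sequentially. \<forall>i\<in>{..m}. dist (X n (g i)) (y b) \<le> 2 * e"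
    by (intro eventually_ball_finite) (auto intro!: ev' g)
  then show "\<forall>\<^sub>F n in sequentially. \<forall>t\<in>{b..a}. dist (X n t) (y b) \<le> 3 * e"
  proof (eventually_elim, intro ballI)
    fix n t assume n: "\<forall>i\<in>{..m}. dist (X n (g i)) (y b) \<le> 2 * e" and t: "t \<in> {b..a}"
    show "dist (X n t) (y b) \<le> 3 * e"
    proof (cases "\<exists>i\<in>{..m}. t = g i")
      case True
      then show ?thesis using n \<open>e > 0\<close> by force
    next
      case False
      define i where "i = nat \<lfloor>(t - b) / v\<rfloor>"
      have nn: "(t - b) / v \<ge> 0" using t w by auto
      then have i: "real i \<le> (t - b) / v" "(t - b) / v < real i + 1"
        unfolding i_def by linarith+
      have 1: "g i \<le> t" "t < g (Suc i)"
        using i[unfolded pos_le_divide_eq[OF w(1)] pos_divide_less_eq[OF w(1)]]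
        by (simp_all add: g_def algebra_simps)
      have "i < m"
      proof (rule ccontr)
        assume "\<not> i < m"
        then have "real m * v \<le> real i * v"
          using w by (intro mult_right_mono) auto
        then have "a \<le> g i" using w by (simp add: g_def)
        then have "t = g m" using 1 t w by (auto simp: g_def)
        then show False using False by auto
      qed
      then have 2: "g i < t" using False 1 by (metis atMost_iff less_eq_real_def less_imp_le_nat)
      have "dist (X n (g i)) (X n t) \<le> 1 / Suc J \<or> dist (X n t) (X n (g (Suc i))) \<le> 1 / Suc J"
      proof (rule two_sided_oscD[OF X_osc])
        have "g (Suc i) - g i = v" by (simp add: g_def algebra_simps)
        then show "g (Suc i) - g i < \<delta> J" using w by simp
        show "g i \<in> {0..<real J}" "t \<in> {0..<real J}" "g (Suc i) \<in> {0..<real J}"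
          using g(2)[of i] g(2)[of "Suc i"] \<open>i < m\<close> assms t by auto
      qed (use 1 2 in auto)
      moreover have "dist (X n (g i)) (y b) \<le> 2 * e" "dist (X n (g (Suc i))) (y b) \<le> 2 * e"
        using n \<open>i < m\<close> by auto
      ultimately show ?thesis using J dist_triangle3[of "X n t" "y b" "X n (g i)"]
          dist_triangle[of "X n t" "y b" "X n (g (Suc i))"] by linarith
    qed
  qed
qed

lemma x_near_flat:
  assumes "flat_step e p p'" "0 \<le> p" "p \<le> s" "s < p'" "b \<in> \<rat>" "p < b" "b < p'" "e > 0"
  shows "dist (x s) (y b) \<le> 2 * e"
proof -
  obtain h where h: "h > 0" "\<forall>q\<in>\<rat> \<inter> {s<..<s+h}. dist (y q) (x s) \<le> e"
    using xr[of s e] assms by auto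
  have "s < min p' (s + h)" using assms h by auto
  then obtain q where q: "q \<in> \<rat>" "s < q" "q < min p' (s + h)" using Rats_dense_in_real by blast
  then have "dist (y q) (x s) \<le> e" "dist (y q) (y b) \<le> e"
    using h assms by (auto simp: flat_step_def)
  then show ?thesis using dist_triangle3[of "x s" "y b" "y q"] by linarith
qed

lemma time_change_extend:
  fixes l :: "real \<Rightarrow> real"
  assumes l: "strict_mono_on {0..p} l" "l ` {0..p} = {0..l p}"
    and "0 \<le> p" "p < p'" "l p < \<tau>"
  defines "l' \<equiv> (\<lambda>s. if s \<le> p then l s else l p + (s - p) * ((\<tau> - l p) / (p' - p)))"
  shows "strict_mono_on {0..p'} l'" "l' ` {0..p'} = {0..l' p'}" "l' p' = \<tau>"
proof -
  define k where "k = (\<tau> - l p) / (p' - p)"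
  have k: "k > 0" "(p' - p) * k = \<tau> - l p" using assms by (auto simp: k_def)
  have l': "l' s = (if s \<le> p then l s else l p + (s - p) * k)" for s by (simp add: l'_def k_def)
  show lend: "l' p' = \<tau>" using k \<open>p < p'\<close> by (simp add: l')
  have lp: "l s \<le> l p" if "0 \<le> s" "s \<le> p" for s
    using that strict_mono_on_leD[OF l(1), of s p] by auto
  show "strict_mono_on {0..p'} l'"
  proof (rule strict_mono_onI)
    fix r s assume *: "r \<in> {0..p'}" "s \<in> {0..p'}" "r < s"
    show "l' r < l' s"
    proof (cases "s \<le> p")
      case True
      then show ?thesis using strict_mono_onD[OF l(1), of r s] * by (auto simp: l')
    next
      case s: False
      show ?thesis
      proof (cases "r \<le> p")
        case True
        have "l r \<le> l p" using lp[of r] True * by auto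
        moreover have "(s - p) * k > 0" using s k by simp
        ultimately show ?thesis using True s by (auto simp: l')
      next
        case False
        then show ?thesis using s * k by (auto simp: l')
      qed
    qed
  qed
  have "{0..p'} = {0..p} \<union> {p<..p'}" using \<open>0 \<le> p\<close> \<open>p < p'\<close> by auto
  then have "l' ` {0..p'} = l' ` {0..p} \<union> l' ` {p<..p'}" by (metis image_Un)
  also have "l' ` {0..p} = {0..l p}" using l(2) by (force simp: l' image_iff)
  also have "l' ` {p<..p'} = {l p<..\<tau>}"
  proof (intro set_eqI iffI)
    fix u assume "u \<in> l' ` {p<..p'}"
    then obtain s where s: "p < s" "s \<le> p'" "u = l p + (s - p) * k" by (auto simp: l')
    have "(s - p) * k \<le> (p' - p) * k" "(s - p) * k > 0" using s k mult_right_mono[of "s - p" "p' - p" k] by auto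
    then show "u \<in> {l p<..\<tau>}" using s k by auto
  next
    fix u assume u: "u \<in> {l p<..\<tau>}"
    define s where "s = p + (u - l p) / k"
    have "(u - l p) / k \<le> (p' - p)" using u k by (simp add: divide_le_eq)
    moreover have "(u - l p) / k > 0" using u k by simp
    ultimately have "s \<in> {p<..p'}" by (auto simp: s_def)
    moreover have "u = l' s" using calculation k by (simp add: l' s_def)
    ultimately show "u \<in> l' ` {p<..p'}" by blast
  qed
  also have "{0..l p} \<union> {l p<..\<tau>} = {0..\<tau>}"
  proof -
    have "l p \<in> {0..l p}" using l(2) \<open>0 \<le> p\<close> by (metis atLeastAtMost_iff imageI order_refl)
    then show ?thesis using assms by (intro ivl_disj_un_two) auto
  qed
  finally show "l' ` {0..p'} = {0..l' p'}" by (simp add: lend)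
qed

text \<open>Induction invariant along the chain of cut points. The time \<open>l p\<close> is where
  \<open>X n\<close> switches near the cut point \<open>p\<close>, and \<open>b\<close> is a
  rational time slightly to the right of \<open>p\<close> by which \<open>X n\<close> has settled on
  its next level. The tolerance \<kappa> is universally quantified because the step calls the
  hypothesis with a smaller one, which forces \<open>b\<close> to lie before the next cut
  point.\<close>

lemma time_change_upto:
  assumes "(flat_step e)\<^sup>*\<^sup>* 0 p" "e > 0" and J: "1 / Suc J \<le> e" "p + 1 < real J" and "\<kappa> > 0"
  shows "p \<ge> 0 \<and> (\<exists>b\<in>\<rat>. p < b \<and> b < p + \<kappa> \<and> (\<forall>\<^sub>F n in sequentially. \<exists>l. strict_mono_on {0..p} l \<and>
     l ` {0..p} = {0..l p} \<and> (\<forall>s\<in>{0..p}. \<bar>l s - s\<bar> < \<kappa>) \<and>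
     (\<forall>s\<in>{0..<p}. dist (X n (l s)) (x s) \<le> 6 * e) \<and> l p \<le> b \<and>
     (\<forall>t\<in>{l p..b}. dist (X n t) (X n b) \<le> 2 * e)))"
  using assms(1) J(2) \<open>\<kappa> > 0\<close>
proof (induction arbitrary: \<kappa> rule: rtranclp_induct)
  case base
  have "0 < min \<kappa> (\<delta> J)" using base \<delta> by simp
  then obtain b where b: "b \<in> \<rat>" "0 < b" "b < min \<kappa> (\<delta> J)" using Rats_dense_in_real by blast
  \<comment> \<open>A time change fixes 0 and cannot absorb a jump right after it. This is where the
    condition against early jumps enters.\<close>
  have "dist (X n t) (X n b) \<le> 2 * e" if "t \<in> {0..b}" for n t
    using X_zero[of t J n] X_zero[of b J n] dist_triangle3[of "X n t" "X n b" "X n 0"] that b J by auto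
  then show ?case using b base
    by (intro conjI bexI[of _ b] always_eventually allI exI[of _ id]) (auto simp: strict_mono_on_def)
next
  case (step p p')
  then have step': "flat_step e p p'" and pp: "p < p'" by (auto simp: flat_step_def)
  define \<kappa>1 where "\<kappa>1 = min \<kappa> (p' - p)"
  have "\<kappa>1 > 0" "p + 1 < real J" using pp step by (auto simp: \<kappa>1_def)
  from step.IH[OF this(2,1)] obtain b where "p \<ge> 0" and b: "b \<in> \<rat>" "p < b" "b < p + \<kappa>1" and
    ev: "\<forall>\<^sub>F n in sequentially. \<exists>l. strict_mono_on {0..p} l \<and>
     l ` {0..p} = {0..l p} \<and> (\<forall>s\<in>{0..p}. \<bar>l s - s\<bar> < \<kappa>1) \<and>
     (\<forall>s\<in>{0..<p}. dist (X n (l s)) (x s) \<le> 6 * e) \<and> l p \<le> b \<and>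
     (\<forall>t\<in>{l p..b}. dist (X n t) (X n b) \<le> 2 * e)" by blast
  have "b < p'" using b by (auto simp: \<kappa>1_def)
  \<comment> \<open>The window from \<open>a\<close> to \<open>b'\<close> extends by less than
    \<open>h\<close> on each side of \<open>p'\<close>, so its length stays below
    \<open>\<delta> J\<close>; the bound 1 keeps it inside the horizon \<open>J\<close>.\<close>
  define h where "h = min (min \<kappa> (\<delta> J)) 1 / 2"
  have h: "h > 0" "h < \<kappa>" "2 * h \<le> \<delta> J" "h < 1" using \<delta>[of J] step by (auto simp: h_def)
  have "max b (p' - h) < p'" using \<open>b < p'\<close> h by auto
  then obtain a where a: "a \<in> \<rat>" "max b (p' - h) < a" "a < p'" using Rats_dense_in_real by blast
  obtain b' where b': "b' \<in> \<rat>" "p' < b'" "b' < p' + h" using h Rats_dense_in_real[of p' "p' + h"] by auto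
  have "b < a" using a by auto
  note bet = X_between[OF step' \<open>p \<ge> 0\<close> b(1) a(1) b(2) \<open>b < a\<close> a(3) _ J(1) \<open>e > 0\<close>]
  have "p' \<le> real J" using step by auto
  show ?case
  proof (intro conjI bexI[OF _ b'(1)])
    show "b' < p' + \<kappa>" using b' h by auto
    show "\<forall>\<^sub>F n in sequentially. \<exists>l. strict_mono_on {0..p'} l \<and>
       l ` {0..p'} = {0..l p'} \<and> (\<forall>s\<in>{0..p'}. \<bar>l s - s\<bar> < \<kappa>) \<and>
       (\<forall>s\<in>{0..<p'}. dist (X n (l s)) (x s) \<le> 6 * e) \<and> l p' \<le> b' \<and>
       (\<forall>t\<in>{l p'..b'}. dist (X n t) (X n b') \<le> 2 * e)"
      using ev bet(1)[OF \<open>p' \<le> real J\<close>] bet(2)[OF \<open>p' \<le> real J\<close>] bet(3)[OF \<open>p' \<le> real J\<close>]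
    proof eventually_elim
      case (elim n)
      then obtain l where l: "strict_mono_on {0..p} l" "l ` {0..p} = {0..l p}"
        "\<And>s. s \<in> {0..p} \<Longrightarrow> \<bar>l s - s\<bar> < \<kappa>1"
        "\<And>s. s \<in> {0..<p} \<Longrightarrow> dist (X n (l s)) (x s) \<le> 6 * e" "l p \<le> b"
        "\<And>t. t \<in> {l p..b} \<Longrightarrow> dist (X n t) (X n b) \<le> 2 * e" by blast
      have osc: "two_sided_osc {a..b'} (\<delta> J) (1 / Suc J) (X n)"
        by (rule two_sided_osc_mono[OF X_osc[of J]]) (use a b b' h step \<open>b < a\<close> \<open>p \<ge> 0\<close> in auto)
      obtain \<tau> where \<tau>: "a \<le> \<tau>" "\<tau> \<le> b'"
        "\<And>t. a \<le> t \<Longrightarrow> t < \<tau> \<Longrightarrow> dist (X n t) (X n a) \<le> 2 * (1 / Suc J)"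
        "\<And>t. \<tau> \<le> t \<Longrightarrow> t \<le> b' \<Longrightarrow> dist (X n t) (X n b') \<le> 1 / Suc J"
        by (rule switch_point[OF osc]) (use a b b' h \<open>b < a\<close> \<open>p \<ge> 0\<close> in \<open>auto intro: X_right\<close>)
      define l' where "l' = (\<lambda>s. if s \<le> p then l s else l p + (s - p) * ((\<tau> - l p) / (p' - p)))"
      have "l p < \<tau>" using l(5) \<tau>(1) \<open>b < a\<close> by linarith
      then have ext: "strict_mono_on {0..p'} l'" "l' ` {0..p'} = {0..l' p'}" "l' p' = \<tau>"
        using time_change_extend[OF l(1,2) \<open>p \<ge> 0\<close> pp, of \<tau>] unfolding l'_def by blast+
      have l'p: "l' p = l p" by (simp add: l'_def)
      have near: "dist (X n u) (y b) \<le> 4 * e" if "l p \<le> u" "u < \<tau>" for u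
      proof -
        consider "u \<le> b" | "b \<le> u" "u \<le> a" | "a \<le> u" by linarith
        then show ?thesis
        proof cases
          case 1
          then have "dist (X n u) (X n b) \<le> 2 * e" using l(6) that by auto
          then show ?thesis using elim(4) dist_triangle[of "X n u" "y b" "X n b"] \<open>e > 0\<close> by linarith
        next
          case 2
          then show ?thesis using elim(2) \<open>e > 0\<close> by force
        next
          case 3
          then have "dist (X n u) (X n a) \<le> 2 * (1 / Suc J)" using \<tau>(3) that by auto
          then show ?thesis using elim(3) dist_triangle[of "X n u" "y b" "X n a"] J by linarith
        qed
      qed
      have "dist (X n (l' s)) (x s) \<le> 6 * e" if s: "s \<in> {0..<p'}" for s
      proof (cases "s < p")
        case True
        then show ?thesis using l(4)[of s] s by (auto simp: l'_def)
      next
        case False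
        have "l' p \<le> l' s" using strict_mono_on_leD[OF ext(1), of p s] False s \<open>p \<ge> 0\<close> by auto
        moreover have "l' s < \<tau>" using strict_mono_onD[OF ext(1), of s p'] s ext(3) by auto
        ultimately have "dist (X n (l' s)) (y b) \<le> 4 * e" by (intro near) (auto simp: l'p)
        moreover have "dist (x s) (y b) \<le> 2 * e"
          by (rule x_near_flat[OF step' \<open>p \<ge> 0\<close>]) (use False s b \<open>b < p'\<close> \<open>e > 0\<close> in auto)
        ultimately show ?thesis using dist_triangle2[of "X n (l' s)" "x s" "y b"] by linarith
      qed
      moreover have "\<bar>l' s - s\<bar> < \<kappa>" if s: "s \<in> {0..p'}" for s
      proof (cases "s \<le> p")
        case True
        then show ?thesis using l(3)[of s] s by (auto simp: l'_def \<kappa>1_def)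
      next
        case False
        \<comment> \<open>The displacement of a linear interpolation is a convex combination of the
          displacements at its two ends.\<close>
        define \<theta> where "\<theta> = (s - p) / (p' - p)"
        have \<theta>: "0 \<le> \<theta>" "\<theta> \<le> 1" "s - p = \<theta> * (p' - p)" using False s pp by (auto simp: \<theta>_def divide_le_eq)
        have "l' s = l p + \<theta> * (\<tau> - l p)" using False by (simp add: l'_def \<theta>_def)
        then have "l' s - s = (1 - \<theta>) * (l p - p) + \<theta> * (\<tau> - p')"
          using \<theta>(3) by (simp add: algebra_simps)
        moreover have "\<bar>l p - p\<bar> < \<kappa>" using l(3)[of p] \<open>p \<ge> 0\<close> by (auto simp: \<kappa>1_def)
        moreover have "\<bar>\<tau> - p'\<bar> < \<kappa>" using \<tau> a b' h by auto
        ultimately show ?thesis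
          using convex_bound_lt[of "l p - p" \<kappa> "\<tau> - p'" "1 - \<theta>" \<theta>]
            convex_bound_lt[of "- (l p - p)" \<kappa> "- (\<tau> - p')" "1 - \<theta>" \<theta>] \<theta>
          by (auto simp: abs_less_iff algebra_simps)
      qed
      moreover have "dist (X n t) (X n b') \<le> 2 * e" if "t \<in> {l' p'..b'}" for t
        using \<tau>(4)[of t] that ext(3) J(1) \<open>e > 0\<close> by auto
      ultimately show ?case using ext \<tau>(2) by (intro exI[of _ l']) auto
    qed
  qed (use b' pp \<open>p \<ge> 0\<close> in auto)
qed

lemma eventually_skorohod_nbhd:
  assumes "\<epsilon> > 0"
  shows "\<forall>\<^sub>F n in sequentially. X n \<in> skorohod_nbhd E x N \<epsilon>"
proof -
  \<comment> \<open>The estimate excludes the end point \<open>M\<close>, hence the margin over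
    \<open>N\<close>, which may be negative.\<close>
  define M where "M = max N 0 + 1"
  \<comment> \<open>The errors add up to at most \<open>6 * e\<close>, so a seventh makes the
    inequality strict.\<close>
  define e where "e = \<epsilon> / 7"
  have "e > 0" using assms by (simp add: e_def)
  obtain j0 :: nat where j0: "1 / e < real j0" using reals_Archimedean2 by blast
  obtain j1 :: nat where j1: "M + 1 < real j1" using reals_Archimedean2 by blast
  define J where "J = max j0 j1"
  have "1 / e < Suc J" using j0 by (auto simp: J_def)
  then have J: "1 / Suc J \<le> e" "M + 1 < real J" using \<open>e > 0\<close> j1 by (auto simp: field_simps J_def)
  have "M \<ge> 0" by (simp add: M_def)
  from time_change_upto[OF flat_chain[OF this \<open>e > 0\<close>] \<open>e > 0\<close> J assms]
  obtain b where ev: "\<forall>\<^sub>F n in sequentially. \<exists>l. strict_mono_on {0..M} l \<and>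
     l ` {0..M} = {0..l M} \<and> (\<forall>s\<in>{0..M}. \<bar>l s - s\<bar> < \<epsilon>) \<and>
     (\<forall>s\<in>{0..<M}. dist (X n (l s)) (x s) \<le> 6 * e) \<and> l M \<le> b \<and>
     (\<forall>t\<in>{l M..b}. dist (X n t) (X n b) \<le> 2 * e)" by blast
  then show ?thesis
  proof eventually_elim
    case (elim n)
    then obtain l where l: "strict_mono_on {0..M} l"
      "l ` {0..M} = {0..l M}" "\<And>s. s \<in> {0..M} \<Longrightarrow> \<bar>l s - s\<bar> < \<epsilon>"
      "\<And>s. s \<in> {0..<M} \<Longrightarrow> dist (X n (l s)) (x s) \<le> 6 * e" by blast
    \<comment> \<open>Beyond \<open>M\<close> the time change is a translation, so its displacement
      stays that of \<open>M\<close>.\<close>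
    define L where "L = (\<lambda>s. if s \<le> M then l s else s - M + l M)"
    have lM: "l s \<le> l M" if "0 \<le> s" "s \<le> M" for s
      using that strict_mono_on_leD[OF l(1), of s M] by auto
    have mono: "strict_mono_on {0..} L"
    proof (rule strict_mono_onI)
      fix r s :: real assume "r \<in> {0..}" "s \<in> {0..}" "r < s"
      then show "L r < L s" using strict_mono_onD[OF l(1), of r s] lM[of r] by (auto simp: L_def)
    qed
    have "{0..} = {0..M} \<union> {M<..}" using \<open>M \<ge> 0\<close> by auto
    then have "L ` {0..} = L ` {0..M} \<union> L ` {M<..}" by (metis image_Un)
    also have "L ` {0..M} = {0..l M}" using l(2) by (force simp: L_def image_iff)
    also have "L ` {M<..} = {l M<..}"
      by (auto simp: L_def image_iff intro!: bexI[of _ "_ + M - l M"])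
    also have "{0..l M} \<union> {l M<..} = {0..}"
      using l(2) \<open>M \<ge> 0\<close> by (metis atLeastAtMost_iff imageI ivl_disj_un_one(7) order_refl)
    finally have "bij_betw L {0..} {0..}"
      using mono by (auto simp: bij_betw_def intro: strict_mono_on_imp_inj_on)
    moreover have "\<bar>L s - s\<bar> < \<epsilon>" if "s \<ge> 0" for s
      using l(3)[of s] l(3)[of M] that \<open>M \<ge> 0\<close> by (auto simp: L_def)
    moreover have "dist (X n (L s)) (x s) < \<epsilon>" if "s \<in> {0..N}" for s
      using l(4)[of s] that \<open>e > 0\<close> by (auto simp: L_def M_def e_def)
    ultimately show ?case using X_cadlag mono by (auto simp: skorohod_nbhd_def time_changes_def)
  qed
qed

end

section \<open>Sequential compactness of the classes\<close>

lemma compact_functions_into: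
  fixes E :: "'a::metric_space set"
  assumes "compact E"
  shows "compact {f :: 'i::countable \<Rightarrow> 'a. \<forall>i. f i \<in> E}"
proof -
  have "compactin (product_topology (\<lambda>i::'i. euclidean) UNIV) (PiE UNIV (\<lambda>_. E))"
    using assms by (simp add: compactin_PiE)
  moreover have "PiE UNIV (\<lambda>_. E) = {f :: 'i \<Rightarrow> 'a. \<forall>i. f i \<in> E}" by (auto simp: PiE_def Pi_def)
  ultimately show ?thesis by (simp add: euclidean_product_topology)
qed

text \<open>Lets the error vanish in a disjunction although the valid alternative may depend on the
  error.\<close>

lemma le_if_le_add_small:
  fixes a b c d :: real
  assumes "\<And>e. e > 0 \<Longrightarrow> a \<le> c + e \<or> b \<le> c + e"
  shows "a \<le> c \<or> b \<le> c"
proof (rule ccontr)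
  assume "\<not> ?thesis"
  then have "(if a \<le> b then a - c else b - c) / 2 > 0" by auto
  from assms[OF this] \<open>\<not> ?thesis\<close> show False
    by (simp add: field_simps split: if_splits)
qed

text \<open>All constraints on \<open>s\<close>, \<open>t\<close>, \<open>u\<close> are strict, so
  the three times can be moved slightly to the right onto rationals without violating them. The
  lemma serves twice: for the limit path, and for the description of the class by rational
  times.\<close>

lemma two_sided_osc_right_approx:
  fixes x y :: "real \<Rightarrow> 'a::metric_space"
  assumes yosc: "two_sided_osc (\<rat> \<inter> {0..<real j}) d c y"
    and approx: "\<And>t e h. t \<ge> 0 \<Longrightarrow> e > 0 \<Longrightarrow> h > 0 \<Longrightarrow> \<exists>q\<in>\<rat>. t < q \<and> q < t + h \<and> dist (y q) (x t) \<le> e"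
  shows "two_sided_osc {0..<real j} d c x"
  unfolding two_sided_osc_def
proof (intro ballI impI, rule le_if_le_add_small)
  fix s t u and e :: real
  assume *: "s \<in> {0..<real j}" "t \<in> {0..<real j}" "u \<in> {0..<real j}"
    "s < t" "t < u" "u - s < d" "e > 0"
  obtain s' where s': "s' \<in> \<rat>" "s < s'" "s' < s + (t - s)" "dist (y s') (x s) \<le> e/2"
    using approx[of s "e/2" "t - s"] * by auto
  obtain t' where t': "t' \<in> \<rat>" "t < t'" "t' < t + (u - t)" "dist (y t') (x t) \<le> e/2"
    using approx[of t "e/2" "u - t"] * by auto
  have "min (real j - u) (d - (u - s)) > 0" using * by auto
  then obtain u' where u': "u' \<in> \<rat>" "u < u'" "u' < u + min (real j - u) (d - (u - s))" "dist (y u') (x u) \<le> e/2"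
    using approx[of u "e/2"] * by (meson atLeastLessThan_iff half_gt_zero)
  have "dist (y s') (y t') \<le> c \<or> dist (y t') (y u') \<le> c"
    by (rule two_sided_oscD[OF yosc]) (use * s' t' u' in auto)
  moreover have "dist (x p) (x q) \<le> dist (y p') (x p) + dist (y p') (y q') + dist (y q') (x q)" for p q p' q'
    using dist_triangle[of "x p" "x q" "y p'"] dist_triangle[of "y p'" "x q" "y q'"]
    by (simp add: dist_commute)
  from this[of s t s' t'] this[of t u t' u']
  have "dist (x s) (x t) \<le> dist (y s') (y t') + e" "dist (x t) (x u) \<le> dist (y t') (y u') + e"
    using s' t' u' by auto
  ultimately show "dist (x s) (x t) \<le> c + e \<or> dist (x t) (x u) \<le> c + e" by linarith
qed

text \<open>A subsequence converges at all rational times to some \<open>y\<close>, which inherits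
  the modulus; the right limits of \<open>y\<close> form \<open>x\<close>. The two may differ at a
  rational jump time, but at 0 the early-jump condition makes them agree, and so \<open>x\<close>
  stays in the class.\<close>

theorem skorohod_class_sequentially_compact:
  assumes E: "compact E" and \<delta>: "\<And>j. \<delta> j > 0" and X: "\<And>n. X n \<in> skorohod_class E \<delta>"
  obtains x r where "x \<in> skorohod_class E \<delta>" "strict_mono (r :: nat \<Rightarrow> nat)"
    "\<And>N e. e > 0 \<Longrightarrow> \<forall>\<^sub>F n in sequentially. X (r n) \<in> skorohod_nbhd E x N e"
proof -
  have XE: "X n t \<in> E" if "t \<ge> 0" for n t
    using X[of n] that by (auto simp: skorohod_class_def cadlag_paths_def)
  \<comment> \<open>Indexing by the countable type \<open>rat\<close> makes the function space
    metrizable, so compactness yields convergent subsequences. Negative rationals are sent to time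
    0.\<close>
  define Z where "Z n = (\<lambda>q::rat. X n (max 0 (of_rat q)))" for n
  have "Z n \<in> {f. \<forall>i. f i \<in> E}" for n using XE by (auto simp: Z_def)
  then have ZE: "\<forall>n. Z n \<in> {f. \<forall>i. f i \<in> E}" by blast
  obtain f r where f: "f \<in> {f. \<forall>i. f i \<in> E}" and r: "strict_mono r" and lim: "(Z \<circ> r) \<longlonglongrightarrow> f"
    by (rule seq_compactE[OF compact_imp_seq_compact[OF compact_functions_into[OF E]] ZE])
  have limq: "(\<lambda>n. Z (r n) q) \<longlonglongrightarrow> f q" for q
  proof -
    have "continuous_on UNIV (\<lambda>g :: rat \<Rightarrow> 'a. g q)" by (rule continuous_on_product_coordinates)
    from continuous_on_tendsto_compose[OF this lim] show ?thesis by (simp add: o_def)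
  qed
  define y where "y t = f (inv of_rat t)" for t :: real
  have yq: "y (of_rat q) = f q" for q
    by (simp add: y_def inv_f_f inj_def)
  have ylim: "(\<lambda>n. X (r n) q) \<longlonglongrightarrow> y q" if q: "q \<in> \<rat>" "q \<ge> 0" for q
  proof -
    obtain q' where "q = of_rat q'" using q by (auto elim: Rats_cases)
    then show ?thesis using limq[of q'] q by (simp add: Z_def yq)
  qed
  have yE: "y q \<in> E" for q using f by (simp add: y_def)
  have yosc: "two_sided_osc (\<rat> \<inter> {0..<real j}) (\<delta> j) (1 / Suc j) y" for j
    unfolding two_sided_osc_def
  proof (intro ballI impI, rule le_if_le_add_small)
    fix s t u and e :: real
    assume *: "s \<in> \<rat> \<inter> {0..<real j}" "t \<in> \<rat> \<inter> {0..<real j}" "u \<in> \<rat> \<inter> {0..<real j}"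
      "s < t" "t < u" "u - s < \<delta> j" "e > 0"
    have "\<forall>\<^sub>F n in sequentially. dist (X (r n) q) (y q) < e/2" if "q \<in> \<rat> \<inter> {0..<real j}" for q
      using tendstoD[OF ylim[of q], of "e/2"] that * by auto
    from eventually_happens[OF eventually_conj[OF eventually_conj[OF this[OF *(1)] this[OF *(2)]] this[OF *(3)]]]
    obtain n where n: "dist (X (r n) s) (y s) < e/2" "dist (X (r n) t) (y t) < e/2" "dist (X (r n) u) (y u) < e/2"
      by auto
    have "dist (X (r n) s) (X (r n) t) \<le> 1 / Suc j \<or> dist (X (r n) t) (X (r n) u) \<le> 1 / Suc j"
      by (rule two_sided_oscD[of "{0..<real j}" "\<delta> j"]) (use * X[of "r n"] in \<open>auto simp: skorohod_class_def\<close>)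
    moreover have "dist (y p) (y q) \<le> dist (X (r n) p) (y p) + dist (X (r n) p) (X (r n) q) + dist (X (r n) q) (y q)" for p q
      using dist_triangle[of "y p" "y q" "X (r n) p"] dist_triangle[of "X (r n) p" "y q" "X (r n) q"]
      by (simp add: dist_commute)
    from this[of s t] this[of t u]
    have "dist (y s) (y t) \<le> dist (X (r n) s) (X (r n) t) + e" "dist (y t) (y u) \<le> dist (X (r n) t) (X (r n) u) + e"
      using n by auto
    ultimately show "dist (y s) (y t) \<le> 1 / Suc j + e \<or> dist (y t) (y u) \<le> 1 / Suc j + e" by linarith
  qed
  have yzero: "dist (y 0) (y q) \<le> 1 / Suc j" if "q \<in> \<rat>" "0 \<le> q" "q < \<delta> j" for q j
  proof (rule tendsto_upperbound)
    show "(\<lambda>n. dist (X (r n) 0) (X (r n) q)) \<longlonglongrightarrow> dist (y 0) (y q)"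
      using that by (intro tendsto_dist ylim) auto
    show "\<forall>\<^sub>F n in sequentially. dist (X (r n) 0) (X (r n) q) \<le> 1 / Suc j"
      using X that by (auto simp: skorohod_class_def)
  qed auto
  have level: "\<exists>j. 1 / Suc j \<le> e \<and> t + 1 < real j" if "e > 0" for e t
  proof -
    obtain j0 :: nat where j0: "1 / e < real j0" using reals_Archimedean2 by blast
    obtain j1 :: nat where j1: "t + 1 < real j1" using reals_Archimedean2 by blast
    have "1 / e < Suc (max j0 j1)" using j0 by auto
    then show ?thesis using \<open>e > 0\<close> j1 by (intro exI[of _ "max j0 j1"]) (auto simp: field_simps)
  qed
  have yosc': "\<exists>d>0. two_sided_osc (\<rat> \<inter> {0..} \<inter> {t-d<..<t+d}) d e y" if "e > 0" for e t
  proof -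
    obtain j where j: "1 / Suc j \<le> e" "t + 1 < real j" using level[OF \<open>e > 0\<close>, of t] by auto
    have "two_sided_osc (\<rat> \<inter> {0..} \<inter> {t - min (\<delta> j) 1<..<t + min (\<delta> j) 1}) (min (\<delta> j) 1) e y"
      by (rule two_sided_osc_mono[OF yosc[of j]]) (use j in auto)
    then show ?thesis using \<delta>[of j] by (intro exI[of _ "min (\<delta> j) 1"]) auto
  qed
  have "\<exists>l\<in>E. \<forall>e>0. \<exists>h>0. \<forall>q\<in>\<rat> \<inter> {0..} \<inter> {t<..<t+h}. dist (y q) l \<le> e" if "t \<ge> 0" for t
  proof (rule right_limit_of_two_sided_osc[of E "\<rat> \<inter> {0..}" y t])
    fix h :: real assume "h > 0"
    then show "\<rat> \<inter> {0..} \<inter> {t<..<t+h} \<noteq> {}" using Rats_dense_in_real[of t "t + h"] that by force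
  next
    fix e :: real assume "e > 0"
    then obtain d where "d > 0" "two_sided_osc (\<rat> \<inter> {0..} \<inter> {t-d<..<t+d}) d e y" using yosc' by blast
    then show "\<exists>d>0. two_sided_osc (\<rat> \<inter> {0..} \<inter> {t<..<t+d}) d e y"
      by (intro exI[of _ d] conjI two_sided_osc_mono[where A' = "_ \<inter> _"]) auto
  qed (use E yE in auto)
  then obtain x0 where x0: "\<And>t. t \<ge> 0 \<Longrightarrow> x0 t \<in> E"
    "\<And>t e. t \<ge> 0 \<Longrightarrow> e > 0 \<Longrightarrow> \<exists>h>0. \<forall>q\<in>\<rat> \<inter> {0..} \<inter> {t<..<t+h}. dist (y q) (x0 t) \<le> e" by metis
  define x where "x = restrict x0 {0..}"
  have xr: "\<exists>h>0. \<forall>q\<in>\<rat> \<inter> {t<..<t+h}. dist (y q) (x t) \<le> e" if "t \<ge> 0" "e > 0" for t e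
    using x0(2)[OF that] that by (fastforce simp: x_def)
  have xl: "\<exists>l. \<forall>e>0. \<exists>h>0. \<forall>q\<in>\<rat> \<inter> {0..} \<inter> {t-h<..<t}. dist (y q) l \<le> e" if "t > 0" for t
  proof (rule left_limit_of_two_sided_osc[of E "\<rat> \<inter> {0..}" y t])
    fix h :: real assume "h > 0"
    then show "\<rat> \<inter> {0..} \<inter> {t-h<..<t} \<noteq> {}" using Rats_dense_in_real[of "max 0 (t-h)" t] that by force
  next
    fix e :: real assume "e > 0"
    then obtain d where "d > 0" "two_sided_osc (\<rat> \<inter> {0..} \<inter> {t-d<..<t+d}) d e y" using yosc' by blast
    then show "\<exists>d>0. two_sided_osc (\<rat> \<inter> {0..} \<inter> {t-d<..<t}) d e y"
      by (intro exI[of _ d] conjI two_sided_osc_mono[where A' = "_ \<inter> _"]) auto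
  qed (use E yE in auto)
  have approx: "\<exists>q\<in>\<rat>. t < q \<and> q < t + h \<and> dist (y q) (x t) \<le> e" if *: "t \<ge> 0" "e > 0" "h > 0" for t e h
  proof -
    obtain h' where h': "h' > 0" "\<forall>q\<in>\<rat> \<inter> {t<..<t+h'}. dist (y q) (x t) \<le> e"
      using xr[OF *(1,2)] by blast
    have "t < t + min h h'" using h' * by simp
    then obtain q where "q \<in> \<rat>" "t < q" "q < t + min h h'"
      using Rats_dense_in_real by blast
    then show ?thesis using h' by auto
  qed
  have xosc: "two_sided_osc {0..<real j} (\<delta> j) (1 / Suc j) x" for j
    using yosc approx by (rule two_sided_osc_right_approx)
  have x_zero: "x 0 = y 0"
  proof (rule ccontr)
    assume "x 0 \<noteq> y 0"
    then have pos: "dist (x 0) (y 0) / 3 > 0" by simp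
    then obtain j where j: "1 / Suc j \<le> dist (x 0) (y 0) / 3" using level by blast
    obtain q where q: "q \<in> \<rat>" "0 < q" "q < 0 + \<delta> j" "dist (y q) (x 0) \<le> dist (x 0) (y 0) / 3"
      using approx[of 0 _ "\<delta> j"] pos \<delta> by blast
    have "dist (y 0) (y q) \<le> dist (x 0) (y 0) / 3" using yzero[of q j] q j by auto
    then show False using q dist_triangle3[of "x 0" "y 0" "y q"] pos by (simp add: dist_commute)
  qed
  have xzero: "dist (x 0) (x t) \<le> 1 / Suc j" if t: "0 \<le> t" "t < \<delta> j" for t j
  proof (rule field_le_epsilon)
    fix e :: real assume "e > 0"
    obtain q where q: "q \<in> \<rat>" "t < q" "q < t + (\<delta> j - t)" "dist (y q) (x t) \<le> e"
      using approx[of t e "\<delta> j - t"] t \<open>e > 0\<close> by auto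
    then show "dist (x 0) (x t) \<le> 1 / Suc j + e"
      using yzero[of q j] dist_triangle[of "x 0" "x t" "y q"] that by (auto simp: x_zero)
  qed
  have xright: "(x \<longlongrightarrow> x t) (at_right t)" if t: "t \<ge> 0" for t
  proof (rule tendstoI)
    fix e :: real assume "e > 0"
    obtain h where h: "h > 0" "\<forall>q\<in>\<rat> \<inter> {t<..<t+h}. dist (y q) (x t) \<le> e/3"
      using xr[of t "e/3"] t \<open>e > 0\<close> by auto
    have "dist (x s) (x t) < e" if s: "t < s" "s < t + h" for s
    proof -
      obtain q where q: "q \<in> \<rat>" "s < q" "q < s + (t + h - s)" "dist (y q) (x s) \<le> e/3"
        using approx[of s "e/3" "t + h - s"] s \<open>t \<ge> 0\<close> \<open>e > 0\<close> by auto
      then have "dist (y q) (x t) \<le> e/3" using h s by auto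
      then show ?thesis using q dist_triangle3[of "x s" "x t" "y q"] \<open>e > 0\<close> by linarith
    qed
    then show "\<forall>\<^sub>F s in at_right t. dist (x s) (x t) < e"
      using h by (auto simp: eventually_at_right_field intro!: exI[of _ "t + h"])
  qed
  have "x \<in> cadlag_paths E"
    by (rule cadlag_pathsI[OF E _ xright \<delta> xosc]) (auto simp: x_def x0)
  then have xK: "x \<in> skorohod_class E \<delta>" using xosc xzero by (auto simp: skorohod_class_def)
  show thesis
  proof (rule that[OF xK r])
    fix N e :: real assume "e > 0"
    then show "\<forall>\<^sub>F n in sequentially. X (r n) \<in> skorohod_nbhd E x N e"
      by (intro eventually_skorohod_nbhd[OF \<delta> X ylim xr xl])
  qed
qed

section \<open>Neighbourhood calculus and compactness by open covers\<close>

lemma time_changes_inverse: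
  assumes l: "l \<in> time_changes"
  shows "the_inv_into {0..} l \<in> time_changes"
proof -
  have b: "bij_betw l {0..} {0..}" and m: "strict_mono_on {0..} l" using l by (auto simp: time_changes_def)
  have inv: "the_inv_into {0..} l s \<in> {0..}" "l (the_inv_into {0..} l s) = s" if "s \<in> {0..}" for s
    using bij_betw_apply[OF bij_betw_the_inv_into[OF b] that] f_the_inv_into_f_bij_betw[OF b, of s] that
    by auto
  have "strict_mono_on {0..} (the_inv_into {0..} l)"
  proof (rule strict_mono_onI)
    fix r s :: real assume "r \<in> {0..}" "s \<in> {0..}" "r < s"
    then show "the_inv_into {0..} l r < the_inv_into {0..} l s"
      using inv[of r] inv[of s] strict_mono_on_leD[OF m, of "the_inv_into {0..} l s" "the_inv_into {0..} l r"] by force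
  qed
  then show ?thesis using bij_betw_the_inv_into[OF b] by (simp add: time_changes_def)
qed

lemma time_changes_comp:
  assumes "l \<in> time_changes" "m \<in> time_changes"
  shows "m \<circ> l \<in> time_changes"
proof -
  have "l s \<ge> 0" if "s \<ge> 0" for s using assms(1) that by (auto simp: time_changes_def bij_betw_def)
  then show ?thesis
    using assms by (auto simp: time_changes_def strict_mono_on_def intro: bij_betw_trans)
qed

text \<open>The first time change can carry the interval up to \<open>N\<close> as far as
  \<open>N + e\<close>, so the second neighbourhood needs the longer horizon. The symmetry lemma
  below loses horizon for the same reason.\<close>

lemma skorohod_nbhd_triangle:
  assumes "y \<in> skorohod_nbhd E x N e" "z \<in> skorohod_nbhd E y N' e'" "N + e \<le> N'"
  shows "z \<in> skorohod_nbhd E x N (e + e')"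
proof -
  obtain l where l: "l \<in> time_changes" "\<forall>s\<ge>0. \<bar>l s - s\<bar> < e" "\<forall>s\<in>{0..N}. dist (y (l s)) (x s) < e"
    using assms(1) by (auto simp: skorohod_nbhd_def)
  obtain m where m: "m \<in> time_changes" "\<forall>s\<ge>0. \<bar>m s - s\<bar> < e'" "\<forall>s\<in>{0..N'}. dist (z (m s)) (y s) < e'"
    using assms(2) by (auto simp: skorohod_nbhd_def)
  have pos: "l s \<ge> 0" if "s \<ge> 0" for s using l(1) that by (auto simp: time_changes_def bij_betw_def)
  have "\<bar>(m \<circ> l) s - s\<bar> < e + e'" if "s \<ge> 0" for s
  proof -
    have "\<bar>l s - s\<bar> < e" "\<bar>m (l s) - l s\<bar> < e'" using l(2) m(2) that pos[of s] by auto
    then show ?thesis by (auto simp: abs_less_iff)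
  qed
  moreover have "dist (z ((m \<circ> l) s)) (x s) < e + e'" if "s \<in> {0..N}" for s
  proof -
    have "\<bar>l s - s\<bar> < e" using l(2) that by auto
    then have "l s \<in> {0..N'}" using that assms(3) pos[of s] by auto
    then have "dist (z (m (l s))) (y (l s)) < e'" "dist (y (l s)) (x s) < e" using m(3) l(3) that by auto
    then show ?thesis using dist_triangle[of "z (m (l s))" "x s" "y (l s)"] by simp
  qed
  moreover have "z \<in> cadlag_paths E" using assms(2) by (auto simp: skorohod_nbhd_def)
  ultimately show ?thesis using time_changes_comp[OF l(1) m(1)]
    by (auto simp: skorohod_nbhd_def intro!: bexI[of _ "m \<circ> l"])
qed

lemma skorohod_nbhd_sym:
  assumes "y \<in> skorohod_nbhd E x (N + e) e" "x \<in> cadlag_paths E"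
  shows "x \<in> skorohod_nbhd E y N e"
proof -
  obtain l where l: "l \<in> time_changes" "\<forall>s\<ge>0. \<bar>l s - s\<bar> < e" "\<forall>s\<in>{0..N+e}. dist (y (l s)) (x s) < e"
    using assms(1) by (auto simp: skorohod_nbhd_def)
  define m where "m = the_inv_into {0..} l"
  have b: "bij_betw l {0..} {0..}" using l(1) by (auto simp: time_changes_def)
  have m: "m s \<ge> 0" "l (m s) = s" if "s \<ge> 0" for s
    using bij_betw_the_inv_into[OF b] f_the_inv_into_f_bij_betw[OF b, of s] that
    by (auto simp: m_def bij_betw_def)
  have close: "\<bar>m s - s\<bar> < e" if "s \<ge> 0" for s using l(2) m[OF that] by (metis abs_minus_commute)
  have "dist (x (m s)) (y s) < e" if "s \<in> {0..N}" for s
  proof -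
    have "m s \<in> {0..N+e}" using close[of s] m(1)[of s] that by auto
    then have "dist (y (l (m s))) (x (m s)) < e" using l(3) by blast
    then show ?thesis using m(2)[of s] that by (simp add: dist_commute)
  qed
  then show ?thesis using close assms(2) time_changes_inverse[OF l(1), folded m_def]
    unfolding skorohod_nbhd_def by blast
qed

text \<open>The neighbourhoods take the place of metric balls in the usual passage from sequential
  to cover compactness: first a Lebesgue number for the cover, then a finite net at that scale, each
  obtained by contradiction from a convergent subsequence.\<close>

theorem compactin_skorohod_class:
  assumes E: "compact E" and \<delta>: "\<And>j. \<delta> j > 0"
  shows "compactin (skorohod_topology E) (skorohod_class E \<delta>)"
  unfolding compactin_def
proof (intro conjI allI impI)
  let ?K = "skorohod_class E \<delta>"
  show "?K \<subseteq> topspace (skorohod_topology E)"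
    by (auto simp: topspace_skorohod_topology skorohod_class_def)
  fix \<U> assume \<U>: "Ball \<U> (openin (skorohod_topology E)) \<and> ?K \<subseteq> \<Union>\<U>"
  have cad: "x \<in> cadlag_paths E" if "x \<in> ?K" for x using that by (auto simp: skorohod_class_def)
  have "\<exists>j::nat. \<forall>x\<in>?K. \<exists>U\<in>\<U>. skorohod_nbhd E x (real j) (1 / Suc j) \<subseteq> U"
  proof (rule ccontr)
    assume "\<not> ?thesis"
    then have "\<forall>j::nat. \<exists>x\<in>?K. \<forall>U\<in>\<U>. \<not> skorohod_nbhd E x (real j) (1 / Suc j) \<subseteq> U" by blast
    then obtain X where X: "\<And>j. X j \<in> ?K" "\<And>j U. U \<in> \<U> \<Longrightarrow> \<not> skorohod_nbhd E (X j) (real j) (1 / Suc j) \<subseteq> U"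
      by metis
    obtain x r where x: "x \<in> ?K" and r: "strict_mono (r :: nat \<Rightarrow> nat)" and
      conv: "\<And>N e. e > 0 \<Longrightarrow> \<forall>\<^sub>F n in sequentially. X (r n) \<in> skorohod_nbhd E x N e"
      using skorohod_class_sequentially_compact[of E \<delta> X] E \<delta> X(1) by metis
    obtain U where U: "U \<in> \<U>" "x \<in> U" using x \<U> by blast
    then obtain N e where Ne: "e > 0" "skorohod_nbhd E x N e \<subseteq> U"
      using \<U> unfolding openin_skorohod_topology skorohod_open_def by meson
    have "\<forall>\<^sub>F n in sequentially. 1 / real (Suc n) < e/2"
      using \<open>e > 0\<close> order_tendstoD(2)[OF LIMSEQ_inverse_real_of_nat, of "e/2"] by (simp add: inverse_eq_divide)
    moreover have "\<forall>\<^sub>F n in sequentially. N + e/2 \<le> real n"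
      using filterlim_real_sequentially by (auto simp: filterlim_at_top)
    ultimately have "\<forall>\<^sub>F n in sequentially. 1 / real (Suc n) < e/2 \<and> N + e/2 \<le> real n"
      by (rule eventually_conj)
    from eventually_conj[OF eventually_subseq[OF r this] conv[of "e/2" N]] Ne
    have "\<forall>\<^sub>F n in sequentially. (1 / real (Suc (r n)) < e/2 \<and> N + e/2 \<le> real (r n)) \<and> X (r n) \<in> skorohod_nbhd E x N (e/2)"
      by linarith
    then obtain n where n: "1 / real (Suc (r n)) < e/2" "N + e/2 \<le> real (r n)" "X (r n) \<in> skorohod_nbhd E x N (e/2)"
      by (auto dest: eventually_happens)
    have "skorohod_nbhd E (X (r n)) (real (r n)) (1 / Suc (r n)) \<subseteq> skorohod_nbhd E x N e"
    proof
      fix z assume "z \<in> skorohod_nbhd E (X (r n)) (real (r n)) (1 / Suc (r n))"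
      then have "z \<in> skorohod_nbhd E x N (e/2 + 1 / Suc (r n))"
        by (rule skorohod_nbhd_triangle[OF n(3)]) (use n in auto)
      then show "z \<in> skorohod_nbhd E x N e"
        using skorohod_nbhd_mono[of N N "e/2 + 1 / Suc (r n)" e E x] n by auto
    qed
    then show False using X(2)[OF U(1)] Ne by blast
  qed
  then obtain j :: nat where j: "\<And>x. x \<in> ?K \<Longrightarrow> \<exists>U\<in>\<U>. skorohod_nbhd E x (real j) (1 / Suc j) \<subseteq> U" by blast
  have "\<exists>F. finite F \<and> F \<subseteq> ?K \<and> ?K \<subseteq> (\<Union>x\<in>F. skorohod_nbhd E x (real j) (1 / Suc j))"
  proof (rule ccontr)
    assume contr: "\<not> ?thesis"
    \<comment> \<open>Without a finite net, points can be chosen one after the other outside all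
      earlier neighbourhoods. Two late members of a convergent subsequence then contradict
      separation through their common limit.\<close>
    define P where "P X n z \<longleftrightarrow> z \<in> ?K \<and> (\<forall>m<n. z \<notin> skorohod_nbhd E (X m) (real j) (1 / Suc j))"
      for X :: "nat \<Rightarrow> real \<Rightarrow> 'a" and n :: nat and z
    have "\<exists>X. \<forall>n. P X n (X n)"
    proof (rule dependent_wellorder_choice)
      fix n :: nat and X :: "nat \<Rightarrow> real \<Rightarrow> 'a"
      assume "\<And>m. m < n \<Longrightarrow> P X m (X m)"
      then have "finite (X ` {..<n})" "X ` {..<n} \<subseteq> ?K" by (auto simp: P_def)
      then have "\<not> ?K \<subseteq> (\<Union>x\<in>X ` {..<n}. skorohod_nbhd E x (real j) (1 / Suc j))"
        using contr by blast
      then show "\<exists>z. P X n z" by (auto simp: P_def)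
    qed (auto simp: P_def)
    then obtain X where "\<And>n. P X n (X n)" by blast
    then have X: "\<And>n. X n \<in> ?K" "\<And>m n. m < n \<Longrightarrow> X n \<notin> skorohod_nbhd E (X m) (real j) (1 / Suc j)"
      by (auto simp: P_def)
    obtain x r where x: "x \<in> ?K" and r: "strict_mono (r :: nat \<Rightarrow> nat)" and
      conv: "\<And>N e. e > 0 \<Longrightarrow> \<forall>\<^sub>F n in sequentially. X (r n) \<in> skorohod_nbhd E x N e"
      using skorohod_class_sequentially_compact[of E \<delta> X] E \<delta> X(1) by metis
    define e where "e = 1 / Suc j / 2"
    have e: "e > 0" "e + e = 1 / Suc j" by (auto simp: e_def field_simps)
    from conv[OF e(1), of "real j + e + e"] obtain m where m: "\<And>n. n \<ge> m \<Longrightarrow> X (r n) \<in> skorohod_nbhd E x (real j + e + e) e"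
      by (auto simp: eventually_sequentially)
    have "x \<in> skorohod_nbhd E (X (r m)) (real j) e"
      by (rule skorohod_nbhd_sym) (use m[of m] skorohod_nbhd_mono[of "real j + e" "real j + e + e" e e E x] e cad[OF x] in auto)
    then have "X (r (Suc m)) \<in> skorohod_nbhd E (X (r m)) (real j) (e + e)"
      by (rule skorohod_nbhd_triangle[OF _ m[of "Suc m"]]) (use e in auto)
    then show False using X(2)[of "r m" "r (Suc m)"] r by (simp add: e strict_mono_def)
  qed
  then obtain F where F: "finite F" "F \<subseteq> ?K" "?K \<subseteq> (\<Union>x\<in>F. skorohod_nbhd E x (real j) (1 / Suc j))" by blast
  have "\<forall>x\<in>F. \<exists>U. U \<in> \<U> \<and> skorohod_nbhd E x (real j) (1 / Suc j) \<subseteq> U" using j F(2) by blast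
  then obtain U where "\<forall>x\<in>F. U x \<in> \<U> \<and> skorohod_nbhd E x (real j) (1 / Suc j) \<subseteq> U x" by metis
  then show "\<exists>\<F>. finite \<F> \<and> \<F> \<subseteq> \<U> \<and> ?K \<subseteq> \<Union>\<F>"
    using F by (intro exI[of _ "U ` F"]) (auto, blast)
qed

section \<open>Sums over finite trees and Lagrange inversion\<close>

lemma Nil_in_gw_tree [simp]: "[] \<in> gw_tree \<xi>"
  by (simp add: gw_tree_def)

lemma snoc_in_gw_tree: "u @ [j] \<in> gw_tree \<xi> \<longleftrightarrow> u \<in> gw_tree \<xi> \<and> j < \<xi> u"
  by (auto simp: gw_tree_def nth_append less_Suc_eq)

lemma Cons_in_gw_tree: "j # u \<in> gw_tree \<xi> \<longleftrightarrow> j < \<xi> [] \<and> u \<in> gw_tree (\<lambda>v. \<xi> (j # v))"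
  by (auto simp: gw_tree_def All_less_Suc2)

lemma append_in_gw_treeD: "u @ v \<in> gw_tree \<xi> \<Longrightarrow> u \<in> gw_tree \<xi>"
  by (induction v rule: rev_induct) (auto simp: snoc_in_gw_tree simp flip: append_assoc)

definition finite_trees :: "nat list set set" where
  "finite_trees = {V. finite V \<and> V \<in> range gw_tree}"

definition child_count :: "nat list set \<Rightarrow> nat list \<Rightarrow> nat" where
  "child_count V u = card {j. u @ [j] \<in> V}"

definition tree_weight :: "nat pmf \<Rightarrow> nat list set \<Rightarrow> real" where
  "tree_weight \<mu> V = (\<Prod>u\<in>V. pmf \<mu> (child_count V u))"

definition subtree :: "nat list set \<Rightarrow> nat list \<Rightarrow> nat list set" where
  "subtree V v = {u \<in> V. prefix v u}"

text \<open>Counting pairs of an ancestor and a descendant the other way round shows that on a tree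
  this is the total path length plus the number of vertices.\<close>

definition subtree_sum :: "nat list set \<Rightarrow> nat" where
  "subtree_sum V = (\<Sum>v\<in>V. card (subtree V v))"

lemma child_count_gw_tree: "u \<in> gw_tree \<xi> \<Longrightarrow> child_count (gw_tree \<xi>) u = \<xi> u"
  by (simp add: child_count_def snoc_in_gw_tree)

text \<open>Prescribing the tree fixes the offspring numbers exactly on its vertices, leaves
  included, so the event is a cylinder with finite base when the tree is finite.\<close>

lemma gw_tree_eq_iff:
  assumes "V \<in> range gw_tree"
  shows "gw_tree \<xi> = V \<longleftrightarrow> (\<forall>u\<in>V. \<xi> u = child_count V u)"
proof
  assume "gw_tree \<xi> = V"
  then show "\<forall>u\<in>V. \<xi> u = child_count V u" using child_count_gw_tree by metis
next
  assume *: "\<forall>u\<in>V. \<xi> u = child_count V u"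
  obtain \<eta> where V: "V = gw_tree \<eta>" using assms by blast
  have "u \<in> gw_tree \<xi> \<longleftrightarrow> u \<in> V" for u
  proof (induction u rule: rev_induct)
    case (snoc j u)
    then show ?case using * child_count_gw_tree[of u \<eta>] by (auto simp: V snoc_in_gw_tree)
  qed (simp add: V)
  then show "gw_tree \<xi> = V" by blast
qed

section \<open>Decomposition of a tree at its root\<close>

definition graft :: "nat list set list \<Rightarrow> nat list set" where
  "graft Vs = insert [] (\<Union>j<length Vs. (#) j ` (Vs ! j))"

lemma Cons_in_graft: "j # u \<in> graft Vs \<longleftrightarrow> j < length Vs \<and> u \<in> Vs ! j"
  by (auto simp: graft_def)

lemma Nil_in_graft [simp]: "[] \<in> graft Vs"
  by (simp add: graft_def)

lemma Nil_in_finite_trees: "V \<in> finite_trees \<Longrightarrow> [] \<in> V"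
  by (auto simp: finite_trees_def)

lemma graft_in_finite_trees:
  assumes "set Vs \<subseteq> finite_trees"
  shows "graft Vs \<in> finite_trees"
proof -
  have "\<forall>j<length Vs. \<exists>\<xi>. Vs ! j = gw_tree \<xi>"
    using assms nth_mem by (fastforce simp: finite_trees_def)
  then obtain \<xi> where \<xi>: "\<And>j. j < length Vs \<Longrightarrow> Vs ! j = gw_tree (\<xi> j)" by metis
  define \<eta> where "\<eta> u = (case u of [] \<Rightarrow> length Vs | j # v \<Rightarrow> \<xi> j v)" for u
  have "u \<in> gw_tree \<eta> \<longleftrightarrow> u \<in> graft Vs" for u
    by (cases u) (auto simp: Cons_in_gw_tree Cons_in_graft \<eta>_def \<xi>)
  then have "graft Vs = gw_tree \<eta>" by blast
  moreover have "finite (graft Vs)"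
    using assms nth_mem by (fastforce simp: graft_def finite_trees_def)
  ultimately show ?thesis by (auto simp: finite_trees_def)
qed

text \<open>Every grafted tree contains its root, so the number of trees can be read off from the
  words of length 1.\<close>

lemma inj_on_graft: "inj_on graft {Vs. set Vs \<subseteq> finite_trees}"
proof (rule inj_onI)
  fix Vs Ws assume *: "Vs \<in> {Vs. set Vs \<subseteq> finite_trees}" "Ws \<in> {Vs. set Vs \<subseteq> finite_trees}" "graft Vs = graft Ws"
  have len: "{j. [j] \<in> graft Us} = {..<length Us}" if "set Us \<subseteq> finite_trees" for Us
  proof -
    have "[] \<in> Us ! j" if "j < length Us" for j
      using \<open>set Us \<subseteq> finite_trees\<close> that nth_mem Nil_in_finite_trees by blast
    then show ?thesis by (auto simp: Cons_in_graft)
  qed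
  then have "{..<length Vs} = {..<length Ws}" using * by (metis mem_Collect_eq)
  then have l: "length Vs = length Ws" by simp
  show "Vs = Ws"
  proof (rule nth_equalityI[OF l])
    fix j assume "j < length Vs"
    then have "u \<in> Vs ! j \<longleftrightarrow> u \<in> Ws ! j" for u
      using *(3) Cons_in_graft[of j u] l by metis
    then show "Vs ! j = Ws ! j" by blast
  qed
qed

lemma finite_trees_eq_graft: "finite_trees = graft ` {Vs. set Vs \<subseteq> finite_trees}"
proof (intro equalityI subsetI)
  fix V assume V: "V \<in> finite_trees"
  then obtain \<xi> where \<xi>: "V = gw_tree \<xi>" by (auto simp: finite_trees_def)
  define Vs where "Vs = map (\<lambda>j. gw_tree (\<lambda>v. \<xi> (j # v))) [0..<\<xi> []]"
  have "finite (gw_tree (\<lambda>v. \<xi> (j # v)))" if "j < \<xi> []" for j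
  proof -
    have "(#) j ` gw_tree (\<lambda>v. \<xi> (j # v)) \<subseteq> V" using that by (auto simp: \<xi> Cons_in_gw_tree)
    then have "finite ((#) j ` gw_tree (\<lambda>v. \<xi> (j # v)))"
      using V finite_subset by (auto simp: finite_trees_def)
    then show ?thesis by (rule finite_imageD) (auto simp: inj_on_def)
  qed
  then have "set Vs \<subseteq> finite_trees" by (auto simp: Vs_def finite_trees_def)
  moreover have "u \<in> V \<longleftrightarrow> u \<in> graft Vs" for u
    by (cases u) (auto simp: \<xi> Cons_in_gw_tree Cons_in_graft Vs_def)
  ultimately show "V \<in> graft ` {Vs. set Vs \<subseteq> finite_trees}" by blast
qed (use graft_in_finite_trees in auto)

lemma sum_graft:
  fixes h :: "nat list \<Rightarrow> 'a::comm_monoid_add"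
  assumes "set Vs \<subseteq> finite_trees"
  shows "sum h (graft Vs) = h [] + (\<Sum>j<length Vs. \<Sum>u\<in>Vs ! j. h (j # u))"
proof -
  have fin: "finite (Vs ! j)" if "j < length Vs" for j
    using assms that nth_mem by (auto simp: finite_trees_def subset_iff)
  have "sum h (graft Vs) = h [] + sum h (\<Union>j<length Vs. (#) j ` (Vs ! j))"
    unfolding graft_def using fin by (subst sum.insert) auto
  also have "sum h (\<Union>j<length Vs. (#) j ` (Vs ! j)) = (\<Sum>j<length Vs. sum h ((#) j ` (Vs ! j)))"
    using fin by (intro sum.UNION_disjoint) auto
  also have "\<dots> = (\<Sum>j<length Vs. \<Sum>u\<in>Vs ! j. h (j # u))"
    by (intro sum.cong refl sum.reindex[unfolded o_def]) (auto simp: inj_on_def)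
  finally show ?thesis .
qed

lemma prod_graft:
  fixes h :: "nat list \<Rightarrow> 'a::comm_monoid_mult"
  assumes "set Vs \<subseteq> finite_trees"
  shows "prod h (graft Vs) = h [] * (\<Prod>j<length Vs. \<Prod>u\<in>Vs ! j. h (j # u))"
proof -
  have fin: "finite (Vs ! j)" if "j < length Vs" for j
    using assms that nth_mem by (auto simp: finite_trees_def subset_iff)
  have "prod h (graft Vs) = h [] * prod h (\<Union>j<length Vs. (#) j ` (Vs ! j))"
    unfolding graft_def using fin by (subst prod.insert) auto
  also have "prod h (\<Union>j<length Vs. (#) j ` (Vs ! j)) = (\<Prod>j<length Vs. prod h ((#) j ` (Vs ! j)))"
    using fin by (intro prod.UNION_disjoint) auto
  also have "\<dots> = (\<Prod>j<length Vs. \<Prod>u\<in>Vs ! j. h (j # u))"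
    by (intro prod.cong refl prod.reindex[unfolded o_def]) (auto simp: inj_on_def)
  finally show ?thesis .
qed

lemma sum_nth_eq_sum_list: "(\<Sum>j<length xs. h (xs ! j)) = sum_list (map h xs)"
  by (simp add: sum_list_sum_nth lessThan_atLeast0)

lemma prod_nth_eq_prod_list: "(\<Prod>j<length xs. h (xs ! j)) = prod_list (map h xs)"
  by (induction xs) (auto simp: prod.lessThan_Suc_shift simp del: prod.lessThan_Suc)

lemma card_graft:
  assumes "set Vs \<subseteq> finite_trees"
  shows "card (graft Vs) = Suc (sum_list (map card Vs))"
  using sum_graft[OF assms, of "\<lambda>_. 1::nat"] sum_nth_eq_sum_list[of card Vs] by simp

lemma tree_weight_graft:
  assumes "set Vs \<subseteq> finite_trees"
  shows "tree_weight \<mu> (graft Vs) = pmf \<mu> (length Vs) * prod_list (map (tree_weight \<mu>) Vs)"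
proof -
  have 1: "child_count (graft Vs) [] = length Vs"
  proof -
    have "[] \<in> Vs ! j" if "j < length Vs" for j
      using assms that nth_mem Nil_in_finite_trees by blast
    then have "{j. [] @ [j] \<in> graft Vs} = {..<length Vs}" by (auto simp: Cons_in_graft)
    then show ?thesis by (simp add: child_count_def)
  qed
  have 2: "child_count (graft Vs) (j # u) = child_count (Vs ! j) u" if "j < length Vs" for j u
    using that by (simp add: child_count_def Cons_in_graft)
  have "tree_weight \<mu> (graft Vs) = pmf \<mu> (length Vs) * (\<Prod>j<length Vs. tree_weight \<mu> (Vs ! j))"
    unfolding tree_weight_def prod_graft[OF assms] 1 by (simp add: 2)
  then show ?thesis by (simp add: prod_nth_eq_prod_list)
qed

lemma subtree_sum_graft:
  assumes "set Vs \<subseteq> finite_trees"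
  shows "subtree_sum (graft Vs) = card (graft Vs) + sum_list (map subtree_sum Vs)"
proof -
  have 1: "subtree (graft Vs) [] = graft Vs" by (simp add: subtree_def)
  have "subtree (graft Vs) (j # u) = (#) j ` subtree (Vs ! j) u" if "j < length Vs" for j u
    using that by (auto simp: subtree_def Cons_in_graft image_iff prefix_def)
  then have 2: "card (subtree (graft Vs) (j # u)) = card (subtree (Vs ! j) u)" if "j < length Vs" for j u
    using that by (simp add: card_image)
  show ?thesis
    unfolding subtree_sum_def sum_graft[OF assms] 1
    by (simp add: 2 subtree_sum_def flip: sum_nth_eq_sum_list)
qed

section \<open>Generating functions of trees and forests\<close>

definition trees_of_size :: "nat \<Rightarrow> nat list set set" where
  "trees_of_size n = {V \<in> finite_trees. card V = n}"

definition forests :: "nat \<Rightarrow> nat \<Rightarrow> nat list set list set" where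
  "forests k n = {Vs. set Vs \<subseteq> finite_trees \<and> length Vs = k \<and> sum_list (map card Vs) = n}"

lemma card_finite_trees_pos: "V \<in> finite_trees \<Longrightarrow> card V > 0"
  using Nil_in_finite_trees by (auto simp: finite_trees_def card_gt_0_iff)

lemma length_le_sum_card: "set Vs \<subseteq> finite_trees \<Longrightarrow> length Vs \<le> sum_list (map card Vs)"
proof (induction Vs)
  case (Cons V Vs)
  then show ?case using card_finite_trees_pos[of V] by auto
qed simp

text \<open>Each tree of a forest has at least one vertex, so a forest with \<open>n\<close>
  vertices has at most \<open>n\<close> trees and the union over \<open>k\<close> misses
  nothing.\<close>

lemma trees_of_size_Suc: "bij_betw graft (\<Union>k\<le>n. forests k n) (trees_of_size (Suc n))"
proof -
  have "(\<Union>k\<le>n. forests k n) = {Vs. set Vs \<subseteq> finite_trees \<and> sum_list (map card Vs) = n}"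
    using length_le_sum_card by (auto simp: forests_def)
  moreover have "graft ` {Vs. set Vs \<subseteq> finite_trees \<and> sum_list (map card Vs) = n} = trees_of_size (Suc n)"
  proof (intro equalityI subsetI)
    fix V assume V: "V \<in> trees_of_size (Suc n)"
    then have "V \<in> graft ` {Vs. set Vs \<subseteq> finite_trees}"
      using equalityD1[OF finite_trees_eq_graft] by (auto simp: trees_of_size_def simp del: image_iff)
    then obtain Vs where "set Vs \<subseteq> finite_trees" "V = graft Vs" by blast
    then show "V \<in> graft ` {Vs. set Vs \<subseteq> finite_trees \<and> sum_list (map card Vs) = n}"
      using V card_graft by (auto simp: trees_of_size_def)
  qed (auto simp: trees_of_size_def graft_in_finite_trees card_graft)
  moreover have "inj_on graft {Vs. set Vs \<subseteq> finite_trees \<and> sum_list (map card Vs) = n}"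
    by (rule inj_on_subset[OF inj_on_graft]) auto
  ultimately show ?thesis by (simp add: bij_betw_def)
qed

lemma trees_of_size_0 [simp]: "trees_of_size 0 = {}"
  using card_finite_trees_pos by (force simp: trees_of_size_def)

lemma finite_trees_of_size: "finite (trees_of_size n)"
proof (induction n rule: less_induct)
  case (less n)
  show ?case
  proof (cases n)
    case (Suc m)
    have "Vs \<in> {Vs. set Vs \<subseteq> (\<Union>i\<le>m. trees_of_size i) \<and> length Vs \<le> m}" if "Vs \<in> (\<Union>k\<le>m. forests k m)" for Vs
    proof -
      have "card V \<le> m" if "V \<in> set Vs" for V
        using member_le_sum_list[of "card V" "map card Vs"] that \<open>Vs \<in> _\<close> by (auto simp: forests_def)
      then show ?thesis using that by (auto simp: forests_def trees_of_size_def)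
    qed
    moreover have "finite {Vs. set Vs \<subseteq> (\<Union>i\<le>m. trees_of_size i) \<and> length Vs \<le> m}"
      using less Suc by (intro finite_lists_length_le) auto
    ultimately have "finite (\<Union>k\<le>m. forests k m)" by (meson finite_subset subsetI)
    then show ?thesis using bij_betw_finite[OF trees_of_size_Suc[of m]] Suc by simp
  qed simp
qed

lemma forests_Suc:
  "bij_betw (\<lambda>(i, V, Vs). V # Vs) (SIGMA i:{0..n}. trees_of_size i \<times> forests k (n - i)) (forests (Suc k) n)"
proof (rule bij_betw_imageI)
  show "inj_on (\<lambda>(i, V, Vs). V # Vs) (SIGMA i:{0..n}. trees_of_size i \<times> forests k (n - i))"
    by (auto simp: inj_on_def trees_of_size_def)
  show "(\<lambda>(i, V, Vs). V # Vs) ` (SIGMA i:{0..n}. trees_of_size i \<times> forests k (n - i)) = forests (Suc k) n"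
  proof (intro equalityI subsetI)
    fix Us assume "Us \<in> forests (Suc k) n"
    then obtain V Vs where "Us = V # Vs" "V \<in> trees_of_size (card V)" "Vs \<in> forests k (n - card V)" "card V \<le> n"
      by (cases Us) (auto simp: forests_def trees_of_size_def)
    then show "Us \<in> (\<lambda>(i, V, Vs). V # Vs) ` (SIGMA i:{0..n}. trees_of_size i \<times> forests k (n - i))"
      by (intro image_eqI[of _ _ "(card V, V, Vs)"]) auto
  qed (auto simp: forests_def trees_of_size_def)
qed

lemma forests_0: "forests 0 n = (if n = 0 then {[]} else {})"
  by (auto simp: forests_def)

definition tree_fps :: "(nat list set \<Rightarrow> real) \<Rightarrow> real fps" where
  "tree_fps h = Abs_fps (\<lambda>n. \<Sum>V\<in>trees_of_size n. h V)"

lemma finite_forests: "finite (forests k n)"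
proof -
  have "forests k n \<subseteq> {Vs. set Vs \<subseteq> (\<Union>i\<le>n. trees_of_size i) \<and> length Vs = k}"
  proof
    fix Vs assume Vs: "Vs \<in> forests k n"
    have "card V \<le> n" if "V \<in> set Vs" for V
      using member_le_sum_list[of "card V" "map card Vs"] that Vs by (auto simp: forests_def)
    then show "Vs \<in> {Vs. set Vs \<subseteq> (\<Union>i\<le>n. trees_of_size i) \<and> length Vs = k}"
      using Vs by (auto simp: forests_def trees_of_size_def)
  qed
  then show ?thesis
    by (rule finite_subset) (intro finite_lists_length_eq, auto simp: finite_trees_of_size)
qed

lemma sum_forests_Suc:
  fixes F :: "nat list set \<Rightarrow> real"
  shows "(\<Sum>Vs\<in>forests (Suc k) n. F (hd Vs) * G (tl Vs)) =
    (\<Sum>i=0..n. tree_fps F $ i * (\<Sum>Vs\<in>forests k (n - i). G Vs))"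
proof -
  have "(\<Sum>Vs\<in>forests (Suc k) n. F (hd Vs) * G (tl Vs)) =
    (\<Sum>(i, V, Vs)\<in>(SIGMA i:{0..n}. trees_of_size i \<times> forests k (n - i)). F V * G Vs)"
    by (subst sum.reindex_bij_betw[OF forests_Suc, symmetric]) (auto intro!: sum.cong)
  also have "\<dots> = (\<Sum>i=0..n. \<Sum>(V, Vs)\<in>trees_of_size i \<times> forests k (n - i). F V * G Vs)"
    by (subst sum.Sigma) (auto simp: finite_trees_of_size finite_forests)
  also have "\<dots> = (\<Sum>i=0..n. tree_fps F $ i * (\<Sum>Vs\<in>forests k (n - i). G Vs))"
    by (simp add: tree_fps_def sum_product sum.cartesian_product)
  finally show ?thesis .
qed

lemma tree_fps_power:
  "(\<Sum>Vs\<in>forests k n. prod_list (map F Vs)) = (tree_fps F ^ k) $ n"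
proof (induction k arbitrary: n)
  case (Suc k)
  have "(\<Sum>Vs\<in>forests (Suc k) n. prod_list (map F Vs)) =
    (\<Sum>Vs\<in>forests (Suc k) n. F (hd Vs) * prod_list (map F (tl Vs)))"
    by (intro sum.cong refl) (auto simp: forests_def length_Suc_conv)
  then show ?case by (simp add: sum_forests_Suc[of F "\<lambda>Vs. prod_list (map F Vs)"] Suc fps_mult_nth)
qed (auto simp: forests_0)

text \<open>The product rule: an additive functional of a forest marks one of its \<open>k\<close>
  trees and leaves a product over the other \<open>k - 1\<close>. For \<open>k = 0\<close> the
  factor \<open>k\<close> makes the truncated exponent harmless.\<close>

lemma tree_fps_power_weighted:
  "(\<Sum>Vs\<in>forests k n. prod_list (map F Vs) * sum_list (map L Vs)) =
     (of_nat k * tree_fps F ^ (k - 1) * tree_fps (\<lambda>V. F V * L V)) $ n"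
proof (induction k arbitrary: n)
  case (Suc k)
  have "(\<Sum>Vs\<in>forests (Suc k) n. prod_list (map F Vs) * sum_list (map L Vs)) =
    (\<Sum>Vs\<in>forests (Suc k) n. (F (hd Vs) * L (hd Vs)) * prod_list (map F (tl Vs))) +
    (\<Sum>Vs\<in>forests (Suc k) n. F (hd Vs) * (prod_list (map F (tl Vs)) * sum_list (map L (tl Vs))))"
    by (subst sum.distrib[symmetric], intro sum.cong refl) (auto simp: forests_def length_Suc_conv algebra_simps)
  also have "\<dots> = (tree_fps (\<lambda>V. F V * L V) * tree_fps F ^ k) $ n +
     (tree_fps F * (of_nat k * tree_fps F ^ (k - 1) * tree_fps (\<lambda>V. F V * L V))) $ n"
    unfolding sum_forests_Suc[where F = "\<lambda>V. F V * L V" and G = "\<lambda>Vs. prod_list (map F Vs)"]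
      sum_forests_Suc[where F = F and G = "\<lambda>Vs. prod_list (map F Vs) * sum_list (map L Vs)"]
      Suc tree_fps_power fps_mult_nth[of "tree_fps _"] ..
  also have "\<dots> = (of_nat (Suc k) * tree_fps F ^ k * tree_fps (\<lambda>V. F V * L V)) $ n"
    by (cases k) (simp_all add: algebra_simps flip: fps_add_nth)
  finally show ?case by simp
qed (auto simp: forests_0)

section \<open>Lagrange inversion\<close>

lemma fps_compose_mult_nth:
  fixes h a Y :: "'a::comm_ring_1 fps"
  assumes "a $ 0 = 0"
  shows "((h oo a) * Y) $ m = (\<Sum>i=0..m. h $ i * (a ^ i * Y) $ m)"
proof -
  have "(h oo a) $ j = (\<Sum>i=0..m. h $ i * (a ^ i) $ j)" if "j \<le> m" for j
    unfolding fps_compose_nth using that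
    by (intro sum.mono_neutral_left) (auto simp: startsby_zero_power_prefix[OF assms, rule_format])
  then have "((h oo a) * Y) $ m = (\<Sum>j=0..m. (\<Sum>i=0..m. h $ i * (a ^ i) $ j) * Y $ (m - j))"
    by (simp add: fps_mult_nth)
  also have "\<dots> = (\<Sum>i=0..m. h $ i * (a ^ i * Y) $ m)"
    unfolding fps_mult_nth sum_distrib_left sum_distrib_right
    by (subst sum.swap) (simp add: mult.assoc)
  finally show ?thesis .
qed

context
  fixes f T :: "real fps"
  assumes f0: "f $ 0 \<noteq> 0" and T0: "T $ 0 = 0" and T_eq: "T = fps_X * (f oo T)"
begin

text \<open>Change of variables in a formal residue. The coefficient of w^m in h is the residue of
  h(w) / w^(m+1), and w is replaced by T(z) = z f(T(z)). Multiplying by z^(m+1) keeps everything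
  within power series. By linearity it suffices to treat h = w^i.\<close>

lemma residue_substitution:
  "((h oo T) * (fps_deriv T * inverse (f oo T) ^ Suc m)) $ m = h $ m"
proof -
  define g where "g = f oo T"
  define G where "G = inverse g"
  have "g $ 0 \<noteq> 0" using f0 by (simp add: g_def)
  then have gG: "g * G = 1" by (simp add: G_def inverse_mult_eq_1')
  have T: "T = fps_X * g" using T_eq by (simp add: g_def)
  then have T': "fps_deriv T = g + fps_X * fps_deriv g" by simp
  have "(T ^ i * (fps_deriv T * G ^ Suc m)) $ m = (if i = m then 1 else 0)" if "i \<le> m" for i
  proof -
    define k where "k = m - i"
    have m: "m = i + k" using that by (simp add: k_def)
    have "g ^ i * G ^ i = 1" using gG by (simp flip: power_mult_distrib)
    then have "T ^ i * (fps_deriv T * G ^ Suc m) = fps_X ^ i * (fps_deriv T * G ^ Suc k)"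
    proof -
      have "T ^ i * (fps_deriv T * G ^ Suc m) = fps_X ^ i * (g ^ i * G ^ i) * (fps_deriv T * G ^ Suc k)"
        unfolding m power_add power_Suc by (subst (1) T) (simp add: power_mult_distrib mult_ac)
      then show ?thesis using \<open>g ^ i * G ^ i = 1\<close> by simp
    qed
    then have "(T ^ i * (fps_deriv T * G ^ Suc m)) $ m = (fps_X ^ i * (fps_deriv T * G ^ Suc k)) $ m"
      by (rule arg_cong)
    also have "\<dots> = (fps_deriv T * G ^ Suc k) $ k" by (simp add: m fps_X_power_mult_nth)
    also have "fps_deriv T * G ^ Suc k = G ^ k + fps_X * (fps_deriv g * G ^ Suc k)"
    proof -
      have "fps_deriv T * G ^ Suc k = (g * G) * G ^ k + fps_X * (fps_deriv g * G ^ Suc k)"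
        unfolding T' power_Suc by (simp add: algebra_simps)
      then show ?thesis using gG by simp
    qed
    finally have *: "(T ^ i * (fps_deriv T * G ^ Suc m)) $ m = (G ^ k) $ k + (fps_X * (fps_deriv g * G ^ Suc k)) $ k"
      by simp
    show ?thesis
    proof (cases "k = 0")
      case True
      then show ?thesis using * m by simp
    next
      case False
      \<comment> \<open>For \<open>k\<close> not 0 the term is, up to a constant, the residue of a
        derivative and vanishes: comparing the coefficients of index \<open>k - 1\<close> in the
        derivative of \<open>G ^ k\<close> gives the cancellation.\<close>
      have "fps_deriv G = - fps_deriv g * G\<^sup>2"
        unfolding G_def by (rule fps_inverse_deriv) fact
      moreover have "G ^ Suc k = G\<^sup>2 * G ^ (k - 1)"
        using False by (simp add: power2_eq_square mult_ac flip: power_Suc power_Suc2)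
      ultimately have "fps_deriv (G ^ k) = fps_const (- real k) * (fps_deriv g * G ^ Suc k)"
        unfolding fps_deriv_power by (simp add: mult_ac flip: fps_const_neg)
      then have "fps_deriv (G ^ k) $ (k - 1) = - real k * (fps_deriv g * G ^ Suc k) $ (k - 1)"
        by (simp del: fps_deriv_nth power_Suc)
      moreover have "fps_deriv (G ^ k) $ (k - 1) = real k * (G ^ k) $ k" using False by simp
      ultimately have "real k * (G ^ k) $ k = real k * - ((fps_deriv g * G ^ Suc k) $ (k - 1))" by simp
      then have "(fps_deriv g * G ^ Suc k) $ (k - 1) = - (G ^ k) $ k"
        unfolding mult_cancel_left using False by simp
      then show ?thesis using * False m by (simp add: fps_X_mult_nth)
    qed
  qed
  note coeff = this
  have "((h oo T) * (fps_deriv T * G ^ Suc m)) $ m = (\<Sum>i=0..m. h $ i * (T ^ i * (fps_deriv T * G ^ Suc m)) $ m)"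
    by (rule fps_compose_mult_nth[OF T0])
  also have "\<dots> = (\<Sum>i=0..m. h $ i * (if i = m then 1 else 0))"
    by (intro sum.cong refl) (simp only: coeff atLeastAtMost_iff)
  finally show ?thesis by (simp add: g_def G_def if_distrib del: power_Suc cong: if_cong)
qed

text \<open>With h a power of \<open>f\<close>, the factor h(T) cancels powers of 1 / f(T) in the
  residue formula. Cancelling all \<open>n\<close> of them gives the first identity, and leaving one
  uncancelled gives the second.\<close>

lemma lagrange_inversion:
  "(fps_X * fps_deriv T) $ n = (if n = 0 then 0 else (f ^ n) $ (n - 1))"
  "(fps_deriv T * inverse (f oo T)) $ n = (f ^ n) $ n"
proof -
  have inv: "(f oo T) * inverse (f oo T) = 1" using f0 by (simp add: inverse_mult_eq_1')
  have p: "(f ^ k oo T) * inverse (f oo T) ^ k = 1" for k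
    by (simp add: fps_compose_power[OF T0, symmetric] inv flip: power_mult_distrib)
  have q: "(f ^ k oo T) * (fps_deriv T * inverse (f oo T) ^ j) = fps_deriv T * inverse (f oo T) ^ (j - k)"
    if "k \<le> j" for k j
  proof -
    have "inverse (f oo T) ^ j = inverse (f oo T) ^ k * inverse (f oo T) ^ (j - k)"
      using that by (simp flip: power_add)
    then have "(f ^ k oo T) * (fps_deriv T * inverse (f oo T) ^ j) =
       ((f ^ k oo T) * inverse (f oo T) ^ k) * (fps_deriv T * inverse (f oo T) ^ (j - k))"
      by (simp only: mult_ac)
    then show ?thesis by (simp only: p mult_1)
  qed
  show "(fps_deriv T * inverse (f oo T)) $ n = (f ^ n) $ n"
    using residue_substitution[of "f ^ n" n] q[of n "Suc n"] by (simp del: power_Suc)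
  show "(fps_X * fps_deriv T) $ n = (if n = 0 then 0 else (f ^ n) $ (n - 1))"
  proof (cases n)
    case (Suc m)
    then show ?thesis
      using residue_substitution[of "f ^ Suc m" m, unfolded q[OF order_refl]] by (simp del: power_Suc)
  qed simp
qed

text \<open>Differentiating the equation for \<open>T\<close> gives 1 - X f'(T) = f(T) / T'. Solving
  the linear equation for \<open>W\<close> therefore yields W = (X T') (T' / f(T)), the product of
  the two series whose coefficients Lagrange inversion provides.\<close>

lemma path_length_fps:
  assumes W: "W = fps_X * fps_deriv T + fps_X * ((fps_deriv f oo T) * W)"
  shows "W $ n = (\<Sum>i=1..n. (f ^ i) $ (i - 1) * (f ^ (n - i)) $ (n - i))"
proof -
  define g where "g = f oo T"
  define F where "F = fps_deriv f oo T"
  have g: "g * inverse g = 1" using f0 by (simp add: g_def inverse_mult_eq_1')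
  have "fps_deriv T = fps_deriv (fps_X * (f oo T))" using T_eq by simp
  also have "\<dots> = g + fps_X * (F * fps_deriv T)"
    using fps_compose_deriv[OF T0, of f] by (simp add: g_def F_def)
  finally have T': "g = fps_deriv T * (1 - fps_X * F)" by (simp add: algebra_simps)
  have W': "W * (1 - fps_X * F) = fps_X * fps_deriv T"
    using W by (simp add: F_def algebra_simps)
  have "W * g = fps_deriv T * (W * (1 - fps_X * F))" by (subst T') (simp only: mult_ac)
  then have "W * g = fps_X * fps_deriv T * fps_deriv T" unfolding W' by (simp only: mult_ac)
  then have "W * g * inverse g = fps_X * fps_deriv T * fps_deriv T * inverse g" by simp
  then have "W = (fps_X * fps_deriv T) * (fps_deriv T * inverse g)" using g by (simp add: mult.assoc)
  then have "W $ n = (\<Sum>i=0..n. (fps_X * fps_deriv T) $ i * (fps_deriv T * inverse g) $ (n - i))"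
    by (simp add: fps_mult_nth)
  also have "\<dots> = (\<Sum>i=0..n. (if i = 0 then 0 else (f ^ i) $ (i - 1)) * (f ^ (n - i)) $ (n - i))"
    unfolding g_def lagrange_inversion ..
  also have "\<dots> = (\<Sum>i=1..n. (f ^ i) $ (i - 1) * (f ^ (n - i)) $ (n - i))"
    by (rule sum.mono_neutral_cong_right) auto
  finally show ?thesis .
qed

end

section \<open>Functional equations for the tree series\<close>

definition offspring_fps :: "nat pmf \<Rightarrow> real fps" where
  "offspring_fps \<mu> = Abs_fps (pmf \<mu>)"

lemma tree_fps_0 [simp]: "tree_fps h $ 0 = 0"
  by (simp add: tree_fps_def)

lemma forests_disjoint: "k \<noteq> k' \<Longrightarrow> forests k n \<inter> forests k' n = {}"
  by (auto simp: forests_def)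

lemma sum_trees_of_size_Suc:
  "(\<Sum>V\<in>trees_of_size (Suc n). h V) = (\<Sum>k=0..n. \<Sum>Vs\<in>forests k n. h (graft Vs))"
proof -
  have "(\<Sum>V\<in>trees_of_size (Suc n). h V) = (\<Sum>Vs\<in>(\<Union>k\<le>n. forests k n). h (graft Vs))"
    by (rule sum.reindex_bij_betw[OF trees_of_size_Suc, symmetric])
  also have "\<dots> = (\<Sum>k\<le>n. \<Sum>Vs\<in>forests k n. h (graft Vs))"
    by (intro sum.UNION_disjoint ballI impI finite_forests finite_atMost forests_disjoint)
  finally show ?thesis by (simp add: atLeast0AtMost)
qed

lemma tree_weight_fps_eq:
  "tree_fps (tree_weight \<mu>) = fps_X * (offspring_fps \<mu> oo tree_fps (tree_weight \<mu>))" (is "?T = _")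
proof (rule fps_ext)
  fix n
  show "?T $ n = (fps_X * (offspring_fps \<mu> oo ?T)) $ n"
  proof (cases n)
    case (Suc m)
    have "?T $ n = (\<Sum>k=0..m. \<Sum>Vs\<in>forests k m. pmf \<mu> k * prod_list (map (tree_weight \<mu>) Vs))"
      unfolding tree_fps_def Suc fps_nth_Abs_fps sum_trees_of_size_Suc
      by (intro sum.cong refl) (auto simp: forests_def tree_weight_graft)
    then show ?thesis
      by (simp add: Suc fps_X_mult_nth fps_compose_nth offspring_fps_def tree_fps_power flip: sum_distrib_left)
  qed simp
qed

text \<open>The root contributes the size of the tree, whence X T'. The remaining sum is additive
  over the branches, and the product rule for the forests produces the derivative of the offspring
  series.\<close>

lemma subtree_sum_fps_eq:
  fixes \<mu> :: "nat pmf"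
  defines "T \<equiv> tree_fps (tree_weight \<mu>)" and "W \<equiv> tree_fps (\<lambda>V. tree_weight \<mu> V * real (subtree_sum V))"
  shows "W = fps_X * fps_deriv T + fps_X * ((fps_deriv (offspring_fps \<mu>) oo T) * W)"
proof (rule fps_ext)
  fix n
  have T0: "T $ 0 = 0" and W0: "W $ 0 = 0" by (simp_all add: T_def W_def)
  show "W $ n = (fps_X * fps_deriv T + fps_X * ((fps_deriv (offspring_fps \<mu>) oo T) * W)) $ n"
  proof (cases n)
    case (Suc m)
    have "W $ n = (\<Sum>k=0..m. \<Sum>Vs\<in>forests k m. pmf \<mu> k * prod_list (map (tree_weight \<mu>) Vs) * real n +
       pmf \<mu> k * (prod_list (map (tree_weight \<mu>) Vs) * sum_list (map (\<lambda>V. real (subtree_sum V)) Vs)))"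
      unfolding W_def tree_fps_def Suc fps_nth_Abs_fps sum_trees_of_size_Suc
    proof (intro sum.cong refl)
      fix k Vs assume "Vs \<in> forests k m"
      moreover have "real (sum_list (map subtree_sum Vs)) = sum_list (map (\<lambda>V. real (subtree_sum V)) Vs)"
        by (induction Vs) auto
      ultimately show "tree_weight \<mu> (graft Vs) * real (subtree_sum (graft Vs)) =
        pmf \<mu> k * prod_list (map (tree_weight \<mu>) Vs) * real (Suc m) +
        pmf \<mu> k * (prod_list (map (tree_weight \<mu>) Vs) * sum_list (map (\<lambda>V. real (subtree_sum V)) Vs))"
        by (auto simp: forests_def tree_weight_graft subtree_sum_graft card_graft algebra_simps)
    qed
    also have "\<dots> = (\<Sum>k=0..m. \<Sum>Vs\<in>forests k m. tree_weight \<mu> (graft Vs)) * real n +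
      (\<Sum>k=0..m. pmf \<mu> k * (of_nat k * T ^ (k - 1) * W) $ m)"
      unfolding sum.distrib sum_distrib_right T_def W_def tree_fps_power_weighted[symmetric] sum_distrib_left
      by (intro arg_cong2[where f = "(+)"] sum.cong refl) (auto simp: forests_def tree_weight_graft)
    also have "(\<Sum>k=0..m. \<Sum>Vs\<in>forests k m. tree_weight \<mu> (graft Vs)) = T $ n"
      unfolding T_def tree_fps_def Suc fps_nth_Abs_fps sum_trees_of_size_Suc ..
    also have "(\<Sum>k=0..m. pmf \<mu> k * (of_nat k * T ^ (k - 1) * W) $ m) =
      (\<Sum>k=0..Suc m. pmf \<mu> k * real k * (T ^ (k - 1) * W) $ m)"
    proof -
      \<comment> \<open>The sum is extended by one index to match the shift in the derivative
        series. The added term vanishes because \<open>T ^ m * W\<close> starts at order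
        \<open>m + 1\<close>.\<close>
      have "(T ^ m * W) $ m = 0"
        unfolding fps_mult_nth
      proof (intro sum.neutral ballI)
        fix i assume "i \<in> {0..m}"
        then show "(T ^ m) $ i * W $ (m - i) = 0"
          using W0 startsby_zero_power_prefix[OF T0, of m] by (cases "i = m") auto
      qed
      moreover have "(of_nat k * T ^ (k - 1) * W) $ m = real k * (T ^ (k - 1) * W) $ m" for k
        by (simp add: mult.assoc flip: fps_of_nat)
      ultimately show ?thesis by (simp add: mult.assoc)
    qed
    also have "\<dots> = (\<Sum>k=0..m. pmf \<mu> (Suc k) * real (Suc k) * (T ^ k * W) $ m)"
      by (subst sum.atLeast0_atMost_Suc_shift) (simp add: o_def)
    also have "\<dots> = ((fps_deriv (offspring_fps \<mu>) oo T) * W) $ m"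
      unfolding fps_compose_mult_nth[OF T0] by (intro sum.cong refl) (simp add: offspring_fps_def)
    finally show ?thesis by (simp add: Suc fps_X_mult_nth mult.commute)
  qed (simp add: W0)
qed

text \<open>Coefficients of powers of the offspring series are point probabilities of the random
  walk, so tree sums become walk probabilities. A positive mass at 0 makes f(T) invertible.\<close>

theorem tree_weight_sums:
  assumes "pmf \<mu> 0 \<noteq> 0"
  shows "n \<ge> 1 \<Longrightarrow> real n * (\<Sum>V\<in>trees_of_size n. tree_weight \<mu> V) = (offspring_fps \<mu> ^ n) $ (n - 1)"
    and "(\<Sum>V\<in>trees_of_size n. tree_weight \<mu> V * real (subtree_sum V)) =
      (\<Sum>i=1..n. (offspring_fps \<mu> ^ i) $ (i - 1) * (offspring_fps \<mu> ^ (n - i)) $ (n - i))"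
proof -
  have f0: "offspring_fps \<mu> $ 0 \<noteq> 0" using assms by (simp add: offspring_fps_def)
  show "real n * (\<Sum>V\<in>trees_of_size n. tree_weight \<mu> V) = (offspring_fps \<mu> ^ n) $ (n - 1)" if "n \<ge> 1"
    using lagrange_inversion(1)[OF f0 tree_fps_0 tree_weight_fps_eq, of n] that
    by (simp add: fps_X_mult_nth tree_fps_def)
  show "(\<Sum>V\<in>trees_of_size n. tree_weight \<mu> V * real (subtree_sum V)) =
      (\<Sum>i=1..n. (offspring_fps \<mu> ^ i) $ (i - 1) * (offspring_fps \<mu> ^ (n - i)) $ (n - i))"
    using path_length_fps[OF f0 tree_fps_0 tree_weight_fps_eq subtree_sum_fps_eq, of n]
    by (simp add: tree_fps_def)
qed

section \<open>Probabilities of tree events\<close>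

interpretation offspring: product_prob_space "\<lambda>_. measure_pmf \<mu>" UNIV for \<mu> :: "nat pmf" ..

lemma space_offspring_field [simp]: "space (offspring_field \<mu>) = UNIV"
  by (simp add: offspring_field_def space_PiM)

lemma prob_space_offspring_field: "prob_space (offspring_field \<mu>)"
  unfolding offspring_field_def by (rule prob_space_PiM) (rule prob_space_measure_pmf)

lemma gw_tree_event:
  assumes V: "V \<in> finite_trees"
  shows "{\<xi>. gw_tree \<xi> = V} \<in> sets (offspring_field \<mu>)"
    and "measure (offspring_field \<mu>) {\<xi>. gw_tree \<xi> = V} = tree_weight \<mu> V"
proof -
  have fin: "finite V" using V by (simp add: finite_trees_def)
  have eq: "{\<xi>. gw_tree \<xi> = V} = prod_emb UNIV (\<lambda>_. measure_pmf \<mu>) V (\<Pi>\<^sub>E u\<in>V. {child_count V u})"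
    using gw_tree_eq_iff[of V] V by (auto simp: finite_trees_def prod_emb_def PiE_iff extensional_def)
  show "{\<xi>. gw_tree \<xi> = V} \<in> sets (offspring_field \<mu>)"
    unfolding eq offspring_field_def by (intro sets_PiM_I fin) auto
  show "measure (offspring_field \<mu>) {\<xi>. gw_tree \<xi> = V} = tree_weight \<mu> V"
    unfolding eq offspring_field_def tree_weight_def
    by (subst offspring.measure_PiM_emb) (auto simp: fin measure_pmf_single)
qed

lemma size_event_eq: "size_event \<mu> n = (\<Union>V\<in>trees_of_size n. {\<xi>. gw_tree \<xi> = V})"
  by (auto simp: size_event_def trees_of_size_def finite_trees_def)

lemma size_event_sets: "size_event \<mu> n \<in> sets (offspring_field \<mu>)"
  unfolding size_event_eq
  by (intro sets.finite_UN gw_tree_event finite_trees_of_size) (auto simp: trees_of_size_def)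

lemma measure_gw_tree_in:
  assumes "\<V> \<subseteq> trees_of_size n"
  shows "measure (offspring_field \<mu>) {\<xi>. gw_tree \<xi> \<in> \<V>} = (\<Sum>V\<in>\<V>. tree_weight \<mu> V)"
    and "{\<xi>. gw_tree \<xi> \<in> \<V>} \<in> sets (offspring_field \<mu>)"
proof -
  interpret prob_space "offspring_field \<mu>" by (rule prob_space_offspring_field)
  have fin: "finite \<V>" using assms finite_trees_of_size finite_subset by blast
  have V: "V \<in> finite_trees" if "V \<in> \<V>" for V using assms that by (auto simp: trees_of_size_def)
  have eq: "{\<xi>. gw_tree \<xi> \<in> \<V>} = (\<Union>V\<in>\<V>. {\<xi>. gw_tree \<xi> = V})" by auto
  show "{\<xi>. gw_tree \<xi> \<in> \<V>} \<in> sets (offspring_field \<mu>)"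
    unfolding eq by (intro sets.finite_UN gw_tree_event fin V)
  have "measure (offspring_field \<mu>) {\<xi>. gw_tree \<xi> \<in> \<V>} = (\<Sum>V\<in>\<V>. measure (offspring_field \<mu>) {\<xi>. gw_tree \<xi> = V})"
    unfolding eq by (rule finite_measure_finite_Union) (auto simp: fin disjoint_family_on_def gw_tree_event V)
  then show "measure (offspring_field \<mu>) {\<xi>. gw_tree \<xi> \<in> \<V>} = (\<Sum>V\<in>\<V>. tree_weight \<mu> V)"
    by (simp add: gw_tree_event V)
qed

lemma measure_size_event:
  "measure (offspring_field \<mu>) (size_event \<mu> n) = (\<Sum>V\<in>trees_of_size n. tree_weight \<mu> V)"
proof -
  have "size_event \<mu> n = {\<xi>. gw_tree \<xi> \<in> trees_of_size n}" unfolding size_event_eq by blast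
  then show ?thesis using measure_gw_tree_in(1)[of "trees_of_size n" n \<mu>] by simp
qed

section \<open>Characteristic functions of stable laws and of random walks\<close>

lemma square_le_exp_abs:
  fixes x b :: real
  assumes "b > 0"
  shows "x\<^sup>2 \<le> 2 / b\<^sup>2 * exp (b * \<bar>x\<bar>)" and "\<bar>x\<bar> \<le> 1 / b * exp (b * \<bar>x\<bar>)"
proof -
  have nn: "b * \<bar>x\<bar> \<ge> 0" using assms by simp
  have "(b * \<bar>x\<bar>)\<^sup>2 / 2 \<le> exp (b * \<bar>x\<bar>)"
    using exp_lower_Taylor_quadratic[OF nn] nn by linarith
  then show "x\<^sup>2 \<le> 2 / b\<^sup>2 * exp (b * \<bar>x\<bar>)" using assms by (simp add: field_simps power_mult_distrib)
  have "b * \<bar>x\<bar> \<le> exp (b * \<bar>x\<bar>)" using exp_ge_add_one_self[of "b * \<bar>x\<bar>"] by linarith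
  then show "\<bar>x\<bar> \<le> 1 / b * exp (b * \<bar>x\<bar>)" using assms by (simp add: field_simps)
qed

lemma exp_abs_le: "exp (b * \<bar>x::real\<bar>) \<le> exp (b * x) + exp (- b * x)"
  by (cases "x \<ge> 0") (auto simp: add_increasing add_increasing2)

text \<open>Differentiation under the integral. The Taylor remainder of the exponential is bounded
  by |h X|^2 exp (b |X|), and the polynomial factor is absorbed into a second exponential.\<close>

lemma laplace_holomorphic:
  fixes X :: "'a \<Rightarrow> real"
  assumes [measurable]: "X \<in> borel_measurable M"
    and int: "\<And>r. r > 0 \<Longrightarrow> integrable M (\<lambda>x. exp (- r * X x))"
  shows "(\<lambda>z. \<integral>x. exp (- z * of_real (X x)) \<partial>M) holomorphic_on {z. Re z > 0}"
proof -
  define F where "F z = (\<integral>x. exp (- z * of_real (X x)) \<partial>M)" for z :: complex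
  have int1: "integrable M (\<lambda>x. exp (- z * complex_of_real (X x)))" if "Re z > 0" for z
    by (rule Bochner_Integration.integrable_bound[OF int[OF that]]) auto
  have "\<exists>D. (F has_field_derivative D) (at z)" if "Re z > 0" for z
  proof -
    define a where "a = Re z"
    \<comment> \<open>The perturbation and the polynomial factor together cost
      \<open>exp (2 * b * \<bar>X\<bar>)\<close>. This turns the exponent \<open>a\<close> into
      \<open>2 * b\<close> or \<open>6 * b\<close>, both positive, where integrability is
      assumed.\<close>
    define b where "b = a / 4"
    have ab: "a > 0" "b > 0" "a = 4 * b" using that by (auto simp: a_def b_def)
    define H where "H x = exp (- (2 * b) * X x) + exp (- (6 * b) * X x)" for x
    have intH: "integrable M H" unfolding H_def using ab by (intro Bochner_Integration.integrable_add int) auto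
    have HH: "exp (- a * X x) * exp (2 * b * \<bar>X x\<bar>) \<le> H x" for x
    proof -
      have "exp (- a * X x) * exp (2 * b * \<bar>X x\<bar>) \<le> exp (- a * X x) * (exp (2 * b * X x) + exp (- (2 * b) * X x))"
        using exp_abs_le[of "2 * b" "X x"] by (intro mult_left_mono) auto
      also have "\<dots> = H x" by (simp add: H_def ab(3) distrib_left algebra_simps flip: exp_add)
      finally show ?thesis .
    qed
    have Hb: "exp (- a * X x) * exp (b * \<bar>X x\<bar>) \<le> H x" for x
    proof -
      have "exp (b * \<bar>X x\<bar>) \<le> exp (2 * b * \<bar>X x\<bar>)" using ab by (simp add: mult_right_mono)
      then have "exp (- a * X x) * exp (b * \<bar>X x\<bar>) \<le> exp (- a * X x) * exp (2 * b * \<bar>X x\<bar>)" by simp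
      then show ?thesis using HH[of x] by linarith
    qed
    define D where "D = (\<integral>x. - of_real (X x) * exp (- z * of_real (X x)) \<partial>M)"
    have intD: "integrable M (\<lambda>x. - of_real (X x) * exp (- z * complex_of_real (X x)))"
    proof (rule Bochner_Integration.integrable_bound)
      show "integrable M (\<lambda>x. 1 / b * H x)" using intH by simp
      show "AE x in M. norm (- of_real (X x) * exp (- z * complex_of_real (X x))) \<le> norm (1 / b * H x)"
      proof (rule AE_I2)
        fix x
        have "norm (- of_real (X x) * exp (- z * complex_of_real (X x))) = \<bar>X x\<bar> * exp (- a * X x)"
          by (simp add: norm_mult a_def)
        also have "\<dots> \<le> 1 / b * exp (b * \<bar>X x\<bar>) * exp (- a * X x)"
          using square_le_exp_abs(2)[OF ab(2)] by (intro mult_right_mono) auto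
        also have "\<dots> = 1 / b * (exp (- a * X x) * exp (b * \<bar>X x\<bar>))" by simp
        also have "\<dots> \<le> 1 / b * H x" using ab Hb[of x] by (intro mult_left_mono) auto
        also have "\<dots> \<le> norm (1 / b * H x)" unfolding real_norm_def by (rule abs_ge_self)
        finally show "norm (- of_real (X x) * exp (- z * complex_of_real (X x))) \<le> norm (1 / b * H x)" .
      qed
    qed simp
    define C where "C = (\<integral>x. 2 / b\<^sup>2 * H x \<partial>M)"
    have bound: "norm ((F (z + h) - F z) / h - D) \<le> C * norm h" if h: "h \<noteq> 0" "norm h < b" for h
    proof -
      have Re: "Re (z + h) > 0" using abs_Re_le_cmod[of h] h ab by (simp add: a_def[symmetric])
      let ?f = "\<lambda>x. exp (- (z + h) * of_real (X x)) - exp (- z * of_real (X x)) - h * (- of_real (X x) * exp (- z * of_real (X x)))"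
      have intf: "integrable M ?f"
        by (intro Bochner_Integration.integrable_diff integrable_mult_right int1 Re \<open>Re z > 0\<close> intD)
      have eq: "F (z + h) - F z - h * D = (\<integral>x. ?f x \<partial>M)"
        unfolding F_def D_def using int1[OF Re] int1[OF \<open>Re z > 0\<close>] intD
        by (simp add: Bochner_Integration.integral_diff Bochner_Integration.integrable_diff)
      have "norm (\<integral>x. ?f x \<partial>M) \<le> (\<integral>x. (norm h)\<^sup>2 * (2 / b\<^sup>2 * H x) \<partial>M)"
      proof (rule order_trans[OF integral_norm_bound], rule integral_mono)
        show "integrable M (\<lambda>x. norm (?f x))" using intf by (rule integrable_norm)
        show "integrable M (\<lambda>x. (norm h)\<^sup>2 * (2 / b\<^sup>2 * H x))" using intH by simp
        fix x
        define w where "w = - h * of_real (X x)"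
        have "?f x = exp (- z * of_real (X x)) * (exp w - (1 + w))"
          by (simp add: w_def algebra_simps exp_add[symmetric])
        then have "norm (?f x) = exp (- a * X x) * norm (exp w - (1 + w))"
          by (simp add: norm_mult a_def)
        also have "norm (exp w - (1 + w)) \<le> exp \<bar>Re w\<bar> * (norm w)\<^sup>2"
          using Taylor_exp[of w 1] by (simp add: numeral_2_eq_2)
        also have "\<dots> \<le> exp (b * \<bar>X x\<bar>) * ((norm h)\<^sup>2 * (2 / b\<^sup>2 * exp (b * \<bar>X x\<bar>)))"
        proof (rule mult_mono)
          have "\<bar>Re w\<bar> = \<bar>Re h\<bar> * \<bar>X x\<bar>" by (simp add: w_def abs_mult)
          also have "\<dots> \<le> b * \<bar>X x\<bar>" using abs_Re_le_cmod[of h] h(2) by (intro mult_right_mono) auto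
          finally show "exp \<bar>Re w\<bar> \<le> exp (b * \<bar>X x\<bar>)" by simp
          have "(norm w)\<^sup>2 = (norm h)\<^sup>2 * (X x)\<^sup>2" by (simp add: w_def norm_mult power_mult_distrib)
          also have "\<dots> \<le> (norm h)\<^sup>2 * (2 / b\<^sup>2 * exp (b * \<bar>X x\<bar>))"
            using square_le_exp_abs(1)[OF ab(2)] by (intro mult_left_mono) auto
          finally show "(norm w)\<^sup>2 \<le> (norm h)\<^sup>2 * (2 / b\<^sup>2 * exp (b * \<bar>X x\<bar>))" .
        qed auto
        finally have "norm (?f x) \<le> exp (- a * X x) * (exp (b * \<bar>X x\<bar>) * ((norm h)\<^sup>2 * (2 / b\<^sup>2 * exp (b * \<bar>X x\<bar>))))"
          by simp
        also have "\<dots> = (norm h)\<^sup>2 * (2 / b\<^sup>2 * (exp (- a * X x) * exp (2 * b * \<bar>X x\<bar>)))"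
        proof -
          have "exp (2 * b * \<bar>X x\<bar>) = exp (b * \<bar>X x\<bar>) * exp (b * \<bar>X x\<bar>)" by (simp flip: exp_add)
          then show ?thesis by (simp only: mult_ac)
        qed
        also have "\<dots> \<le> (norm h)\<^sup>2 * (2 / b\<^sup>2 * H x)" using HH[of x] by (intro mult_left_mono) auto
        finally show "norm (?f x) \<le> (norm h)\<^sup>2 * (2 / b\<^sup>2 * H x)" .
      qed
      also have "\<dots> = (norm h)\<^sup>2 * C" by (simp add: C_def)
      finally have "norm (F (z + h) - F z - h * D) \<le> (norm h)\<^sup>2 * C" by (simp add: eq)
      moreover have "(F (z + h) - F z) / h - D = (F (z + h) - F z - h * D) / h" using h by (simp add: field_simps)
      ultimately show ?thesis using h by (simp add: norm_divide divide_le_eq power2_eq_square mult_ac)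
    qed
    have "(\<lambda>h. (F (z + h) - F z) / h - D) \<midarrow>0\<rightarrow> 0"
    proof (rule Lim_null_comparison)
      show "\<forall>\<^sub>F h in at 0. norm ((F (z + h) - F z) / h - D) \<le> C * norm h"
        using bound ab(2) by (auto simp: eventually_at intro!: exI[of _ b])
      show "((\<lambda>h. C * norm h) \<longlongrightarrow> 0) (at (0::complex))" by (auto intro!: tendsto_eq_intros)
    qed
    then have "(\<lambda>h. (F (z + h) - F z) / h) \<midarrow>0\<rightarrow> D" by (simp add: LIM_zero_iff)
    then show ?thesis by (auto simp: DERIV_def)
  qed
  then have "F holomorphic_on {z. Re z > 0}"
    unfolding holomorphic_on_def field_differentiable_def by (blast intro: has_field_derivative_at_within)
  then show ?thesis by (simp add: F_def[abs_def])
qed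

lemma LIMSEQ_one_over_Suc: "(\<lambda>n. 1 / real (Suc n)) \<longlonglongrightarrow> 0"
  using LIMSEQ_inverse_real_of_nat by (simp add: inverse_eq_divide)

text \<open>Identity theorem: the positive reals accumulate at 1 inside the half plane.\<close>

lemma right_half_plane_identity:
  assumes "f holomorphic_on {z. Re z > 0}" "g holomorphic_on {z. Re z > 0}"
    and eq: "\<And>r. r > 0 \<Longrightarrow> f (of_real r) = g (of_real r)" and "Re z > 0"
  shows "f z = g z"
proof -
  let ?U = "complex_of_real ` {0<..}"
  have "f z - g z = 0"
  proof (rule analytic_continuation[of "\<lambda>z. f z - g z" "{z. Re z > 0}" ?U 1])
    show "(\<lambda>z. f z - g z) holomorphic_on {z. Re z > 0}" using assms by (intro holomorphic_on_diff)
    show "open {z. Re z > 0}" by (rule open_halfspace_Re_gt)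
    show "connected {z. Re z > 0}" by (intro convex_connected convex_halfspace_Re_gt)
    have "(\<lambda>n. complex_of_real (1 + 1 / Suc n)) \<longlonglongrightarrow> complex_of_real (1 + 0)"
      by (intro tendsto_of_real tendsto_add tendsto_const) (rule LIMSEQ_one_over_Suc)
    then show "1 islimpt ?U"
      unfolding islimpt_sequential
    proof (intro exI[of _ "\<lambda>n. complex_of_real (1 + 1 / Suc n)"] conjI allI)
      fix n
      have "1 + 1 / real (Suc n) \<in> {0<..}" "1 + 1 / real (Suc n) \<noteq> 1" by (auto simp: add_pos_nonneg)
      then show "complex_of_real (1 + 1 / Suc n) \<in> ?U - {1}"
        using of_real_eq_1_iff[where 'a = complex] by blast
    qed simp
  qed (use assms in auto)
  then show ?thesis by simp
qed

section \<open>Characteristic function of the stable law\<close>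

definition stable_const :: "real \<Rightarrow> real" where
  "stable_const \<alpha> = (if \<alpha> = 2 then 1 / 2 else 1)"

text \<open>For s > 0 the \<alpha>-th power of \<i> s is s^\<alpha> times
  \<open>cis (pi * \<alpha> / 2)\<close>. The sign is chosen so that the real part, the decay rate
  of the characteristic function, is positive for 1 < \<alpha> \<le> 2.\<close>

definition stable_exponent :: "real \<Rightarrow> complex" where
  "stable_exponent \<alpha> = - (stable_const \<alpha> * cis (pi * \<alpha> / 2))"

lemma Re_stable_exponent_pos:
  assumes "1 < \<alpha>" "\<alpha> \<le> 2"
  shows "Re (stable_exponent \<alpha>) > 0"
proof -
  have "cos (pi * \<alpha> / 2) = - cos (pi - pi * \<alpha> / 2)" by (simp add: cos_diff)
  moreover have "cos (pi - pi * \<alpha> / 2) > 0"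
    using assms by (intro cos_gt_zero_pi) (auto simp: field_simps)
  ultimately show ?thesis by (simp add: stable_exponent_def stable_const_def)
qed

text \<open>The Laplace transform, prescribed on the positive reals, is continued analytically to
  the right half plane; the boundary point \<i> s is then approached from inside. Dominated
  convergence applies with \<open>1 + exp (- x)\<close> because the real parts stay between 0 and
  1.\<close>

lemma char_stable_law:
  assumes Z: "stable_law \<alpha> Z" and \<alpha>: "1 < \<alpha>" "\<alpha> \<le> 2" and "s > 0"
  shows "char Z (- s) = exp (- stable_exponent \<alpha> * of_real (s powr \<alpha>))"
proof -
  interpret real_distribution Z using Z by (simp add: stable_law_def)
  let ?c = "stable_const \<alpha>"
  define F where "F z = (\<integral>x. exp (- z * complex_of_real x) \<partial>Z)" for z
  have int: "integrable Z (\<lambda>x. exp (- r * x))" if "r > 0" for r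
    using Z that by (auto simp: stable_law_def)
  have holF: "F holomorphic_on {z. Re z > 0}"
    unfolding F_def by (rule laplace_holomorphic) (use int in auto)
  have pow: "(of_real r :: complex) powr of_real \<alpha> = of_real (r powr \<alpha>)" if "r > 0" for r
    using that by (simp add: powr_of_real)
  have F: "F z = exp (of_real ?c * z powr of_real \<alpha>)" if "Re z > 0" for z
  proof (rule right_half_plane_identity[OF holF _ _ that])
    show "(\<lambda>z. exp (complex_of_real ?c * z powr complex_of_real \<alpha>)) holomorphic_on {z. 0 < Re z}"
      by (intro holomorphic_intros) (auto simp: complex_nonpos_Reals_iff)
    fix r :: real assume r: "r > 0"
    have "F (of_real r) = of_real (\<integral>x. exp (- r * x) \<partial>Z)"
      unfolding F_def by (subst integral_complex_of_real[symmetric]) (simp flip: exp_of_real)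
    also have "(\<integral>x. exp (- r * x) \<partial>Z) = exp (?c * r powr \<alpha>)"
      using Z r by (auto simp: stable_law_def stable_const_def)
    finally show "F (of_real r) = exp (complex_of_real ?c * complex_of_real r powr complex_of_real \<alpha>)"
      by (simp add: pow[OF r] flip: exp_of_real)
  qed
  define zs where "zs n = Complex (1 / Suc n) s" for n
  have zlim: "zs \<longlonglongrightarrow> Complex 0 s"
    unfolding zs_def by (intro tendsto_Complex tendsto_const) (rule LIMSEQ_one_over_Suc)
  have "(\<lambda>n. F (zs n)) \<longlonglongrightarrow> (\<integral>x. exp (- Complex 0 s * complex_of_real x) \<partial>Z)"
    unfolding F_def
  proof (rule integral_dominated_convergence)
    show "integrable Z (\<lambda>x. 1 + exp (- 1 * x))" using int[of 1] by simp
    show "AE x in Z. (\<lambda>n. exp (- zs n * complex_of_real x)) \<longlonglongrightarrow> exp (- Complex 0 s * complex_of_real x)"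
      by (intro AE_I2 tendsto_intros zlim)
    show "AE x in Z. norm (exp (- zs n * complex_of_real x)) \<le> 1 + exp (- 1 * x)" for n
    proof (rule AE_I2)
      fix x
      have "norm (exp (- zs n * complex_of_real x)) = exp (- (1 / Suc n) * x)" by (simp add: zs_def)
      also have "\<dots> \<le> 1 + exp (- 1 * x)"
      proof (cases "x \<ge> 0")
        case True
        then have "exp (- (1 / Suc n) * x) \<le> 1" by simp
        then show ?thesis using exp_gt_zero[of "-1 * x"] by linarith
      next
        case False
        then have "- (1 / Suc n) * x \<le> - 1 * x" by (simp add: field_simps mult_le_0_iff)
        then have "exp (- (1 / Suc n) * x) \<le> exp (- 1 * x)" by (simp only: exp_le_cancel_iff)
        then show ?thesis by linarith
      qed
      finally show "norm (exp (- zs n * complex_of_real x)) \<le> 1 + exp (- 1 * x)" .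
    qed
  qed auto
  also have "(\<integral>x. exp (- Complex 0 s * complex_of_real x) \<partial>Z) = char Z (- s)"
    unfolding char_def by (intro Bochner_Integration.integral_cong refl arg_cong[where f = exp]) (auto simp: complex_eq_iff)
  finally have 1: "(\<lambda>n. F (zs n)) \<longlonglongrightarrow> char Z (- s)" .
  have "F (zs n) = exp (of_real ?c * zs n powr of_real \<alpha>)" for n by (rule F) (simp add: zs_def)
  moreover have "(\<lambda>n. exp (of_real ?c * zs n powr of_real \<alpha>)) \<longlonglongrightarrow> exp (of_real ?c * Complex 0 s powr of_real \<alpha>)"
    using \<open>s > 0\<close> by (intro tendsto_intros zlim) (auto simp: complex_nonpos_Reals_iff)
  ultimately have "char Z (- s) = exp (of_real ?c * Complex 0 s powr of_real \<alpha>)"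
    using 1 LIMSEQ_unique by auto
  also have "Complex 0 s powr of_real \<alpha> = of_real (s powr \<alpha>) * cis (pi * \<alpha> / 2)"
  proof -
    have "Complex 0 s = \<i> * of_real s" by (simp add: complex_eq_iff)
    then have Ln: "Ln (Complex 0 s) = of_real (ln s) + \<i> * of_real (pi / 2)"
      using \<open>s > 0\<close> Ln_times_of_real[of s \<i>] by (simp add: mult.commute Ln_of_real)
    have "Complex 0 s \<noteq> 0" using \<open>s > 0\<close> by (simp add: complex_eq_iff)
    then have "Complex 0 s powr of_real \<alpha> = exp (of_real (\<alpha> * ln s) + \<i> * of_real (pi * \<alpha> / 2))"
      unfolding powr_def Ln by (simp add: distrib_left mult_ac)
    also have "\<dots> = of_real (exp (\<alpha> * ln s)) * cis (pi * \<alpha> / 2)"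
      by (simp only: exp_add cis_conv_exp exp_of_real)
    finally show ?thesis using \<open>s > 0\<close> by (simp add: powr_def)
  qed
  finally show ?thesis by (simp add: stable_exponent_def mult_ac)
qed

lemma set_integrable_exp_powr:
  fixes \<alpha> r :: real
  assumes "\<alpha> \<ge> 1" "r > 0"
  shows "set_integrable lborel {0<..} (\<lambda>s. exp (- r * s powr \<alpha>))"
proof (rule set_integrable_bound)
  show "set_integrable lborel {0<..} (\<lambda>s. exp r * exp (- (s * r)))"
    by (intro set_integrable_mult_right integrable_I0i_exp_mscale assms)
  show "AE s in lborel. s \<in> {0<..} \<longrightarrow> norm (exp (- r * s powr \<alpha>)) \<le> norm (exp r * exp (- (s * r)))"
  proof (intro AE_I2 impI)
    fix s :: real assume s: "s \<in> {0<..}"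
    have "s - 1 \<le> s powr \<alpha>"
    proof (cases "s \<ge> 1")
      case True
      then have "s powr 1 \<le> s powr \<alpha>" using assms by (intro powr_mono) auto
      then show ?thesis using s by simp
    next
      case False
      then show ?thesis using powr_ge_zero[of s \<alpha>] by linarith
    qed
    then have "r * (s - 1) \<le> r * s powr \<alpha>" using assms by (intro mult_left_mono) auto
    then have "exp (- r * s powr \<alpha>) \<le> exp (r - s * r)" by (simp add: algebra_simps)
    then show "norm (exp (- r * s powr \<alpha>)) \<le> norm (exp r * exp (- (s * r)))" by (simp add: exp_diff exp_minus field_simps)
  qed
qed (auto simp: set_borel_measurable_def)

text \<open>Scaling gives the formula for real arguments; it extends by analytic continuation.\<close>

lemma integral_exp_powr:
  fixes \<alpha> :: real and w :: complex
  assumes \<alpha>: "\<alpha> \<ge> 1" and w: "Re w > 0"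
  shows "(CLBINT s:{0<..}. exp (- w * of_real (s powr \<alpha>))) =
    w powr of_real (- 1 / \<alpha>) * of_real (LBINT s:{0<..}. exp (- (s powr \<alpha>)))"
proof -
  let ?M = "restrict_space lborel {0<..}"
  define F where "F w = (\<integral>s. exp (- w * complex_of_real (s powr \<alpha>)) \<partial>?M)" for w
  have F: "F w = (CLBINT s:{0<..}. exp (- w * of_real (s powr \<alpha>)))" for w
    unfolding F_def set_lebesgue_integral_def by (subst integral_restrict_space) auto
  have hol: "F holomorphic_on {z. Re z > 0}"
    unfolding F_def
  proof (rule laplace_holomorphic)
    show "(\<lambda>s. s powr \<alpha>) \<in> borel_measurable ?M" by (intro measurable_restrict_space1) auto
    fix r :: real assume "r > 0"
    then show "integrable ?M (\<lambda>s. exp (- r * s powr \<alpha>))"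
      using set_integrable_exp_powr[OF \<alpha>] by (subst integrable_restrict_space) (auto simp: set_integrable_def)
  qed
  have "F w = w powr of_real (- 1 / \<alpha>) * of_real (LBINT s:{0<..}. exp (- (s powr \<alpha>)))"
  proof (rule right_half_plane_identity[OF hol _ _ w])
    show "(\<lambda>w. w powr complex_of_real (- 1 / \<alpha>) * complex_of_real (LBINT s:{0<..}. exp (- (s powr \<alpha>)))) holomorphic_on {z. 0 < Re z}"
      by (intro holomorphic_intros) (auto simp: complex_nonpos_Reals_iff)
    fix r :: real assume r: "r > 0"
    define c where "c = r powr (- 1 / \<alpha>)"
    have "c powr \<alpha> = r powr (- 1)" unfolding c_def powr_powr using \<alpha> by simp
    then have c: "c > 0" "r * c powr \<alpha> = 1" using r by (auto simp: c_def powr_minus)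
    have "F (of_real r) = of_real (LBINT s:{0<..}. exp (- r * s powr \<alpha>))"
      unfolding F set_lebesgue_integral_def
      by (subst integral_complex_of_real[symmetric]) (auto intro!: Bochner_Integration.integral_cong simp: indicator_def exp_of_real[symmetric])
    also have "(LBINT s:{0<..}. exp (- r * s powr \<alpha>)) = c * (LBINT s:{0<..}. exp (- (s powr \<alpha>)))"
    proof -
      have "(LBINT s:{0<..}. exp (- r * s powr \<alpha>)) = \<bar>c\<bar> *\<^sub>R (LBINT x. indicator {0<..} (0 + c * x) *\<^sub>R exp (- r * (0 + c * x) powr \<alpha>))"
        unfolding set_lebesgue_integral_def using c by (intro lborel_integral_real_affine) auto
      also have "(LBINT x. indicator {0<..} (0 + c * x) *\<^sub>R exp (- r * (0 + c * x) powr \<alpha>)) = (LBINT s:{0<..}. exp (- (s powr \<alpha>)))"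
        unfolding set_lebesgue_integral_def
      proof (rule Bochner_Integration.integral_cong[OF refl])
        fix x
        have "r * (c * x) powr \<alpha> = x powr \<alpha>" if "x > 0" using that c by (simp add: powr_mult mult.assoc[symmetric])
        then show "indicator {0<..} (0 + c * x) *\<^sub>R exp (- r * (0 + c * x) powr \<alpha>) = indicator {0<..} x *\<^sub>R exp (- (x powr \<alpha>))"
          using c by (auto simp: indicator_def zero_less_mult_iff)
      qed
      finally show ?thesis using c by simp
    qed
    finally show "F (of_real r) = complex_of_real r powr complex_of_real (- 1 / \<alpha>) * complex_of_real (LBINT s:{0<..}. exp (- (s powr \<alpha>)))"
      using r powr_of_real[of r "- 1 / \<alpha>"] by (simp only: c_def of_real_mult less_imp_le)
  qed
  then show ?thesis by (simp add: F)
qed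

text \<open>The argument of \<open>w\<close> is less than pi / 2 in modulus, and dividing it by
  \<alpha> \<ge> 1 keeps it so. Hence the power \<open>w powr (- 1 / \<alpha>)\<close> in the closed
  formula has positive real part.\<close>

lemma integral_Re_exp_powr_pos:
  fixes \<alpha> :: real and w :: complex
  assumes \<alpha>: "\<alpha> \<ge> 1" and w: "Re w > 0"
  shows "0 < (LBINT s:{0<..}. Re (exp (- w * of_real (s powr \<alpha>))))"
proof -
  define J where "J = (LBINT s:{0<..}. exp (- (s powr \<alpha>)))"
  have J: "J > 0"
  proof -
    have si: "set_integrable lborel {0<..} (\<lambda>s. exp (- (s powr \<alpha>)))" using set_integrable_exp_powr[OF \<alpha>, of 1] by simp
    have "exp (- 1) = (LBINT s:{0<..<1::real}. exp (- 1::real))" by (simp add: set_lebesgue_integral_def)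
    also have "\<dots> \<le> (LBINT s:{0<..<1::real}. exp (- (s powr \<alpha>)))"
    proof (rule set_integral_mono)
      show "set_integrable lborel {0<..<1::real} (\<lambda>s. exp (- (s powr \<alpha>)))" by (rule set_integrable_subset[OF si]) auto
      show "set_integrable lborel {0<..<1::real} (\<lambda>s. exp (- 1::real))" by (auto simp: set_integrable_def)
      fix s :: real assume "s \<in> {0<..<1}"
      then have "s powr \<alpha> \<le> 1" using \<alpha> by (simp add: powr_le1)
      then show "exp (- 1) \<le> exp (- (s powr \<alpha>))" by simp
    qed
    also have "\<dots> \<le> J"
      unfolding J_def set_lebesgue_integral_def
    proof (rule integral_mono)
      have "set_integrable lborel {0<..<1} (\<lambda>s. exp (- (s powr \<alpha>)))" by (rule set_integrable_subset[OF si]) auto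
      then show "integrable lborel (\<lambda>s. indicator {0<..<1} s *\<^sub>R exp (- (s powr \<alpha>)))"
        by (simp only: set_integrable_def)
    qed (use si in \<open>auto simp: set_integrable_def indicator_def\<close>)
    finally show ?thesis using exp_gt_zero[of "-1::real"] by linarith
  qed
  have int: "set_integrable lborel {0<..} (\<lambda>s. exp (- w * complex_of_real (s powr \<alpha>)))"
    by (rule set_integrable_bound[OF set_integrable_exp_powr[OF \<alpha> w]]) (auto simp: set_borel_measurable_def)
  have "w \<noteq> 0" using w by auto
  have ln: "\<bar>Im (Ln w)\<bar> < pi / 2" using Re_Ln_pos_lt[OF \<open>w \<noteq> 0\<close>] w by simp
  have "(LBINT s:{0<..}. Re (exp (- w * of_real (s powr \<alpha>)))) = Re (CLBINT s:{0<..}. exp (- w * of_real (s powr \<alpha>)))"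
    using int unfolding set_lebesgue_integral_def set_integrable_def by (subst integral_Re[symmetric]) auto
  also have "\<dots> = Re (w powr of_real (- 1 / \<alpha>)) * J"
    unfolding integral_exp_powr[OF assms] J_def by simp
  also have "Re (w powr of_real (- 1 / \<alpha>)) = exp (- 1 / \<alpha> * Re (Ln w)) * cos (- 1 / \<alpha> * Im (Ln w))"
    using \<open>w \<noteq> 0\<close> unfolding powr_def by (simp only: if_False Re_exp) simp
  also have "\<dots> * J > 0"
  proof -
    define x where "x = - 1 / \<alpha> * Im (Ln w)"
    have "\<bar>x\<bar> = \<bar>Im (Ln w)\<bar> / \<alpha>" using \<alpha> by (simp add: x_def abs_mult)
    also have "\<dots> \<le> \<bar>Im (Ln w)\<bar> / 1" using \<alpha> by (intro divide_left_mono) auto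
    finally have "\<bar>x\<bar> < pi / 2" using ln by simp
    then have "cos (- 1 / \<alpha> * Im (Ln w)) > 0" unfolding x_def[symmetric] by (intro cos_gt_zero_pi) linarith+
    then show ?thesis using J by simp
  qed
  finally show ?thesis .
qed

text \<open>The explicit formula covers negative arguments; conjugation covers positive
  ones.\<close>

lemma norm_char_stable_law:
  assumes Z: "stable_law \<alpha> Z" and \<alpha>: "1 < \<alpha>" "\<alpha> \<le> 2"
  shows "norm (char Z s) = exp (- Re (stable_exponent \<alpha>) * \<bar>s\<bar> powr \<alpha>)"
    and "Re (char Z s) = Re (exp (- stable_exponent \<alpha> * of_real (\<bar>s\<bar> powr \<alpha>)))"
proof -
  interpret real_distribution Z using Z by (simp add: stable_law_def)
  have cnj: "char Z s = cnj (char Z (- s))" for s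
  proof -
    have "cnj (char Z (- s)) = (CLINT x|Z. cnj (iexp (- s * x)))"
      unfolding char_def by (rule Bochner_Integration.integral_cnj[symmetric])
    then show ?thesis by (simp add: char_def exp_cnj)
  qed
  have *: "char Z s = exp (- stable_exponent \<alpha> * of_real (\<bar>s\<bar> powr \<alpha>)) \<or>
     char Z s = cnj (exp (- stable_exponent \<alpha> * of_real (\<bar>s\<bar> powr \<alpha>)))" for s
  proof (cases "s = 0")
    case True
    then show ?thesis by (simp add: char_zero)
  next
    case False
    then show ?thesis
      using char_stable_law[OF Z \<alpha>, of "\<bar>s\<bar>"] cnj[of s] by (cases "s > 0") auto
  qed
  show "norm (char Z s) = exp (- Re (stable_exponent \<alpha>) * \<bar>s\<bar> powr \<alpha>)"
    using *[of s] by (auto simp del: exp_cnj)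
  show "Re (char Z s) = Re (exp (- stable_exponent \<alpha> * of_real (\<bar>s\<bar> powr \<alpha>)))"
    using *[of s] by (auto simp del: exp_cnj)
qed

text \<open>By Fourier inversion this integral is 2 pi times the density of \<open>Z\<close> at 0,
  and it supplies the constant of the local lower bound.\<close>

lemma integral_Re_char_stable_law_pos:
  assumes Z: "stable_law \<alpha> Z" and \<alpha>: "1 < \<alpha>" "\<alpha> \<le> 2"
  shows "0 < (LBINT s. Re (char Z s))"
proof -
  define w where "w = stable_exponent \<alpha>"
  have w: "Re w > 0" using Re_stable_exponent_pos[OF \<alpha>] by (simp add: w_def)
  define h where "h s = Re (exp (- w * of_real (\<bar>s\<bar> powr \<alpha>)))" for s
  have int: "set_integrable lborel {0<..} h"
  proof (rule set_integrable_bound[OF set_integrable_exp_powr[OF _ w, of \<alpha>]])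
    show "AE s in lborel. s \<in> {0<..} \<longrightarrow> norm (h s) \<le> norm (exp (- Re w * s powr \<alpha>))"
    proof (intro AE_I2 impI)
      fix s :: real assume "s \<in> {0<..}"
      then show "norm (h s) \<le> norm (exp (- Re w * s powr \<alpha>))"
        using abs_Re_le_cmod[of "exp (- w * of_real (s powr \<alpha>))"] by (simp add: h_def)
    qed
  qed (use \<alpha> in \<open>auto simp: set_borel_measurable_def h_def\<close>)
  have hm [measurable]: "h \<in> borel_measurable borel" unfolding h_def by measurable
  have neg: "(LBINT s. indicator {..<0} s *\<^sub>R h s) = (LBINT s. indicator {0<..} s *\<^sub>R h s)"
    using lborel_integral_real_affine[of "-1" "\<lambda>s. indicator {..<0} s *\<^sub>R h s" 0]
    by (auto simp: h_def indicator_def intro!: Bochner_Integration.integral_cong)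
  have intneg: "integrable lborel (\<lambda>s. indicator {..<0} s *\<^sub>R h s)"
    using lborel_integrable_real_affine_iff[of "-1" "\<lambda>s. indicator {..<0} s *\<^sub>R h s" 0] int
    by (auto simp: h_def indicator_def set_integrable_def cong: if_cong)
  have "(LBINT s. Re (char Z s)) = (LBINT s. h s)"
    by (simp add: norm_char_stable_law(2)[OF Z \<alpha>] h_def w_def)
  also have "\<dots> = (LBINT s. indicator {..<0} s *\<^sub>R h s + indicator {0<..} s *\<^sub>R h s)"
  proof (rule integral_cong_AE)
    show "AE s in lborel. h s = indicator {..<0} s *\<^sub>R h s + indicator {0<..} s *\<^sub>R h s"
      using AE_lborel_singleton[of "0::real"] by eventually_elim (auto simp: indicator_def)
  qed auto
  also have "\<dots> = 2 * (LBINT s:{0<..}. h s)"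
    using int intneg neg by (simp add: set_lebesgue_integral_def set_integrable_def)
  also have "(LBINT s:{0<..}. h s) = (LBINT s:{0<..}. Re (exp (- w * of_real (s powr \<alpha>))))"
    unfolding set_lebesgue_integral_def by (intro Bochner_Integration.integral_cong) (auto simp: h_def indicator_def)
  finally show ?thesis using integral_Re_exp_powr_pos[OF _ w, of \<alpha>] \<alpha> by simp
qed

text \<open>In the fourth-order expansion y^4 / 24 is at most y^2 / 6 for |y| \<le> 2, and 1/2 - 1/6
  = 1/3.\<close>

lemma one_minus_cos_ge:
  fixes y :: real
  assumes "\<bar>y\<bar> \<le> 2"
  shows "1 - cos y \<ge> y\<^sup>2 / 3"
proof -
  obtain t where "cos y = (\<Sum>m<4. cos_coeff m * y ^ m) + (cos (t + 1/2 * real 4 * pi) / fact 4) * y ^ 4"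
    using Maclaurin_cos_expansion[of y 4] by blast
  moreover have "(\<Sum>m<4. cos_coeff m * y ^ m) = 1 - y\<^sup>2 / 2"
  proof -
    have "(\<Sum>m<4. cos_coeff m * y ^ m) = cos_coeff 0 + cos_coeff 1 * y + cos_coeff 2 * y\<^sup>2 + cos_coeff 3 * y ^ 3"
      by (simp add: eval_nat_numeral)
    then show ?thesis by (simp add: cos_coeff_def)
  qed
  moreover have "cos (t + 1/2 * real 4 * pi) / fact 4 * y ^ 4 \<le> 1 / 24 * y ^ 4"
    by (intro mult_right_mono) (auto simp: fact_numeral)
  moreover have "y ^ 4 \<le> 4 * y\<^sup>2"
  proof -
    have "y\<^sup>2 \<le> 2\<^sup>2" using assms abs_le_square_iff[of y 2] by simp
    then have "y\<^sup>2 * y\<^sup>2 \<le> 4 * y\<^sup>2" by (intro mult_right_mono) auto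
    then show ?thesis by (simp add: power_numeral_reduce power2_eq_square mult.assoc)
  qed
  ultimately have "cos y \<le> 1 - y\<^sup>2 / 2 + 1 / 24 * (4 * y\<^sup>2)" by linarith
  then show ?thesis by simp
qed

text \<open>The cosine defect of the symmetrized offspring law is \<open>1 - \<bar>\<phi>\<bar>\<^sup>2\<close> for its characteristic function
  \<open>\<phi>\<close>, but it need not be monotone.  The truncated moment is, and the two are comparable up to a change
  of scale, so that growth estimates can be carried out on the latter.\<close>

definition trunc_moment :: "real measure \<Rightarrow> real \<Rightarrow> real" where
  "trunc_moment N t = (\<integral>x. min 1 ((t * x)\<^sup>2) \<partial>N)"

definition cos_defect :: "real measure \<Rightarrow> real \<Rightarrow> real" where
  "cos_defect N t = (\<integral>x. (1 - cos (t * x)) \<partial>N)"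

context real_distribution
begin

lemma integrable_trunc [simp]: "integrable M (\<lambda>x. min 1 ((t * x)\<^sup>2))"
  by (rule integrable_const_bound[where B = 1]) auto

lemma integrable_cos_defect [simp]: "integrable M (\<lambda>x. 1 - cos (t * x))"
  by (rule integrable_const_bound[where B = 2]) auto

lemma cos_defect_eq_char: "cos_defect M t = 1 - Re (char M t)"
proof -
  have "integrable M (\<lambda>x. iexp (t * x))" by (rule integrable_const_bound[where B = 1]) auto
  then have "Re (char M t) = (\<integral>x. cos (t * x) \<partial>M)"
    unfolding char_def by (subst integral_Re[symmetric]) (auto simp: Re_exp)
  moreover have "integrable M (\<lambda>x. cos (t * x))" by (rule integrable_const_bound[where B = 1]) auto
  ultimately show ?thesis by (simp add: cos_defect_def prob_space[simplified])
qed

lemma isCont_cos_defect: "isCont (cos_defect M) t"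
  unfolding cos_defect_eq_char[abs_def] by (intro continuous_diff continuous_const isCont_Re isCont_char)

lemma trunc_moment_nonneg: "trunc_moment M t \<ge> 0"
  unfolding trunc_moment_def by (rule Bochner_Integration.integral_nonneg) auto

lemma trunc_moment_mono: "0 \<le> s \<Longrightarrow> s \<le> t \<Longrightarrow> trunc_moment M s \<le> trunc_moment M t"
  unfolding trunc_moment_def
  by (intro integral_mono integrable_trunc min.mono order_refl)
    (auto simp: power_mult_distrib intro!: mult_right_mono power_mono)

lemma trunc_moment_scale_le:
  assumes "c \<ge> 1"
  shows "trunc_moment M (c * t) \<le> c\<^sup>2 * trunc_moment M t"
proof -
  have "trunc_moment M (c * t) \<le> (\<integral>x. c\<^sup>2 * min 1 ((t * x)\<^sup>2) \<partial>M)"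
    unfolding trunc_moment_def
  proof (rule integral_mono)
    fix x
    have "1 \<le> c\<^sup>2" using assms by simp
    then have "min 1 (c\<^sup>2 * (t * x)\<^sup>2) \<le> min (c\<^sup>2 * 1) (c\<^sup>2 * (t * x)\<^sup>2)" by (intro min.mono) auto
    also have "\<dots> = c\<^sup>2 * min 1 ((t * x)\<^sup>2)" by (simp add: min_mult_distrib_left)
    finally show "min 1 ((c * t * x)\<^sup>2) \<le> c\<^sup>2 * min 1 ((t * x)\<^sup>2)" by (simp add: power_mult_distrib mult_ac)
  qed auto
  then show ?thesis by (simp add: trunc_moment_def)
qed

lemma cos_defect_le: "cos_defect M t \<le> 2 * trunc_moment M t"
proof -
  have "cos_defect M t \<le> (\<integral>x. 2 * min 1 ((t * x)\<^sup>2) \<partial>M)"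
    unfolding cos_defect_def
  proof (rule integral_mono)
    fix x
    have "1 - cos (t * x) \<le> 2" using cos_ge_minus_one[of "t * x"] by linarith
    moreover have "1 - cos (t * x) \<le> 2 * (t * x)\<^sup>2"
    proof -
      have "1 - cos (t * x) = 2 * (sin (t * x / 2))\<^sup>2" using cos_double_sin[of "t * x / 2"] by simp
      also have "(sin (t * x / 2))\<^sup>2 \<le> (t * x / 2)\<^sup>2"
        using abs_sin_x_le_abs_x[of "t * x / 2"] by (simp only: abs_le_square_iff)
      finally have "1 - cos (t * x) \<le> (t * x)\<^sup>2 / 2" by (simp add: power_divide)
      then show ?thesis using zero_le_power2[of "t * x"] by linarith
    qed
    ultimately show "1 - cos (t * x) \<le> 2 * min 1 ((t * x)\<^sup>2)" by (simp add: min_def)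
  qed auto
  then show ?thesis by (simp add: trunc_moment_def)
qed

text \<open>The difference of the truncated squares is at most 0 unless |u x| \<le> 1, where the
  cosine is controlled by its quadratic bound. So growth of the truncated moment between
  \<open>u\<close> and \<open>c * u\<close> gives a lower bound for the defect at \<open>u\<close>
  itself.\<close>

lemma cos_defect_ge:
  assumes "c \<ge> 1"
  shows "cos_defect M u \<ge> (trunc_moment M (c * u) - trunc_moment M u) / (3 * c\<^sup>2)"
proof -
  have "(\<integral>x. (min 1 ((c * u * x)\<^sup>2) - min 1 ((u * x)\<^sup>2)) / (3 * c\<^sup>2) \<partial>M) \<le> cos_defect M u"
    unfolding cos_defect_def
  proof (rule integral_mono)
    fix x
    show "(min 1 ((c * u * x)\<^sup>2) - min 1 ((u * x)\<^sup>2)) / (3 * c\<^sup>2) \<le> 1 - cos (u * x)"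
    proof (cases "\<bar>u * x\<bar> \<le> 1")
      case True
      have "min 1 ((c * u * x)\<^sup>2) - min 1 ((u * x)\<^sup>2) \<le> (c * u * x)\<^sup>2"
        using zero_le_power2[of "u * x"] zero_le_power2[of "c * u * x"] by linarith
      then have "(min 1 ((c * u * x)\<^sup>2) - min 1 ((u * x)\<^sup>2)) / (3 * c\<^sup>2) \<le> (c * u * x)\<^sup>2 / (3 * c\<^sup>2)"
        by (intro divide_right_mono) auto
      also have "\<dots> = (u * x)\<^sup>2 / 3" using assms by (simp add: power_mult_distrib)
      also have "\<dots> \<le> 1 - cos (u * x)" using True by (intro one_minus_cos_ge) auto
      finally show ?thesis .
    next
      case False
      then have "(u * x)\<^sup>2 \<ge> 1" using abs_le_square_iff[of 1 "u * x"] by simp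
      then have "min 1 ((c * u * x)\<^sup>2) - min 1 ((u * x)\<^sup>2) \<le> 0" by simp
      then have "(min 1 ((c * u * x)\<^sup>2) - min 1 ((u * x)\<^sup>2)) / (3 * c\<^sup>2) \<le> 0" by (intro divide_nonpos_nonneg) auto
      then show ?thesis using cos_le_one[of "u * x"] by linarith
    qed
  qed auto
  then show ?thesis by (simp add: trunc_moment_def)
qed

text \<open>Averaging over \<open>r\<close> smooths out the zeros of the integrand: the integral of
  1 - cos (r y) over [0, 2] is at least 8/9 min 1 (y^2). Integrating the bound \<open>c\<close> over
  an interval of length 2 gives the factor 2 * 9/8 = 9/4.\<close>

lemma trunc_moment_le_of_cos_defect_le:
  assumes c: "\<And>r. r \<in> {0..2} \<Longrightarrow> cos_defect M (r * t) \<le> c"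
  shows "trunc_moment M t \<le> 9 / 4 * c"
proof -
  define L where "L = restrict_space lborel {0..2::real}"
  have space: "space L = {0..2}" by (simp add: L_def space_restrict_space)
  have mL: "measure L {0..2} = 2" by (simp add: L_def measure_restrict_space)
  interpret L: finite_measure L
    by (rule finite_measureI) (simp add: L_def space_restrict_space emeasure_restrict_space)
  interpret P: pair_sigma_finite L M ..
  have m [measurable]: "(\<lambda>x. x) \<in> borel_measurable L" by (simp add: L_def measurable_restrict_space1)
  have intL: "(\<integral>r. f r \<partial>L) = (LBINT r. indicator {0..2} r *\<^sub>R f r)" for f :: "real \<Rightarrow> real"
    unfolding L_def by (rule integral_restrict_space) auto
  have bd: "integrable L (\<lambda>r. 1 - cos (r * y))" for y
    by (rule L.integrable_const_bound[where B = 2]) auto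
  have low: "8 / 9 * min 1 (y\<^sup>2) \<le> (\<integral>r. (1 - cos (r * y)) \<partial>L)" for y :: real
  proof (cases "\<bar>y\<bar> \<le> 1")
    case True
    have "8 / 9 * min 1 (y\<^sup>2) \<le> 8 / 9 * y\<^sup>2" by simp
    also have "\<dots> = (\<integral>r. (r * y)\<^sup>2 / 3 \<partial>L)"
    proof -
      have "(LBINT r. indicator {0..2} r *\<^sub>R ((r * y)\<^sup>2 / 3)) = (LBINT r. (r\<^sup>2 * indicator {0..2} r) * (y\<^sup>2 / 3))"
        by (simp add: power_mult_distrib mult_ac)
      also have "\<dots> = 8 / 9 * y\<^sup>2"
        using integral_power[of 0 2 2] by (simp only: integral_mult_left_zero) simp
      finally show ?thesis unfolding intL by simp
    qed
    also have "\<dots> \<le> (\<integral>r. (1 - cos (r * y)) \<partial>L)"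
    proof (rule integral_mono[OF _ bd])
      show "integrable L (\<lambda>r. (r * y)\<^sup>2 / 3)"
      proof (rule L.integrable_const_bound[where B = "(2 * \<bar>y\<bar>)\<^sup>2 / 3"])
        show "AE r in L. norm ((r * y)\<^sup>2 / 3) \<le> (2 * \<bar>y\<bar>)\<^sup>2 / 3"
        proof (rule AE_I2)
          fix r assume "r \<in> space L"
          then have "\<bar>r * y\<bar> \<le> 2 * \<bar>y\<bar>" unfolding abs_mult using space by (intro mult_right_mono) auto
          then have "(r * y)\<^sup>2 \<le> (2 * \<bar>y\<bar>)\<^sup>2" using abs_le_square_iff[of "r * y" "2 * \<bar>y\<bar>"] by simp
          then show "norm ((r * y)\<^sup>2 / 3) \<le> (2 * \<bar>y\<bar>)\<^sup>2 / 3" by simp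
        qed
      qed simp
      fix r assume "r \<in> space L"
      then have "\<bar>r * y\<bar> \<le> 2 * 1" unfolding abs_mult using True space by (intro mult_mono) auto
      then show "(r * y)\<^sup>2 / 3 \<le> 1 - cos (r * y)" by (intro one_minus_cos_ge) simp
    qed
    finally show ?thesis .
  next
    case False
    then have "y \<noteq> 0" by auto
    have "(\<integral>r. (1 - cos (r * y)) \<partial>L) = (2 - sin (2 * y) / y) - (0 - sin (0 * y) / y)"
      unfolding intL
    proof (rule integral_FTC_atLeastAtMost)
      fix r :: real
      show "((\<lambda>r. r - sin (r * y) / y) has_vector_derivative 1 - cos (r * y)) (at r within {0..2})"
        unfolding has_real_derivative_iff_has_vector_derivative[symmetric]
        using \<open>y \<noteq> 0\<close> by (auto intro!: derivative_eq_intros)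
    qed (auto intro!: continuous_intros)
    moreover have "sin (2 * y) / y \<le> 1"
    proof -
      have "\<bar>sin (2 * y) / y\<bar> \<le> 1 / 1" unfolding abs_divide using False by (intro frac_le) auto
      then show ?thesis by linarith
    qed
    ultimately show ?thesis by simp
  qed
  have "8 / 9 * trunc_moment M t = (\<integral>x. 8 / 9 * min 1 ((t * x)\<^sup>2) \<partial>M)" by (simp add: trunc_moment_def)
  also have "\<dots> \<le> (\<integral>x. (\<integral>r. (1 - cos (r * (t * x))) \<partial>L) \<partial>M)"
  proof (rule integral_mono[OF _ _ low])
    show "integrable M (\<lambda>x. \<integral>r. 1 - cos (r * (t * x)) \<partial>L)"
    proof (rule integrable_const_bound[where B = "4"])
      show "AE x in M. norm (\<integral>r. 1 - cos (r * (t * x)) \<partial>L) \<le> 4"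
      proof (rule AE_I2)
        fix x
        have "norm (\<integral>r. 1 - cos (r * (t * x)) \<partial>L) \<le> (\<integral>r. norm (1 - cos (r * (t * x))) \<partial>L)" by (rule integral_norm_bound)
        also have "\<dots> \<le> (\<integral>r. 2 \<partial>L)"
          by (rule integral_mono[OF integrable_norm[OF bd]]) auto
        finally show "norm (\<integral>r. 1 - cos (r * (t * x)) \<partial>L) \<le> 4" by (simp add: space mL)
      qed
    qed measurable
  qed simp
  also have "\<dots> = (\<integral>r. (\<integral>x. (1 - cos (r * (t * x))) \<partial>M) \<partial>L)"
  proof (rule P.Fubini_integral)
    interpret PF: finite_measure "L \<Otimes>\<^sub>M M" by (rule finite_measure_pair_measure) unfold_locales
    show "integrable (L \<Otimes>\<^sub>M M) (\<lambda>(r, x). 1 - cos (r * (t * x)))"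
    proof (rule PF.integrable_const_bound[where B = 2])
      show "AE p in L \<Otimes>\<^sub>M M. norm (case p of (r, x) \<Rightarrow> 1 - cos (r * (t * x))) \<le> 2"
        by (rule AE_I2) (auto split: prod.splits)
    qed measurable
  qed
  also have "\<dots> = (\<integral>r. cos_defect M (r * t) \<partial>L)" by (simp add: cos_defect_def mult.assoc)
  also have "\<dots> \<le> (\<integral>r. c \<partial>L)"
  proof (cases "integrable L (\<lambda>r. cos_defect M (r * t))")
    case True
    then show ?thesis by (rule integral_mono) (auto simp: space c)
  next
    case False
    \<comment> \<open>A non-integrable function has integral 0 by convention, so it suffices that
      \<open>c\<close> is nonnegative.\<close>
    have "0 \<le> cos_defect M (0 * t)" by (simp add: cos_defect_def)
    then have "c \<ge> 0" using c[of 0] by simp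
    then show ?thesis using False by (simp add: not_integrable_integral_eq)
  qed
  also have "\<dots> = 2 * c" by (simp add: space mL)
  finally show ?thesis by simp
qed

end

text \<open>On the probability space of the Skorohod representation the variables converge
  pointwise. The difference of the exponentials is at most min 2 (T |Yn - Y|) for all |s| \<le> T at
  once, whence uniformity.\<close>

lemma weak_conv_char_uniform:
  fixes M :: "nat \<Rightarrow> real measure"
  assumes M: "\<And>n. real_distribution (M n)" and Z: "real_distribution Z" and conv: "weak_conv_m M Z"
    and "e > 0" "T \<ge> 0"
  shows "\<forall>\<^sub>F n in sequentially. \<forall>s. \<bar>s\<bar> \<le> T \<longrightarrow> norm (char (M n) s - char Z s) < e"
proof -
  obtain \<Omega> :: "real measure" and Yn Y where \<Omega>: "prob_space \<Omega>" and
    Yn [measurable]: "\<And>n. Yn n \<in> borel_measurable \<Omega>" and dn: "\<And>n. distr \<Omega> borel (Yn n) = M n" and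
    Y: "Y \<in> measurable \<Omega> lborel" and d: "distr \<Omega> borel Y = Z" and
    lim: "\<And>x. x \<in> space \<Omega> \<Longrightarrow> (\<lambda>n. Yn n x) \<longlonglongrightarrow> Y x"
    using Skorohod[OF M Z conv] by blast
  interpret prob_space \<Omega> by (rule \<Omega>)
  have [measurable]: "Y \<in> borel_measurable \<Omega>" using Y by simp
  define D where "D n x = min 2 (T * \<bar>Yn n x - Y x\<bar>)" for n x
  have Dm [measurable]: "D n \<in> borel_measurable \<Omega>" for n unfolding D_def by measurable
  have "(\<lambda>n. \<integral>x. D n x \<partial>\<Omega>) \<longlonglongrightarrow> (\<integral>x. 0 \<partial>\<Omega>)"
  proof (rule integral_dominated_convergence[where w = "\<lambda>_. 2"])
    show "AE x in \<Omega>. (\<lambda>n. D n x) \<longlonglongrightarrow> 0"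
    proof (rule AE_I2)
      fix x assume "x \<in> space \<Omega>"
      then have "(\<lambda>n. min 2 (T * \<bar>Yn n x - Y x\<bar>)) \<longlonglongrightarrow> min 2 (T * \<bar>Y x - Y x\<bar>)"
        by (intro tendsto_intros lim)
      then show "(\<lambda>n. D n x) \<longlonglongrightarrow> 0" by (simp add: D_def)
    qed
    show "AE x in \<Omega>. norm (D n x) \<le> 2" for n
      using \<open>T \<ge> 0\<close> by (intro AE_I2) (auto simp: D_def)
  qed auto
  then have "\<forall>\<^sub>F n in sequentially. (\<integral>x. D n x \<partial>\<Omega>) < e"
    using order_tendstoD(2)[of _ 0 _ e] \<open>e > 0\<close> by simp
  then show ?thesis
  proof (eventually_elim, intro allI impI)
    fix n s assume n: "(\<integral>x. D n x \<partial>\<Omega>) < e" and s: "\<bar>s\<bar> \<le> T"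
    have ie: "integrable \<Omega> (\<lambda>x. iexp (s * f x))" if [measurable]: "f \<in> borel_measurable \<Omega>" for f
      by (rule integrable_const_bound[where B = 1]) auto
    have "char (M n) s - char Z s = (\<integral>x. iexp (s * Yn n x) - iexp (s * Y x) \<partial>\<Omega>)"
      unfolding char_def dn[symmetric] d[symmetric]
      by (subst (1 2) integral_distr) (simp_all add: Bochner_Integration.integral_diff[OF ie ie] del: of_real_mult)
    also have "norm \<dots> \<le> (\<integral>x. norm (iexp (s * Yn n x) - iexp (s * Y x)) \<partial>\<Omega>)" by (rule integral_norm_bound)
    also have "\<dots> \<le> (\<integral>x. D n x \<partial>\<Omega>)"
    proof (rule integral_mono)
      show "integrable \<Omega> (\<lambda>x. norm (iexp (s * Yn n x) - iexp (s * Y x)))" by (intro integrable_norm Bochner_Integration.integrable_diff ie) auto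
      show "integrable \<Omega> (D n)" by (rule integrable_const_bound[where B = 2]) (use \<open>T \<ge> 0\<close> in \<open>auto simp: D_def\<close>)
      fix x
      have 1: "norm (iexp (s * Yn n x) - iexp (s * Y x)) \<le> 2"
        using norm_triangle_ineq4[of "iexp (s * Yn n x)" "iexp (s * Y x)"] by simp
      have "iexp (s * Yn n x) - iexp (s * Y x) = iexp (s * Y x) * (iexp (s * (Yn n x - Y x)) - 1)"
        by (simp add: algebra_simps exp_add[symmetric])
      then have "norm (iexp (s * Yn n x) - iexp (s * Y x)) = norm (iexp (s * (Yn n x - Y x)) - 1)"
        by (simp add: norm_mult)
      also have "\<dots> \<le> \<bar>s * (Yn n x - Y x)\<bar>" using iexp_approx1[of "s * (Yn n x - Y x)" 0] by simp
      also have "\<dots> \<le> T * \<bar>Yn n x - Y x\<bar>" unfolding abs_mult using s by (intro mult_right_mono) auto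
      finally show "norm (iexp (s * Yn n x) - iexp (s * Y x)) \<le> D n x" using 1 by (simp add: D_def)
    qed
    finally show "norm (char (M n) s - char Z s) < e" using n by linarith
  qed
qed

section \<open>Characteristic functions of the offspring law and of the walk\<close>

definition offspring_char :: "nat pmf \<Rightarrow> real \<Rightarrow> complex" where
  "offspring_char \<mu> t = (\<integral>k. iexp (t * real k) \<partial>measure_pmf \<mu>)"

text \<open>Taking the difference of two independent copies removes the centring of the walk and
  makes the characteristic function real.\<close>

definition symmetrized :: "nat pmf \<Rightarrow> real measure" where
  "symmetrized \<mu> = distr (measure_pmf \<mu> \<Otimes>\<^sub>M measure_pmf \<mu>) borel (\<lambda>(j, k). real j - real k)"

lemma real_distribution_symmetrized: "real_distribution (symmetrized \<mu>)"
proof -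
  interpret pair_prob_space "measure_pmf \<mu>" "measure_pmf \<mu>" ..
  show ?thesis unfolding symmetrized_def by (rule real_distribution_distr) measurable
qed

lemma cos_defect_symmetrized: "cos_defect (symmetrized \<mu>) t = 1 - (norm (offspring_char \<mu> t))\<^sup>2"
proof -
  interpret P: pair_prob_space "measure_pmf \<mu>" "measure_pmf \<mu>" ..
  interpret real_distribution "symmetrized \<mu>" by (rule real_distribution_symmetrized)
  have int: "integrable (measure_pmf \<mu>) (\<lambda>k. iexp (t * real k))" for t
    by (rule measure_pmf.integrable_const_bound[where B = 1]) auto
  have cnj: "offspring_char \<mu> (- t) = cnj (offspring_char \<mu> t)"
  proof -
    have "cnj (offspring_char \<mu> t) = (\<integral>k. cnj (iexp (t * real k)) \<partial>measure_pmf \<mu>)"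
      unfolding offspring_char_def by (rule Bochner_Integration.integral_cnj[symmetric])
    then show ?thesis by (simp add: offspring_char_def exp_cnj)
  qed
  have "char (symmetrized \<mu>) t = (\<integral>p. iexp (t * (real (fst p) - real (snd p))) \<partial>(measure_pmf \<mu> \<Otimes>\<^sub>M measure_pmf \<mu>))"
    unfolding char_def symmetrized_def by (subst integral_distr) (auto simp: split_beta)
  also have "\<dots> = (\<integral>j. (\<integral>k. iexp (t * real j) * iexp (- t * real k) \<partial>measure_pmf \<mu>) \<partial>measure_pmf \<mu>)"
  proof (subst P.integral_fst'[symmetric])
    show "integrable (measure_pmf \<mu> \<Otimes>\<^sub>M measure_pmf \<mu>) (\<lambda>p. iexp (t * (real (fst p) - real (snd p))))"
      by (rule P.integrable_const_bound[where B = 1]) auto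
  qed (simp add: right_diff_distrib exp_diff exp_minus field_simps)
  also have "\<dots> = offspring_char \<mu> t * offspring_char \<mu> (- t)"
    by (simp add: offspring_char_def)
  also have "\<dots> = of_real ((norm (offspring_char \<mu> t))\<^sup>2)"
    by (simp only: cnj complex_norm_square)
  finally have char: "char (symmetrized \<mu>) t = of_real ((norm (offspring_char \<mu> t))\<^sup>2)" .
  show ?thesis by (simp add: cos_defect_eq_char char)
qed

definition scaled_walk :: "nat pmf \<Rightarrow> (nat \<Rightarrow> real) \<Rightarrow> nat \<Rightarrow> real measure" where
  "scaled_walk \<mu> B n = distr (\<Pi>\<^sub>M i\<in>UNIV. measure_pmf \<mu>) borel (\<lambda>Y. ((\<Sum>i=1..n. real (Y i)) - real n) / B n)"

lemma real_distribution_scaled_walk: "real_distribution (scaled_walk \<mu> B n)"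
proof -
  have "prob_space (\<Pi>\<^sub>M i\<in>(UNIV :: nat set). measure_pmf \<mu>)" by (rule prob_space_PiM) (rule prob_space_measure_pmf)
  then show ?thesis unfolding scaled_walk_def by (rule prob_space.real_distribution_distr) measurable
qed

lemma char_scaled_walk:
  "char (scaled_walk \<mu> B n) s = offspring_char \<mu> (s / B n) ^ n * iexp (- s * real n / B n)"
proof -
  have P: "product_prob_space (\<lambda>_::nat. measure_pmf \<mu>)" by (rule product_prob_spaceI) (rule prob_space_measure_pmf)
  have Q: "product_sigma_finite (\<lambda>_::nat. measure_pmf \<mu>)"
    using prob_space_measure_pmf by (auto simp: product_sigma_finite_def intro: prob_space_imp_sigma_finite)
  let ?Pi = "\<Pi>\<^sub>M i\<in>(UNIV :: nat set). measure_pmf \<mu>"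
  let ?PJ = "\<Pi>\<^sub>M i\<in>{1..n}. measure_pmf \<mu>"
  let ?f = "\<lambda>Y. \<Prod>i=1..n. iexp (s / B n * real (Y i))"
  have fm: "?f \<in> borel_measurable ?PJ" by measurable
  have "char (scaled_walk \<mu> B n) s = (\<integral>Y. iexp (s * (((\<Sum>i=1..n. real (Y i)) - real n) / B n)) \<partial>?Pi)"
    unfolding char_def scaled_walk_def by (rule integral_distr) measurable
  also have "\<dots> = (\<integral>Y. ?f Y * iexp (- s * real n / B n) \<partial>?Pi)"
  proof (rule Bochner_Integration.integral_cong[OF refl])
    fix Y :: "nat \<Rightarrow> nat"
    have "iexp (s * (((\<Sum>i=1..n. real (Y i)) - real n) / B n)) = exp ((\<Sum>i=1..n. \<i> * of_real (s / B n * real (Y i))) + \<i> * of_real (- s * real n / B n))"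
      by (rule arg_cong[where f = exp]) (simp add: diff_divide_distrib right_diff_distrib sum_distrib_left sum_divide_distrib)
    also have "\<dots> = ?f Y * iexp (- s * real n / B n)" by (simp only: exp_add exp_sum finite_atLeastAtMost)
    finally show "iexp (s * (((\<Sum>i=1..n. real (Y i)) - real n) / B n)) = ?f Y * iexp (- s * real n / B n)" .
  qed
  also have "\<dots> = (\<integral>Y. ?f Y \<partial>?Pi) * iexp (- s * real n / B n)" by simp
  also have "(\<integral>Y. ?f Y \<partial>?Pi) = (\<integral>Y. ?f (restrict Y {1..n}) \<partial>?Pi)"
    by (intro Bochner_Integration.integral_cong refl prod.cong) auto
  also have "\<dots> = (\<integral>Y. ?f Y \<partial>distr ?Pi ?PJ (\<lambda>Y. restrict Y {1..n}))"
    by (rule integral_distr[symmetric, OF _ fm]) (rule measurable_restrict_subset, simp)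
  also have "distr ?Pi ?PJ (\<lambda>Y. restrict Y {1..n}) = ?PJ"
    by (rule product_prob_space.distr_PiM_restrict_finite[OF P]) auto
  also have "(\<integral>Y. ?f Y \<partial>?PJ) = (\<Prod>i=1..n. offspring_char \<mu> (s / B n))"
    unfolding offspring_char_def
    by (rule product_sigma_finite.product_integral_prod[OF Q]) (auto intro!: measure_pmf.integrable_const_bound[where B = 1])
  finally show ?thesis by simp
qed

section \<open>Local limit estimates\<close>

text \<open>The doubling inequality is iterated along t, l t, l^2 t and so on. Monotonicity covers
  the last incomplete step, at the price of the factor \<open>l\<close> in the denominator.\<close>

lemma powr_le_of_doubling:
  fixes K :: "real \<Rightarrow> real"
  assumes l: "l > 1" and b: "b > 0"
    and pos: "\<And>t. 0 \<le> K t" and mono: "\<And>s t. 0 \<le> s \<Longrightarrow> s \<le> t \<Longrightarrow> K s \<le> K t"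
    and double: "\<And>t. 0 < t \<Longrightarrow> t \<le> t0 \<Longrightarrow> l powr b * K t \<le> K (l * t)"
    and t: "0 < t" "t \<le> t'" "t' \<le> t0"
  shows "(t' / (l * t)) powr b * K t \<le> K t'"
proof -
  have "(t' / (l * t)) powr b * K t \<le> K t'" if "0 < t" "t \<le> t'" "t' \<le> t0" "t' < l ^ j * t" for j t
    using that
  proof (induction j arbitrary: t)
    case 0
    then show ?case by simp
  next
    case (Suc j)
    show ?case
    proof (cases "t' \<le> l * t")
      case True
      then have "(t' / (l * t)) powr b \<le> 1 powr b" using Suc.prems l b by (intro powr_mono2) auto
      then have "(t' / (l * t)) powr b * K t \<le> 1 * K t" using pos by (intro mult_right_mono) auto
      also have "\<dots> \<le> K t'" using Suc.prems by (simp add: mono)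
      finally show ?thesis .
    next
      case False
      have "(t' / (l * t)) powr b * K t = (t' / (l * (l * t))) powr b * (l powr b * K t)"
        using Suc.prems l by (simp add: powr_divide powr_mult)
      also have "\<dots> \<le> (t' / (l * (l * t))) powr b * K (l * t)"
        using Suc.prems by (intro mult_left_mono double) auto
      also have "\<dots> \<le> K t'" using False Suc.prems l by (intro Suc.IH) (auto simp: mult_ac)
      finally show ?thesis .
    qed
  qed
  moreover obtain j where "t' / t < l ^ j" using real_arch_pow[OF l] by blast
  then have "t' < l ^ j * t" using t by (simp add: field_simps)
  ultimately show ?thesis using t by blast
qed

section \<open>Behaviour of the defect near 0 and regularity of the norming sequence\<close>

lemma cos_defect_abs: "cos_defect M \<bar>t\<bar> = cos_defect M t"
  by (auto simp: cos_defect_def abs_if)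

lemma cos_defect_symmetrized_bounds: "0 \<le> cos_defect (symmetrized \<mu>) t" "cos_defect (symmetrized \<mu>) t \<le> 1"
proof -
  show "0 \<le> cos_defect (symmetrized \<mu>) t" unfolding cos_defect_def by (rule Bochner_Integration.integral_nonneg) simp
  show "cos_defect (symmetrized \<mu>) t \<le> 1" by (simp add: cos_defect_symmetrized)
qed

lemma norm_offspring_char_power:
  "norm (offspring_char \<mu> t) ^ n \<le> exp (- (real n * cos_defect (symmetrized \<mu>) t / 2))"
proof -
  let ?G = "cos_defect (symmetrized \<mu>) t"
  have "(norm (offspring_char \<mu> t))\<^sup>2 = 1 - ?G" by (simp add: cos_defect_symmetrized)
  also have "\<dots> \<le> exp (- ?G)" using exp_ge_add_one_self[of "- ?G"] by simp
  also have "\<dots> = (exp (- (?G / 2)))\<^sup>2" by (simp flip: exp_double)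
  finally have "norm (offspring_char \<mu> t) \<le> exp (- (?G / 2))" by (rule power2_le_imp_le) simp
  then have "norm (offspring_char \<mu> t) ^ n \<le> exp (- (?G / 2)) ^ n" by (intro power_mono) auto
  then show ?thesis by (simp flip: exp_of_nat_mult)
qed

locale stable_attraction =
  fixes \<mu> :: "nat pmf" and \<alpha> :: real and B :: "nat \<Rightarrow> real" and Z :: "real measure"
  assumes \<alpha>: "1 < \<alpha>" "\<alpha> \<le> 2"
    and B_pos: "\<And>n. n \<ge> 1 \<Longrightarrow> B n > 0" and B_lim: "filterlim B at_top sequentially"
    and Z: "stable_law \<alpha> Z" and conv: "weak_conv_m (scaled_walk \<mu> B) Z"
begin

abbreviation G :: "real \<Rightarrow> real" where "G \<equiv> cos_defect (symmetrized \<mu>)"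
abbreviation K :: "real \<Rightarrow> real" where "K \<equiv> trunc_moment (symmetrized \<mu>)"
text \<open>Any exponent \<open>\<beta>\<close> strictly between 1 and \<open>\<alpha>\<close> would do: \<open>\<beta> < \<alpha>\<close> absorbs the slowly varying part of
  \<open>B\<close>, and \<open>\<beta> > 1\<close> makes \<open>\<Sum>i. i powr (- 1 / \<beta>)\<close> grow like a positive power.\<close>

definition \<kappa> :: real where "\<kappa> = Re (stable_exponent \<alpha>)"
definition \<beta> :: real where "\<beta> = (1 + \<alpha>) / 2"

lemma \<kappa>_pos: "\<kappa> > 0" using Re_stable_exponent_pos[OF \<alpha>] by (simp add: \<kappa>_def)

lemma \<beta>: "1 < \<beta>" "\<beta> < \<alpha>" using \<alpha> by (auto simp: \<beta>_def)

interpretation N: real_distribution "symmetrized \<mu>" by (rule real_distribution_symmetrized)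

lemma norm_char_scaled_walk: "(norm (char (scaled_walk \<mu> B n) s))\<^sup>2 = (1 - G (s / B n)) ^ n"
proof -
  have "norm (char (scaled_walk \<mu> B n) s) = norm (offspring_char \<mu> (s / B n)) ^ n"
    unfolding char_scaled_walk norm_mult norm_exp_i_times by (simp add: norm_power)
  then show ?thesis by (simp add: cos_defect_symmetrized power_mult[symmetric] mult.commute)
qed

text \<open>Squared moduli discard the centring phase. Squaring is 2-Lipschitz on [0, 1], hence the
  tolerance \<open>e / 2\<close> for the characteristic functions.\<close>

lemma cos_defect_power_uniform:
  assumes "e > 0" "T \<ge> 0"
  shows "\<forall>\<^sub>F n in sequentially. \<forall>s. \<bar>s\<bar> \<le> T \<longrightarrow> \<bar>(1 - G (s / B n)) ^ n - exp (- 2 * \<kappa> * \<bar>s\<bar> powr \<alpha>)\<bar> < e"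
proof -
  have rd: "real_distribution (scaled_walk \<mu> B n)" for n by (rule real_distribution_scaled_walk)
  have rZ: "real_distribution Z" using Z by (simp add: stable_law_def)
  have "\<forall>\<^sub>F n in sequentially. \<forall>s. \<bar>s\<bar> \<le> T \<longrightarrow> norm (char (scaled_walk \<mu> B n) s - char Z s) < e / 2"
    using assms by (intro weak_conv_char_uniform rd rZ conv) auto
  then show ?thesis
  proof (eventually_elim, intro allI impI)
    fix n s assume *: "\<forall>s. \<bar>s\<bar> \<le> T \<longrightarrow> norm (char (scaled_walk \<mu> B n) s - char Z s) < e / 2" and s: "\<bar>s\<bar> \<le> T"
    define a b where "a = norm (char (scaled_walk \<mu> B n) s)" and "b = norm (char Z s)"
    have "\<bar>a - b\<bar> < e / 2" using * s norm_triangle_ineq3[of "char (scaled_walk \<mu> B n) s" "char Z s"]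
      by (force simp: a_def b_def)
    moreover have ab: "0 \<le> a" "a \<le> 1" "0 \<le> b" "b \<le> 1"
      using real_distribution.cmod_char_le_1[OF rd] real_distribution.cmod_char_le_1[OF rZ] by (auto simp: a_def b_def)
    moreover from ab have "\<bar>a - b\<bar> * \<bar>a + b\<bar> \<le> \<bar>a - b\<bar> * 2" by (intro mult_left_mono) auto
    ultimately have "\<bar>a - b\<bar> * \<bar>a + b\<bar> < e" by simp
    then have "\<bar>a\<^sup>2 - b\<^sup>2\<bar> < e" by (simp add: abs_mult[symmetric] power2_eq_square algebra_simps)
    moreover have "a\<^sup>2 = (1 - G (s / B n)) ^ n" by (simp only: a_def norm_char_scaled_walk)
    moreover have "b\<^sup>2 = exp (- 2 * \<kappa> * \<bar>s\<bar> powr \<alpha>)"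
      unfolding b_def norm_char_stable_law(1)[OF Z \<alpha>] \<kappa>_def by (simp flip: exp_double)
    ultimately show "\<bar>(1 - G (s / B n)) ^ n - exp (- 2 * \<kappa> * \<bar>s\<bar> powr \<alpha>)\<bar> < e" by simp
  qed
qed

lemma trunc_moment_upper:
  obtains C :: real where "C > 0" "\<forall>\<^sub>F n in sequentially. real n * K (1 / B n) \<le> C"
proof -
  \<comment> \<open>The limit is at least \<open>2 * e\<close> for |s| \<le> 2, which is the range
    over which the averaging bound samples the defect.\<close>
  define e where "e = exp (- 2 * \<kappa> * 2 powr \<alpha>) / 2"
  have "e > 0" by (simp add: e_def)
  have "\<forall>\<^sub>F n in sequentially. \<forall>s. \<bar>s\<bar> \<le> 2 \<longrightarrow> \<bar>(1 - G (s / B n)) ^ n - exp (- 2 * \<kappa> * \<bar>s\<bar> powr \<alpha>)\<bar> < e"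
    using \<open>e > 0\<close> by (intro cos_defect_power_uniform) auto
  then have "\<forall>\<^sub>F n in sequentially. real n * K (1 / B n) \<le> 9 / 4 * (- ln e)"
    using eventually_gt_at_top[of 0]
  proof eventually_elim
    case (elim n)
    have "G (r * (1 / B n)) \<le> - ln e / n" if r: "r \<in> {0..2}" for r
    proof -
      have "r powr \<alpha> \<le> 2 powr \<alpha>" using r \<alpha> by (intro powr_mono2) auto
      then have "exp (- 2 * \<kappa> * 2 powr \<alpha>) \<le> exp (- 2 * \<kappa> * r powr \<alpha>)" using \<kappa>_pos by simp
      moreover have "\<bar>(1 - G (r / B n)) ^ n - exp (- 2 * \<kappa> * r powr \<alpha>)\<bar> < e" using elim(1)[rule_format, of r] r by simp
      ultimately have "e \<le> (1 - G (r / B n)) ^ n" unfolding e_def by linarith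
      also have "\<dots> \<le> exp (- G (r / B n)) ^ n"
        using exp_ge_add_one_self[of "- G (r / B n)"] cos_defect_symmetrized_bounds[of \<mu> "r / B n"] by (intro power_mono) auto
      also have "\<dots> = exp (- (n * G (r / B n)))" by (simp flip: exp_of_nat_mult)
      finally have "ln e \<le> - (n * G (r / B n))" using \<open>e > 0\<close> using ln_le_cancel_iff[of e "exp (- (n * G (r / B n)))"] by simp
      then show ?thesis using elim(2) by (simp add: field_simps)
    qed
    then have "K (1 / B n) \<le> 9 / 4 * (- ln e / n)" by (rule N.trunc_moment_le_of_cos_defect_le)
    then show ?case using elim(2) by (simp add: field_simps)
  qed
  then have "\<forall>\<^sub>F n in sequentially. real n * K (1 / B n) \<le> max 1 (9 / 4 * (- ln e))"
    by eventually_elim auto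
  then show ?thesis using that[of "max 1 (9 / 4 * (- ln e))"] by simp
qed

lemma trunc_moment_lower:
  assumes "s > 0"
  shows "\<forall>\<^sub>F n in sequentially. \<kappa> / 4 * s powr \<alpha> \<le> real n * K (s / B n)"
proof -
  \<comment> \<open>The limit is \<open>exp (- 2 * x)\<close>, so eventually the power lies below
    \<open>exp (- x)\<close>. Comparing 1 - G with exp (-2 G) loses a factor 2, and bounding the
    defect by the truncated moment loses another.\<close>
  define x where "x = \<kappa> * s powr \<alpha>"
  have x: "x > 0" using \<kappa>_pos assms by (simp add: x_def)
  have "\<forall>\<^sub>F n in sequentially. \<forall>r. \<bar>r\<bar> \<le> s \<longrightarrow> \<bar>(1 - G (r / B n)) ^ n - exp (- 2 * \<kappa> * \<bar>r\<bar> powr \<alpha>)\<bar> < exp (- x) - exp (- 2 * x)"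
    using x assms by (intro cos_defect_power_uniform) auto
  moreover have "\<forall>\<^sub>F n in sequentially. real n \<ge> x" by real_asymp
  ultimately show ?thesis
  proof eventually_elim
    case (elim n)
    have "(1 - G (s / B n)) ^ n < exp (- x)"
      using elim(1)[rule_format, of s] assms by (simp add: x_def mult.assoc)
    have "x / 2 \<le> n * G (s / B n)"
    proof (cases "G (s / B n) \<le> 1 / 2")
      case True
      let ?g = "G (s / B n)"
      have g: "0 \<le> ?g" by (rule cos_defect_symmetrized_bounds)
      have "?g * ?g \<le> 1 / 2 * ?g" using True g by (intro mult_right_mono) auto
      then have "- 2 * ?g \<le> ln (1 - ?g)"
        using ln_one_minus_pos_lower_bound[OF g True] by (simp add: power2_eq_square)
      then have "exp (- 2 * ?g) \<le> 1 - ?g" using True by (subst (asm) ln_ge_iff) auto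
      then have "exp (- 2 * ?g) ^ n \<le> (1 - ?g) ^ n" by (intro power_mono) auto
      then have "exp (n * (- 2 * ?g)) < exp (- x)"
        using \<open>(1 - ?g) ^ n < exp (- x)\<close> by (simp only: exp_of_nat_mult)
      then show ?thesis by simp
    next
      case False
      then have "n * (1 / 2) \<le> n * G (s / B n)" by (intro mult_left_mono) auto
      then show ?thesis using elim(2) by simp
    qed
    also have "\<dots> \<le> n * (2 * K (s / B n))" by (intro mult_left_mono N.cos_defect_le) auto
    finally show ?case by (simp add: x_def)
  qed
qed

text \<open>No monotonicity or regular variation of \<open>B\<close> is assumed. A large jump of
  \<open>B\<close> would keep the truncated moment at \<open>M / B (Suc n)\<close> below the one at
  \<open>1 / B n\<close>, against the lower bound at the scale \<open>M\<close>.\<close>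

lemma scaling_ratio_bounded:
  obtains M where "M \<ge> 1" "\<forall>\<^sub>F n in sequentially. B (Suc n) \<le> M * B n"
proof -
  obtain C where C: "C > 0" "\<forall>\<^sub>F n in sequentially. real n * K (1 / B n) \<le> C" by (rule trunc_moment_upper)
  \<comment> \<open>With this \<open>M\<close> the lower bound is at least \<open>3 * C\<close>,
    while a large jump would give at most \<open>2 * C\<close>.\<close>
  define M where "M = max 1 (12 * C / \<kappa>)"
  have M: "M \<ge> 1" "M \<ge> 12 * C / \<kappa>" by (auto simp: M_def)
  have "3 * C \<le> \<kappa> / 4 * M powr 1" using M \<kappa>_pos by (simp add: field_simps)
  also have "\<dots> \<le> \<kappa> / 4 * M powr \<alpha>" using M \<alpha> \<kappa>_pos by (intro mult_left_mono powr_mono) auto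
  finally have M\<alpha>: "3 * C \<le> \<kappa> / 4 * M powr \<alpha>" .
  have "\<forall>\<^sub>F n in sequentially. \<kappa> / 4 * M powr \<alpha> \<le> real n * K (M / B n)"
    using M by (intro trunc_moment_lower) auto
  then have "\<forall>\<^sub>F n in sequentially. \<kappa> / 4 * M powr \<alpha> \<le> real (Suc n) * K (M / B (Suc n))"
    by (subst eventually_sequentially_Suc)
  then have "\<forall>\<^sub>F n in sequentially. B (Suc n) \<le> M * B n"
    using C(2) eventually_ge_at_top[of 1]
  proof eventually_elim
    case (elim n)
    show ?case
    proof (rule ccontr)
      assume "\<not> B (Suc n) \<le> M * B n"
      then have "M / B (Suc n) \<le> 1 / B n"
        using B_pos[of n] B_pos[of "Suc n"] elim by (simp add: field_simps)
      then have "K (M / B (Suc n)) \<le> K (1 / B n)"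
        using M B_pos[of "Suc n"] by (intro N.trunc_moment_mono) auto
      then have "real (Suc n) * K (M / B (Suc n)) \<le> real (2 * n) * K (1 / B n)"
        using elim N.trunc_moment_nonneg by (intro mult_mono) auto
      then show False using elim M\<alpha> C(1) by simp
    qed
  qed
  then show ?thesis using that M by blast
qed

text \<open>Bounded ratios let every small \<open>t\<close> be matched with some \<open>n\<close>
  such that 1 / B n \<le> t \<le> M / B n. Then n K(t) is at most M^2 C, while n K(l t) is at least
  \<kappa> / 4 times l^\<alpha>. Since \<beta> < \<alpha>, a large \<open>l\<close> absorbs the
  constants.\<close>

lemma trunc_moment_doubling:
  obtains l t0 where "l > 1" "t0 > 0" "\<And>t. 0 < t \<Longrightarrow> t \<le> t0 \<Longrightarrow> l powr \<beta> * K t \<le> K (l * t)"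
proof -
  obtain C where C: "C > 0" "\<forall>\<^sub>F n in sequentially. real n * K (1 / B n) \<le> C" by (rule trunc_moment_upper)
  obtain M where M: "M \<ge> 1" "\<forall>\<^sub>F n in sequentially. B (Suc n) \<le> M * B n" by (rule scaling_ratio_bounded)
  define D where "D = max 2 (4 * M\<^sup>2 * C / \<kappa>)"
  define l where "l = D powr (1 / (\<alpha> - \<beta>))"
  have l: "l > 1" unfolding l_def using \<beta> by (intro gr_one_powr) (auto simp: D_def)
  have "l powr (\<alpha> - \<beta>) = D" unfolding l_def powr_powr using \<beta> by (simp add: D_def)
  then have "l powr \<beta> * D = l powr \<alpha>" by (metis powr_add add.commute diff_add_cancel)
  have "4 * M\<^sup>2 * C / \<kappa> \<le> D" by (simp add: D_def)
  then have "M\<^sup>2 * C \<le> \<kappa> / 4 * D" using \<kappa>_pos by (simp add: field_simps)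
  then have "l powr \<beta> * (M\<^sup>2 * C) \<le> l powr \<beta> * (\<kappa> / 4 * D)" by (intro mult_left_mono) auto
  also have "\<dots> = \<kappa> / 4 * (l powr \<beta> * D)" by (simp add: mult_ac)
  also have "l powr \<beta> * D = l powr \<alpha>" by fact
  finally have l\<beta>: "l powr \<beta> * (M\<^sup>2 * C) \<le> \<kappa> / 4 * l powr \<alpha>" .
  have "\<forall>\<^sub>F n in sequentially. 1 \<le> n \<and> real n * K (1 / B n) \<le> C \<and> B (Suc n) \<le> M * B n \<and>
      \<kappa> / 4 * l powr \<alpha> \<le> real n * K (l / B n)"
    using l by (intro eventually_conj C M trunc_moment_lower eventually_ge_at_top) auto
  then obtain n1 where n1: "\<And>n. n \<ge> n1 \<Longrightarrow> 1 \<le> n \<and> real n * K (1 / B n) \<le> C \<and> B (Suc n) \<le> M * B n \<and>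
      \<kappa> / 4 * l powr \<alpha> \<le> real n * K (l / B n)"
    unfolding eventually_sequentially by blast
  \<comment> \<open>The factor 2 makes \<open>1 / t\<close> exceed \<open>B n1\<close>, so the first
    index \<open>n\<close> with \<open>B n\<close> at least \<open>1 / t\<close> has a predecessor
    that is still at least \<open>n1\<close>.\<close>
  define t0 where "t0 = 1 / (2 * B n1)"
  have Bn1: "B n1 > 0" using n1[of n1] B_pos by auto
  have "l powr \<beta> * K t \<le> K (l * t)" if t: "0 < t" "t \<le> t0" for t
  proof -
    have "\<exists>n. n \<ge> n1 \<and> 1 / t \<le> B n"
      using filterlim_at_top[THEN iffD1, OF B_lim, rule_format, of "1 / t"] eventually_ge_at_top[of n1]
      by (metis (mono_tags, lifting) eventually_conj eventually_happens sequentially_bot)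
    define n where "n = (LEAST n. n \<ge> n1 \<and> 1 / t \<le> B n)"
    have n: "n \<ge> n1" "1 / t \<le> B n" using LeastI_ex[OF \<open>\<exists>n. _\<close>] by (auto simp: n_def)
    have "1 / t > B n1" using t Bn1 by (simp add: t0_def field_simps)
    then have "n \<noteq> n1" using n by auto
    then obtain m where m: "n = Suc m" "m \<ge> n1" using n(1) by (cases n) auto
    have "\<not> (m \<ge> n1 \<and> 1 / t \<le> B m)" using not_less_Least[of m "\<lambda>n. n \<ge> n1 \<and> 1 / t \<le> B n"] m by (simp add: n_def)
    then have "B m < 1 / t" using m by auto
    have "B n \<le> M * B m" using n1[of m] m by auto
    have Bn: "B n > 0" using n1[of n] n B_pos by auto
    have "B n \<le> M * B m" by fact
    also have "\<dots> \<le> M * (1 / t)" using \<open>B m < 1 / t\<close> M(1) by (intro mult_left_mono) auto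
    finally have "t * B n \<le> M" using t by (simp add: field_simps)
    then have "t \<le> M * (1 / B n)" using Bn by (simp add: field_simps)
    then have "K t \<le> K (M * (1 / B n))" using t by (intro N.trunc_moment_mono) auto
    also have "\<dots> \<le> M\<^sup>2 * K (1 / B n)" using M(1) by (rule N.trunc_moment_scale_le)
    finally have "real n * K t \<le> M\<^sup>2 * (real n * K (1 / B n))" by (simp add: mult_left_mono mult.left_commute)
    also have "\<dots> \<le> M\<^sup>2 * C" using n1[of n] n by (intro mult_left_mono) auto
    finally have "l powr \<beta> * (real n * K t) \<le> l powr \<beta> * (M\<^sup>2 * C)" by (intro mult_left_mono) auto
    also note l\<beta>
    also have "\<kappa> / 4 * l powr \<alpha> \<le> real n * K (l / B n)" using n1[of n] n by auto
    also have "\<dots> \<le> real n * K (l * t)"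
      using n(2) t Bn l by (intro mult_left_mono N.trunc_moment_mono) (auto simp: field_simps)
    finally have "real n * (l powr \<beta> * K t) \<le> real n * K (l * t)" by (simp add: mult_ac)
    then show ?thesis using n1[of n] n by simp
  qed
  then show ?thesis using that[of l t0] l Bn1 by (simp add: t0_def)
qed

text \<open>Doubling gives K(l t) - K(t) \<ge> (l^\<beta> - 1) K(t), and such growth bounds the
  cosine defect at \<open>t\<close> from below. Thus the defect is comparable with a monotone
  function of power growth.\<close>

lemma regular_scale:
  obtains t0 c where "t0 > 0" "c > 0"
    "\<And>t t'. 0 < t \<Longrightarrow> t \<le> t' \<Longrightarrow> t' \<le> t0 \<Longrightarrow> c * (t' / t) powr \<beta> * K t \<le> K t'"
    "\<And>t. 0 < t \<Longrightarrow> t \<le> t0 \<Longrightarrow> c * K t \<le> G t"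
proof -
  obtain l t0 where l: "l > 1" "t0 > 0" and d: "\<And>t. 0 < t \<Longrightarrow> t \<le> t0 \<Longrightarrow> l powr \<beta> * K t \<le> K (l * t)"
    using trunc_moment_doubling by metis
  have l\<beta>: "l powr \<beta> > 1" using l \<beta> by (intro gr_one_powr) auto
  define c where "c = min (1 / l powr \<beta>) ((l powr \<beta> - 1) / (3 * l\<^sup>2))"
  have c: "c > 0" using l l\<beta> by (simp add: c_def)
  have 1: "c * (t' / t) powr \<beta> * K t \<le> K t'" if t: "0 < t" "t \<le> t'" "t' \<le> t0" for t t'
  proof -
    have "c * ((t' / t) powr \<beta> * K t) \<le> 1 / l powr \<beta> * ((t' / t) powr \<beta> * K t)"
      using N.trunc_moment_nonneg by (intro mult_right_mono) (auto simp: c_def)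
    also have "\<dots> = (t' / (l * t)) powr \<beta> * K t" using t l by (simp add: powr_divide powr_mult)
    also have "\<dots> \<le> K t'"
      using \<beta> l(1) t by (intro powr_le_of_doubling[where ?t0.0 = t0] N.trunc_moment_nonneg N.trunc_moment_mono d) auto
    finally show ?thesis by (simp add: mult.assoc)
  qed
  have 2: "c * K t \<le> G t" if t: "0 < t" "t \<le> t0" for t
  proof -
    have "c * K t \<le> (l powr \<beta> - 1) / (3 * l\<^sup>2) * K t"
      using N.trunc_moment_nonneg by (intro mult_right_mono) (auto simp: c_def)
    also have "\<dots> = (l powr \<beta> * K t - K t) / (3 * l\<^sup>2)" by (simp add: field_simps)
    also have "\<dots> \<le> (K (l * t) - K t) / (3 * l\<^sup>2)" using d[OF t] by (intro divide_right_mono) auto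
    also have "\<dots> \<le> G t" using l by (intro N.cos_defect_ge) auto
    finally show ?thesis .
  qed
  show ?thesis using that[OF l(2) c 1 2] .
qed

lemma cos_defect_growth:
  assumes t0: "t0 > 0" and c: "c > 0"
    and K: "\<And>t t'. 0 < t \<Longrightarrow> t \<le> t' \<Longrightarrow> t' \<le> t0 \<Longrightarrow> c * (t' / t) powr \<beta> * K t \<le> K t'"
    and G: "\<And>t. 0 < t \<Longrightarrow> t \<le> t0 \<Longrightarrow> c * K t \<le> G t"
  shows "\<forall>\<^sub>F n in sequentially. \<forall>s. 1 \<le> s \<and> s \<le> t0 * B n \<longrightarrow> c\<^sup>2 * (\<kappa> / 4) * s powr \<beta> \<le> real n * G (s / B n)"
  using trunc_moment_lower[of 1, simplified] eventually_ge_at_top[of 1]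
proof (eventually_elim, intro allI impI)
  fix n s assume n: "\<kappa> \<le> real n * K (1 / B n) * 4" "1 \<le> n" and s: "1 \<le> s \<and> s \<le> t0 * B n"
  have Bn: "B n > 0" using n B_pos by auto
  have "c\<^sup>2 * (\<kappa> / 4) * s powr \<beta> \<le> c\<^sup>2 * (real n * K (1 / B n)) * s powr \<beta>"
    using n by (intro mult_right_mono mult_left_mono) auto
  also have "\<dots> = real n * (c * (c * ((s / B n) / (1 / B n)) powr \<beta> * K (1 / B n)))"
    using Bn by (simp add: power2_eq_square mult_ac)
  also have "\<dots> \<le> real n * (c * K (s / B n))"
    using s Bn c by (intro mult_left_mono K) (auto simp: field_simps)
  also have "\<dots> \<le> real n * G (s / B n)" using s Bn by (intro mult_left_mono G) (auto simp: field_simps)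
  finally show "c\<^sup>2 * (\<kappa> / 4) * s powr \<beta> \<le> real n * G (s / B n)" .
qed

text \<open>A bound of Potter type. Since n K(1 / B n) lies between positive constants, K(1 / B n)
  has order 1 / n, and the power growth of K with exponent \<beta> inverts to growth of
  \<open>B\<close> with exponent 1 / \<beta>.\<close>

lemma scaling_potter:
  obtains C :: real and n0 :: nat where "C \<ge> 1" "n0 \<ge> 1" "\<And>m n. n0 \<le> m \<Longrightarrow> m \<le> n \<Longrightarrow> B n \<le> C * (n / m) powr (1 / \<beta>) * B m"
proof -
  obtain t0 c where t0: "t0 > 0" and c: "c > 0"
    and K: "\<And>t t'. 0 < t \<Longrightarrow> t \<le> t' \<Longrightarrow> t' \<le> t0 \<Longrightarrow> c * (t' / t) powr \<beta> * K t \<le> K t'"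
    using regular_scale by metis
  obtain C where C: "C > 0" "\<forall>\<^sub>F n in sequentially. real n * K (1 / B n) \<le> C" by (rule trunc_moment_upper)
  have "\<forall>\<^sub>F n in sequentially. 1 \<le> n \<and> real n * K (1 / B n) \<le> C \<and> \<kappa> / 4 \<le> real n * K (1 / B n) \<and> 1 / t0 \<le> B n"
    using trunc_moment_lower[of 1] B_lim by (intro eventually_conj C eventually_ge_at_top) (auto simp: filterlim_at_top)
  then obtain n0 where n0: "\<And>n. n \<ge> n0 \<Longrightarrow> 1 \<le> n \<and> real n * K (1 / B n) \<le> C \<and> \<kappa> / 4 \<le> real n * K (1 / B n) \<and> 1 / t0 \<le> B n"
    unfolding eventually_sequentially by blast
  define D where "D = max 1 (4 * C / (c * \<kappa>))"
  define E where "E = D powr (1 / \<beta>)"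
  have E: "E \<ge> 1" unfolding E_def using \<beta> by (intro ge_one_powr_ge_zero) (auto simp: D_def)
  have "B n \<le> E * (n / m) powr (1 / \<beta>) * B m" if mn: "n0 \<le> m" "m \<le> n" for m n
  proof (cases "B n \<le> B m")
    case True
    have "1 * 1 \<le> E * (n / m) powr (1 / \<beta>)"
      using E n0[of m] mn \<beta> by (intro mult_mono ge_one_powr_ge_zero) auto
    then have "1 * B m \<le> E * (n / m) powr (1 / \<beta>) * B m"
      using B_pos[of m] n0[of m] mn by (intro mult_right_mono) auto
    then show ?thesis using True by simp
  next
    case False
    have m: "m \<ge> 1" "n \<ge> 1" "B m > 0" "B n > 0" using n0[of m] mn B_pos[of m] B_pos[of n] by auto
    have "c * ((1 / B m) / (1 / B n)) powr \<beta> * K (1 / B n) \<le> K (1 / B m)"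
      using False m n0[of m] mn t0 by (intro K) (auto simp: field_simps)
    then have "c * (B n / B m) powr \<beta> * K (1 / B n) \<le> K (1 / B m)" by simp
    then have "(real n * real m) * (c * (B n / B m) powr \<beta> * K (1 / B n)) \<le> (real n * real m) * K (1 / B m)"
      by (intro mult_left_mono) auto
    then have "(m * c * (B n / B m) powr \<beta>) * (n * K (1 / B n)) \<le> n * (m * K (1 / B m))" by (simp add: mult_ac)
    also have "\<dots> \<le> n * C" using n0[of m] mn by (intro mult_left_mono) auto
    finally have "(m * c * (B n / B m) powr \<beta>) * (n * K (1 / B n)) \<le> n * C" .
    moreover have "(m * c * (B n / B m) powr \<beta>) * (\<kappa> / 4) \<le> (m * c * (B n / B m) powr \<beta>) * (n * K (1 / B n))"
      using n0[of n] mn c by (intro mult_left_mono) auto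
    ultimately have "(m * c * (B n / B m) powr \<beta>) * (\<kappa> / 4) \<le> n * C" by linarith
    then have "(B n / B m) powr \<beta> \<le> 4 * C / (c * \<kappa>) * (n / m)" using c \<kappa>_pos m by (simp add: field_simps)
    also have "\<dots> \<le> D * (n / m)" by (intro mult_right_mono) (auto simp: D_def)
    finally have "((B n / B m) powr \<beta>) powr (1 / \<beta>) \<le> (D * (n / m)) powr (1 / \<beta>)"
      using \<beta> by (intro powr_mono2) auto
    then have "B n / B m \<le> E * (n / m) powr (1 / \<beta>)"
      using m \<beta> powr_mult[of D "real n / real m" "1 / \<beta>"] by (simp add: powr_powr E_def D_def)
    then show ?thesis using m by (simp add: field_simps)
  qed
  moreover have "n0 \<ge> 1" using n0[of n0] by simp
  ultimately show ?thesis using that E by blast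
qed

end

section \<open>Consequences of criticality and aperiodicity\<close>

lemma pmf_nat_sums: "pmf \<mu> sums 1" for \<mu> :: "nat pmf"
  using sums_integral_count_space_nat[OF integrable_pmf[of UNIV \<mu>]] by (simp add: integral_pmf)

text \<open>Without mass at 0 the variable \<open>k - 1\<close> would be nonnegative with mean 0, so
  the law would be concentrated at 1.\<close>

lemma pmf_0_pos:
  assumes mean: "(\<lambda>k. real k * pmf \<mu> k) sums 1" and less: "pmf \<mu> 0 + pmf \<mu> 1 < 1"
  shows "pmf \<mu> 0 > 0"
proof (rule ccontr)
  assume "\<not> pmf \<mu> 0 > 0"
  then have 0: "pmf \<mu> 0 = 0" using pmf_nonneg[of \<mu> 0] by linarith
  have "pmf \<mu> sums 1" by (rule pmf_nat_sums)
  from sums_diff[OF mean this] have s: "(\<lambda>k. (real k - 1) * pmf \<mu> k) sums 0" by (simp add: left_diff_distrib)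
  have "(real k - 1) * pmf \<mu> k \<ge> 0" for k by (cases k) (auto simp: 0)
  then have *: "(real k - 1) * pmf \<mu> k = 0" for k
    using suminf_eq_zero_iff[OF sums_summable[OF s]] sums_unique[OF s] by simp
  have "pmf \<mu> k = 0" if "k \<noteq> 1" for k
    using *[of k] that 0 by (cases "k = 0") auto
  then have "pmf \<mu> sums pmf \<mu> 1" using sums_finite[of "{1}" "pmf \<mu>"] by simp
  with \<open>pmf \<mu> sums 1\<close> have "pmf \<mu> 1 = 1" using sums_unique2 by blast
  then show False using less 0 by simp
qed

text \<open>Such an \<open>x\<close> is rational, and its reduced denominator divides every element
  of \<open>S\<close>, hence their gcd.\<close>

lemma Ints_of_aperiodic:
  assumes "Gcd S = (1::nat)" and x: "\<And>k. k \<in> S \<Longrightarrow> x * real k \<in> \<int>"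
  shows "x \<in> \<int>"
proof -
  have "\<exists>k\<in>S. k \<noteq> 0"
    using assms(1) Gcd_0_iff[of S] by auto
  then obtain k where k: "k \<in> S" "k \<noteq> 0" by blast
  obtain a where a: "x * real k = of_int a" using x[OF k(1)] by (auto elim: Ints_cases)
  then have "x = of_int a / real k" using k by (simp add: field_simps)
  then have "x \<in> \<rat>" by simp
  then obtain m n where n: "n \<noteq> 0" "\<bar>x\<bar> = real m / real n" "coprime m n" by (rule Rats_abs_nat_div_natE)
  have "n dvd Gcd S"
  proof (rule Gcd_greatest)
    fix k assume "k \<in> S"
    then have "\<bar>x\<bar> * real k \<in> \<int>" using x[of k] by (cases "x \<ge> 0") auto
    then obtain b where b: "\<bar>x\<bar> * real k = of_int b" by (auto elim: Ints_cases)
    then have "real_of_int (int m * int k) = real_of_int (b * int n)" using n by (simp add: field_simps)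
    then have "int m * int k = b * int n" by (simp only: of_int_eq_iff)
    then have "int n dvd int (m * k)" by simp
    then have "n dvd m * k" by (simp only: int_dvd_int_iff)
    then show "n dvd k" using n(3) by (simp add: coprime_dvd_mult_right_iff coprime_commute)
  qed
  then have "\<bar>x\<bar> = real m" using n assms(1) by simp
  then show ?thesis by (metis Ints_minus Ints_of_nat abs_if minus_minus)
qed

text \<open>A vanishing defect forces t (j - k) to be a multiple of 2 pi for all j, k in the
  support. As 0 belongs to the support, the same holds for t k, and aperiodicity applies to t / (2
  pi).\<close>

lemma cos_defect_symmetrized_pos:
  assumes aper: "aperiodic \<mu>" and pos: "pmf \<mu> 0 > 0" and t: "0 < t" "t < 2 * pi"
  shows "cos_defect (symmetrized \<mu>) t > 0"
proof -
  have "cos_defect (symmetrized \<mu>) t \<noteq> 0"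
  proof
    assume 0: "cos_defect (symmetrized \<mu>) t = 0"
    interpret N: real_distribution "symmetrized \<mu>" by (rule real_distribution_symmetrized)
    have P: "pair_sigma_finite (measure_pmf \<mu>) (measure_pmf \<mu>)"
      by (intro pair_sigma_finite.intro prob_space_imp_sigma_finite prob_space_measure_pmf)
    have "AE x in symmetrized \<mu>. 1 - cos (t * x) = 0"
      using 0 N.integrable_cos_defect[of t] unfolding cos_defect_def by (subst (asm) integral_nonneg_eq_0_iff_AE) auto
    then have "AE p in measure_pmf \<mu> \<Otimes>\<^sub>M measure_pmf \<mu>. cos (t * (real (fst p) - real (snd p))) = 1"
      unfolding symmetrized_def by (subst (asm) AE_distr_iff) (auto simp: split_beta)
    from pair_sigma_finite.AE_pair[OF P this] have *: "cos (t * (real j - real k)) = 1" if "j \<in> set_pmf \<mu>" "k \<in> set_pmf \<mu>" for j k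
      using that by (auto simp: AE_measure_pmf_iff)
    have "t / (2 * pi) \<in> \<int>"
    proof (rule Ints_of_aperiodic)
      show "Gcd (set_pmf \<mu>) = 1" using aper by (simp add: aperiodic_def)
      fix k assume "k \<in> set_pmf \<mu>"
      then have "cos (t * real k) = 1" using *[of k 0] pos by (simp add: set_pmf_iff)
      then obtain n :: int where "t * real k = n * 2 * pi" using cos_one_2pi_int by auto
      then have "t / (2 * pi) * real k = of_int n" by (simp add: field_simps)
      then show "t / (2 * pi) * real k \<in> \<int>" by simp
    qed
    then obtain n where n: "t / (2 * pi) = of_int n" by (auto elim: Ints_cases)
    have "0 < t / (2 * pi)" "t / (2 * pi) < 1" using t by auto
    then show False unfolding n by simp
  qed
  then show ?thesis using cos_defect_symmetrized_bounds(1)[of \<mu> t] by simp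
qed

text \<open>The coefficients of the \<open>n\<close>-th power are the point probabilities P (S_n =
  k). Their total mass and their characteristic function are obtained from Cauchy products.\<close>

lemma offspring_fps_power:
  shows offspring_fps_power_nonneg: "(offspring_fps \<mu> ^ n) $ k \<ge> 0"
    and offspring_fps_power_sums: "(\<lambda>k. (offspring_fps \<mu> ^ n) $ k) sums 1"
    and offspring_fps_power_char: "(\<lambda>k. of_real ((offspring_fps \<mu> ^ n) $ k) * iexp (t * real k)) sums (offspring_char \<mu> t ^ n)"
proof (induction n arbitrary: k)
  case 0
  have eq: "(\<lambda>k. of_real ((offspring_fps \<mu> ^ 0) $ k) * iexp (t * real k)) = (\<lambda>k. if k = 0 then 1 else 0)"
    by (auto simp: fun_eq_iff)
  { case 1 show ?case by simp }
  { case 2 show ?case using sums_single[of 0 "\<lambda>_. 1 :: real"] by (simp add: fps_one_nth) }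
  { case 3 show ?case unfolding eq using sums_single[of 0 "\<lambda>_. 1 :: complex"] by simp }
next
  case (Suc n)
  let ?q = "\<lambda>n k. (offspring_fps \<mu> ^ n) $ k"
  have q1: "?q 1 k = pmf \<mu> k" for k by (simp add: offspring_fps_def)
  have nth: "?q (Suc n) k = (\<Sum>i\<le>k. pmf \<mu> i * ?q n (k - i))" for k
    by (simp add: fps_mult_nth offspring_fps_def atLeast0AtMost)
  have char: "(\<lambda>k. of_real (pmf \<mu> k) * iexp (t * real k)) sums offspring_char \<mu> t"
  proof -
    have "integrable (count_space UNIV) (\<lambda>k. pmf \<mu> k *\<^sub>R iexp (t * real k))"
      by (rule Bochner_Integration.integrable_bound[OF integrable_pmf[of UNIV \<mu>]]) (auto simp: norm_mult)
    from sums_integral_count_space_nat[OF this] show ?thesis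
      by (simp add: offspring_char_def measure_pmf_eq_density integral_density scaleR_conv_of_real)
  qed
  have s1: "summable (\<lambda>k. norm (of_real (pmf \<mu> k) * iexp (t * real k)))"
    using sums_summable[OF pmf_nat_sums[of \<mu>]] by (simp add: norm_mult)
  have s2: "summable (\<lambda>k. norm (of_real (?q n k) * iexp (t * real k)))"
    using sums_summable[OF Suc.IH(2)] Suc.IH(1) by (simp add: norm_mult)
  { case 1 show ?case unfolding nth using Suc.IH(1) by (intro sum_nonneg mult_nonneg_nonneg) auto }
  { case 2
    have "(\<lambda>k. \<Sum>i\<le>k. pmf \<mu> i * ?q n (k - i)) sums ((\<Sum>k. pmf \<mu> k) * (\<Sum>k. ?q n k))"
      by (rule Cauchy_product_sums) (use sums_summable[OF pmf_nat_sums[of \<mu>]] sums_summable[OF Suc.IH(2)] Suc.IH(1) in auto)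
    then show ?case by (simp add: nth sums_unique[OF pmf_nat_sums, symmetric] sums_unique[OF Suc.IH(2), symmetric] del: power_Suc) }
  { case 3
    have "(\<lambda>k. \<Sum>i\<le>k. (of_real (pmf \<mu> i) * iexp (t * real i)) * (of_real (?q n (k - i)) * iexp (t * real (k - i))))
        sums ((\<Sum>k. of_real (pmf \<mu> k) * iexp (t * real k)) * (\<Sum>k. of_real (?q n k) * iexp (t * real k)))"
      by (rule Cauchy_product_sums[OF s1 s2])
    also have "(\<lambda>k. \<Sum>i\<le>k. (of_real (pmf \<mu> i) * iexp (t * real i)) * (of_real (?q n (k - i)) * iexp (t * real (k - i)))) =
        (\<lambda>k. of_real (?q (Suc n) k) * iexp (t * real k))"
    proof (rule ext)
      fix k
      have "(of_real (pmf \<mu> i) * iexp (t * real i)) * (of_real (?q n (k - i)) * iexp (t * real (k - i))) =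
          of_real (pmf \<mu> i * ?q n (k - i)) * iexp (t * real k)" if "i \<le> k" for i
      proof -
        have "iexp (t * real i) * iexp (t * real (k - i)) = iexp (t * real k)"
          using that by (simp add: exp_add[symmetric] of_nat_diff algebra_simps)
        then show ?thesis by (simp add: mult_ac)
      qed
      then show "(\<Sum>i\<le>k. (of_real (pmf \<mu> i) * iexp (t * real i)) * (of_real (?q n (k - i)) * iexp (t * real (k - i)))) =
          of_real (?q (Suc n) k) * iexp (t * real k)"
        unfolding nth of_real_sum sum_distrib_right by (intro sum.cong) auto
    qed
    finally show ?case
      unfolding sums_unique[OF char, symmetric] sums_unique[OF Suc.IH(3), symmetric] power_Suc . }
qed

section \<open>Fourier inversion for the walk\<close>

lemma integral_cos_period:
  "(LBINT t:{-pi..pi}. cos ((real j - real k) * t)) = (if j = k then 2 * pi else 0)"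
proof (cases "j = k")
  case True
  then show ?thesis by (simp add: set_lebesgue_integral_def)
next
  case False
  define m where "m = real j - real k"
  have "m \<noteq> 0" using False by (simp add: m_def)
  have "(LBINT t:{-pi..pi}. cos (m * t)) = sin (m * pi) / m - sin (m * (- pi)) / m"
    unfolding set_lebesgue_integral_def
  proof (rule integral_FTC_atLeastAtMost)
    fix t :: real
    show "((\<lambda>t. sin (m * t) / m) has_vector_derivative cos (m * t)) (at t within {-pi..pi})"
      unfolding has_real_derivative_iff_has_vector_derivative[symmetric]
      using \<open>m \<noteq> 0\<close> by (auto intro!: derivative_eq_intros)
  qed (auto intro!: continuous_intros)
  moreover have "sin (m * pi) = 0"
    unfolding sin_zero_iff_int2 by (rule exI[of _ "int j - int k"]) (simp add: m_def)
  ultimately show ?thesis using False by (simp add: m_def)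
qed

lemma continuous_offspring_char: "continuous_on A (offspring_char \<mu>)"
proof -
  have "real_distribution (distr (measure_pmf \<mu>) borel real)"
    by (rule prob_space.real_distribution_distr[OF prob_space_measure_pmf]) simp
  moreover have "char (distr (measure_pmf \<mu>) borel real) = offspring_char \<mu>"
    by (simp add: fun_eq_iff char_def offspring_char_def integral_distr)
  ultimately show ?thesis
    using real_distribution.isCont_char continuous_at_imp_continuous_on by metis
qed

lemma borel_measurable_offspring_char [measurable]: "offspring_char \<mu> \<in> borel_measurable borel"
  by (rule borel_measurable_continuous_onI[OF continuous_offspring_char])

text \<open>The coefficients are summable, so the Fourier series may be integrated term by term, and
  orthogonality isolates the index \<open>k\<close>.\<close>

lemma offspring_fps_power_fourier:
  "2 * pi * (offspring_fps \<mu> ^ n) $ k = (LBINT t:{-pi..pi}. Re (offspring_char \<mu> t ^ n * iexp (- t * real k)))"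
proof -
  let ?q = "\<lambda>j. (offspring_fps \<mu> ^ n) $ j"
  define f where "f j t = indicator {-pi..pi} t * (?q j * cos ((real j - real k) * t))" for j t
  have int: "integrable lborel (f j)" for j
  proof -
    have "set_integrable lborel {-pi..pi} (\<lambda>t. ?q j * cos ((real j - real k) * t))"
      by (rule borel_integrable_atLeastAtMost') (auto intro!: continuous_intros)
    then show ?thesis by (simp add: f_def[abs_def] set_integrable_def)
  qed
  have sm: "summable ?q" by (rule sums_summable[OF offspring_fps_power_sums])
  have bd: "norm (f j t) \<le> indicator {-pi..pi} t * ?q j" for j t
    using offspring_fps_power_nonneg[of \<mu> n j] mult_left_mono[OF abs_cos_le_one, of "?q j"] by (auto simp: f_def abs_mult split: split_indicator)
  have "(\<lambda>j. \<integral>t. f j t \<partial>lborel) sums (\<integral>t. (\<Sum>j. f j t) \<partial>lborel)"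
  proof (rule sums_integral[OF int])
    show "AE t in lborel. summable (\<lambda>j. norm (f j t))"
      by (intro AE_I2 summable_comparison_test'[OF summable_mult[OF sm], of 0]) (use bd in auto)
    show "summable (\<lambda>j. \<integral>t. norm (f j t) \<partial>lborel)"
    proof (rule summable_comparison_test'[OF summable_mult[OF sm, of "2 * pi"], of 0])
      fix j
      have "(\<integral>t. norm (f j t) \<partial>lborel) \<le> (\<integral>t. indicator {-pi..pi} t * ?q j \<partial>lborel)"
        by (intro integral_mono integrable_norm int bd) auto
      then show "norm (\<integral>t. norm (f j t) \<partial>lborel) \<le> 2 * pi * ?q j" by simp
    qed
  qed
  moreover have "(\<Sum>j. f j t) = indicator {-pi..pi} t *\<^sub>R Re (offspring_char \<mu> t ^ n * iexp (- t * real k))" for t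
  proof -
    have "(\<lambda>j. Re (of_real (?q j) * iexp (t * real j) * iexp (- t * real k))) sums Re (offspring_char \<mu> t ^ n * iexp (- t * real k))"
      by (intro sums_Re sums_mult2 offspring_fps_power_char)
    moreover have "Re (of_real (?q j) * iexp (t * real j) * iexp (- t * real k)) = ?q j * cos ((real j - real k) * t)" for j
    proof -
      have "of_real (?q j) * iexp (t * real j) * iexp (- t * real k) = of_real (?q j) * cis ((real j - real k) * t)"
        by (simp add: cis_conv_exp exp_add[symmetric] algebra_simps)
      from arg_cong[OF this, of Re] show ?thesis by (simp only: Re_complex_of_real Im_complex_of_real times_complex.sel cis.sel mult_zero_left diff_zero)
    qed
    ultimately have "(\<lambda>j. indicator {-pi..pi} t * (?q j * cos ((real j - real k) * t))) sums (indicator {-pi..pi} t * Re (offspring_char \<mu> t ^ n * iexp (- t * real k)))"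
      by (intro sums_mult) simp
    then show ?thesis by (simp add: f_def sums_iff)
  qed
  moreover have "(\<integral>t. f j t \<partial>lborel) = (if j = k then 2 * pi * ?q k else 0)" for j
  proof -
    have "(\<integral>t. f j t \<partial>lborel) = (\<integral>t. ?q j * (indicator {-pi..pi} t *\<^sub>R cos ((real j - real k) * t)) \<partial>lborel)"
      by (simp add: f_def mult_ac)
    also have "\<dots> = ?q j * (LBINT t:{-pi..pi}. cos ((real j - real k) * t))"
      unfolding set_lebesgue_integral_def by (rule integral_mult_right_zero)
    finally show ?thesis unfolding integral_cos_period by simp
  qed
  ultimately have "(\<lambda>j. if j = k then 2 * pi * ?q k else 0) sums (LBINT t:{-pi..pi}. Re (offspring_char \<mu> t ^ n * iexp (- t * real k)))"
    unfolding set_lebesgue_integral_def by simp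
  then show ?thesis using sums_single[of k "\<lambda>_. 2 * pi * ?q k"] sums_unique2 by blast
qed

lemma offspring_fps_power_fourier_scaled:
  assumes "b > 0"
  shows "2 * pi * b * (offspring_fps \<mu> ^ n) $ k =
    (LBINT s. indicator {- pi * b..pi * b} s * Re (offspring_char \<mu> (s / b) ^ n * iexp (- s * real k / b)))"
proof -
  let ?f = "\<lambda>t. indicator {-pi..pi} t *\<^sub>R Re (offspring_char \<mu> t ^ n * iexp (- t * real k))"
  have "2 * pi * (offspring_fps \<mu> ^ n) $ k = (LBINT t. ?f t)"
    unfolding offspring_fps_power_fourier set_lebesgue_integral_def ..
  also have "\<dots> = (LBINT s. ?f (0 + (1 / b) * s)) / b"
    using assms lborel_integral_real_affine[of "1 / b" ?f 0] by simp
  also have "(LBINT s. ?f (0 + (1 / b) * s)) =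
      (LBINT s. indicator {- pi * b..pi * b} s * Re (offspring_char \<mu> (s / b) ^ n * iexp (- s * real k / b)))"
  proof (intro Bochner_Integration.integral_cong refl)
    fix s
    have "indicator {-pi..pi} (0 + (1 / b) * s) = (indicator {- pi * b..pi * b} s :: real)"
      using assms by (auto simp: indicator_def field_simps)
    then show "?f (0 + (1 / b) * s) = indicator {- pi * b..pi * b} s * Re (offspring_char \<mu> (s / b) ^ n * iexp (- s * real k / b))"
      by simp
  qed
  finally show ?thesis using assms by (simp add: field_simps)
qed

text \<open>Comparison with an integral, carried out as a telescoping sum by the mean value
  theorem.\<close>

lemma sum_powr_le:
  assumes g: "0 < g" "g < 1"
  shows "(\<Sum>i=1..n. real i powr (- g)) \<le> real n powr (1 - g) / (1 - g)"
proof (induction n)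
  case 0
  then show ?case using g by simp
next
  case (Suc n)
  have "(1 - g) * real (Suc n) powr (- g) \<le> real (Suc n) powr (1 - g) - real n powr (1 - g)"
  proof (cases "n = 0")
    case True
    then show ?thesis using g by simp
  next
    case False
    have "\<exists>z. real n < z \<and> z < real (Suc n) \<and>
        real (Suc n) powr (1 - g) - real n powr (1 - g) = (real (Suc n) - real n) * ((1 - g) * z powr (1 - g - 1))"
      using False by (intro MVT2) (auto intro!: derivative_eq_intros)
    then obtain z where z: "real n < z" "z < real (Suc n)"
      "real (Suc n) powr (1 - g) - real n powr (1 - g) = (1 - g) * z powr (- g)" by auto
    have "real (Suc n) powr (- g) \<le> z powr (- g)" using z False g by (intro powr_mono2') auto
    then show ?thesis unfolding z(3) using g by (intro mult_left_mono) auto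
  qed
  then have "real (Suc n) powr (- g) \<le> (real (Suc n) powr (1 - g) - real n powr (1 - g)) / (1 - g)"
    using g by (simp add: field_simps)
  then show ?case using Suc.IH by (simp add: diff_divide_distrib)
qed

text \<open>One of \<open>i\<close>, \<open>n - i\<close> is at least \<open>n / 2\<close>, which reduces the convolution to a single sum.\<close>

lemma sum_powr_convolution_le:
  assumes g: "0 < g" "g < 1" and n: "n \<ge> 1"
  shows "(\<Sum>i=1..<n. (n / i) powr g * (n / real (n - i)) powr g) \<le> 4 / (1 - g) * n"
proof -
  have summand: "(n / i) powr g * (n / real (n - i)) powr g \<le> 2 * ((n / i) powr g + (n / real (n - i)) powr g)"
    if i: "i \<in> {1..<n}" for i
  proof -
    have two: "x powr g \<le> 2" if "0 \<le> x" "x \<le> 2" for x :: real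
    proof -
      have "x powr g \<le> 2 powr g" using that g by (intro powr_mono2) auto
      also have "\<dots> \<le> 2 powr 1" using g by (intro powr_mono) auto
      finally show ?thesis by simp
    qed
    show ?thesis
    proof (cases "2 * i \<ge> n")
      case True
      then have "(n / i) powr g \<le> 2" using i by (intro two) (auto simp: field_simps)
      then have "(n / i) powr g * (n / real (n - i)) powr g \<le> 2 * (n / real (n - i)) powr g" by (intro mult_right_mono) auto
      then show ?thesis using powr_ge_zero[of "n / i" g] by argo
    next
      case False
      then have "(n / real (n - i)) powr g \<le> 2" using i by (intro two) (auto simp: field_simps)
      then have "(n / i) powr g * (n / real (n - i)) powr g \<le> (n / i) powr g * 2" by (intro mult_left_mono) auto
      then show ?thesis using powr_ge_zero[of "n / real (n - i)" g] by argo
    qed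
  qed
  have one: "(\<Sum>i=1..<n. (n / i) powr g) \<le> n / (1 - g)"
  proof -
    have "(\<Sum>i=1..<n. (n / i) powr g) \<le> (\<Sum>i=1..n. (n / i) powr g)" by (intro sum_mono2) auto
    also have "\<dots> = n powr g * (\<Sum>i=1..n. real i powr (- g))"
      unfolding sum_distrib_left by (intro sum.cong) (auto simp: powr_divide powr_minus field_simps)
    also have "\<dots> \<le> n powr g * (real n powr (1 - g) / (1 - g))" by (intro mult_left_mono sum_powr_le g) auto
    also have "\<dots> = n / (1 - g)" using n by (simp add: powr_add[symmetric])
    finally show ?thesis .
  qed
  have "(\<Sum>i=1..<n. (n / i) powr g * (n / real (n - i)) powr g) \<le> (\<Sum>i=1..<n. 2 * ((n / i) powr g + (n / real (n - i)) powr g))"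
    by (intro sum_mono summand)
  also have "\<dots> = 2 * ((\<Sum>i=1..<n. (n / i) powr g) + (\<Sum>i=1..<n. (n / real (n - i)) powr g))"
    by (simp add: sum_distrib_left sum.distrib)
  also have "(\<Sum>i=1..<n. (n / real (n - i)) powr g) = (\<Sum>i=1..<n. (n / i) powr g)"
    by (rule sum.reindex_bij_witness[of _ "\<lambda>i. n - i" "\<lambda>i. n - i"]) auto
  also have "2 * ((\<Sum>i=1..<n. (n / i) powr g) + (\<Sum>i=1..<n. (n / i) powr g)) \<le> 2 * (n / (1 - g) + n / (1 - g))"
    using one by (intro mult_left_mono add_mono) auto
  finally show ?thesis by simp
qed

section \<open>Local limit bounds and the mean path length\<close>

locale critical_stable_attraction = stable_attraction +
  assumes aperiodic: "aperiodic \<mu>" and mean: "(\<lambda>k. real k * pmf \<mu> k) sums 1"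
    and nondegenerate: "pmf \<mu> 0 + pmf \<mu> 1 < 1"
begin

abbreviation q :: "nat \<Rightarrow> nat \<Rightarrow> real" where "q n k \<equiv> fps_nth (offspring_fps \<mu> ^ n) k"

text \<open>From the Potter bound, as 1 / \<beta> < 1. It turns decay that is exponential in
  \<open>n\<close> into decay in s, which is at most pi times \<open>B n\<close>.\<close>

lemma scaling_le_linear:
  obtains C :: real where "C > 0" "\<forall>\<^sub>F n in sequentially. B n \<le> C * n"
proof -
  obtain C n0 where C: "C \<ge> 1" "n0 \<ge> 1" "\<And>m n. n0 \<le> m \<Longrightarrow> m \<le> n \<Longrightarrow> B n \<le> C * (n / m) powr (1 / \<beta>) * B m"
    using scaling_potter by metis
  have "\<forall>\<^sub>F n in sequentially. B n \<le> C * B n0 * n"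
    using eventually_ge_at_top[of n0]
  proof eventually_elim
    case (elim n)
    have "(n / n0) powr (1 / \<beta>) \<le> (n / n0) powr 1" using elim C(2) \<beta> by (intro powr_mono) auto
    also have "\<dots> \<le> n" using C(2) elim mult_left_mono[of 1 n0 "real n"] by (simp add: field_simps)
    finally have "C * (n / n0) powr (1 / \<beta>) * B n0 \<le> C * n * B n0"
      using C B_pos[of n0] by (intro mult_right_mono mult_left_mono) auto
    then show ?case using C(3)[of n0 n] elim by (simp add: mult_ac)
  qed
  then show ?thesis using that[of "C * B n0"] C B_pos[of n0] by simp
qed

lemma cos_defect_bounded_below:
  assumes "t0 > 0"
  obtains g where "g > 0" "\<And>t. t0 \<le> t \<Longrightarrow> t \<le> pi \<Longrightarrow> g \<le> G t"
proof (cases "t0 \<le> pi")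
  case True
  interpret N: real_distribution "symmetrized \<mu>" by (rule real_distribution_symmetrized)
  have "continuous_on {t0..pi} G" by (intro continuous_at_imp_continuous_on ballI N.isCont_cos_defect)
  then obtain t where t: "t \<in> {t0..pi}" "\<And>s. s \<in> {t0..pi} \<Longrightarrow> G t \<le> G s"
    using continuous_attains_inf[of "{t0..pi}" G] True by auto
  have "G t > 0"
    using t assms by (intro cos_defect_symmetrized_pos aperiodic pmf_0_pos mean nondegenerate) auto
  then show ?thesis using that t by auto
next
  case False
  then show ?thesis using that[of 1] by auto
qed

text \<open>An integrable majorant for the inversion integral, from three ranges. It is at least 1
  for |s| \<le> 1. Up to \<open>t0 * B n\<close> the growth |s|^\<beta> with \<beta> > 1 is more
  than enough. Beyond that, the defect is bounded away from 0 and \<open>B n\<close> is at most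
  linear.\<close>

lemma offspring_char_decay:
  obtains c where "c > 0"
    "\<forall>\<^sub>F n in sequentially. \<forall>s. \<bar>s\<bar> \<le> pi * B n \<longrightarrow> norm (offspring_char \<mu> (s / B n)) ^ n \<le> exp (c - c * \<bar>s\<bar>)"
proof -
  obtain t0 c1 where t0: "t0 > 0" and c1: "c1 > 0"
    and K: "\<And>t t'. 0 < t \<Longrightarrow> t \<le> t' \<Longrightarrow> t' \<le> t0 \<Longrightarrow> c1 * (t' / t) powr \<beta> * K t \<le> K t'"
    and GK: "\<And>t. 0 < t \<Longrightarrow> t \<le> t0 \<Longrightarrow> c1 * K t \<le> G t"
    using regular_scale by metis
  obtain g where g: "g > 0" "\<And>t. t0 \<le> t \<Longrightarrow> t \<le> pi \<Longrightarrow> g \<le> G t" using cos_defect_bounded_below[OF t0] by metis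
  obtain C :: real where C: "C > 0" "\<forall>\<^sub>F n in sequentially. B n \<le> C * n" by (rule scaling_le_linear)
  define a where "a = c1\<^sup>2 * (\<kappa> / 4)"
  have a: "a > 0" using c1 \<kappa>_pos by (simp add: a_def)
  define c where "c = min (a / 2) (g / (2 * (pi * C)))"
  have c: "c > 0" using a g C by (simp add: c_def)
  have "\<forall>\<^sub>F n in sequentially. \<forall>s. 1 \<le> s \<and> s \<le> t0 * B n \<longrightarrow> a * s powr \<beta> \<le> real n * G (s / B n)"
    unfolding a_def by (rule cos_defect_growth[OF t0 c1 K GK])
  then have "\<forall>\<^sub>F n in sequentially. \<forall>s. \<bar>s\<bar> \<le> pi * B n \<longrightarrow> norm (offspring_char \<mu> (s / B n)) ^ n \<le> exp (c - c * \<bar>s\<bar>)"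
    using C(2) eventually_ge_at_top[of 1]
  proof eventually_elim
    case (elim n)
    have Bn: "B n > 0" using elim B_pos by simp
    show ?case
    proof (intro allI impI)
      fix s assume s: "\<bar>s\<bar> \<le> pi * B n"
      have "c * \<bar>s\<bar> - c \<le> n * G (\<bar>s\<bar> / B n) / 2"
      proof -
        consider "\<bar>s\<bar> \<le> 1" | "1 \<le> \<bar>s\<bar>" "\<bar>s\<bar> \<le> t0 * B n" | "t0 * B n \<le> \<bar>s\<bar>" by linarith
        then show ?thesis
        proof cases
          case 1
          then have "c * \<bar>s\<bar> - c \<le> 0" using c mult_left_mono[of "\<bar>s\<bar>" 1 c] by simp
          also have "\<dots> \<le> n * G (\<bar>s\<bar> / B n) / 2" by (simp add: cos_defect_symmetrized_bounds)
          finally show ?thesis .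
        next
          case 2
          have "c * \<bar>s\<bar> - c \<le> c * \<bar>s\<bar>" using c by simp
          also have "\<dots> \<le> a / 2 * \<bar>s\<bar>" by (intro mult_right_mono) (auto simp: c_def)
          also have "\<dots> = a / 2 * \<bar>s\<bar> powr 1" by simp
          also have "\<dots> \<le> a / 2 * \<bar>s\<bar> powr \<beta>" using 2 a \<beta> by (intro mult_left_mono powr_mono) auto
          also have "\<dots> \<le> n * G (\<bar>s\<bar> / B n) / 2" using elim(1) 2 by simp
          finally show ?thesis .
        next
          case 3
          have "c * \<bar>s\<bar> - c \<le> c * \<bar>s\<bar>" using c by simp
          also have "\<dots> \<le> g / (2 * (pi * C)) * (pi * (C * n))"
            using s elim(2) c g C by (intro mult_mono order_trans[OF s] mult_left_mono) (auto simp: c_def)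
          also have "\<dots> = n * g / 2" using C by simp
          also have "\<dots> \<le> n * G (\<bar>s\<bar> / B n) / 2"
            using 3 s Bn by (intro divide_right_mono mult_left_mono g) (auto simp: field_simps)
          finally show ?thesis .
        qed
      qed
      moreover have "G (\<bar>s\<bar> / B n) = G (s / B n)"
        using cos_defect_abs[of "symmetrized \<mu>" "s / B n"] Bn by (simp add: abs_divide)
      ultimately have "- (n * G (s / B n) / 2) \<le> c - c * \<bar>s\<bar>" by simp
      then have "exp (- (n * G (s / B n) / 2)) \<le> exp (c - c * \<bar>s\<bar>)" by simp
      then show "norm (offspring_char \<mu> (s / B n)) ^ n \<le> exp (c - c * \<bar>s\<bar>)"
        using norm_offspring_char_power[of \<mu> "s / B n" n] by linarith
    qed
  qed
  then show ?thesis using that c by blast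
qed

lemma integrable_exp_abs:
  assumes "c > (0::real)"
  shows "integrable lborel (\<lambda>s. exp (c - c * \<bar>s\<bar>))"
proof -
  define h where "h s = indicator {0<..} s * exp (- c * s)" for s :: real
  have "integrable lborel h"
    using integrable_I0i_exp_mscale[of c] assms by (simp add: h_def[abs_def] set_integrable_def mult_ac)
  moreover have "integrable lborel (\<lambda>s. h (- s))"
    using lborel_integrable_real_affine[OF \<open>integrable lborel h\<close>, of "-1" 0] by simp
  ultimately have "integrable lborel (\<lambda>s. exp c * (h s + h (- s)))" by simp
  then show ?thesis
  proof (rule Bochner_Integration.integrable_bound)
    show "AE s in lborel. norm (exp (c - c * \<bar>s\<bar>)) \<le> norm (exp c * (h s + h (- s)))"
      using AE_lborel_singleton[of "0::real"]
      by eventually_elim (auto simp: h_def exp_diff exp_minus field_simps indicator_def)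
  qed simp
qed

lemma walk_local_upper:
  obtains C :: real where "C > 0" "\<forall>\<^sub>F n in sequentially. \<forall>k. q n k \<le> C / B n"
proof -
  obtain c where c: "c > 0"
    "\<forall>\<^sub>F n in sequentially. \<forall>s. \<bar>s\<bar> \<le> pi * B n \<longrightarrow> norm (offspring_char \<mu> (s / B n)) ^ n \<le> exp (c - c * \<bar>s\<bar>)"
    by (rule offspring_char_decay)
  define I where "I = (LBINT s. exp (c - c * \<bar>s\<bar>))"
  have I: "I \<ge> 0" unfolding I_def by (rule Bochner_Integration.integral_nonneg) simp
  have "\<forall>\<^sub>F n in sequentially. \<forall>k. q n k \<le> (I + 1) / (2 * pi) / B n"
    using c(2) eventually_ge_at_top[of 1]
  proof (eventually_elim, intro allI)
    fix n k assume n: "\<forall>s. \<bar>s\<bar> \<le> pi * B n \<longrightarrow> norm (offspring_char \<mu> (s / B n)) ^ n \<le> exp (c - c * \<bar>s\<bar>)" "1 \<le> n"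
    have Bn: "B n > 0" using n B_pos by simp
    have "2 * pi * B n * q n k \<le> I"
      unfolding offspring_fps_power_fourier_scaled[OF Bn] I_def
    proof (rule integral_mono_AE')
      show "integrable lborel (\<lambda>s. exp (c - c * \<bar>s\<bar>))" by (rule integrable_exp_abs[OF c(1)])
      show "AE s in lborel. indicator {- pi * B n..pi * B n} s * Re (offspring_char \<mu> (s / B n) ^ n * iexp (- s * real k / B n)) \<le> exp (c - c * \<bar>s\<bar>)"
      proof (rule AE_I2)
        fix s
        have "Re (offspring_char \<mu> (s / B n) ^ n * iexp (- s * real k / B n)) \<le> norm (offspring_char \<mu> (s / B n)) ^ n"
          using complex_Re_le_cmod[of "offspring_char \<mu> (s / B n) ^ n * iexp (- s * real k / B n)"]
          by (simp only: norm_mult norm_power norm_exp_i_times mult_1_right)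
        then show "indicator {- pi * B n..pi * B n} s * Re (offspring_char \<mu> (s / B n) ^ n * iexp (- s * real k / B n)) \<le> exp (c - c * \<bar>s\<bar>)"
          using n(1)[rule_format, of s] by (force simp: indicator_def abs_le_iff simp del: Re_exp times_complex.sel)
      qed
    qed auto
    then show "q n k \<le> (I + 1) / (2 * pi) / B n" using Bn by (simp add: field_simps)
  qed
  then show ?thesis using that[of "(I + 1) / (2 * pi)"] I by simp
qed

text \<open>The walk is centred at \<open>n\<close> but evaluated at \<open>n - 1\<close>; this only
  adds a phase tending to 1. The inversion integral then converges to that of \<open>Z\<close>,
  which is positive.\<close>

lemma walk_local_lower:
  obtains c where "c > 0" "\<forall>\<^sub>F n in sequentially. c / B n \<le> q n (n - 1)"
proof -
  obtain c where c: "c > 0"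
    "\<forall>\<^sub>F n in sequentially. \<forall>s. \<bar>s\<bar> \<le> pi * B n \<longrightarrow> norm (offspring_char \<mu> (s / B n)) ^ n \<le> exp (c - c * \<bar>s\<bar>)"
    by (rule offspring_char_decay)
  then obtain n0 where n0: "\<And>n s. n \<ge> n0 \<Longrightarrow> \<bar>s\<bar> \<le> pi * B n \<Longrightarrow> norm (offspring_char \<mu> (s / B n)) ^ n \<le> exp (c - c * \<bar>s\<bar>)"
    unfolding eventually_sequentially by blast
  define F where "F n s = indicator {- pi * B n..pi * B n} s * Re (offspring_char \<mu> (s / B n) ^ n * iexp (- s * real (n - 1) / B n))" for n s
  define I where "I = (LBINT s. Re (char Z s))"
  have I: "I > 0" unfolding I_def by (rule integral_Re_char_stable_law_pos[OF Z \<alpha>])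
  interpret Z: real_distribution Z using Z by (simp add: stable_law_def)
  \<comment> \<open>The majorant is available from \<open>n0\<close> on only, so the sequence is
    shifted before dominated convergence is applied.\<close>
  have "(\<lambda>n. F (n + max 1 n0) s) \<longlonglongrightarrow> Re (char Z s)" for s
  proof (rule LIMSEQ_ignore_initial_segment)
    have "(\<lambda>n. char (scaled_walk \<mu> B n) s) \<longlonglongrightarrow> char Z s"
      by (rule levy_continuity1[OF real_distribution_scaled_walk Z.real_distribution_axioms conv])
    moreover have "(\<lambda>n. s / B n) \<longlonglongrightarrow> 0"
      by (rule real_tendsto_divide_at_top[OF tendsto_const B_lim])
    then have "(\<lambda>n. iexp (s / B n)) \<longlonglongrightarrow> iexp 0" by (intro tendsto_intros)
    ultimately have "(\<lambda>n. Re (char (scaled_walk \<mu> B n) s * iexp (s / B n))) \<longlonglongrightarrow> Re (char Z s * iexp 0)"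
      by (intro tendsto_Re tendsto_mult)
    then have "(\<lambda>n. Re (char (scaled_walk \<mu> B n) s * iexp (s / B n))) \<longlonglongrightarrow> Re (char Z s)" by simp
    moreover have "\<forall>\<^sub>F n in sequentially. Re (char (scaled_walk \<mu> B n) s * iexp (s / B n)) = F n s"
      using B_lim[unfolded filterlim_at_top, rule_format, of "\<bar>s\<bar> / pi"] eventually_ge_at_top[of 1]
    proof eventually_elim
      case (elim n)
      then have "s \<in> {- pi * B n..pi * B n}" by (simp add: field_simps abs_le_iff)
      moreover have "iexp (- s * real n / B n) * iexp (s / B n) = iexp (- s * real (n - 1) / B n)"
      proof -
        have "- s * real n / B n + s / B n = - s * real (n - 1) / B n"
          using elim by (simp add: of_nat_diff add_divide_distrib[symmetric] algebra_simps)
        then show ?thesis by (simp only: exp_add[symmetric] distrib_left[symmetric] of_real_add[symmetric])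
      qed
      ultimately show ?case by (simp only: F_def char_scaled_walk mult.assoc indicator_simps mult_1_left)
    qed
    ultimately show "(\<lambda>n. F n s) \<longlonglongrightarrow> Re (char Z s)" by (rule Lim_transform_eventually)
  qed
  have "(\<lambda>n. LBINT s. F (n + max 1 n0) s) \<longlonglongrightarrow> I"
    unfolding I_def
  proof (rule integral_dominated_convergence[OF _ _ integrable_exp_abs[OF c(1)]])
    show "AE s in lborel. (\<lambda>n. F (n + max 1 n0) s) \<longlonglongrightarrow> Re (char Z s)"
      by (intro AE_I2) (rule \<open>\<And>s. (\<lambda>n. F (n + max 1 n0) s) \<longlonglongrightarrow> Re (char Z s)\<close>)
    show "AE s in lborel. norm (F (n + max 1 n0) s) \<le> exp (c - c * \<bar>s\<bar>)" for n
    proof (rule AE_I2)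
      fix s
      let ?n = "n + max 1 n0"
      define r where "r = Re (offspring_char \<mu> (s / B ?n) ^ ?n * iexp (- s * real (?n - 1) / B ?n))"
      have "\<bar>r\<bar> \<le> norm (offspring_char \<mu> (s / B ?n)) ^ ?n"
        using abs_Re_le_cmod[of "offspring_char \<mu> (s / B ?n) ^ ?n * iexp (- s * real (?n - 1) / B ?n)"]
        by (simp only: r_def norm_mult norm_power norm_exp_i_times mult_1_right)
      moreover have "\<bar>s\<bar> \<le> pi * B ?n \<Longrightarrow> norm (offspring_char \<mu> (s / B ?n)) ^ ?n \<le> exp (c - c * \<bar>s\<bar>)" by (rule n0) auto
      moreover have "F ?n s = indicator {- pi * B ?n..pi * B ?n} s * r" by (simp only: F_def r_def)
      ultimately show "norm (F ?n s) \<le> exp (c - c * \<bar>s\<bar>)" by (auto simp: indicator_def abs_le_iff)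
    qed
  qed (auto simp: F_def)
  then have "\<forall>\<^sub>F n in sequentially. I / 2 < (LBINT s. F (n + max 1 n0) s)"
    using order_tendstoD(1)[of _ I _ "I / 2"] I by simp
  then have "\<forall>\<^sub>F n in sequentially. I / 2 < (LBINT s. F n s)" 
    by (simp only: eventually_sequentially_seg[of "\<lambda>n. I / 2 < (LBINT s. F n s)" "max 1 n0"])
  then have "\<forall>\<^sub>F n in sequentially. I / (4 * pi) / B n \<le> q n (n - 1)"
    using eventually_ge_at_top[of 1]
  proof eventually_elim
    case (elim n)
    have Bn: "B n > 0" using elim B_pos by simp
    have "I / 2 < 2 * pi * B n * q n (n - 1)"
      using elim(1) unfolding F_def offspring_fps_power_fourier_scaled[OF Bn] .
    then show ?case using Bn by (simp add: field_simps)
  qed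
  then show ?thesis using that[of "I / (4 * pi)"] I by simp
qed

lemma offspring_fps_power_le_1: "q n k \<le> 1"
  using sum_le_suminf[OF sums_summable[OF offspring_fps_power_sums[of \<mu> n]], of "{k}"]
  by (simp add: offspring_fps_power_nonneg sums_unique[OF offspring_fps_power_sums, symmetric])

text \<open>The local upper bound at a time m \<le> n is expressed through \<open>B n\<close> by the
  Potter bound. This leaves a convolution of the powers (n / m)^(1 / \<beta>), which has order
  \<open>n\<close> because 1 / \<beta> < 1.\<close>

lemma walk_convolution_bound:
  obtains C :: real where "C > 0" "\<forall>\<^sub>F n in sequentially. (\<Sum>i=1..n. q i (i - 1) * q (n - i) (n - i)) \<le> C * n / (B n)\<^sup>2"
proof -
  obtain D where D: "D > 0" "\<forall>\<^sub>F n in sequentially. \<forall>k. q n k \<le> D / B n" by (rule walk_local_upper)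
  obtain A :: real where A: "A > 0" "\<forall>\<^sub>F n in sequentially. B n \<le> A * n" by (rule scaling_le_linear)
  obtain P n0 where P: "P \<ge> 1" "n0 \<ge> 1" "\<And>m n. n0 \<le> m \<Longrightarrow> m \<le> n \<Longrightarrow> B n \<le> P * (n / m) powr (1 / \<beta>) * B m"
    using scaling_potter by metis
  obtain n1 where n1: "\<And>n k. n \<ge> n1 \<Longrightarrow> q n k \<le> D / B n" using D(2) unfolding eventually_sequentially by blast
  define g where "g = 1 / \<beta>"
  have g: "0 < g" "g < 1" using \<beta> by (auto simp: g_def)
  define n2 where "n2 = max n0 n1"
  \<comment> \<open>The maximum with \<open>B n2\<close> makes the bound exceed 1 for small times,
    where only the trivial bound by 1 is available.\<close>
  define E where "E = P * max D (B n2)"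
  have E: "E > 0" using P D by (simp add: E_def less_max_iff_disj)
  have q: "q m k \<le> E / B n * (n / m) powr g" if "1 \<le> m" "m \<le> n" "n2 \<le> n" for m n k
  proof -
    have Bn: "B n > 0" "B m > 0" using that B_pos by auto
    show ?thesis
    proof (cases "n2 \<le> m")
      case True
      have "B n \<le> P * (n / m) powr g * B m" unfolding g_def using True that by (intro P) (auto simp: n2_def)
      then have "1 / B m \<le> P * (n / m) powr g / B n" using Bn by (simp add: field_simps)
      then have "D * (1 / B m) \<le> D * (P * (n / m) powr g / B n)" using D by (intro mult_left_mono) auto
      also have "\<dots> \<le> max D (B n2) * (P * (n / m) powr g / B n)" using P Bn by (intro mult_right_mono) auto
      finally have "D / B m \<le> E / B n * (n / m) powr g" by (simp add: E_def mult_ac)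
      then show ?thesis using n1[of m k] True by (simp add: n2_def)
    next
      case False
      have "B n \<le> P * (n / n2) powr g * B n2" unfolding g_def using that by (intro P) (auto simp: n2_def)
      also have "\<dots> \<le> P * (n / m) powr g * max D (B n2)"
        using False that P g D by (intro mult_mono mult_left_mono powr_mono2 divide_left_mono) (auto simp: le_max_iff_disj B_pos less_imp_le n2_def)
      finally have "1 \<le> E / B n * (n / m) powr g" using Bn by (simp add: E_def field_simps)
      then show ?thesis using offspring_fps_power_le_1[of m k] by linarith
    qed
  qed
  define C where "C = E\<^sup>2 * (4 / (1 - g)) + E * A"
  have "\<forall>\<^sub>F n in sequentially. (\<Sum>i=1..n. q i (i - 1) * q (n - i) (n - i)) \<le> C * n / (B n)\<^sup>2"
    using eventually_ge_at_top[of n2] eventually_ge_at_top[of 1] A(2)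
  proof eventually_elim
    case (elim n)
    have Bn: "B n > 0" using elim B_pos by simp
    \<comment> \<open>The term \<open>i = n\<close> pairs with a walk of length 0. It has order 1 /
      B n, and linear growth of \<open>B\<close> converts this into n / (B n)^2.\<close>
    have "{1..n} = insert n {1..<n}" using elim by auto
    then have "(\<Sum>i=1..n. q i (i - 1) * q (n - i) (n - i)) = q n (n - 1) + (\<Sum>i=1..<n. q i (i - 1) * q (n - i) (n - i))"
      by simp
    also have "(\<Sum>i=1..<n. q i (i - 1) * q (n - i) (n - i)) \<le> (\<Sum>i=1..<n. (E / B n * (n / i) powr g) * (E / B n * (n / real (n - i)) powr g))"
    proof (intro sum_mono mult_mono)
      fix i assume "i \<in> {1..<n}"
      then show "q i (i - 1) \<le> E / B n * (n / i) powr g" "q (n - i) (n - i) \<le> E / B n * (n / real (n - i)) powr g"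
        using elim by - (rule q; auto)+
    qed (use E Bn in \<open>auto simp: offspring_fps_power_nonneg\<close>)
    also have "\<dots> = (E / B n)\<^sup>2 * (\<Sum>i=1..<n. (n / i) powr g * (n / real (n - i)) powr g)"
      unfolding sum_distrib_left by (intro sum.cong refl) (simp add: power2_eq_square)
    also have "\<dots> \<le> (E / B n)\<^sup>2 * (4 / (1 - g) * n)" using elim g by (intro mult_left_mono sum_powr_convolution_le) auto
    also have "\<dots> = E\<^sup>2 * (4 / (1 - g)) * n / (B n)\<^sup>2" by (simp add: power_divide mult.commute)
    also have "q n (n - 1) \<le> E * A * n / (B n)\<^sup>2"
    proof -
      have "q n (n - 1) \<le> E / B n" using q[of n n "n - 1"] elim by simp
      also have "\<dots> = E * B n / (B n)\<^sup>2" using Bn by (simp add: power2_eq_square)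
      also have "\<dots> \<le> E * (A * n) / (B n)\<^sup>2" using elim E by (intro divide_right_mono mult_left_mono) auto
      finally show ?thesis by (simp add: mult.assoc)
    qed
    finally show ?case by (simp add: C_def add_divide_distrib ring_distribs)
  qed
  moreover have "C > 0" using E A g by (simp add: C_def add_pos_pos)
  ultimately show ?thesis using that by blast
qed

lemma mean_path_length_bounded:
  obtains C :: real where "C > 0"
    "\<And>n. measure (offspring_field \<mu>) (size_event \<mu> n) > 0 \<Longrightarrow>
      (\<Sum>V\<in>trees_of_size n. tree_weight \<mu> V * real (subtree_sum V)) \<le>
        C * n * (n / B n) * measure (offspring_field \<mu>) (size_event \<mu> n)"
proof -
  let ?p = "\<lambda>n. measure (offspring_field \<mu>) (size_event \<mu> n)"
  let ?S = "\<lambda>n. (\<Sum>V\<in>trees_of_size n. tree_weight \<mu> V * real (subtree_sum V))"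
  have p0: "pmf \<mu> 0 \<noteq> 0" using pmf_0_pos[OF mean nondegenerate] by simp
  have p: "n \<ge> 1 \<Longrightarrow> real n * ?p n = q n (n - 1)" for n
    unfolding measure_size_event by (rule tree_weight_sums(1)[OF p0])
  have S: "?S n = (\<Sum>i=1..n. q i (i - 1) * q (n - i) (n - i))" for n by (rule tree_weight_sums(2)[OF p0])
  have "trees_of_size 0 = {}" using card_finite_trees_pos by (auto simp: trees_of_size_def)
  then have "?p 0 = 0" by (simp add: measure_size_event)
  then have n_pos: "n \<ge> 1" if "?p n > 0" for n using that by (cases n) auto
  obtain D :: real where D: "D > 0" "\<forall>\<^sub>F n in sequentially. ?S n \<le> D * n / (B n)\<^sup>2"
    unfolding S by (rule walk_convolution_bound)
  obtain c where c: "c > 0" "\<forall>\<^sub>F n in sequentially. c / B n \<le> q n (n - 1)" by (rule walk_local_lower)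
  obtain n0 where n0: "\<And>n. n \<ge> n0 \<Longrightarrow> ?S n \<le> D * n / (B n)\<^sup>2 \<and> c / B n \<le> q n (n - 1)"
    using eventually_conj[OF D(2) c(2)] unfolding eventually_sequentially by blast
  \<comment> \<open>The ratio is at most \<open>D / c\<close> from \<open>n0\<close> on. The
    finitely many remaining values enter the constant through the maximum.\<close>
  define R where "R n = ?S n / (n * (n / B n) * ?p n)" for n
  define C where "C = Max (insert (D / c) (R ` {..<n0}))"
  have "D / c \<le> C" "\<And>n. n < n0 \<Longrightarrow> R n \<le> C" unfolding C_def by (intro Max_ge; simp)+
  then have "C > 0" using divide_pos_pos[OF D(1) c(1)] by linarith
  moreover have "?S n \<le> C * n * (n / B n) * ?p n" if n: "?p n > 0" for n
  proof -
    have Bn: "B n > 0" "n \<ge> 1" using n_pos[OF n] B_pos by auto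
    then have pos: "n * (n / B n) * ?p n > 0" using n by simp
    have "R n \<le> C"
    proof (cases "n < n0")
      case False
      have "?S n \<le> D * n / (B n)\<^sup>2" using n0[of n] False by simp
      also have "\<dots> = D / c * n / B n * (c / B n)" using c by (simp add: power2_eq_square)
      also have "\<dots> \<le> D / c * n / B n * (real n * ?p n)"
        using n0[of n] False Bn D c by (intro mult_left_mono) (auto simp: p)
      also have "\<dots> = D / c * (n * (n / B n) * ?p n)" by simp
      finally have "R n \<le> D / c" unfolding R_def using pos by (simp only: pos_divide_le_eq)
      then show ?thesis using \<open>D / c \<le> C\<close> by linarith
    qed fact
    then have "?S n \<le> C * (n * (n / B n) * ?p n)" unfolding R_def using pos by (simp only: pos_divide_le_eq)
    then show ?thesis by (simp add: mult.assoc)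
  qed
  ultimately show ?thesis using that by blast
qed

end

section \<open>Oscillations of the fragmentation process\<close>

abbreviation kept_edges :: "nat list set \<Rightarrow> (edge \<Rightarrow> bool) \<Rightarrow> edge set" where
  "kept_edges V P \<equiv> {e \<in> tree_edges V. P e}"

text \<open>Each edge is named by its lower end \<open>w\<close>. The path between \<open>u\<close>
  and \<open>v\<close> uses the edge above \<open>w\<close> exactly when \<open>w\<close> is an
  ancestor of one of them but not of the other, so connectivity becomes a condition on edges without
  any paths.\<close>

definition connected_in :: "nat list set \<Rightarrow> (edge \<Rightarrow> bool) \<Rightarrow> nat list \<Rightarrow> nat list \<Rightarrow> bool" where
  "connected_in V P u v \<longleftrightarrow> u \<in> V \<and> v \<in> V \<and>
     (\<forall>w\<in>V. w \<noteq> [] \<longrightarrow> prefix w u \<noteq> prefix w v \<longrightarrow> P (butlast w, w))"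

lemma prefix_butlast_iff: "x \<noteq> [] \<Longrightarrow> prefix w x \<longleftrightarrow> prefix w (butlast x) \<or> w = x"
  by (cases x rule: rev_cases) auto

text \<open>The only edge between the words extending \<open>w\<close> and the others is the edge
  above \<open>w\<close>; a path from one side to the other must cross it.\<close>

lemma path_separates:
  assumes "(u, v) \<in> (kept_edges V P \<union> (kept_edges V P)\<inverse>)\<^sup>*" "w \<noteq> []" "prefix w u \<noteq> prefix w v"
  shows "P (butlast w, w)"
  using assms(1,3)
proof (induction rule: rtrancl_induct)
  case (step x y)
  show ?case
  proof (cases "prefix w u = prefix w x")
    case True
    then have "prefix w x \<noteq> prefix w y" using step.prems by simp
    then show ?thesis using step.hyps(2)
      by (auto simp: tree_edges_def) (metis prefix_butlast_iff)+
  qed (use step.IH in blast)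
qed simp

lemma path_to_ancestor:
  assumes "c @ z \<in> gw_tree \<xi>"
    and "\<And>w. w \<in> gw_tree \<xi> \<Longrightarrow> prefix w (c @ z) \<Longrightarrow> \<not> prefix w c \<Longrightarrow> P (butlast w, w)"
  shows "(c, c @ z) \<in> (kept_edges (gw_tree \<xi>) P)\<^sup>*"
  using assms
proof (induction z rule: rev_induct)
  case (snoc j z)
  have "c @ z \<in> gw_tree \<xi>" using append_in_gw_treeD[of "c @ z" "[j]"] snoc.prems(1) by simp
  moreover have "P (butlast w, w)" if "w \<in> gw_tree \<xi>" "prefix w (c @ z)" "\<not> prefix w c" for w
    using snoc.prems(2)[OF that(1)] that by (metis append.assoc prefix_prefix)
  ultimately have "(c, c @ z) \<in> (kept_edges (gw_tree \<xi>) P)\<^sup>*" by (rule snoc.IH)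
  moreover have "P (butlast (c @ z @ [j]), c @ z @ [j])"
    by (rule snoc.prems(2)) (use snoc.prems(1) in auto)
  then have "(c @ z, c @ z @ [j]) \<in> kept_edges (gw_tree \<xi>) P"
    using snoc.prems(1) by (auto simp: tree_edges_def butlast_append intro!: exI[of _ "c @ z @ [j]"])
  ultimately show ?case by (rule rtrancl_into_rtrancl)
qed simp

text \<open>The longest common prefix is the meeting point: the edges from it down to
  \<open>u\<close> and \<open>v\<close> are those above the words that are prefixes of just one of
  the two.\<close>

lemma connected_in_iff:
  assumes "V = gw_tree \<xi>"
  shows "(u, v) \<in> V \<times> V \<and> (u, v) \<in> (kept_edges V P \<union> (kept_edges V P)\<inverse>)\<^sup>* \<longleftrightarrow> connected_in V P u v"
proof (intro iffI)
  assume "(u, v) \<in> V \<times> V \<and> (u, v) \<in> (kept_edges V P \<union> (kept_edges V P)\<inverse>)\<^sup>*"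
  then show "connected_in V P u v" using path_separates[of u v V P] by (auto simp: connected_in_def)
next
  assume *: "connected_in V P u v"
  define c where "c = longest_common_prefix u v"
  let ?R = "kept_edges V P \<union> (kept_edges V P)\<inverse>"
  have up: "(c, x) \<in> (kept_edges V P)\<^sup>*" if x: "x = u \<or> x = v" for x
  proof -
    have "prefix c x" using x by (auto simp: c_def longest_common_prefix_prefix1 longest_common_prefix_prefix2)
    then obtain z where z: "x = c @ z" by (auto simp: prefix_def)
    have "(c, c @ z) \<in> (kept_edges (gw_tree \<xi>) P)\<^sup>*"
    proof (rule path_to_ancestor)
      show "c @ z \<in> gw_tree \<xi>" using x z * assms by (auto simp: connected_in_def)
      fix w assume w: "w \<in> gw_tree \<xi>" "prefix w (c @ z)" "\<not> prefix w c"
      then have "\<not> (prefix w u \<and> prefix w v)" by (auto simp: c_def intro: longest_common_prefix_max_prefix)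
      moreover have "prefix w u \<or> prefix w v" using w x z by auto
      moreover have "w \<noteq> []" using w by auto
      ultimately show "P (butlast w, w)" using * w assms by (auto simp: connected_in_def)
    qed
    then show ?thesis using z assms by simp
  qed
  have 1: "(c, v) \<in> ?R\<^sup>*" using up[of v] by (meson UnCI in_mono rtrancl_mono subsetI)
  have "(c, u) \<in> ?R\<^sup>*" using up[of u] by (meson UnCI in_mono rtrancl_mono subsetI)
  moreover have "sym (?R\<^sup>*)" by (intro sym_rtrancl) (auto simp: sym_def)
  ultimately have "(u, c) \<in> ?R\<^sup>*" by (auto dest: symD)
  then show "(u, v) \<in> V \<times> V \<and> (u, v) \<in> ?R\<^sup>*"
    using 1 * by (auto simp: connected_in_def intro: rtrancl_trans)
qed

definition connected_rel :: "nat list set \<Rightarrow> (edge \<Rightarrow> bool) \<Rightarrow> (nat list \<times> nat list) set" where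
  "connected_rel V P = {(u, v). connected_in V P u v}"

lemma components_eq:
  assumes "V = gw_tree \<xi>"
  shows "components V (kept_edges V P) = V // connected_rel V P"
  unfolding components_def connected_rel_def connected_in_iff[OF assms, symmetric]
  by (rule arg_cong[where f = "(//) V"]) auto

lemma equiv_connected_rel: "equiv V (connected_rel V P)"
proof (rule equivI)
  show "refl_on V (connected_rel V P)"
    by (auto simp: refl_on_def connected_rel_def connected_in_def)
  show "sym (connected_rel V P)"
    by (auto simp: sym_def connected_rel_def connected_in_def)
  show "trans (connected_rel V P)"
    unfolding trans_def connected_rel_def connected_in_def by blast
  show "connected_rel V P \<subseteq> V \<times> V" 
    by (auto simp: connected_rel_def connected_in_def)
qed

lemma quotient_eq_class: "equiv A r \<Longrightarrow> c \<in> A // r \<Longrightarrow> u \<in> c \<Longrightarrow> c = r `` {u}"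
  by (metis Image_singleton_iff equiv_class_eq_iff quotientE)

lemma connected_rel_mono: "(\<And>e. P e \<Longrightarrow> Q e) \<Longrightarrow> connected_rel V P \<subseteq> connected_rel V Q"
  by (auto simp: connected_rel_def connected_in_def)

section \<open>Ranked component sizes by counting\<close>

lemma nth_ge_iff_length_filter:
  assumes "sorted_wrt (\<ge>) (xs :: nat list)"
  shows "i < length xs \<and> k \<le> xs ! i \<longleftrightarrow> i < length (filter (\<lambda>m. k \<le> m) xs)"
proof -
  have app: "length (filter (\<lambda>m. k \<le> m) xs) =
    length (filter (\<lambda>m. k \<le> m) (take j xs)) + length (filter (\<lambda>m. k \<le> m) (drop j xs))" for j
    by (metis append_take_drop_id filter_append length_append)
  show ?thesis
  proof
    assume *: "i < length xs \<and> k \<le> xs ! i"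
    have "k \<le> m" if m: "m \<in> set (take (Suc i) xs)" for m
    proof -
      obtain j where "j < length (take (Suc i) xs)" "m = take (Suc i) xs ! j"
        using m by (auto simp: in_set_conv_nth)
      then have j: "j \<le> i" "m = xs ! j" by auto
      then show ?thesis
        using sorted_wrt_nth_less[OF assms, of j i] * by (cases "j = i") auto
    qed
    then have "filter (\<lambda>m. k \<le> m) (take (Suc i) xs) = take (Suc i) xs" by (simp add: filter_id_conv)
    then show "i < length (filter (\<lambda>m. k \<le> m) xs)" using app[of "Suc i"] * by simp
  next
    assume *: "i < length (filter (\<lambda>m. k \<le> m) xs)"
    have len: "i < length xs" using * length_filter_le[of "\<lambda>m. k \<le> m" xs] by linarith
    moreover have "k \<le> xs ! i"
    proof (rule ccontr)
      assume "\<not> k \<le> xs ! i"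
      have "\<not> k \<le> m" if m: "m \<in> set (drop i xs)" for m
      proof -
        obtain j where "j < length xs - i" "m = xs ! (i + j)"
          using m len by (auto simp: in_set_conv_nth)
        moreover from this have "i + j < length xs" by linarith
        ultimately show ?thesis
          using sorted_wrt_nth_less[OF assms, of i "i + j"] \<open>\<not> k \<le> xs ! i\<close> by (cases "j = 0") auto
      qed
      then have "filter (\<lambda>m. k \<le> m) (drop i xs) = []" by (simp add: filter_empty_conv)
      then show False using app[of i] * len length_filter_le[of "\<lambda>m. k \<le> m" "take i xs"] by simp
    qed
    ultimately show "i < length xs \<and> k \<le> xs ! i" by blast
  qed
qed

text \<open>Trades sorting for counting: later bounds compare numbers of large components through
  injections. The case \<open>k = 0\<close> is excluded because \<open>ranked\<close> is 0 beyond
  the last entry.\<close>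

lemma ranked_ge_iff:
  assumes "k \<ge> 1"
  shows "k \<le> ranked M i \<longleftrightarrow> i < size (filter_mset (\<lambda>m. k \<le> m) M)"
proof -
  define xs where "xs = rev (sorted_list_of_multiset M)"
  have "sorted_wrt (\<ge>) xs"
    using sorted_sorted_list_of_multiset[of M] by (simp add: xs_def sorted_wrt_rev)
  from nth_ge_iff_length_filter[OF this, of i k]
  have "k \<le> ranked M i \<longleftrightarrow> i < length (filter (\<lambda>m. k \<le> m) xs)"
    using assms by (auto simp: ranked_def xs_def Let_def)
  also have "length (filter (\<lambda>m. k \<le> m) xs) = size (mset (filter (\<lambda>m. k \<le> m) xs))"
    by (rule size_mset[symmetric])
  also have "mset (filter (\<lambda>m. k \<le> m) xs) = filter_mset (\<lambda>m. k \<le> m) M"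
    by (simp add: xs_def mset_filter)
  finally show ?thesis .
qed

text \<open>Finiteness appears explicitly since \<open>mset_set\<close> of an infinite set is
  empty.\<close>

lemma ranked_component_ge_iff:
  assumes "k \<ge> 1" "V = gw_tree \<xi>"
  shows "k \<le> ranked (component_sizes V (kept_edges V P)) i \<longleftrightarrow>
    finite (V // connected_rel V P) \<and> i < card {c \<in> V // connected_rel V P. k \<le> card c}"
proof -
  have "size (filter_mset (\<lambda>m. k \<le> m) (component_sizes V (kept_edges V P))) =
    size (filter_mset (\<lambda>c. k \<le> card c) (mset_set (V // connected_rel V P)))"
    unfolding component_sizes_def components_eq[OF assms(2)] by (simp add: filter_mset_image_mset)
  also have "\<dots> = (if finite (V // connected_rel V P) then card {c \<in> V // connected_rel V P. k \<le> card c} else 0)"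
    by (simp add: filter_mset_mset_set)
  finally show ?thesis using ranked_ge_iff[OF assms(1)] by simp
qed

lemma ranked_antimono: "i \<le> j \<Longrightarrow> ranked M j \<le> ranked M i"
  using ranked_ge_iff[of "ranked M j" M j] ranked_ge_iff[of "ranked M j" M i]
  by (cases "ranked M j = 0") auto

lemma ranked_infinite: 
  assumes "V = gw_tree \<xi>" "infinite (V // connected_rel V P)"
  shows "ranked (component_sizes V (kept_edges V P)) i = 0"
  using ranked_component_ge_iff[of 1 V \<xi> P i] assms by simp

lemma sum_ranked_le: "(\<Sum>i<N. ranked M i) \<le> sum_mset M"
proof -
  define xs where "xs = rev (sorted_list_of_multiset M)"
  have "(\<Sum>i<N. ranked M i) = (\<Sum>i\<in>{..<N} \<inter> {..<length xs}. xs ! i)"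
    by (rule sum.mono_neutral_cong_right) (auto simp: ranked_def xs_def Let_def)
  also have "\<dots> \<le> (\<Sum>i<length xs. xs ! i)" by (rule sum_mono2) auto
  also have "\<dots> = sum_list xs" by (simp add: sum_list_sum_nth lessThan_atLeast0)
  also have "\<dots> = sum_mset (mset xs)" by (simp add: sum_mset_sum_list)
  also have "mset xs = M" by (simp add: xs_def)
  finally show ?thesis .
qed

section \<open>Effect of cuts on the ranked sizes\<close>

definition cut_size :: "nat list set \<Rightarrow> nat list \<Rightarrow> nat" where
  "cut_size V w = min (card (subtree V w)) (card V - card (subtree V w))"

lemma separated_small_side:
  assumes "finite V" "w \<in> V"
  obtains Z where "Z \<subseteq> V" "card Z = cut_size V w"
    "\<And>u v. u \<in> V \<Longrightarrow> v \<in> V \<Longrightarrow> prefix w u \<noteq> prefix w v \<Longrightarrow> u \<in> Z \<or> v \<in> Z"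
proof -
  have sub: "subtree V w \<subseteq> V" by (auto simp: subtree_def)
  show thesis
  proof (cases "card (subtree V w) \<le> card V - card (subtree V w)")
    case True
    then show ?thesis by (intro that[OF sub]) (auto simp: cut_size_def subtree_def)
  next
    case False
    then show ?thesis using assms sub
      by (intro that[of "V - subtree V w"]) (auto simp: cut_size_def subtree_def card_Diff_subset finite_subset)
  qed
qed

lemma card_one_side_le:
  assumes "finite V" "w \<in> V" "A \<subseteq> V" "B \<subseteq> V" "\<And>x. x \<in> A \<Longrightarrow> prefix w x" "\<And>x. x \<in> B \<Longrightarrow> \<not> prefix w x"
  shows "min (card A) (card B) \<le> cut_size V w"
proof -
  have sub: "subtree V w \<subseteq> V" by (auto simp: subtree_def)
  have "card A \<le> card (subtree V w)"
    using assms sub by (intro card_mono) (auto simp: subtree_def)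
  moreover have "card B \<le> card (V - subtree V w)"
    using assms by (intro card_mono) (auto simp: subtree_def)
  moreover have "card (V - subtree V w) = card V - card (subtree V w)"
    using assms sub by (intro card_Diff_subset) (auto intro: finite_subset)
  ultimately show ?thesis by (auto simp: cut_size_def)
qed

text \<open>Both bounds come from injections between large components. For the first, remove from a
  component for \<open>Q\<close> the smaller side of every newly cut edge: at most \<open>a\<close>
  vertices go, and the rest lies in one component for \<open>P\<close>. For the second, two
  components for \<open>P\<close> inside the same component for \<open>Q\<close> are separated by a
  newly cut edge, so one of them has at most \<open>a\<close> vertices; hence those larger than
  \<open>a\<close> lie in different components for \<open>Q\<close>.\<close>

lemma ranked_component_change:
  assumes V: "V = gw_tree \<xi>" "finite V" and PQ: "\<And>e. P e \<Longrightarrow> Q e"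
    and a: "(\<Sum>w | w \<in> V \<and> w \<noteq> [] \<and> Q (butlast w, w) \<and> \<not> P (butlast w, w). cut_size V w) \<le> a"
  shows "ranked (component_sizes V (kept_edges V Q)) i \<le> ranked (component_sizes V (kept_edges V P)) i + a"
    and "ranked (component_sizes V (kept_edges V P)) i \<le> ranked (component_sizes V (kept_edges V Q)) i + a"
proof -
  define D where "D = {w \<in> V. w \<noteq> [] \<and> Q (butlast w, w) \<and> \<not> P (butlast w, w)}"
  define RP where "RP = connected_rel V P"
  define RQ where "RQ = connected_rel V Q"
  have eP: "equiv V RP" and eQ: "equiv V RQ" unfolding RP_def RQ_def by (rule equiv_connected_rel)+
  have RPQ: "RP \<subseteq> RQ" unfolding RP_def RQ_def by (rule connected_rel_mono) (rule PQ)
  have fin: "finite (V // RP)" "finite (V // RQ)"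
    using V(2) equiv_type[OF eP] equiv_type[OF eQ] by (auto intro!: finite_quotient)
  have finc: "finite c" "c \<subseteq> V" if "c \<in> V // RP \<or> c \<in> V // RQ" for c
    using that in_quotient_imp_subset[OF eP] in_quotient_imp_subset[OF eQ] V(2) finite_subset by metis+
  have finD: "finite D" using V(2) by (simp add: D_def)
  have sep: "\<exists>w\<in>D. prefix w u \<noteq> prefix w v" if "(u, v) \<in> RQ" "(u, v) \<notin> RP" for u v
    using that by (auto simp: RP_def RQ_def connected_rel_def connected_in_def D_def)
  have same_side: "prefix w u = prefix w v" if "(u, v) \<in> RP" "w \<in> D" for u v w
    using that by (auto simp: RP_def connected_rel_def connected_in_def D_def)
  let ?q = "ranked (component_sizes V (kept_edges V Q)) i"
  let ?p = "ranked (component_sizes V (kept_edges V P)) i"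
  show "?q \<le> ?p + a"
  proof (cases "?q \<le> a")
    case False
    define k where "k = ?q - a"
    have k: "k \<ge> 1" "k + a = ?q" using False by (auto simp: k_def)
    have "\<forall>w. \<exists>Z. w \<in> D \<longrightarrow> Z \<subseteq> V \<and> card Z = cut_size V w \<and>
      (\<forall>u v. u \<in> V \<longrightarrow> v \<in> V \<longrightarrow> prefix w u \<noteq> prefix w v \<longrightarrow> u \<in> Z \<or> v \<in> Z)"
      using separated_small_side[OF V(2)] D_def by (metis (mono_tags, lifting) mem_Collect_eq)
    then obtain Zf where Zf: "\<And>w. w \<in> D \<Longrightarrow> Zf w \<subseteq> V" "\<And>w. w \<in> D \<Longrightarrow> card (Zf w) = cut_size V w"
      "\<And>w u v. w \<in> D \<Longrightarrow> u \<in> V \<Longrightarrow> v \<in> V \<Longrightarrow> prefix w u \<noteq> prefix w v \<Longrightarrow> u \<in> Zf w \<or> v \<in> Zf w"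
      by metis
    define Z where "Z = (\<Union>w\<in>D. Zf w)"
    have finZ: "finite Z" using Zf(1) V(2) finD by (auto simp: Z_def intro: finite_subset)
    have "card Z \<le> (\<Sum>w\<in>D. card (Zf w))" unfolding Z_def by (rule card_UN_le[OF finD])
    also have "\<dots> \<le> a" using a Zf(2) by (simp add: D_def)
    finally have cardZ: "card Z \<le> a" .
    have "\<exists>d. d \<in> V // RP \<and> d \<subseteq> c \<and> k \<le> card d" if c: "c \<in> V // RQ" "k + a \<le> card c" for c
    proof -
      have big: "k \<le> card (c - Z)" using diff_card_le_card_Diff[OF finZ, of c] cardZ c by linarith
      then have "c - Z \<noteq> {}" using k by (metis card.empty not_one_le_zero le_zero_eq)
      then obtain u where u: "u \<in> c" "u \<notin> Z" by blast
      have uV: "u \<in> V" using u finc(2)[of c] c by blast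
      have cu: "c = RQ `` {u}" by (rule quotient_eq_class[OF eQ c(1) u(1)])
      have "RP `` {u} \<subseteq> c" using RPQ by (auto simp: cu)
      moreover have "c - Z \<subseteq> RP `` {u}"
      proof
        fix x assume x: "x \<in> c - Z"
        then have "(u, x) \<in> RQ" "x \<in> V" using finc(2)[of c] c by (auto simp: cu)
        then show "x \<in> RP `` {u}" using sep[of u x] Zf(3)[of _ u x] u x uV by (auto simp: Z_def)
      qed
      then have "card (c - Z) \<le> card (RP `` {u})"
        using finc(1)[of "RP `` {u}"] uV by (intro card_mono) (auto intro: quotientI)
      ultimately show ?thesis using big uV by (intro exI[of _ "RP `` {u}"]) (auto intro: quotientI)
    qed
    then obtain g where g: "\<And>c. c \<in> V // RQ \<Longrightarrow> k + a \<le> card c \<Longrightarrow> g c \<in> V // RP \<and> g c \<subseteq> c \<and> k \<le> card (g c)"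
      by metis
    have "inj_on g {c \<in> V // RQ. k + a \<le> card c}"
    proof (rule inj_onI)
      fix c c' assume *: "c \<in> {c \<in> V // RQ. k + a \<le> card c}" "c' \<in> {c \<in> V // RQ. k + a \<le> card c}" "g c = g c'"
      then have "g c \<noteq> {}" using g[of c] k by auto
      then obtain x where "x \<in> c" "x \<in> c'" using g[of c] g[of c'] * by blast
      then show "c = c'" using quotient_disj[OF eQ, of c c'] * by blast
    qed
    then have "card {c \<in> V // RQ. k + a \<le> card c} \<le> card {c \<in> V // RP. k \<le> card c}"
      using fin g by (intro card_inj_on_le[of g]) auto
    moreover have "i < card {c \<in> V // RQ. k + a \<le> card c}"
      using ranked_component_ge_iff[OF _ V(1), of "k + a" Q i] k by (simp add: RQ_def)
    ultimately have "k \<le> ?p"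
      using ranked_component_ge_iff[OF k(1) V(1), of P i] fin by (simp add: RP_def)
    then show ?thesis using k by linarith
  qed simp
  show "?p \<le> ?q + a"
  proof (cases "?p \<le> a")
    case False
    define k where "k = ?p"
    have k: "k \<ge> 1" "a < k" using False by (auto simp: k_def)
    define g where "g d = RQ `` d" for d
    have g: "g d \<in> V // RQ" "d \<subseteq> g d" "u \<in> d \<Longrightarrow> g d = RQ `` {u}" if d: "d \<in> V // RP" for d u
    proof -
      have *: "g d = RQ `` {u}" if "u \<in> d" for u
      proof -
        have "d = RP `` {u}" by (rule quotient_eq_class[OF eP d that])
        then have ud: "(u, x) \<in> RQ" if "x \<in> d" for x using that RPQ by auto
        have "trans RQ" using eQ by (simp add: equiv_def)
        then show ?thesis using \<open>u \<in> d\<close> ud unfolding g_def by (blast dest: transD)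
      qed
      obtain u0 where u0: "u0 \<in> d" "u0 \<in> V" using d eP finc(2)[of d] in_quotient_imp_non_empty[OF eP d] by blast
      show "g d \<in> V // RQ" using *[OF u0(1)] u0(2) by (auto intro: quotientI)
      show "d \<subseteq> g d" unfolding g_def using finc(2)[of d] d eQ by (auto simp: equiv_def refl_on_def)
      show "u \<in> d \<Longrightarrow> g d = RQ `` {u}" by (rule *)
    qed
    have "inj_on g {c \<in> V // RP. k \<le> card c}"
    proof (rule inj_onI, rule ccontr)
      fix c c' assume *: "c \<in> {c \<in> V // RP. k \<le> card c}" "c' \<in> {c \<in> V // RP. k \<le> card c}" "g c = g c'" "c \<noteq> c'"
      obtain u v where u: "u \<in> c" and v: "v \<in> c'" using k * by (metis (no_types, lifting) card.empty ex_in_conv mem_Collect_eq not_one_le_zero order_trans)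
      have "(u, v) \<in> RQ" using g(2)[of c'] g(3)[of c u] * u v by auto
      moreover have cu: "c = RP `` {u}" and cv: "c' = RP `` {v}"
        using * u v quotient_eq_class[OF eP, of c u] quotient_eq_class[OF eP, of c' v] by blast+
      then have "(u, v) \<notin> RP" using *(4) eP by (metis equiv_class_eq)
      ultimately obtain w where w: "w \<in> D" "prefix w u \<noteq> prefix w v" using sep by blast
      have 1: "prefix w x = prefix w u" if "x \<in> c" for x using same_side[of u x w] that w by (auto simp: cu)
      have 2: "prefix w x = prefix w v" if "x \<in> c'" for x using same_side[of v x w] that w by (auto simp: cv)
      have "min (card c) (card c') \<le> cut_size V w"
      proof (cases "prefix w u")
        case True
        then show ?thesis using 1 2 w finc(2) * by (intro card_one_side_le V(2)) (auto simp: D_def)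
      next
        case False
        have "min (card c') (card c) \<le> cut_size V w"
          using 1 2 w finc(2) * False by (intro card_one_side_le V(2)) (auto simp: D_def)
        then show ?thesis by (simp add: min.commute)
      qed
      also have "cut_size V w \<le> (\<Sum>w\<in>D. cut_size V w)" by (rule member_le_sum) (use w finD in auto)
      also have "\<dots> \<le> a" using a by (simp add: D_def)
      finally show False using * k by auto
    qed
    moreover have "k \<le> card (g c)" if "c \<in> V // RP" "k \<le> card c" for c
      using card_mono[OF finc(1)[of "g c"] g(2)[OF that(1)]] g(1)[OF that(1)] that(2) by linarith
    ultimately have "card {c \<in> V // RP. k \<le> card c} \<le> card {c \<in> V // RQ. k \<le> card c}"
      using fin g(1) by (intro card_inj_on_le[of g]) auto
    moreover have "i < card {c \<in> V // RP. k \<le> card c}"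
      using ranked_component_ge_iff[OF _ V(1), of k P i] k by (simp add: RP_def k_def)
    ultimately have "k \<le> ?q"
      using ranked_component_ge_iff[OF k(1) V(1), of Q i] fin by (simp add: RQ_def)
    then show ?thesis by (simp add: k_def)
  qed simp
qed

text \<open>Each condition now involves finitely many coordinates only, which shows that the set is
  closed in the product topology.\<close>

lemma mass_partitions_iff:
  "x \<in> mass_partitions \<longleftrightarrow> decseq x \<and> (\<forall>i. 0 \<le> x i) \<and> (\<forall>N. (\<Sum>i<N. x i) \<le> 1)"
proof (intro iffI conjI allI)
  assume x: "x \<in> mass_partitions"
  fix N
  have "(\<Sum>i<N. x i) \<le> suminf x" using x by (intro sum_le_suminf) (auto simp: mass_partitions_def)
  then show "(\<Sum>i<N. x i) \<le> 1" using x by (auto simp: mass_partitions_def)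
next
  assume x: "decseq x \<and> (\<forall>i. 0 \<le> x i) \<and> (\<forall>N. (\<Sum>i<N. x i) \<le> 1)"
  then have "summable x" by (intro summableI_nonneg_bounded[of x 1]) auto
  then show "x \<in> mass_partitions" using x by (auto simp: mass_partitions_def intro: suminf_le_const)
qed (auto simp: mass_partitions_def)

lemma compact_mass_partitions: "compact mass_partitions"
proof -
  have eq: "mass_partitions = {f. \<forall>i. f i \<in> {0..1}} \<inter>
    ((\<Inter>i. {x. x (Suc i) \<le> x i}) \<inter> (\<Inter>N. {x. (\<Sum>i<N. x i) \<le> 1}))" (is "_ = _ \<inter> ?C")
  proof -
    have "x i \<le> 1" if "\<forall>i. 0 \<le> x i" "\<forall>N. (\<Sum>i<N. x i) \<le> 1" for x :: "nat \<Rightarrow> real" and i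
    proof -
      have "x i \<le> (\<Sum>i<Suc i. x i)" by (rule member_le_sum) (use that in auto)
      then show ?thesis using that(2) by (meson order_trans)
    qed
    then show ?thesis by (auto simp: mass_partitions_iff decseq_Suc_iff)
  qed
  have "closed ?C"
    by (intro closed_Int closed_INT ballI closed_Collect_le continuous_on_sum continuous_on_product_coordinates
        continuous_on_const)
  moreover have "compact {f :: nat \<Rightarrow> real. \<forall>i. f i \<in> {0..1}}" by (rule compact_functions_into) simp
  ultimately show ?thesis unfolding eq by (intro compact_Int_closed)
qed

text \<open>The factor 2 is the sum of the weights (1/2)^n in the product metric.\<close>

lemma dist_le_coordinatewise:
  fixes x y :: "nat \<Rightarrow> real"
  assumes "\<And>i. \<bar>x i - y i\<bar> \<le> r"
  shows "dist x y \<le> 2 * r"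
proof -
  have s: "summable (\<lambda>n. (1/2::real) ^ n)" by (rule summable_geometric) auto
  have "r \<ge> 0" using assms[of 0] by linarith
  have "dist x y = (\<Sum>n. (1/2) ^ n * min (dist (x (from_nat n)) (y (from_nat n))) 1)"
    by (simp add: dist_fun_def)
  also have "\<dots> \<le> (\<Sum>n. (1/2) ^ n * r)"
  proof (rule suminf_le)
    show "summable (\<lambda>n. (1/2) ^ n * r)" using s by (rule summable_mult2)
    show "summable (\<lambda>n. (1/2) ^ n * min (dist (x (from_nat n)) (y (from_nat n))) 1)"
      by (rule summable_comparison_test'[OF s]) (auto simp: mult_left_le)
    fix n
    have "min (dist (x (from_nat n)) (y (from_nat n))) 1 \<le> r"
      using assms[of "from_nat n"] by (simp add: dist_real_def)
    then show "(1/2) ^ n * min (dist (x (from_nat n)) (y (from_nat n))) 1 \<le> (1/2) ^ n * r"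
      by (intro mult_left_mono) auto
  qed
  also have "\<dots> = 2 * r" using s by (simp add: suminf_mult2[symmetric] suminf_geometric)
  finally show ?thesis .
qed

section \<open>Measurability of the process on all configurations\<close>

type_synonym marked_field = "(nat list \<Rightarrow> nat) \<times> (edge \<Rightarrow> real)"

definition survives :: "(nat \<Rightarrow> real) \<Rightarrow> nat \<Rightarrow> marked_field \<Rightarrow> real \<Rightarrow> edge \<Rightarrow> bool" where
  "survives B n w t e \<longleftrightarrow> \<not> deletion_time B n (snd w) e \<le> t"

definition conn_at :: "(nat \<Rightarrow> real) \<Rightarrow> nat \<Rightarrow> marked_field \<Rightarrow> real \<Rightarrow> (nat list \<times> nat list) set" where
  "conn_at B n w t = connected_rel (gw_tree (fst w)) (survives B n w t)"

definition fin_at :: "(nat \<Rightarrow> real) \<Rightarrow> nat \<Rightarrow> marked_field \<Rightarrow> real \<Rightarrow> bool" where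
  "fin_at B n w t \<longleftrightarrow> finite (gw_tree (fst w) // conn_at B n w t)"

definition masses_at :: "(nat \<Rightarrow> real) \<Rightarrow> nat \<Rightarrow> marked_field \<Rightarrow> real \<Rightarrow> nat \<Rightarrow> real" where
  "masses_at B n w t i = real (ranked (component_sizes (gw_tree (fst w))
     (kept_edges (gw_tree (fst w)) (survives B n w t))) i) / real n"

lemma fragmentation_process_eq: "fragmentation_process B n w = restrict (masses_at B n w) {0..}"
  by (cases w) (simp add: fragmentation_process_def masses_at_def[abs_def] survives_def[abs_def])

lemma equiv_conn_at: "equiv (gw_tree (fst w)) (conn_at B n w t)"
  unfolding conn_at_def by (rule equiv_connected_rel)

lemma conn_at_antimono: "s \<le> t \<Longrightarrow> conn_at B n w t \<subseteq> conn_at B n w s"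
  unfolding conn_at_def by (rule connected_rel_mono) (auto simp: survives_def)

lemma fin_at_antimono: "s \<le> t \<Longrightarrow> fin_at B n w t \<Longrightarrow> fin_at B n w s"
  unfolding fin_at_def by (rule finite_refines_finite[OF _ conn_at_antimono equiv_conn_at equiv_conn_at])

lemma masses_at_cong: "conn_at B n w s = conn_at B n w t \<Longrightarrow> masses_at B n w s = masses_at B n w t"
  by (auto simp: masses_at_def component_sizes_def components_eq conn_at_def)

lemma masses_at_not_fin: "\<not> fin_at B n w t \<Longrightarrow> masses_at B n w t = (\<lambda>i. 0)"
  using ranked_infinite[OF refl] by (auto simp: masses_at_def fin_at_def conn_at_def)

lemma decseq_masses_at: "decseq (masses_at B n w t)"
  unfolding masses_at_def decseq_def by (auto intro!: divide_right_mono ranked_antimono)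

text \<open>Representatives in a list replace sets of classes: lists over a countable type are
  countable in number, so the condition is measurable in the relation.\<close>

lemma finite_quotient_iff:
  assumes "equiv V R"
  shows "finite (V // R) \<longleftrightarrow> (\<exists>us. \<forall>v\<in>V. \<exists>u\<in>set us. (u, v) \<in> R)"
proof
  assume "finite (V // R)"
  then obtain cs where cs: "set cs = V // R" using finite_list by blast
  have "\<exists>u\<in>set (map (\<lambda>c. SOME u. u \<in> c) cs). (u, v) \<in> R" if "v \<in> V" for v
  proof -
    have *: "R `` {v} \<in> set cs" "v \<in> R `` {v}"
      using that cs quotientI[OF that] equiv_class_self[OF assms that] by simp_all
    have "(SOME u. u \<in> R `` {v}) \<in> R `` {v}" using *(2) by (rule someI)
    then have "((SOME u. u \<in> R `` {v}), v) \<in> R" using assms by (auto simp: equiv_def dest: symD)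
    then show ?thesis using *(1) by force
  qed
  then show "\<exists>us. \<forall>v\<in>V. \<exists>u\<in>set us. (u, v) \<in> R" by blast
next
  assume "\<exists>us. \<forall>v\<in>V. \<exists>u\<in>set us. (u, v) \<in> R"
  then obtain us where us: "\<forall>v\<in>V. \<exists>u\<in>set us. (u, v) \<in> R" by blast
  have "V // R \<subseteq> (\<lambda>u. R `` {u}) ` set us"
  proof
    fix c assume "c \<in> V // R"
    then obtain v where "v \<in> V" "c = R `` {v}" by (auto elim: quotientE)
    moreover from this obtain u where "u \<in> set us" "(u, v) \<in> R" using us by blast
    ultimately show "c \<in> (\<lambda>u. R `` {u}) ` set us" using equiv_class_eq[OF assms] by auto
  qed
  then show "finite (V // R)" by (rule finite_subset) simp
qed

text \<open>Again a reduction to countable quantifiers, with a list of pairwise inequivalent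
  representatives. An infinite class has \<open>card\<close> 0, so a class of size at least
  \<open>k\<close> is finite and can be listed as \<open>xs\<close>.\<close>

lemma card_quotient_gt_iff:
  assumes "equiv V R" "finite (V // R)" "k \<ge> 1"
  shows "i < card {c \<in> V // R. k \<le> card c} \<longleftrightarrow> (\<exists>us. length us = Suc i \<and>
    (\<forall>u\<in>set us. u \<in> V \<and> (\<exists>xs. (\<forall>v. (u, v) \<in> R \<longleftrightarrow> v \<in> set xs) \<and> k \<le> card (set xs))) \<and>
    (\<forall>a b. a < b \<longrightarrow> b < length us \<longrightarrow> (us ! a, us ! b) \<notin> R))" (is "?L \<longleftrightarrow> ?R")
proof
  assume ?L
  then obtain C where C: "C \<subseteq> {c \<in> V // R. k \<le> card c}" "card C = Suc i" "finite C"
    by (rule obtain_subset_with_card_n[OF Suc_leI])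
  then obtain cs where cs: "set cs = C" "distinct cs" using finite_distinct_list by blast
  define f where "f c = (SOME u. u \<in> c)" for c :: "'a set"
  have f: "f c \<in> c" "c = R `` {f c}" "f c \<in> V" if "c \<in> C" for c
  proof -
    have c: "c \<in> V // R" using C that by auto
    show "f c \<in> c" using in_quotient_imp_non_empty[OF assms(1) c] by (auto simp: f_def intro: someI)
    then show "c = R `` {f c}" "f c \<in> V"
      using quotient_eq_class[OF assms(1) c] in_quotient_imp_subset[OF assms(1) c] by auto
  qed
  show ?R
  proof (rule exI[of _ "map f cs"], intro conjI ballI allI impI)
    show "length (map f cs) = Suc i" using cs C distinct_card[of cs] by simp
    fix u assume "u \<in> set (map f cs)"
    then obtain c where c: "c \<in> C" "u = f c" using cs by auto
    then show "u \<in> V" using f by simp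
    have "k \<le> card c" using C c by auto
    then have "finite c" using assms(3) card.infinite[of c] by fastforce
    then obtain xs where "set xs = c" using finite_list by blast
    then show "\<exists>xs. (\<forall>v. (u, v) \<in> R \<longleftrightarrow> v \<in> set xs) \<and> k \<le> card (set xs)"
      using f(2)[OF c(1)] c \<open>k \<le> card c\<close> by (intro exI[of _ xs]) auto
  next
    fix a b assume ab: "a < b" "b < length (map f cs)"
    then have *: "cs ! a \<in> C" "cs ! b \<in> C" "cs ! a \<noteq> cs ! b"
      using cs by (auto simp: nth_eq_iff_index_eq)
    have "(f (cs ! a), f (cs ! b)) \<notin> R"
      using f(2)[OF *(1)] f(2)[OF *(2)] *(3) equiv_class_eq[OF assms(1), of "f (cs ! a)" "f (cs ! b)"] by metis
    then show "(map f cs ! a, map f cs ! b) \<notin> R" using ab by simp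
  qed
next
  assume ?R
  then obtain us where us: "length us = Suc i"
    "\<And>u. u \<in> set us \<Longrightarrow> u \<in> V" "\<And>u. u \<in> set us \<Longrightarrow> \<exists>xs. (\<forall>v. (u, v) \<in> R \<longleftrightarrow> v \<in> set xs) \<and> k \<le> card (set xs)"
    "\<And>a b. a < b \<Longrightarrow> b < length us \<Longrightarrow> (us ! a, us ! b) \<notin> R" by blast
  define cs where "cs = map (\<lambda>u. R `` {u}) us"
  have "distinct cs"
    unfolding distinct_conv_nth
  proof (intro allI impI)
    have *: "cs ! a \<noteq> cs ! b" if "a < b" "b < length cs" for a b
      using us(4)[OF that(1)] us(2)[of "us ! b"] that assms(1)
      by (auto simp: cs_def dest!: eq_equiv_class[rotated])
    fix a b assume "a < length cs" "b < length cs" "a \<noteq> b"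
    then show "cs ! a \<noteq> cs ! b" using *[of a b] *[of b a] by (metis linorder_neqE_nat)
  qed
  moreover have "set cs \<subseteq> {c \<in> V // R. k \<le> card c}"
  proof
    fix c assume "c \<in> set cs"
    then obtain u where u: "u \<in> set us" "c = R `` {u}" by (auto simp: cs_def)
    then obtain xs where xs: "\<forall>v. (u, v) \<in> R \<longleftrightarrow> v \<in> set xs" "k \<le> card (set xs)" using us(3) by blast
    then have "c = set xs" using u by auto
    moreover have "c \<in> V // R" using u us(2) quotientI[of u V R] by simp
    ultimately show "c \<in> {c \<in> V // R. k \<le> card c}" using xs by simp
  qed
  then have "card (set cs) \<le> card {c \<in> V // R. k \<le> card c}" using assms(2) by (intro card_mono) auto
  ultimately show ?L using us(1) distinct_card[of cs] by (simp add: cs_def)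
qed

text \<open>The sigma-algebra common to all \<open>fragmentation_space\<close>s, so that
  measurability can be settled without reference to \<mu> and n.\<close>

definition frag_sigma :: "marked_field measure" where
  "frag_sigma = (\<Pi>\<^sub>M u\<in>UNIV. count_space UNIV) \<Otimes>\<^sub>M (\<Pi>\<^sub>M e\<in>UNIV. borel)"

lemma sets_fragmentation_space: "sets (fragmentation_space \<mu> n) = sets frag_sigma"
  unfolding fragmentation_space_def conditioned_offspring_field_def frag_sigma_def offspring_field_def
  by (intro sets_pair_measure_cong) (auto intro!: sets_PiM_cong simp: sets_measure_pmf)

lemma space_frag_sigma [simp]: "space frag_sigma = UNIV"
  by (simp add: frag_sigma_def space_pair_measure space_PiM)

lemma offspring_measurable [measurable]: "(\<lambda>w. fst w u) \<in> measurable frag_sigma (count_space UNIV)"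
  unfolding frag_sigma_def by measurable

lemma mark_measurable [measurable]: "(\<lambda>w. snd w e) \<in> borel_measurable frag_sigma"
  unfolding frag_sigma_def by measurable

lemma in_gw_tree_measurable [measurable]: "Measurable.pred frag_sigma (\<lambda>w. u \<in> gw_tree (fst w))"
  unfolding gw_tree_def mem_Collect_eq by measurable

context
  fixes B :: "nat \<Rightarrow> real" and n :: nat and \<tau> :: "marked_field \<Rightarrow> real"
  assumes \<tau> [measurable]: "\<tau> \<in> borel_measurable frag_sigma"
begin

text \<open>The time \<tau> is random because the explosion time will be substituted for it.\<close>

lemma conn_at_measurable [measurable]: "Measurable.pred frag_sigma (\<lambda>w. (u, v) \<in> conn_at B n w (\<tau> w))"
  unfolding conn_at_def connected_rel_def connected_in_def survives_def deletion_time_def Ball_def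
    mem_Collect_eq case_prod_conv
  by measurable

lemma fin_at_measurable [measurable]: "Measurable.pred frag_sigma (\<lambda>w. fin_at B n w (\<tau> w))"
  unfolding fin_at_def finite_quotient_iff[OF equiv_conn_at] Ball_def Bex_def by measurable

lemma masses_at_measurable [measurable]: "(\<lambda>w. masses_at B n w (\<tau> w) i) \<in> borel_measurable frag_sigma"
proof -
  define r where "r w = ranked (component_sizes (gw_tree (fst w))
     (kept_edges (gw_tree (fst w)) (survives B n w (\<tau> w)))) i" for w
  have "{w \<in> space frag_sigma. a \<le> real (r w)} \<in> sets frag_sigma" for a
  proof (cases "a \<le> 0")
    case True
    then have "{w \<in> space frag_sigma. a \<le> real (r w)} = space frag_sigma" by (auto intro: order_trans)
    then show ?thesis by (simp only: sets.top)
  next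
    case False
    define k where "k = nat \<lceil>a\<rceil>"
    have k: "k \<ge> 1" "a \<le> real m \<longleftrightarrow> k \<le> m" for m using False by (auto simp: k_def) linarith+
    have eq: "k \<le> r w \<longleftrightarrow> fin_at B n w (\<tau> w) \<and> (\<exists>us. length us = Suc i \<and>
      (\<forall>u\<in>set us. u \<in> gw_tree (fst w) \<and> (\<exists>xs. (\<forall>v. (u, v) \<in> conn_at B n w (\<tau> w) \<longleftrightarrow> v \<in> set xs) \<and> k \<le> card (set xs))) \<and>
      (\<forall>a b. a < b \<longrightarrow> b < length us \<longrightarrow> (us ! a, us ! b) \<notin> conn_at B n w (\<tau> w)))" for w
      unfolding r_def ranked_component_ge_iff[OF k(1) refl] fin_at_def conn_at_def
      using card_quotient_gt_iff[OF equiv_connected_rel _ k(1)] by blast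
    have "Measurable.pred frag_sigma (\<lambda>w. k \<le> r w)" unfolding eq Ball_def by measurable
    then show ?thesis unfolding k(2) by (simp add: pred_def)
  qed
  then have "(\<lambda>w. real (r w)) \<in> borel_measurable frag_sigma" by (simp add: borel_measurable_iff_ge)
  then show ?thesis unfolding masses_at_def r_def by measurable
qed

end

text \<open>If finitely many components remain at a later time \<open>q\<close>, the relation
  between \<open>t\<close> and \<open>q\<close> is determined by finitely many representatives. Two
  vertices connected at \<open>t\<close> are joined by finitely many edges, each deleted strictly
  after \<open>t\<close>, so all relevant connections persist for a while.\<close>

lemma right_continuous_masses_at:
  assumes "t < q" "fin_at B n w q"
  shows "\<forall>\<^sub>F s in at_right t. masses_at B n w s = masses_at B n w t"
proof -
  define V where "V = gw_tree (fst w)"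
  let ?R = "conn_at B n w"
  obtain us where us: "\<And>v. v \<in> V \<Longrightarrow> \<exists>u\<in>set us. (u, v) \<in> ?R q"
    using assms(2) unfolding fin_at_def finite_quotient_iff[OF equiv_conn_at] V_def by blast
  have ev: "\<forall>\<^sub>F s in at_right t. (u, v) \<in> ?R s" if uv: "(u, v) \<in> ?R t" for u v
  proof -
    define D where "D = {x. x \<noteq> [] \<and> prefix x u \<noteq> prefix x v}"
    have "D \<subseteq> set (prefixes u) \<union> set (prefixes v)" by (auto simp: D_def)
    then have "finite D" by (rule finite_subset) simp
    have "\<forall>\<^sub>F s in at_right t. x \<in> V \<longrightarrow> survives B n w s (butlast x, x)" if "x \<in> D" for x
    proof (cases "x \<in> V")
      case True
      then have "t < deletion_time B n (snd w) (butlast x, x)"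
        using uv that by (auto simp: conn_at_def connected_rel_def connected_in_def survives_def V_def D_def)
      then show ?thesis unfolding survives_def
        by (auto simp: eventually_at_right_field not_le intro!: exI[of _ "deletion_time B n (snd w) (butlast x, x)"])
    qed simp
    then have "\<forall>\<^sub>F s in at_right t. \<forall>x\<in>D. x \<in> V \<longrightarrow> survives B n w s (butlast x, x)"
      using \<open>finite D\<close> by (simp add: eventually_ball_finite)
    then show ?thesis
    proof eventually_elim
      case (elim s)
      then show ?case using uv
        by (auto simp: conn_at_def connected_rel_def connected_in_def V_def D_def)
    qed
  qed
  have "\<forall>\<^sub>F s in at_right t. \<forall>p\<in>(set us \<times> set us) \<inter> ?R t. p \<in> ?R s"
    using ev by (intro eventually_ball_finite) auto
  moreover have "\<forall>\<^sub>F s in at_right t. s < q" using assms(1) by (rule order_tendstoD(2)[OF tendsto_ident_at])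
  moreover have "\<forall>\<^sub>F s in at_right t. t < s" by (rule eventually_at_right_less)
  ultimately show ?thesis
  proof eventually_elim
    case (elim s)
    have sub: "?R s \<subseteq> ?R t" "?R q \<subseteq> ?R s" "?R q \<subseteq> ?R t"
      using elim by (auto intro!: conn_at_antimono)
    have tr: "trans (?R r)" "sym (?R r)" for r using equiv_conn_at by (auto simp: equiv_def)
    have "?R t \<subseteq> ?R s"
    proof
      fix p assume p: "p \<in> ?R t"
      obtain x y where xy: "p = (x, y)" by (cases p)
      have "x \<in> V" "y \<in> V" using p by (auto simp: xy conn_at_def connected_rel_def connected_in_def V_def)
      then obtain u v where uv: "u \<in> set us" "v \<in> set us" "(u, x) \<in> ?R q" "(v, y) \<in> ?R q" using us by blast
      have "(u, y) \<in> ?R t" using tr(1) uv(3) sub(3) p xy by (blast dest: transD)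
      moreover have "(y, v) \<in> ?R t" using tr(2) uv(4) sub(3) by (blast dest: symD)
      ultimately have "(u, v) \<in> ?R t" using tr(1) by (blast dest: transD)
      then have "(u, v) \<in> ?R s" using elim(1) uv by blast
      then have "(u, y) \<in> ?R s" using tr(1) uv(4) sub(2) by (blast dest: transD)
      moreover have "(x, u) \<in> ?R s" using tr(2) uv(3) sub(2) by (blast dest: symD)
      ultimately show "p \<in> ?R s" using tr(1) unfolding xy by (blast dest: transD)
    qed
    then show ?case using sub(1) by (intro masses_at_cong) auto
  qed
qed

text \<open>On an infinite tree the components may become infinite in number immediately after a time at
  which there are finitely many; this is the only way in which right-continuity can fail.\<close>

definition explosion :: "(nat \<Rightarrow> real) \<Rightarrow> nat \<Rightarrow> marked_field \<Rightarrow> bool" where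
  "explosion B n w \<longleftrightarrow> (\<exists>t\<ge>0. fin_at B n w t \<and> (\<forall>q. t < q \<longrightarrow> \<not> fin_at B n w q) \<and> masses_at B n w t 0 \<noteq> 0)"

lemma right_continuous_iff_not_explosion:
  "(\<forall>t\<ge>0. (masses_at B n w \<longlongrightarrow> masses_at B n w t) (at_right t)) \<longleftrightarrow> \<not> explosion B n w"
proof (intro iffI notI)
  assume rc: "\<forall>t\<ge>0. (masses_at B n w \<longlongrightarrow> masses_at B n w t) (at_right t)" and "explosion B n w"
  then obtain t where t: "t \<ge> 0" "\<And>q. t < q \<Longrightarrow> \<not> fin_at B n w q" "masses_at B n w t 0 \<noteq> 0"
    by (auto simp: explosion_def)
  have "\<forall>\<^sub>F s in at_right t. masses_at B n w s = (\<lambda>i. 0)"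
    using eventually_at_right_less by (rule eventually_mono) (auto intro!: masses_at_not_fin t)
  then have "(masses_at B n w \<longlongrightarrow> (\<lambda>i. 0)) (at_right t)" by (rule tendsto_eventually)
  then have "masses_at B n w t = (\<lambda>i. 0)"
    using rc t(1) by (intro tendsto_unique[of "at_right t"]) auto
  then show False using t(3) by simp
next
  assume ne: "\<not> explosion B n w"
  show "\<forall>t\<ge>0. (masses_at B n w \<longlongrightarrow> masses_at B n w t) (at_right t)"
  proof (intro allI impI)
    fix t :: real assume "t \<ge> 0"
    show "(masses_at B n w \<longlongrightarrow> masses_at B n w t) (at_right t)"
    proof (cases "\<exists>q>t. fin_at B n w q")
      case True
      then show ?thesis using right_continuous_masses_at by (blast intro: tendsto_eventually)
    next
      case False
      have "masses_at B n w t = (\<lambda>i. 0)"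
      proof (cases "fin_at B n w t")
        case True
        then have "masses_at B n w t 0 = 0" using ne False \<open>t \<ge> 0\<close> by (auto simp: explosion_def)
        moreover have "masses_at B n w t i \<le> masses_at B n w t 0" for i
          using decseqD[OF decseq_masses_at] by blast
        moreover have "masses_at B n w t i \<ge> 0" for i by (simp add: masses_at_def)
        ultimately show ?thesis by (metis order_antisym)
      qed (rule masses_at_not_fin)
      moreover have "\<forall>\<^sub>F s in at_right t. masses_at B n w s = (\<lambda>i. 0)"
        using eventually_at_right_less by (rule eventually_mono) (use False masses_at_not_fin in blast)
      ultimately show ?thesis by (simp add: tendsto_eventually)
    qed
  qed
qed

text \<open>Infinitude of the components is monotone in time, so an explosion can only happen at the
  infimum of the times at which it holds. Evaluation at this infimum over rational times replaces
  the uncountable quantifier.\<close>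

lemma explosion_measurable [measurable]: "Measurable.pred frag_sigma (explosion B n)"
proof -
  define \<rho> :: "marked_field \<Rightarrow> ereal" where
    "\<rho> w = (INF q. if 0 \<le> real_of_rat q \<and> \<not> fin_at B n w (real_of_rat q) then ereal (real_of_rat q) else \<infinity>)" for w
  have [measurable]: "\<rho> \<in> borel_measurable frag_sigma" unfolding \<rho>_def by measurable
  have pos: "0 \<le> \<rho> w" for w unfolding \<rho>_def by (rule INF_greatest) auto
  have "explosion B n w \<longleftrightarrow> \<rho> w \<noteq> \<infinity> \<and> fin_at B n w (real_of_ereal (\<rho> w)) \<and> masses_at B n w (real_of_ereal (\<rho> w)) 0 \<noteq> 0" for w
  proof
    assume "explosion B n w"
    then obtain t where t: "t \<ge> 0" "fin_at B n w t" "\<And>q. t < q \<Longrightarrow> \<not> fin_at B n w q" "masses_at B n w t 0 \<noteq> 0"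
      by (auto simp: explosion_def)
    have "ereal t \<le> \<rho> w"
      unfolding \<rho>_def using fin_at_antimono[OF _ t(2)] by (intro INF_greatest) (auto, meson nle_le)
    moreover have "\<rho> w \<le> ereal t"
    proof (rule ccontr)
      assume "\<not> \<rho> w \<le> ereal t"
      then obtain z where z: "t < z" "ereal z < \<rho> w" using ereal_dense2[of "ereal t" "\<rho> w"] by (auto simp: not_le)
      then obtain q where q: "t < real_of_rat q" "real_of_rat q < z" using of_rat_dense by blast
      have "0 \<le> real_of_rat q" using q t by linarith
      then have "\<rho> w \<le> ereal (real_of_rat q)"
        unfolding \<rho>_def by (intro INF_lower2[of q]) (use q t in auto)
      also have "\<dots> < ereal z" using q by simp
      finally show False using z by simp
    qed
    ultimately have "\<rho> w = ereal t" by simp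
    then show "\<rho> w \<noteq> \<infinity> \<and> fin_at B n w (real_of_ereal (\<rho> w)) \<and> masses_at B n w (real_of_ereal (\<rho> w)) 0 \<noteq> 0"
      using t by simp
  next
    assume *: "\<rho> w \<noteq> \<infinity> \<and> fin_at B n w (real_of_ereal (\<rho> w)) \<and> masses_at B n w (real_of_ereal (\<rho> w)) 0 \<noteq> 0"
    then obtain t where t: "\<rho> w = ereal t" "t \<ge> 0" using pos[of w] by (cases "\<rho> w") auto
    have "\<not> fin_at B n w q" if "t < q" for q
    proof -
      have "\<rho> w < ereal q" using t that by simp
      then obtain q' where q': "(if 0 \<le> real_of_rat q' \<and> \<not> fin_at B n w (real_of_rat q') then ereal (real_of_rat q') else \<infinity>) < ereal q"
        unfolding \<rho>_def INF_less_iff by blast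
      then show ?thesis using fin_at_antimono[of "real_of_rat q'" q B n w] by (auto split: if_splits)
    qed
    then show "explosion B n w" using * t by (auto simp: explosion_def)
  qed
  then have "explosion B n = (\<lambda>w. \<rho> w \<noteq> \<infinity> \<and> fin_at B n w (real_of_ereal (\<rho> w)) \<and> masses_at B n w (real_of_ereal (\<rho> w)) 0 \<noteq> 0)"
    by blast
  then show ?thesis by simp
qed

text \<open>Apart from explosion the conditions involve rational times only. Once explosion is
  excluded, right-continuity carries them to all times, and closedness of the mass partitions
  carries over membership.\<close>

lemma fragmentation_in_skorohod_class_iff:
  assumes \<delta>: "\<And>j. \<delta> j > 0"
  shows "fragmentation_process B n w \<in> skorohod_class mass_partitions \<delta> \<longleftrightarrow> \<not> explosion B n w \<and>
    (\<forall>q\<in>\<rat>. 0 \<le> q \<longrightarrow> masses_at B n w q \<in> mass_partitions) \<and>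
    (\<forall>j. two_sided_osc (\<rat> \<inter> {0..<real j}) (\<delta> j) (1 / Suc j) (masses_at B n w)) \<and>
    (\<forall>j. \<forall>q\<in>\<rat>. 0 \<le> q \<longrightarrow> q < \<delta> j \<longrightarrow> dist (masses_at B n w 0) (masses_at B n w q) \<le> 1 / Suc j)"
    (is "?L \<longleftrightarrow> ?R")
proof -
  let ?x = "masses_at B n w"
  have ev: "\<forall>\<^sub>F s in at_right t. restrict ?x {0..} s = ?x s" if "t \<ge> 0" for t
    using eventually_at_right_less[of t] that by (auto elim!: eventually_mono)
  have rc: "(restrict ?x {0..} \<longlongrightarrow> restrict ?x {0..} t) (at_right t) \<longleftrightarrow> (?x \<longlongrightarrow> ?x t) (at_right t)"
    if "t \<ge> 0" for t
  proof -
    have "restrict ?x {0..} t = ?x t" using that by simp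
    then show ?thesis using tendsto_cong[OF ev[OF that]] by (simp only:)
  qed
  show ?thesis
  proof
    assume L: ?L
    then have "\<not> explosion B n w"
      using rc right_continuous_iff_not_explosion[of B n w]
      by (auto simp: skorohod_class_def cadlag_paths_def fragmentation_process_eq)
    moreover have "?x t \<in> mass_partitions" if "t \<ge> 0" for t
      using L that by (auto simp: skorohod_class_def cadlag_paths_def fragmentation_process_eq PiE_iff)
    moreover have "two_sided_osc (\<rat> \<inter> {0..<real j}) (\<delta> j) (1 / Suc j) ?x" for j
    proof -
      have "two_sided_osc {0..<real j} (\<delta> j) (1 / Suc j) (restrict ?x {0..})"
        using L by (auto simp: skorohod_class_def fragmentation_process_eq)
      then show ?thesis unfolding two_sided_osc_def by auto
    qed
    moreover have "dist (?x 0) (?x q) \<le> 1 / Suc j" if "0 \<le> q" "q < \<delta> j" for q j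
    proof -
      have "\<forall>t. 0 \<le> t \<and> t < \<delta> j \<longrightarrow> dist (restrict ?x {0..} 0) (restrict ?x {0..} t) \<le> 1 / Suc j"
        using L by (auto simp: skorohod_class_def fragmentation_process_eq)
      then show ?thesis using that by auto
    qed
    ultimately show ?R by auto
  next
    assume R: ?R
    have right: "(?x \<longlongrightarrow> ?x t) (at_right t)" if "t \<ge> 0" for t
      using right_continuous_iff_not_explosion[of B n w] R that by blast
    have approx: "\<exists>q\<in>\<rat>. t < q \<and> q < t + h \<and> dist (?x q) (?x t) \<le> e" if t: "t \<ge> 0" "e > 0" "h > 0" for t e h
    proof -
      obtain b where b: "b > t" "\<And>s. t < s \<Longrightarrow> s < b \<Longrightarrow> dist (?x s) (?x t) < e"
        using tendstoD[OF right[OF t(1)] t(2)] by (auto simp: eventually_at_right_field)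
      have "t < min b (t + h)" using b t by simp
      then obtain q where "q \<in> \<rat>" "t < q" "q < min b (t + h)" using Rats_dense_in_real by blast
      then show ?thesis using b(2)[of q] by auto
    qed
    have E: "?x t \<in> mass_partitions" if t: "t \<ge> 0" for t
    proof -
      have "\<forall>e>0. \<exists>y\<in>mass_partitions. dist y (?x t) < e"
      proof (intro allI impI)
        fix e :: real assume "e > 0"
        then obtain q where "q \<in> \<rat>" "t < q" "dist (?x q) (?x t) \<le> e/2" using approx[OF t, of "e/2" 1] by auto
        then show "\<exists>y\<in>mass_partitions. dist y (?x t) < e"
          using R t \<open>e > 0\<close> by (intro bexI[of _ "?x q"]) auto
      qed
      then have "?x t \<in> closure mass_partitions" by (simp add: closure_approachable)
      then show ?thesis using compact_imp_closed[OF compact_mass_partitions] by simp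
    qed
    have osc: "two_sided_osc {0..<real j} (\<delta> j) (1 / Suc j) (restrict ?x {0..})" for j
    proof -
      have "two_sided_osc {0..<real j} (\<delta> j) (1 / Suc j) ?x"
        by (rule two_sided_osc_right_approx[OF _ approx]) (use R in auto)
      then show ?thesis unfolding two_sided_osc_def by auto
    qed
    have "dist (?x 0) (?x t) \<le> 1 / Suc j" if t: "0 \<le> t" "t < \<delta> j" for t j
    proof (rule field_le_epsilon)
      fix e :: real assume "e > 0"
      then obtain q where q: "q \<in> \<rat>" "t < q" "q < t + (\<delta> j - t)" "dist (?x q) (?x t) \<le> e"
        using approx[OF t(1), of e "\<delta> j - t"] t by auto
      have "dist (?x 0) (?x q) \<le> 1 / Suc j" using R q t by auto
      then show "dist (?x 0) (?x t) \<le> 1 / Suc j + e"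
        using q dist_triangle[of "?x 0" "?x t" "?x q"] by linarith
    qed
    moreover have "restrict ?x {0..} \<in> cadlag_paths mass_partitions"
      by (rule cadlag_pathsI[OF compact_mass_partitions _ _ \<delta> osc]) (use E rc right in auto)
    ultimately show ?L using osc by (auto simp: skorohod_class_def fragmentation_process_eq)
  qed
qed

lemma skorohod_class_event_sets:
  assumes \<delta>: "\<And>j. \<delta> j > 0"
  shows "{w. fragmentation_process B n w \<in> skorohod_class mass_partitions \<delta>} \<in> sets frag_sigma"
proof -
  have [measurable]: "(\<lambda>w. masses_at B n w q) \<in> borel_measurable frag_sigma" for q
    by (rule measurable_coordinatewise_then_product) measurable
  have [measurable]: "Measurable.pred frag_sigma (\<lambda>w. masses_at B n w q \<in> mass_partitions)" for q
    using borel_closed[OF compact_imp_closed[OF compact_mass_partitions]] by measurable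
  have ball: "(\<forall>x\<in>\<rat>. P x) \<longleftrightarrow> (\<forall>q. P (real_of_rat q))"
    "(\<forall>x\<in>\<rat> \<inter> A. P x) \<longleftrightarrow> (\<forall>q. real_of_rat q \<in> A \<longrightarrow> P (real_of_rat q))" for P A
    by (auto simp: Rats_def)
  have "Measurable.pred frag_sigma (\<lambda>w. fragmentation_process B n w \<in> skorohod_class mass_partitions \<delta>)"
    unfolding fragmentation_in_skorohod_class_iff[OF \<delta>] two_sided_osc_def ball by measurable
  then show ?thesis by (simp add: pred_def)
qed

section \<open>Moment estimates for the deletion times\<close>

definition mark_measure :: "(edge \<Rightarrow> real) measure" where
  "mark_measure = (\<Pi>\<^sub>M e\<in>UNIV. uniform_measure lborel {0<..<1})"

lemma prob_space_unit_uniform: "prob_space (uniform_measure lborel {0<..<1::real})"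
  by (rule prob_space_uniform_measure) auto

lemma prob_space_mark_measure: "prob_space mark_measure"
  unfolding mark_measure_def by (intro prob_space_PiM prob_space_unit_uniform)

lemma space_mark_measure [simp]: "space mark_measure = UNIV"
  by (simp add: mark_measure_def space_PiM)

lemma sets_mark_measure: "sets mark_measure = sets (\<Pi>\<^sub>M e\<in>UNIV. borel)"
  unfolding mark_measure_def by (intro sets_PiM_cong) auto

lemma mark_measure_component [measurable]: "(\<lambda>U. U e) \<in> borel_measurable mark_measure"
proof -
  have "(\<lambda>U. U e) \<in> borel_measurable (\<Pi>\<^sub>M e\<in>(UNIV :: edge set). (borel :: real measure))" by measurable
  then show ?thesis using measurable_cong_sets[OF sets_mark_measure refl] by blast
qed

lemma measure_unit_uniform_le:
  assumes "A \<subseteq> {a..b}" "a \<le> b" "A \<in> sets borel"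
  shows "measure (uniform_measure lborel {0<..<1::real}) A \<le> b - a"
proof -
  have "measure (uniform_measure lborel {0<..<1::real}) A = measure lborel ({0<..<1} \<inter> A)"
    using assms(3) by (subst measure_uniform_measure) auto
  also have "\<dots> \<le> measure lborel {a..b}"
    using assms by (intro measure_mono_fmeasurable) (auto simp: fmeasurable_def)
  finally show ?thesis using assms(2) by simp
qed

lemma mark_measure_prod:
  assumes "finite J" "\<And>e. e \<in> J \<Longrightarrow> A e \<in> sets borel"
  shows "measure mark_measure {U. \<forall>e\<in>J. U e \<in> A e} = (\<Prod>e\<in>J. measure (uniform_measure lborel {0<..<1}) (A e))"
proof -
  interpret product_prob_space "\<lambda>_::edge. uniform_measure lborel {0<..<1::real}" UNIV
    by (intro product_prob_spaceI prob_space_unit_uniform)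
  have "{U. \<forall>e\<in>J. U e \<in> A e} = prod_emb UNIV (\<lambda>_. uniform_measure lborel {0<..<1::real}) J (Pi\<^sub>E J A)"
    by (auto simp: prod_emb_def PiE_iff)
  then show ?thesis unfolding mark_measure_def using assms by (simp add: measure_PiM_emb)
qed

context
  fixes B :: "nat \<Rightarrow> real" and n :: nat and r :: real
  assumes r: "r = real n / B n" "r > 0"
begin

abbreviation "cut_time U w \<equiv> deletion_time B n U (butlast w, w)"

lemma deletion_time_measurable [measurable]: "(\<lambda>U. deletion_time B n U e) \<in> borel_measurable mark_measure"
  unfolding deletion_time_def by measurable

lemma measure_window:
  assumes "c \<le> d"
  shows "measure (uniform_measure lborel {0<..<1::real}) {x. c < r * (1 - x) \<and> r * (1 - x) \<le> d} \<le> (d - c) / r"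
proof -
  have "measure (uniform_measure lborel {0<..<1::real}) {x. c < r * (1 - x) \<and> r * (1 - x) \<le> d} \<le> (1 - c / r) - (1 - d / r)"
  proof (rule measure_unit_uniform_le)
    show "{x. c < r * (1 - x) \<and> r * (1 - x) \<le> d} \<subseteq> {1 - d / r..1 - c / r}"
      using r(2) by (auto simp: field_simps)
  qed (use assms r(2) in \<open>auto simp: divide_right_mono\<close>)
  then show ?thesis by (simp add: diff_divide_distrib)
qed

lemma prob_cut_in_window:
  assumes "c \<le> d"
  shows "measure mark_measure {U. c < deletion_time B n U e \<and> deletion_time B n U e \<le> d} \<le> (d - c) / r"
  using mark_measure_prod[of "{e}" "\<lambda>_. {x. c < r * (1 - x) \<and> r * (1 - x) \<le> d}"] measure_window[OF assms]
  by (simp add: deletion_time_def r(1))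

lemma prob_two_cuts_in_windows:
  assumes "c \<le> d" "c' \<le> d'" "e \<noteq> e'"
  shows "measure mark_measure {U. (c < deletion_time B n U e \<and> deletion_time B n U e \<le> d) \<and>
     (c' < deletion_time B n U e' \<and> deletion_time B n U e' \<le> d')} \<le> (d - c) / r * ((d' - c') / r)"
proof -
  define A where "A f = (if f = e then {x. c < r * (1 - x) \<and> r * (1 - x) \<le> d} else {x. c' < r * (1 - x) \<and> r * (1 - x) \<le> d'})" for f
  have "measure mark_measure {U. \<forall>f\<in>{e,e'}. U f \<in> A f} = (\<Prod>f\<in>{e,e'}. measure (uniform_measure lborel {0<..<1}) (A f))"
    by (rule mark_measure_prod) (auto simp: A_def)
  moreover have "{U. \<forall>f\<in>{e,e'}. U f \<in> A f} = {U. (c < deletion_time B n U e \<and> deletion_time B n U e \<le> d) \<and>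
     (c' < deletion_time B n U e' \<and> deletion_time B n U e' \<le> d')}"
    using assms(3) by (auto simp: A_def deletion_time_def r(1))
  moreover have "(\<Prod>f\<in>{e,e'}. measure (uniform_measure lborel {0<..<1}) (A f)) =
    measure (uniform_measure lborel {0<..<1}) (A e) * measure (uniform_measure lborel {0<..<1}) (A e')"
    using assms(3) by (subst prod.insert) auto
  moreover have "measure (uniform_measure lborel {0<..<1}) (A e) * measure (uniform_measure lborel {0<..<1}) (A e')
    \<le> (d - c) / r * ((d' - c') / r)"
  proof (rule mult_mono)
    show "measure (uniform_measure lborel {0<..<1}) (A e) \<le> (d - c) / r"
      unfolding A_def if_P[OF refl] by (rule measure_window[OF assms(1)])
    have "A e' = {x. c' < r * (1 - x) \<and> r * (1 - x) \<le> d'}" using assms(3) by (simp add: A_def)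
    then show "measure (uniform_measure lborel {0<..<1}) (A e') \<le> (d' - c') / r"
      using measure_window[OF assms(2)] by (simp only:)
  qed (use assms r(2) in auto)
  ultimately show ?thesis by (simp only:)
qed

lemma prob_cut_before:
  assumes "d \<ge> 0"
  shows "measure mark_measure {U. deletion_time B n U e < d} \<le> d / r"
proof -
  \<comment> \<open>Marks above 1 would also satisfy the inequality, but they have probability
    0.\<close>
  have "measure (uniform_measure lborel {0<..<1::real}) {x. r * (1 - x) < d} =
    measure (uniform_measure lborel {0<..<1::real}) ({x. r * (1 - x) < d} \<inter> {..1})"
    by (simp add: measure_uniform_measure) (rule arg_cong[where f = "measure lborel"], auto)
  also have "\<dots> \<le> 1 - (1 - d / r)"
  proof (rule measure_unit_uniform_le)
    show "{x. r * (1 - x) < d} \<inter> {..1} \<subseteq> {1 - d / r..1}" using r(2) by (auto simp: field_simps)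
  qed (use assms r(2) in auto)
  finally show ?thesis
    using mark_measure_prod[of "{e}" "\<lambda>_. {x. r * (1 - x) < d}"] by (simp add: deletion_time_def r(1))
qed

text \<open>Time is divided into cells of length \<delta>. If the first cut lies in a cell, the
  other lies in that cell or one of its two neighbours, a window of length
  \<open>3 * \<delta>\<close>; independence of the two marks gives the product.\<close>

lemma prob_close_cuts:
  assumes "e \<noteq> e'" "0 < \<delta>" "0 \<le> N"
  shows "measure mark_measure {U. 0 < deletion_time B n U e \<and> deletion_time B n U e \<le> N \<and>
      \<bar>deletion_time B n U e - deletion_time B n U e'\<bar> < \<delta>} \<le> (N / \<delta> + 1) * (\<delta> / r * (3 * \<delta> / r))" (is "measure _ ?A \<le> _")
proof -
  interpret prob_space mark_measure by (rule prob_space_mark_measure)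
  define m where "m = nat \<lfloor>N / \<delta>\<rfloor> + 1"
  have m: "real m \<le> N / \<delta> + 1" using assms by (simp add: m_def)
  define C where "C k = {U. (real k * \<delta> < deletion_time B n U e \<and> deletion_time B n U e \<le> (real k + 1) * \<delta>) \<and>
     ((real k - 1) * \<delta> < deletion_time B n U e' \<and> deletion_time B n U e' \<le> (real k + 2) * \<delta>)}" for k
  have [measurable]: "C k \<in> sets mark_measure" for k
  proof -
    have "Measurable.pred mark_measure (\<lambda>U. (real k * \<delta> < deletion_time B n U e \<and> deletion_time B n U e \<le> (real k + 1) * \<delta>) \<and>
     ((real k - 1) * \<delta> < deletion_time B n U e' \<and> deletion_time B n U e' \<le> (real k + 2) * \<delta>))" by measurable
    then show ?thesis by (simp add: pred_def C_def)
  qed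
  have "?A \<subseteq> (\<Union>k<m. C k)"
  proof
    fix U assume U: "U \<in> ?A"
    define t where "t = deletion_time B n U e"
    define k where "k = nat (\<lceil>t / \<delta>\<rceil> - 1)"
    have t: "0 < t" "t \<le> N" using U by (auto simp: t_def)
    have pos: "t / \<delta> > 0" using t assms by simp
    then have k: "real k < t / \<delta>" "t / \<delta> \<le> real k + 1" unfolding k_def by linarith+
    have kk: "real k * \<delta> < t" "t \<le> (real k + 1) * \<delta>"
      using k assms(2) by (simp_all add: pos_less_divide_eq pos_divide_le_eq)
    have "real k < N / \<delta>" using k(1) t(2) assms(2) by (meson divide_right_mono le_less_trans less_eq_real_def order_less_le_trans)
    then have "k < m" unfolding m_def by linarith
    moreover have "U \<in> C k" using kk U by (auto simp: C_def t_def algebra_simps)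
    ultimately show "U \<in> (\<Union>k<m. C k)" by blast
  qed
  then have "measure mark_measure ?A \<le> measure mark_measure (\<Union>k<m. C k)"
    by (intro finite_measure_mono) auto
  also have "\<dots> \<le> (\<Sum>k<m. measure mark_measure (C k))"
    by (intro finite_measure_subadditive_finite) auto
  also have "\<dots> \<le> (\<Sum>k<m. \<delta> / r * (3 * \<delta> / r))"
  proof (rule sum_mono)
    fix k
    have "measure mark_measure (C k) \<le> ((real k + 1) * \<delta> - real k * \<delta>) / r * (((real k + 2) * \<delta> - (real k - 1) * \<delta>) / r)"
      unfolding C_def by (rule prob_two_cuts_in_windows) (use assms in \<open>auto intro!: mult_right_mono\<close>)
    also have "\<dots> = \<delta> / r * (3 * \<delta> / r)" by (simp add: algebra_simps)
    finally show "measure mark_measure (C k) \<le> \<delta> / r * (3 * \<delta> / r)" .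
  qed
  also have "\<dots> = real m * (\<delta> / r * (3 * \<delta> / r))" by simp
  also have "\<dots> \<le> (N / \<delta> + 1) * (\<delta> / r * (3 * \<delta> / r))"
    by (rule mult_right_mono[OF m]) (use assms r(2) in auto)
  finally show ?thesis .
qed

text \<open>Markov's inequality for the square. Off-diagonal terms factor by independence and sum to
  at most C^2 h^2 n^2. On the diagonal one factor is bounded by \<eta> n, leaving \<eta> C h
  n^2.\<close>

lemma prob_many_small_cuts:
  fixes s :: "nat list \<Rightarrow> nat" and \<eta> C h a c :: real
  assumes "finite S" "\<And>w. w \<in> S \<Longrightarrow> real (s w) \<le> \<eta> * n" "real (\<Sum>w\<in>S. s w) \<le> C * n * r"
    and "h \<ge> 0" "a > 0" "\<eta> \<ge> 0" "n \<ge> 1" "C \<ge> 0"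
  shows "measure mark_measure {U. a * n \<le> real (\<Sum>w | w \<in> S \<and> c < cut_time U w \<and> cut_time U w \<le> c + h. s w)}
    \<le> (\<eta> * C * h + C\<^sup>2 * h\<^sup>2) / a\<^sup>2"
proof -
  interpret prob_space mark_measure by (rule prob_space_mark_measure)
  define A where "A w = {U. c < cut_time U w \<and> cut_time U w \<le> c + h}" for w
  have [measurable]: "A w \<in> sets mark_measure" for w
  proof -
    have "Measurable.pred mark_measure (\<lambda>U. c < cut_time U w \<and> cut_time U w \<le> c + h)" by measurable
    then show ?thesis by (simp add: pred_def A_def)
  qed
  define Y where "Y U = (\<Sum>w\<in>S. real (s w) * indicator (A w) U)" for U
  have Y: "real (\<Sum>w | w \<in> S \<and> c < cut_time U w \<and> cut_time U w \<le> c + h. s w) = Y U" for U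
    unfolding Y_def of_nat_sum by (rule sum.mono_neutral_cong_left) (auto simp: assms A_def indicator_def)
  have Y2: "(Y U)\<^sup>2 = (\<Sum>w\<in>S. \<Sum>w'\<in>S. real (s w) * real (s w') * indicator (A w \<inter> A w') U)" for U
    unfolding Y_def power2_eq_square sum_product indicator_inter_arith by (simp add: mult_ac)
  define p where "p = h / r"
  have p: "p \<ge> 0" "r * p = h" using assms r(2) by (auto simp: p_def)
  have m: "measure mark_measure (A w \<inter> A w') \<le> (if w = w' then p else 0) + p * p" for w w'
  proof (cases "w = w'")
    case True
    have "measure mark_measure (A w) \<le> p" using prob_cut_in_window[of c "c + h"] assms by (simp add: A_def p_def)
    moreover have "p * p \<ge> 0" by simp
    ultimately show ?thesis using True by (simp add: add_increasing2)
  next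
    case False
    have "A w \<inter> A w' = {U. (c < cut_time U w \<and> cut_time U w \<le> c + h) \<and> (c < cut_time U w' \<and> cut_time U w' \<le> c + h)}" by (auto simp: A_def)
    then show ?thesis
      using prob_two_cuts_in_windows[of c "c + h" c "c + h" "(butlast w, w)" "(butlast w', w')"] assms False
      by (simp add: p_def)
  qed
  have int: "integrable mark_measure (\<lambda>U. real (s w) * real (s w') * indicator (A w \<inter> A w') U)" for w w'
    by (intro integrable_mult_right integrable_real_indicator) (auto simp: emeasure_eq_measure)
  have "expectation (\<lambda>U. (Y U)\<^sup>2) = (\<Sum>w\<in>S. \<Sum>w'\<in>S. real (s w) * real (s w') * measure mark_measure (A w \<inter> A w'))"
  proof -
    have "expectation (\<lambda>U. (Y U)\<^sup>2) = (\<Sum>w\<in>S. expectation (\<lambda>U. \<Sum>w'\<in>S. real (s w) * real (s w') * indicator (A w \<inter> A w') U))"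
      unfolding Y2 by (intro Bochner_Integration.integral_sum Bochner_Integration.integrable_sum int)
    also have "\<dots> = (\<Sum>w\<in>S. \<Sum>w'\<in>S. expectation (\<lambda>U. real (s w) * real (s w') * indicator (A w \<inter> A w') U))"
      by (intro sum.cong refl Bochner_Integration.integral_sum int)
    finally show ?thesis by simp
  qed
  also have "\<dots> \<le> (\<Sum>w\<in>S. \<Sum>w'\<in>S. real (s w) * real (s w') * ((if w = w' then p else 0) + p * p))"
    by (intro sum_mono mult_left_mono m) auto
  also have "\<dots> = (\<Sum>w\<in>S. \<Sum>w'\<in>S. (if w = w' then real (s w) * real (s w') * p else 0) + real (s w) * real (s w') * (p * p))"
    by (intro sum.cong refl) (simp add: distrib_left)
  also have "\<dots> = (\<Sum>w\<in>S. real (s w) * real (s w) * p) + (\<Sum>w\<in>S. real (s w)) * (\<Sum>w\<in>S. real (s w)) * (p * p)"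
  proof -
    have "(\<Sum>w\<in>S. \<Sum>w'\<in>S. real (s w) * real (s w') * (p * p)) = (\<Sum>w\<in>S. real (s w)) * (\<Sum>w\<in>S. real (s w)) * (p * p)"
      by (subst sum_product) (simp only: sum_distrib_right)
    moreover have "(\<Sum>w\<in>S. \<Sum>w'\<in>S. if w = w' then real (s w) * real (s w') * p else 0) = (\<Sum>w\<in>S. real (s w) * real (s w) * p)"
      by (simp add: assms(1))
    ultimately show ?thesis by (simp only: sum.distrib)
  qed
  also have "\<dots> \<le> \<eta> * n * (C * n * r) * p + (C * n * r) * (C * n * r) * (p * p)"
  proof (rule add_mono)
    have "(\<Sum>w\<in>S. real (s w) * real (s w) * p) \<le> (\<Sum>w\<in>S. \<eta> * n * real (s w) * p)"
      using assms p by (intro sum_mono mult_right_mono) auto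
    also have "\<dots> = \<eta> * n * (\<Sum>w\<in>S. real (s w)) * p" by (simp add: sum_distrib_left sum_distrib_right mult.assoc)
    also have "\<dots> \<le> \<eta> * n * (C * n * r) * p"
      using assms p by (intro mult_right_mono mult_left_mono) auto
    finally show "(\<Sum>w\<in>S. real (s w) * real (s w) * p) \<le> \<eta> * n * (C * n * r) * p" .
    show "(\<Sum>w\<in>S. real (s w)) * (\<Sum>w\<in>S. real (s w)) * (p * p) \<le> (C * n * r) * (C * n * r) * (p * p)"
      using assms p r(2) by (intro mult_right_mono mult_mono) (auto intro: sum_nonneg)
  qed
  also have "\<dots> = (\<eta> * C * h + C\<^sup>2 * h\<^sup>2) * (real n)\<^sup>2" unfolding p(2)[symmetric] by (simp add: power2_eq_square algebra_simps)
  finally have E: "expectation (\<lambda>U. (Y U)\<^sup>2) \<le> (\<eta> * C * h + C\<^sup>2 * h\<^sup>2) * (real n)\<^sup>2" .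
  have nonneg: "Y U \<ge> 0" for U by (auto simp: Y_def intro!: sum_nonneg)
  have Ym [measurable]: "Y \<in> borel_measurable mark_measure" unfolding Y_def by measurable
  have "integrable mark_measure (\<lambda>U. (Y U)\<^sup>2)" unfolding Y2 by (intro Bochner_Integration.integrable_sum int)
  then have "measure mark_measure {U \<in> space mark_measure. (a * n)\<^sup>2 \<le> (Y U)\<^sup>2} \<le> expectation (\<lambda>U. (Y U)\<^sup>2) / (a * n)\<^sup>2"
    using assms by (intro integral_Markov_inequality_measure[where A = "{}"]) auto
  also have "{U \<in> space mark_measure. (a * n)\<^sup>2 \<le> (Y U)\<^sup>2} = {U. a * n \<le> Y U}"
    using nonneg assms by (auto simp: power2_le_iff_abs_le)
  also have "expectation (\<lambda>U. (Y U)\<^sup>2) / (a * n)\<^sup>2 \<le> (\<eta> * C * h + C\<^sup>2 * h\<^sup>2) * (real n)\<^sup>2 / (a * n)\<^sup>2"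
    using E by (rule divide_right_mono) simp
  also have "\<dots> = (\<eta> * C * h + C\<^sup>2 * h\<^sup>2) / a\<^sup>2"
    using assms by (simp add: power_mult_distrib)
  finally show ?thesis unfolding Y .
qed

end

section \<open>Good events for a fixed tree\<close>

lemma sum_cut_size_le:
  assumes "finite V" "S \<subseteq> V"
  shows "(\<Sum>w\<in>S. cut_size V w) \<le> subtree_sum V"
proof -
  have "(\<Sum>w\<in>S. cut_size V w) \<le> (\<Sum>w\<in>S. card (subtree V w))"
    by (intro sum_mono) (simp add: cut_size_def)
  also have "\<dots> \<le> subtree_sum V"
    unfolding subtree_sum_def using assms by (intro sum_mono2) auto
  finally show ?thesis .
qed

text \<open>Three bad events are excluded: two large cuts close together, an early large cut, and a
  window in which the small cuts add up to at least a n. They receive the shares p/4, p/4 and p/2.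
  The scale \<delta> is found before \<open>B\<close>, \<open>n\<close> and the tree, as tightness
  requires.\<close>

lemma good_event_at_scale:
  fixes C N a p :: real
  assumes C: "C > 0" and N: "N > 0" and a: "a > 0" and p: "p > 0"
  obtains \<delta> where "\<delta> > 0"
    "\<And>B n \<xi>. n \<ge> 1 \<Longrightarrow> B n > 0 \<Longrightarrow> gw_tree \<xi> \<in> trees_of_size n \<Longrightarrow>
      real (subtree_sum (gw_tree \<xi>)) \<le> C * n * (n / B n) \<Longrightarrow>
      \<exists>G\<in>sets mark_measure. 1 - p \<le> measure mark_measure G \<and>
        (\<forall>U\<in>G. two_sided_osc {0..<N} \<delta> (4 * a) (masses_at B n (\<xi>, U)) \<and>
          (\<forall>t. 0 \<le> t \<and> t < \<delta> \<longrightarrow> dist (masses_at B n (\<xi>, U) 0) (masses_at B n (\<xi>, U) t) \<le> 4 * a))"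
proof -
  \<comment> \<open>As h \<le> 1, there are at most \<open>K / h\<close> windows; as \<delta> \<le>
    1, \<open>N * \<delta> + \<delta>^2\<close> is at most \<open>K1 * \<delta>\<close>.\<close>
  define K where "K = N + 2"
  define K1 where "K1 = N + 1"
  have K: "K > 0" "K1 > 0" using N by (auto simp: K_def K1_def)
  \<comment> \<open>The choices of \<open>h\<close> and \<eta> make C^2 h and \<eta> C each at most
    p a^2 / (4 K), which gives p / 2 in total over all windows.\<close>
  define h where "h = min 1 (p * a\<^sup>2 / (4 * K * C\<^sup>2))"
  define \<eta> where "\<eta> = p * a\<^sup>2 / (4 * K * C)"
  define c where "c = C / \<eta>"
  define \<delta> where "\<delta> = min (min h N) (min 1 (min (p / (12 * c\<^sup>2 * K1)) (p / (4 * c))))"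
  have h: "h > 0" "h \<le> 1" "h \<le> p * a\<^sup>2 / (4 * K * C\<^sup>2)" using assms K by (auto simp: h_def)
  have \<eta>: "\<eta> > 0" using assms K by (auto simp: \<eta>_def)
  have c: "c > 0" using C \<eta> by (auto simp: c_def)
  have \<delta>: "\<delta> > 0" "\<delta> \<le> h" "\<delta> \<le> N" "\<delta> \<le> 1" "\<delta> \<le> p / (12 * c\<^sup>2 * K1)" "\<delta> \<le> p / (4 * c)"
    using h c assms K by (auto simp: \<delta>_def)
  have small: "(N / h + 2) * ((\<eta> * C * h + C\<^sup>2 * h\<^sup>2) / a\<^sup>2) \<le> p / 2"
  proof -
    have "C\<^sup>2 * h \<le> p * a\<^sup>2 / (4 * K)" using h(3) C K by (simp add: field_simps)
    moreover have "\<eta> * C = p * a\<^sup>2 / (4 * K)" using C K by (simp add: \<eta>_def field_simps)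
    ultimately have 1: "\<eta> * C + C\<^sup>2 * h \<le> p * a\<^sup>2 / (2 * K)" using K by (simp add: field_simps)
    have "N / h + 2 \<le> K / h" using h N by (simp add: field_simps K_def)
    then have "(N / h + 2) * ((\<eta> * C * h + C\<^sup>2 * h\<^sup>2) / a\<^sup>2) \<le> K / h * ((\<eta> * C * h + C\<^sup>2 * h\<^sup>2) / a\<^sup>2)"
      using \<eta> C h by (intro mult_right_mono) auto
    also have "\<dots> = K / a\<^sup>2 * (\<eta> * C + C\<^sup>2 * h)" using h a by (simp add: field_simps power2_eq_square)
    also have "\<dots> \<le> K / a\<^sup>2 * (p * a\<^sup>2 / (2 * K))"
      using K a by (intro mult_left_mono[OF 1]) auto
    also have "\<dots> = p / 2" using K a by (simp add: field_simps)
    finally show ?thesis .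
  qed
  have close: "c\<^sup>2 * (3 * (N * \<delta> + \<delta>\<^sup>2)) \<le> p / 4"
  proof -
    have "\<delta>\<^sup>2 \<le> \<delta>" using \<delta> by (simp add: power2_eq_square mult_left_le)
    then have "c\<^sup>2 * (3 * (N * \<delta> + \<delta>\<^sup>2)) \<le> c\<^sup>2 * (3 * (N * \<delta> + \<delta>))" by (intro mult_left_mono) auto
    also have "\<dots> = (3 * c\<^sup>2 * K1) * \<delta>" by (simp add: K1_def algebra_simps)
    also have "\<dots> \<le> (3 * c\<^sup>2 * K1) * (p / (12 * c\<^sup>2 * K1))" using K \<delta> by (intro mult_left_mono) auto
    also have "\<dots> = p / 4" using c K by (simp add: field_simps)
    finally show ?thesis .
  qed
  have early: "c * \<delta> \<le> p / 4" using \<delta>(6) c by (simp add: field_simps)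
  show thesis
  proof (rule that[OF \<delta>(1)])
    fix B :: "nat \<Rightarrow> real" and n :: nat and \<xi>
    assume n: "n \<ge> 1" and Bn: "B n > 0" and V0: "gw_tree \<xi> \<in> trees_of_size n"
      and L: "real (subtree_sum (gw_tree \<xi>)) \<le> C * n * (n / B n)"
    interpret prob_space mark_measure by (rule prob_space_mark_measure)
    define V where "V = gw_tree \<xi>"
    have V: "finite V" "card V = n" using V0 by (auto simp: V_def trees_of_size_def finite_trees_def)
    define r where "r = n / B n"
    have r: "r = real n / B n" "r > 0" using n Bn by (auto simp: r_def)
    let ?T = "\<lambda>U w. deletion_time B n U (butlast w, w)"
    define W where "W = V - {[]}"
    define Bg where "Bg = {w \<in> W. \<eta> * n \<le> cut_size V w}"
    define Sm where "Sm = {w \<in> W. cut_size V w < \<eta> * n}"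
    have fin: "finite Bg" "finite Sm" "Bg \<subseteq> V" "Sm \<subseteq> V" using V by (auto simp: Bg_def Sm_def W_def)
    have LS: "real (\<Sum>w\<in>S. cut_size V w) \<le> C * n * r" if "S \<subseteq> V" for S
    proof -
      have "real (\<Sum>w\<in>S. cut_size V w) \<le> real (subtree_sum V)"
        using sum_cut_size_le[OF V(1) that] by (simp only: of_nat_le_iff)
      then show ?thesis using L unfolding V_def r_def by (rule order_trans)
    qed
    have cardBg: "card Bg \<le> c * r"
    proof -
      have "card Bg * (\<eta> * n) \<le> (\<Sum>w\<in>Bg. real (cut_size V w))"
        using sum_bounded_below[of Bg "\<eta> * n" "\<lambda>w. real (cut_size V w)"] by (auto simp: Bg_def)
      also have "\<dots> \<le> C * n * r" using LS[OF fin(3)] by simp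
      finally have "n * (card Bg * \<eta>) \<le> n * (C * r)" by (simp add: mult_ac)
      then have "card Bg * \<eta> \<le> C * r" using n by simp
      then show ?thesis using \<eta> by (simp add: c_def field_simps)
    qed
    have [measurable]: "(\<lambda>U. deletion_time B n U e) \<in> borel_measurable mark_measure" for e
      by (rule deletion_time_measurable[where B = B and n = n and r = r, OF r])
    note close_cuts = prob_close_cuts[where B = B and n = n and r = r, OF r]
    note early_cut = prob_cut_before[where B = B and n = n and r = r, OF r]
    note small_cuts = prob_many_small_cuts[where B = B and n = n and r = r, OF r]
    \<comment> \<open>One window more than is needed to cover the times up to \<open>N\<close>,
      because an interval starting in window \<open>k\<close> may reach into the next one.\<close>
    define m where "m = nat \<lfloor>N / h\<rfloor> + 2"
    have m: "real m \<le> N / h + 2" using N h by (simp add: m_def)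
    define A1 where "A1 e = {U. 0 < ?T U (fst e) \<and> ?T U (fst e) \<le> N \<and> \<bar>?T U (fst e) - ?T U (snd e)\<bar> < \<delta>}" for e
    define A2 where "A2 w = {U. ?T U w < \<delta>}" for w
    define A3 where "A3 k = {U. a * n \<le> real (\<Sum>w | w \<in> Sm \<and> k * h < ?T U w \<and> ?T U w \<le> k * h + h. cut_size V w)}" for k :: nat
    define P where "P = {e \<in> Bg \<times> Bg. fst e \<noteq> snd e}"
    have finP: "finite P" using fin by (auto simp: P_def)
    have A1s [measurable]: "A1 e \<in> sets mark_measure" for e
    proof -
      have "Measurable.pred mark_measure (\<lambda>U. 0 < ?T U (fst e) \<and> ?T U (fst e) \<le> N \<and> \<bar>?T U (fst e) - ?T U (snd e)\<bar> < \<delta>)" by measurable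
      then show ?thesis by (simp add: pred_def A1_def)
    qed
    have A2s [measurable]: "A2 w \<in> sets mark_measure" for w
    proof -
      have "Measurable.pred mark_measure (\<lambda>U. ?T U w < \<delta>)" by measurable
      then show ?thesis by (simp add: pred_def A2_def)
    qed
    have A3s [measurable]: "A3 k \<in> sets mark_measure" for k
    proof -
      have eq: "real (\<Sum>w | w \<in> Sm \<and> k * h < ?T U w \<and> ?T U w \<le> k * h + h. cut_size V w) =
        (\<Sum>w\<in>Sm. if k * h < ?T U w \<and> ?T U w \<le> k * h + h then real (cut_size V w) else 0)" for U
        unfolding of_nat_sum by (rule sum.mono_neutral_cong_left) (auto simp: fin)
      have "Measurable.pred mark_measure (\<lambda>U. a * n \<le>
        (\<Sum>w\<in>Sm. if k * h < ?T U w \<and> ?T U w \<le> k * h + h then real (cut_size V w) else 0))" by measurable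
      then show ?thesis unfolding A3_def eq by (simp add: pred_def)
    qed
    define bad where "bad = (\<Union>e\<in>P. A1 e) \<union> (\<Union>w\<in>Bg. A2 w) \<union> (\<Union>k<m. A3 k)"
    have [measurable]: "bad \<in> sets mark_measure"
      unfolding bad_def using finP fin by (intro sets.Un sets.finite_UN) auto
    have "measure mark_measure (\<Union>e\<in>P. A1 e) \<le> (\<Sum>e\<in>P. measure mark_measure (A1 e))"
      by (intro finite_measure_subadditive_finite finP) auto
    also have "\<dots> \<le> (\<Sum>e\<in>P. (N / \<delta> + 1) * (\<delta> / r * (3 * \<delta> / r)))"
      unfolding A1_def using N \<delta> by (intro sum_mono close_cuts) (auto simp: P_def)
    also have "\<dots> = card P * ((N / \<delta> + 1) * (\<delta> / r * (3 * \<delta> / r)))" by simp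
    also have "\<dots> \<le> (c * r)\<^sup>2 * ((N / \<delta> + 1) * (\<delta> / r * (3 * \<delta> / r)))"
    proof (rule mult_right_mono)
      have "card P \<le> card (Bg \<times> Bg)" using fin by (intro card_mono) (auto simp: P_def)
      then have "real (card P) \<le> real (card Bg) * real (card Bg)"
        by (simp flip: of_nat_mult add: card_cartesian_product)
      also have "\<dots> \<le> (c * r) * (c * r)" using cardBg by (intro mult_mono) auto
      finally show "real (card P) \<le> (c * r)\<^sup>2" by (simp add: power2_eq_square)
    qed (use N \<delta> r in auto)
    also have "\<dots> = c\<^sup>2 * (3 * (N * \<delta> + \<delta>\<^sup>2))" using r(2) \<delta>(1) by (simp add: field_simps power2_eq_square)
    finally have b1: "measure mark_measure (\<Union>e\<in>P. A1 e) \<le> p / 4" using close by linarith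
    have "measure mark_measure (\<Union>w\<in>Bg. A2 w) \<le> (\<Sum>w\<in>Bg. measure mark_measure (A2 w))"
      by (intro finite_measure_subadditive_finite fin) auto
    also have "\<dots> \<le> (\<Sum>w\<in>Bg. \<delta> / r)"
      unfolding A2_def using \<delta> by (intro sum_mono early_cut) auto
    also have "\<dots> = real (card Bg) * (\<delta> / r)" by simp
    also have "\<dots> \<le> c * r * (\<delta> / r)" using \<delta>(1) r(2) by (intro mult_right_mono[OF cardBg]) auto
    also have "\<dots> = c * \<delta>" using r(2) by simp
    finally have b2: "measure mark_measure (\<Union>w\<in>Bg. A2 w) \<le> p / 4" using early by linarith
    have "measure mark_measure (\<Union>k<m. A3 k) \<le> (\<Sum>k<m. measure mark_measure (A3 k))"
      by (intro finite_measure_subadditive_finite) auto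
    also have "\<dots> \<le> (\<Sum>k<m. (\<eta> * C * h + C\<^sup>2 * h\<^sup>2) / a\<^sup>2)"
      unfolding A3_def using h a \<eta> C n fin LS[OF fin(4)]
      by (intro sum_mono small_cuts) (auto simp: Sm_def)
    also have "\<dots> = real m * ((\<eta> * C * h + C\<^sup>2 * h\<^sup>2) / a\<^sup>2)" by simp
    also have "\<dots> \<le> (N / h + 2) * ((\<eta> * C * h + C\<^sup>2 * h\<^sup>2) / a\<^sup>2)"
      using \<eta> C h by (intro mult_right_mono[OF m]) auto
    finally have b3: "measure mark_measure (\<Union>k<m. A3 k) \<le> p / 2" using small by linarith
    have "measure mark_measure bad \<le> measure mark_measure ((\<Union>e\<in>P. A1 e) \<union> (\<Union>w\<in>Bg. A2 w)) + measure mark_measure (\<Union>k<m. A3 k)"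
      unfolding bad_def using finP fin by (intro measure_Un_le sets.Un sets.finite_UN) auto
    also have "measure mark_measure ((\<Union>e\<in>P. A1 e) \<union> (\<Union>w\<in>Bg. A2 w)) \<le>
      measure mark_measure (\<Union>e\<in>P. A1 e) + measure mark_measure (\<Union>w\<in>Bg. A2 w)"
      using finP fin by (intro measure_Un_le sets.finite_UN) auto
    finally have "measure mark_measure bad \<le> p" using b1 b2 b3 by linarith
    then have G: "1 - p \<le> measure mark_measure (UNIV - bad)"
      using prob_compl[of bad] by simp
    \<comment> \<open>With no large cut between \<open>s\<close> and \<open>t\<close>, only small
      cuts act. An interval shorter than \<open>h\<close> meets at most two consecutive windows, so
      the masses change by at most 2 a, and the metric contributes another factor 2.\<close>
    have step: "dist (masses_at B n (\<xi>, U) s) (masses_at B n (\<xi>, U) t) \<le> 4 * a"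
      if U: "U \<notin> bad" and st: "0 \<le> s" "s \<le> t" "t < N" "t - s < h"
        and noBg: "\<And>w. w \<in> Bg \<Longrightarrow> \<not> (s < ?T U w \<and> ?T U w \<le> t)" for U s t
    proof -
      define D where "D = {w \<in> V. w \<noteq> [] \<and> s < ?T U w \<and> ?T U w \<le> t}"
      define k where "k = nat \<lfloor>s / h\<rfloor>"
      have "s / h \<ge> 0" using st h by simp
      then have kk: "real k \<le> s / h" "s / h < real k + 1" unfolding k_def by linarith+
      then have k: "k * h \<le> s" "s < k * h + h" using h(1) by (auto simp: field_simps)
      have "s / h \<le> N / h" using st h by (intro divide_right_mono) auto
      then have km: "Suc k < m" using kk(1) unfolding m_def by linarith
      define E where "E j = {w. w \<in> Sm \<and> real j * h < ?T U w \<and> ?T U w \<le> real j * h + h}" for j :: nat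
      have DE: "D \<subseteq> E k \<union> E (Suc k)"
      proof
        fix w assume w: "w \<in> D"
        then have "w \<notin> Bg" "w \<in> W" using noBg[of w] by (auto simp: D_def W_def)
        then have "w \<in> Sm" by (auto simp: Sm_def Bg_def not_le)
        moreover have "k * h < ?T U w" "?T U w \<le> Suc k * h + h" using w k st by (auto simp: D_def algebra_simps)
        ultimately show "w \<in> E k \<union> E (Suc k)" by (auto simp: E_def algebra_simps)
      qed
      have finE: "finite (E j)" for j using fin by (auto simp: E_def)
      have "real (\<Sum>w\<in>E j. cut_size V w) \<le> a * n" if "j < m" for j
        using U that by (auto simp: bad_def A3_def E_def not_le intro: less_imp_le)
      then have "real (\<Sum>w\<in>E k. cut_size V w) + real (\<Sum>w\<in>E (Suc k). cut_size V w) \<le> a * n + a * n"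
        using km by (intro add_mono) auto
      moreover have "(\<Sum>w\<in>D. cut_size V w) \<le> (\<Sum>w\<in>E k \<union> E (Suc k). cut_size V w)"
        using DE finE by (intro sum_mono2) auto
      moreover have "(\<Sum>w\<in>E k \<union> E (Suc k). cut_size V w) \<le> (\<Sum>w\<in>E k. cut_size V w) + (\<Sum>w\<in>E (Suc k). cut_size V w)"
        using sum.union_inter[OF finE finE, of "cut_size V" k "Suc k"] by linarith
      ultimately have D: "real (\<Sum>w\<in>D. cut_size V w) \<le> 2 * a * n" by linarith
      have "(\<Sum>w | w \<in> V \<and> w \<noteq> [] \<and> survives B n (\<xi>, U) s (butlast w, w) \<and> \<not> survives B n (\<xi>, U) t (butlast w, w). cut_size V w) \<le> (\<Sum>w\<in>D. cut_size V w)"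
        using V by (intro sum_mono2) (auto simp: D_def survives_def)
      from ranked_component_change[OF V_def V(1) _ this]
      have rk: "ranked (component_sizes V (kept_edges V (survives B n (\<xi>, U) s))) i \<le> ranked (component_sizes V (kept_edges V (survives B n (\<xi>, U) t))) i + (\<Sum>w\<in>D. cut_size V w)"
        "ranked (component_sizes V (kept_edges V (survives B n (\<xi>, U) t))) i \<le> ranked (component_sizes V (kept_edges V (survives B n (\<xi>, U) s))) i + (\<Sum>w\<in>D. cut_size V w)" for i
        using st by (auto simp: survives_def)
      have "\<bar>masses_at B n (\<xi>, U) s i - masses_at B n (\<xi>, U) t i\<bar> \<le> 2 * a" for i
      proof -
        define x where "x = ranked (component_sizes V (kept_edges V (survives B n (\<xi>, U) s))) i"
        define y where "y = ranked (component_sizes V (kept_edges V (survives B n (\<xi>, U) t))) i"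
        have "real x \<le> real y + 2 * a * n" "real y \<le> real x + 2 * a * n"
          using rk[of i] D unfolding x_def[symmetric] y_def[symmetric] by linarith+
        then have "\<bar>real x - real y\<bar> \<le> 2 * a * n" by linarith
        then have "\<bar>real x - real y\<bar> / n \<le> 2 * a" using n by (simp add: divide_le_eq)
        moreover have "\<bar>real x - real y\<bar> / n = \<bar>real x / n - real y / n\<bar>"
          by (simp add: diff_divide_distrib[symmetric])
        ultimately show ?thesis by (simp add: masses_at_def x_def y_def V_def)
      qed
      from dist_le_coordinatewise[OF this] show ?thesis by simp
    qed
    show "\<exists>G\<in>sets mark_measure. 1 - p \<le> measure mark_measure G \<and>
        (\<forall>U\<in>G. two_sided_osc {0..<N} \<delta> (4 * a) (masses_at B n (\<xi>, U)) \<and>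
          (\<forall>t. 0 \<le> t \<and> t < \<delta> \<longrightarrow> dist (masses_at B n (\<xi>, U) 0) (masses_at B n (\<xi>, U) t) \<le> 4 * a))"
    proof (intro bexI[of _ "UNIV - bad"] conjI ballI allI impI G)
      show "UNIV - bad \<in> sets mark_measure" using sets.compl_sets[of bad mark_measure] by simp
      fix U assume U: "U \<in> UNIV - bad"
      have late: "\<delta> \<le> ?T U w" if "w \<in> Bg" for w using U that by (force simp: bad_def A2_def)
      show "two_sided_osc {0..<N} \<delta> (4 * a) (masses_at B n (\<xi>, U))"
        unfolding two_sided_osc_def
      proof (intro ballI impI, rule ccontr)
        fix s t u assume *: "s \<in> {0..<N}" "t \<in> {0..<N}" "u \<in> {0..<N}" "s < t" "t < u" "u - s < \<delta>"
          "\<not> (dist (masses_at B n (\<xi>, U) s) (masses_at B n (\<xi>, U) t) \<le> 4 * a \<or>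
              dist (masses_at B n (\<xi>, U) t) (masses_at B n (\<xi>, U) u) \<le> 4 * a)"
        \<comment> \<open>A large oscillation on both sides of \<open>t\<close> produces two large
          cuts, at distinct edges since one is made by time \<open>t\<close> and the other after it,
          within a time less than \<delta>.\<close>
        obtain w where w: "w \<in> Bg" "s < ?T U w" "?T U w \<le> t"
          using step[of U s t] * U \<delta>(2) by fastforce
        obtain w' where w': "w' \<in> Bg" "t < ?T U w'" "?T U w' \<le> u"
          using step[of U t u] * U \<delta>(2) by fastforce
        have "(w, w') \<in> P" using w w' by (auto simp: P_def)
        moreover have "U \<in> A1 (w, w')" using w w' * by (auto simp: A1_def)
        ultimately show False using U by (auto simp: bad_def)
      qed
      fix t assume t: "0 \<le> t \<and> t < \<delta>"
      show "dist (masses_at B n (\<xi>, U) 0) (masses_at B n (\<xi>, U) t) \<le> 4 * a"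
        by (rule step) (use U t \<delta> late in \<open>fastforce+\<close>)
    qed
  qed
qed

section \<open>From the path length bound to tightness\<close>

lemma masses_at_in_mass_partitions:
  assumes "n \<ge> 1" "gw_tree (fst w) \<in> trees_of_size n"
  shows "masses_at B n w t \<in> mass_partitions"
  unfolding mass_partitions_iff
proof (intro conjI allI)
  show "decseq (masses_at B n w t)" by (rule decseq_masses_at)
  show "0 \<le> masses_at B n w t i" for i by (simp add: masses_at_def)
  fix N
  define V where "V = gw_tree (fst w)"
  have V: "finite V" "card V = n" using assms by (auto simp: V_def trees_of_size_def finite_trees_def)
  have eq: "equiv V (conn_at B n w t)" unfolding V_def by (rule equiv_conn_at)
  have fin: "finite (V // conn_at B n w t)" using V(1) equiv_type[OF eq] by (auto intro!: finite_quotient)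
  have "(\<Sum>i<N. ranked (component_sizes V (kept_edges V (survives B n w t))) i) \<le>
    sum_mset (component_sizes V (kept_edges V (survives B n w t)))" by (rule sum_ranked_le)
  also have "\<dots> = (\<Sum>c\<in>V // conn_at B n w t. card c)"
    unfolding component_sizes_def components_eq[OF V_def] conn_at_def V_def[symmetric] sum_unfold_sum_mset ..
  also have "\<dots> = card (\<Union>(V // conn_at B n w t))"
  proof (rule card_Union_disjoint[symmetric])
    show "pairwise disjnt (V // conn_at B n w t)"
      using quotient_disj[OF eq] unfolding pairwise_def disjnt_def by blast
    show "finite c" if "c \<in> V // conn_at B n w t" for c
      using in_quotient_imp_subset[OF eq that] V(1) by (rule finite_subset)
  qed
  also have "\<dots> = n" using Union_quotient[OF eq] V by simp
  finally have "real (\<Sum>i<N. ranked (component_sizes V (kept_edges V (survives B n w t))) i) \<le> real n"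
    by (simp only: of_nat_le_iff)
  then show "(\<Sum>i<N. masses_at B n w t i) \<le> 1"
    using assms(1) unfolding masses_at_def V_def[symmetric] of_nat_sum sum_divide_distrib[symmetric] by simp
qed

lemma not_explosion_finite_tree: 
  assumes "finite (gw_tree (fst w))"
  shows "\<not> explosion B n w"
proof -
  have "fin_at B n w t" for t
    unfolding fin_at_def using assms equiv_type[OF equiv_conn_at[of w B n t]] by (auto intro!: finite_quotient)
  then show ?thesis unfolding explosion_def by (meson lt_ex gt_ex)
qed

text \<open>By Markov's inequality the path length is of the right order outside an event of
  conditional probability \<epsilon> / 2. Given such a tree, the good events of all levels hold
  together up to a further \<epsilon> / 2, by a geometric series. Integrating over the tree gives
  the product (1 - \<epsilon> / 2)^2 \<ge> 1 - \<epsilon>.\<close>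

theorem tight_if_mean_path_length_bounded:
  assumes B: "\<And>n. n \<ge> 1 \<Longrightarrow> B n > 0" and C: "C > 0"
    and mean: "\<And>n. measure (offspring_field \<mu>) (size_event \<mu> n) > 0 \<Longrightarrow>
      (\<Sum>V\<in>trees_of_size n. tree_weight \<mu> V * real (subtree_sum V)) \<le>
        C * n * (n / B n) * measure (offspring_field \<mu>) (size_event \<mu> n)"
  shows "tight_family (skorohod_topology mass_partitions)
    {n. measure (offspring_field \<mu>) (size_event \<mu> n) > 0}
    (fragmentation_space \<mu>) (fragmentation_process B)"
  unfolding tight_family_def
proof (intro allI impI)
  fix e :: real assume "e > 0"
  \<comment> \<open>Truncation at 1 keeps the factor 1 - \<epsilon> / 2 positive.\<close>
  define \<epsilon> where "\<epsilon> = min e 1"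
  have \<epsilon>: "\<epsilon> > 0" "\<epsilon> \<le> e" "\<epsilon> \<le> 1" using \<open>e > 0\<close> by (auto simp: \<epsilon>_def)
  define C' where "C' = 2 * C / \<epsilon>"
  have C': "C' > 0" using C \<epsilon> by (simp add: C'_def)
  \<comment> \<open>The horizon is \<open>Suc j\<close> rather than \<open>j\<close> because the
    good event needs a positive horizon at level 0 too; a longer one is stronger.\<close>
  let ?good = "\<lambda>j \<delta>. \<delta> > 0 \<and> (\<forall>B n \<xi>. n \<ge> 1 \<longrightarrow> B n > 0 \<longrightarrow> gw_tree \<xi> \<in> trees_of_size n \<longrightarrow>
      real (subtree_sum (gw_tree \<xi>)) \<le> C' * n * (n / B n) \<longrightarrow>
      (\<exists>G\<in>sets mark_measure. 1 - \<epsilon> / 2 * (1/2) ^ Suc j \<le> measure mark_measure G \<and>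
        (\<forall>U\<in>G. two_sided_osc {0..<real (Suc j)} \<delta> (1 / Suc j) (masses_at B n (\<xi>, U)) \<and>
          (\<forall>t. 0 \<le> t \<and> t < \<delta> \<longrightarrow> dist (masses_at B n (\<xi>, U) 0) (masses_at B n (\<xi>, U) t) \<le> 1 / Suc j))))"
  have "\<exists>\<delta>. ?good j \<delta>" for j
  proof -
    have a: "1 / (4 * real (Suc j)) > 0" "4 * (1 / (4 * real (Suc j))) = 1 / Suc j" by (auto simp: field_simps)
    obtain \<delta> where "\<delta> > 0" and "\<And>B n \<xi>. n \<ge> 1 \<Longrightarrow> B n > 0 \<Longrightarrow> gw_tree \<xi> \<in> trees_of_size n \<Longrightarrow>
      real (subtree_sum (gw_tree \<xi>)) \<le> C' * n * (n / B n) \<Longrightarrow>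
      \<exists>G\<in>sets mark_measure. 1 - \<epsilon> / 2 * (1/2) ^ Suc j \<le> measure mark_measure G \<and>
        (\<forall>U\<in>G. two_sided_osc {0..<real (Suc j)} \<delta> (4 * (1 / (4 * real (Suc j)))) (masses_at B n (\<xi>, U)) \<and>
          (\<forall>t. 0 \<le> t \<and> t < \<delta> \<longrightarrow> dist (masses_at B n (\<xi>, U) 0) (masses_at B n (\<xi>, U) t) \<le> 4 * (1 / (4 * real (Suc j)))))"
      using good_event_at_scale[OF C', of "real (Suc j)" "1 / (4 * real (Suc j))" "\<epsilon> / 2 * (1/2) ^ Suc j"] \<epsilon> a(1)
      by (metis (no_types, lifting) half_gt_zero mult_pos_pos of_nat_0_less_iff zero_less_Suc zero_less_divide_1_iff zero_less_numeral zero_less_power)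
    then show ?thesis unfolding a(2) by blast
  qed
  then obtain \<delta> where \<delta>: "\<And>j. ?good j (\<delta> j)" by metis
  have \<delta>pos: "\<delta> j > 0" for j using \<delta>[of j] by blast
  let ?K = "skorohod_class mass_partitions \<delta>"
  show "\<exists>K. compactin (skorohod_topology mass_partitions) K \<and>
    (\<forall>n\<in>{n. measure (offspring_field \<mu>) (size_event \<mu> n) > 0}.
      1 - e \<le> measure (fragmentation_space \<mu> n) {w \<in> space (fragmentation_space \<mu> n). fragmentation_process B n w \<in> K})"
  proof (intro exI[of _ ?K] conjI ballI)
    show "compactin (skorohod_topology mass_partitions) ?K"
      by (rule compactin_skorohod_class[OF compact_mass_partitions \<delta>pos])
    fix n assume "n \<in> {n. measure (offspring_field \<mu>) (size_event \<mu> n) > 0}"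
    then have pos: "measure (offspring_field \<mu>) (size_event \<mu> n) > 0" by simp
    have n: "n \<ge> 1" using pos by (cases n) (auto simp: measure_size_event)
    interpret M: prob_space mark_measure by (rule prob_space_mark_measure)
    interpret O: prob_space "offspring_field \<mu>" by (rule prob_space_offspring_field)
    define P1 where "P1 = conditioned_offspring_field \<mu> n"
    have sets1: "sets P1 = sets (offspring_field \<mu>)" by (simp add: P1_def conditioned_offspring_field_def)
    have P1: "prob_space P1" unfolding P1_def conditioned_offspring_field_def
      using pos by (intro prob_space_uniform_measure) (auto simp: O.emeasure_eq_measure)
    interpret P1: prob_space P1 by (rule P1)
    have fs: "fragmentation_space \<mu> n = P1 \<Otimes>\<^sub>M mark_measure"
      by (simp add: fragmentation_space_def P1_def mark_measure_def)
    interpret PM: pair_prob_space P1 mark_measure ..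
    define S where "S = {w. fragmentation_process B n w \<in> ?K}"
    have S: "S \<in> sets (P1 \<Otimes>\<^sub>M mark_measure)"
      using skorohod_class_event_sets[OF \<delta>pos, of B n] sets_fragmentation_space[of \<mu> n] by (simp add: S_def fs)
    define \<V> where "\<V> = {V \<in> trees_of_size n. real (subtree_sum V) \<le> C' * n * (n / B n)}"
    define H where "H = {\<xi>. gw_tree \<xi> \<in> \<V>}"
    have H: "H \<in> sets P1" unfolding H_def sets1 by (rule measure_gw_tree_in(2)[of _ n]) (auto simp: \<V>_def)
    have "1 - \<epsilon> / 2 \<le> measure P1 H"
    proof -
      define c where "c = C' * n * (n / B n)"
      have c: "c > 0" using C' n B[OF n] by (simp add: c_def)
      have "c * (\<Sum>V\<in>trees_of_size n - \<V>. tree_weight \<mu> V) \<le> (\<Sum>V\<in>trees_of_size n - \<V>. tree_weight \<mu> V * real (subtree_sum V))"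
        unfolding sum_distrib_left
      proof (rule sum_mono)
        fix V assume "V \<in> trees_of_size n - \<V>"
        then have "c \<le> real (subtree_sum V)" by (auto simp: \<V>_def c_def)
        then show "c * tree_weight \<mu> V \<le> tree_weight \<mu> V * real (subtree_sum V)"
          by (subst mult.commute) (auto intro!: mult_left_mono simp: tree_weight_def prod_nonneg)
      qed
      also have "\<dots> \<le> (\<Sum>V\<in>trees_of_size n. tree_weight \<mu> V * real (subtree_sum V))"
        by (intro sum_mono2 finite_trees_of_size) (auto simp: tree_weight_def prod_nonneg)
      also have "\<dots> \<le> c * (\<epsilon> / 2) * measure (offspring_field \<mu>) (size_event \<mu> n)"
        using mean[OF pos] \<epsilon> by (simp add: c_def C'_def)
      finally have "(\<Sum>V\<in>trees_of_size n - \<V>. tree_weight \<mu> V) \<le> \<epsilon> / 2 * measure (offspring_field \<mu>) (size_event \<mu> n)"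
        using c by (simp add: mult.assoc)
      moreover have "(\<Sum>V\<in>trees_of_size n. tree_weight \<mu> V) = (\<Sum>V\<in>trees_of_size n - \<V>. tree_weight \<mu> V) + (\<Sum>V\<in>\<V>. tree_weight \<mu> V)"
        by (rule sum.subset_diff) (auto simp: \<V>_def finite_trees_of_size)
      ultimately have "(1 - \<epsilon> / 2) * measure (offspring_field \<mu>) (size_event \<mu> n) \<le> (\<Sum>V\<in>\<V>. tree_weight \<mu> V)"
        by (simp add: measure_size_event algebra_simps)
      also have "\<dots> = measure (offspring_field \<mu>) H"
        unfolding H_def by (rule measure_gw_tree_in(1)[of _ n, symmetric]) (auto simp: \<V>_def)
      finally have "1 - \<epsilon> / 2 \<le> measure (offspring_field \<mu>) H / measure (offspring_field \<mu>) (size_event \<mu> n)"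
        using pos by (simp add: le_divide_eq)
      also have "\<dots> = measure P1 H"
      proof -
        have "size_event \<mu> n \<inter> H = H" by (auto simp: H_def \<V>_def size_event_eq)
        then show ?thesis unfolding P1_def conditioned_offspring_field_def
          using H pos size_event_sets by (subst measure_uniform_measure) (auto simp: sets1 O.emeasure_eq_measure)
      qed
      finally show ?thesis .
    qed
    have sec: "ennreal (1 - \<epsilon> / 2) \<le> emeasure mark_measure (Pair \<xi> -` S)" if \<xi>: "\<xi> \<in> H" for \<xi>
    proof -
      have t: "gw_tree \<xi> \<in> trees_of_size n" "real (subtree_sum (gw_tree \<xi>)) \<le> C' * n * (n / B n)"
        using \<xi> by (auto simp: H_def \<V>_def)
      have "\<forall>j. \<exists>G. G \<in> sets mark_measure \<and> 1 - \<epsilon> / 2 * (1/2) ^ Suc j \<le> measure mark_measure G \<and>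
        (\<forall>U\<in>G. two_sided_osc {0..<real (Suc j)} (\<delta> j) (1 / Suc j) (masses_at B n (\<xi>, U)) \<and>
          (\<forall>t. 0 \<le> t \<and> t < \<delta> j \<longrightarrow> dist (masses_at B n (\<xi>, U) 0) (masses_at B n (\<xi>, U) t) \<le> 1 / Suc j))"
      proof
        fix j
        show "\<exists>G. G \<in> sets mark_measure \<and> 1 - \<epsilon> / 2 * (1/2) ^ Suc j \<le> measure mark_measure G \<and>
          (\<forall>U\<in>G. two_sided_osc {0..<real (Suc j)} (\<delta> j) (1 / Suc j) (masses_at B n (\<xi>, U)) \<and>
            (\<forall>t. 0 \<le> t \<and> t < \<delta> j \<longrightarrow> dist (masses_at B n (\<xi>, U) 0) (masses_at B n (\<xi>, U) t) \<le> 1 / Suc j))"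
          using \<delta>[of j, THEN conjunct2, THEN spec[of _ B], THEN spec[of _ n], THEN spec[of _ \<xi>], THEN mp, OF n,
            THEN mp, OF B[OF n], THEN mp, OF t(1), THEN mp, OF t(2)]
          unfolding Bex_def .
      qed
      then obtain G where G: "\<And>j. G j \<in> sets mark_measure" "\<And>j. 1 - \<epsilon> / 2 * (1/2) ^ Suc j \<le> measure mark_measure (G j)"
        "\<And>j U. U \<in> G j \<Longrightarrow> two_sided_osc {0..<real (Suc j)} (\<delta> j) (1 / Suc j) (masses_at B n (\<xi>, U))"
        "\<And>j U t. U \<in> G j \<Longrightarrow> 0 \<le> t \<Longrightarrow> t < \<delta> j \<Longrightarrow> dist (masses_at B n (\<xi>, U) 0) (masses_at B n (\<xi>, U) t) \<le> 1 / Suc j"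
        by metis
      have sub: "(\<Inter>j. G j) \<subseteq> Pair \<xi> -` S"
      proof
        fix U assume U: "U \<in> (\<Inter>j. G j)"
        have "fragmentation_process B n (\<xi>, U) \<in> ?K"
          unfolding fragmentation_in_skorohod_class_iff[OF \<delta>pos]
        proof (intro conjI ballI allI impI)
          show "\<not> explosion B n (\<xi>, U)"
            using t by (intro not_explosion_finite_tree) (auto simp: trees_of_size_def finite_trees_def)
          show "masses_at B n (\<xi>, U) q \<in> mass_partitions" for q
            by (rule masses_at_in_mass_partitions) (use n t in auto)
          show "two_sided_osc (\<rat> \<inter> {0..<real j}) (\<delta> j) (1 / Suc j) (masses_at B n (\<xi>, U))" for j
            by (rule two_sided_osc_mono[OF G(3)]) (use U in auto)
        qed (use U G(4) in auto)
        then show "U \<in> Pair \<xi> -` S" by (simp add: S_def)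
      qed
      have "measure mark_measure (\<Union>j. UNIV - G j) \<le> (\<Sum>j. measure mark_measure (UNIV - G j))"
      proof (rule M.finite_measure_subadditive_countably)
        show "range (\<lambda>j. UNIV - G j) \<subseteq> sets mark_measure"
          using sets.compl_sets[OF G(1)] by auto
        show "summable (\<lambda>j. measure mark_measure (UNIV - G j))"
        proof (rule summable_comparison_test')
          show "summable (\<lambda>j. \<epsilon> / 2 * (1/2::real) ^ Suc j)" by (intro summable_mult) (simp add: summable_geometric)
          show "norm (measure mark_measure (UNIV - G j)) \<le> \<epsilon> / 2 * (1/2) ^ Suc j" for j
            using M.prob_compl[OF G(1)] G(2)[of j] by simp
        qed
      qed
      also have "\<dots> \<le> (\<Sum>j. \<epsilon> / 2 * (1/2) ^ Suc j)"
      proof (rule suminf_le)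
        show le: "measure mark_measure (UNIV - G j) \<le> \<epsilon> / 2 * (1/2) ^ Suc j" for j
          using M.prob_compl[OF G(1)] G(2)[of j] by simp
        show s: "summable (\<lambda>j. \<epsilon> / 2 * (1/2::real) ^ Suc j)" by (intro summable_mult) (simp add: summable_geometric)
        show "summable (\<lambda>j. measure mark_measure (UNIV - G j))"
          by (rule summable_comparison_test'[OF s]) (use le in auto)
      qed
      also have "\<dots> = \<epsilon> / 2" using power_half_series by (intro sums_unique[symmetric]) (auto dest: sums_mult[of _ _ "\<epsilon> / 2"])
      finally have le: "measure mark_measure (\<Union>j. UNIV - G j) \<le> \<epsilon> / 2" .
      define Y where "Y = (\<Union>j. UNIV - G j)"
      have "Y \<in> sets mark_measure"
        unfolding Y_def using sets.compl_sets[OF G(1)] by (intro sets.countable_UN) auto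
      then have "measure mark_measure (UNIV - Y) = 1 - measure mark_measure Y"
        using M.prob_compl[of Y] by simp
      moreover have "UNIV - Y = (\<Inter>j. G j)" by (auto simp: Y_def)
      ultimately have "1 - \<epsilon> / 2 \<le> measure mark_measure (\<Inter>j. G j)"
        using le unfolding Y_def[symmetric] by simp
      also have "\<dots> \<le> measure mark_measure (Pair \<xi> -` S)"
        by (intro M.finite_measure_mono sub sets_Pair1[OF S])
      finally show ?thesis by (simp add: M.emeasure_eq_measure)
    qed
    have "ennreal ((1 - \<epsilon> / 2) * (1 - \<epsilon> / 2)) = ennreal (1 - \<epsilon> / 2) * ennreal (1 - \<epsilon> / 2)"
      using \<epsilon> by (intro ennreal_mult) auto
    also have "\<dots> \<le> ennreal (1 - \<epsilon> / 2) * emeasure P1 H"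
      using \<open>1 - \<epsilon> / 2 \<le> measure P1 H\<close> by (intro mult_left_mono) (auto simp: P1.emeasure_eq_measure intro: ennreal_leI)
    also have "\<dots> = (\<integral>\<^sup>+\<xi>. ennreal (1 - \<epsilon> / 2) * indicator H \<xi> \<partial>P1)" using H by (simp add: nn_integral_cmult_indicator)
    also have "\<dots> \<le> (\<integral>\<^sup>+\<xi>. emeasure mark_measure (Pair \<xi> -` S) \<partial>P1)"
      by (intro nn_integral_mono) (auto simp: indicator_def sec)
    also have "\<dots> = emeasure (P1 \<Otimes>\<^sub>M mark_measure) S" by (rule M.emeasure_pair_measure_alt[OF S, symmetric])
    finally have "(1 - \<epsilon> / 2) * (1 - \<epsilon> / 2) \<le> measure (P1 \<Otimes>\<^sub>M mark_measure) S"
      by (simp add: PM.emeasure_eq_measure)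
    moreover have "(1 - \<epsilon> / 2) * (1 - \<epsilon> / 2) \<ge> 1 - \<epsilon>" using sum_squares_ge_zero[of "\<epsilon>/2" 0] by (simp add: algebra_simps)
    moreover have "{w \<in> space (fragmentation_space \<mu> n). fragmentation_process B n w \<in> ?K} = S"
      using sets.sets_into_space[OF S] by (auto simp: S_def fs)
    ultimately show "1 - e \<le> measure (fragmentation_space \<mu> n) {w \<in> space (fragmentation_space \<mu> n). fragmentation_process B n w \<in> ?K}"
      using \<epsilon> by (simp add: fs)
  qed
qed

theorem corollary6p1:
  fixes \<alpha> :: real and \<mu> :: "nat pmf" and B :: "nat \<Rightarrow> real"
  assumes "1 < \<alpha>" and "\<alpha> \<le> 2"
    and "aperiodic \<mu>"
    and "(\<lambda>k. real k * pmf \<mu> k) sums 1"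
    and "pmf \<mu> 0 + pmf \<mu> 1 < 1"
    and "domain_of_attraction \<mu> \<alpha> B"
  shows "tight_family (skorohod_topology mass_partitions)
    {n. measure (offspring_field \<mu>) (size_event \<mu> n) > 0}
    (fragmentation_space \<mu>) (fragmentation_process B)"
proof -
  from assms(6) obtain Z where B: "\<And>n. n \<ge> 1 \<Longrightarrow> B n > 0" "filterlim B at_top sequentially"
    and Z: "stable_law \<alpha> Z" "weak_conv_m (scaled_walk \<mu> B) Z"
    unfolding domain_of_attraction_def scaled_walk_def[abs_def] by blast
  interpret critical_stable_attraction \<mu> \<alpha> B Z
    using assms B Z by unfold_locales auto
  obtain C where "C > 0" "\<And>n. measure (offspring_field \<mu>) (size_event \<mu> n) > 0 \<Longrightarrow>
      (\<Sum>V\<in>trees_of_size n. tree_weight \<mu> V * real (subtree_sum V)) \<le>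
        C * n * (n / B n) * measure (offspring_field \<mu>) (size_event \<mu> n)"
    by (rule mean_path_length_bounded) blast
  then show ?thesis by (intro tight_if_mean_path_length_bounded B) auto
qed

end
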